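(* Let $D\subset\mathbb{R}^n$ be a bounded $C^{1,1}$ open set, and let $X$ be an isotropic unimodal pure jump Lévy process satisfying the weak scaling condition and the jump kernel condition in the context. If $f\in C(D)$, then there exists a unique viscosity solution $u$ of $$Lu=f\ \text{in } D,\qquad u=0\ \text{in }\mathbb{R}^n\setminus D,$$ and $u\in C^{\overline{\phi}}(D)$, where $\overline{\phi}(r):=\varphi(r)^{1/2}$. Moreover $\|u\|_{C^{\overline{\phi}}(D)}\le C\|f\|_{C(D)}$ for some constant $C>0$ depending only on $n$, $D$ and $\Phi$.
   Context: Standing setting: $X$ is a Lévy process on $\mathbb{R}^n$ with no Gaussian part and no drift, whose Lévy measure is infinite and has an isotropic density $J(|y|)$ with $r\mapsto J(r)$ nonincreasing; its characteristic exponent is the radial function $\Phi(|z|)=\int_{\mathbb{R}^n}(1-\cos(z\cdot y))J(|y|)\,dy$. Assumptions: (weak scaling) there are $a_1\ge1$ and $0<\alpha_1\le\alpha_2<1$ with $a_1^{-1}(R/r)^{2\alpha_1}\le\Phi(R)/\Phi(r)\le a_1(R/r)^{2\alpha_2}$ for all $1<r\le R$; (jump kernel) there is $a_2>0$ with $J(r+1)\le a_2J(r)$ for all $r>0$, and $r\mapsto -J'(r)/r$ is nonincreasing. Define $\varphi(r)=J(1)/(J(r)r^n)$. The operator is $Lu(x)=\frac12\int_{\mathbb{R}^n}(u(x+y)+u(x-y)-2u(x))J(|y|)\,dy$ for $u$ bounded on $\mathbb{R}^n$ and $C^2$ near $x$. Viscosity solutions: $u:\mathbb{R}^n\to\mathbb{R}$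 upper (resp. lower) semicontinuous on $\overline D$ is a viscosity subsolution (resp. supersolution) of $Lu=f$ in $D$ if for every $x\in D$ and every $v$ which is $C^2$ in a neighborhood of $x$ with $v(x)=u(x)$ and $v>u$ (resp. $v<u$) on $\mathbb{R}^n\setminus\{x\}$, one has $Lv(x)\ge f(x)$ (resp. $\le$); a viscosity solution is both. $C(D)$: bounded continuous functions on $D$, sup norm. For $h:(0,\infty)\to(0,\infty)$, $\|f\|_{C^h(D)}=\sup_D|f|+\sup_{x\ne y\in D}|f(x)-f(y)|/h(|x-y|)$ and $C^h(D)=\{f\in C(D):\|f\|_{C^h(D)}<\infty\}$. $D$ (for $n\ge2$) is a $C^{1,1}$ open set if there are $R_0,\Lambda>0$ such that for every $z\in\partial D$ there are a $C^{1,1}$ function $\varphi_z:\mathbb{R}^{n-1}\to\mathbb{R}$ with $\varphi_z(0)=0$, $\nabla\varphi_z(0)=0$, $\|\nabla\varphi_z\|_\infty\le\Lambda$, $\nabla\varphi_z$ $\Lambda$-Lipschitz, and orthonormal coordinates centered at $z$ with $D\cap B(z,R_0)=\{(\tilde y,y_n)\in B(0,R_0):y_n>\varphi_z(\tilde y)\}$; for $n=1$, a union of disjoint open intervals with lengths and mutual distances at least some $R_0>0$. *)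

theory Defs
  imports "HOL-Analysis.Analysis"
begin

text \<open>Characteristic exponent \<Phi>(|z|) = \<integral> (1 - cos(z\<cdot>y)) J(|y|) dy, written as a function of z.\<close>
definition char_exp :: "(real \<Rightarrow> real) \<Rightarrow> 'a::euclidean_space \<Rightarrow> real" where
  "char_exp J z = (\<integral> y. (1 - cos (z \<bullet> y)) * J (norm y) \<partial>lborel)"

definition Lop :: "(real \<Rightarrow> real) \<Rightarrow> ('a::euclidean_space \<Rightarrow> real) \<Rightarrow> 'a \<Rightarrow> real" where
  "Lop J u x = (1/2) * (\<integral> y. (u (x + y) + u (x - y) - 2 * u x) * J (norm y) \<partial>lborel)"

definition phiJ :: "(real \<Rightarrow> real) \<Rightarrow> nat \<Rightarrow> real \<Rightarrow> real" where
  "phiJ J n r = J 1 / (J r * r ^ n)"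

definition C2_near :: "('a::euclidean_space \<Rightarrow> real) \<Rightarrow> 'a \<Rightarrow> bool" where
  "C2_near v x \<longleftrightarrow> (\<exists>e>0. \<exists>(Dv :: 'a \<Rightarrow> ('a \<Rightarrow>\<^sub>L real)) (D2v :: 'a \<Rightarrow> ('a \<Rightarrow>\<^sub>L ('a \<Rightarrow>\<^sub>L real))).
     (\<forall>y\<in>ball x e. (v has_derivative blinfun_apply (Dv y)) (at y)
                    \<and> (Dv has_derivative blinfun_apply (D2v y)) (at y))
     \<and> continuous_on (ball x e) D2v)"

definition usc_on :: "'a::metric_space set \<Rightarrow> ('a \<Rightarrow> real) \<Rightarrow> bool" where
  "usc_on S u \<longleftrightarrow> (\<forall>x\<in>S. \<forall>e>0. \<exists>d>0. \<forall>y\<in>S. dist y x < d \<longrightarrow> u y < u x + e)"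

definition lsc_on :: "'a::metric_space set \<Rightarrow> ('a \<Rightarrow> real) \<Rightarrow> bool" where
  "lsc_on S u \<longleftrightarrow> (\<forall>x\<in>S. \<forall>e>0. \<exists>d>0. \<forall>y\<in>S. dist y x < d \<longrightarrow> u x - e < u y)"

text \<open>Admissible test functions at x: bounded, Borel measurable, C^2 near x
  (L v(x) is only defined for such v).\<close>
definition test_fun :: "('a::euclidean_space \<Rightarrow> real) \<Rightarrow> 'a \<Rightarrow> bool" where
  "test_fun v x \<longleftrightarrow> bounded (range v) \<and> v \<in> borel_measurable borel \<and> C2_near v x"

definition visc_sub :: "(real \<Rightarrow> real) \<Rightarrow> ('a::euclidean_space \<Rightarrow> real) \<Rightarrow> 'a set \<Rightarrow> ('a \<Rightarrow> real) \<Rightarrow> bool" where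
  "visc_sub J f D u \<longleftrightarrow> usc_on (closure D) u \<and>
     (\<forall>x\<in>D. \<forall>v. test_fun v x \<and> v x = u x \<and> (\<forall>y. y \<noteq> x \<longrightarrow> v y > u y) \<longrightarrow> Lop J v x \<ge> f x)"

definition visc_super :: "(real \<Rightarrow> real) \<Rightarrow> ('a::euclidean_space \<Rightarrow> real) \<Rightarrow> 'a set \<Rightarrow> ('a \<Rightarrow> real) \<Rightarrow> bool" where
  "visc_super J f D u \<longleftrightarrow> lsc_on (closure D) u \<and>
     (\<forall>x\<in>D. \<forall>v. test_fun v x \<and> v x = u x \<and> (\<forall>y. y \<noteq> x \<longrightarrow> v y < u y) \<longrightarrow> Lop J v x \<le> f x)"

definition visc_sol :: "(real \<Rightarrow> real) \<Rightarrow> ('a::euclidean_space \<Rightarrow> real) \<Rightarrow> 'a set \<Rightarrow> ('a \<Rightarrow> real) \<Rightarrow> bool" where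
  "visc_sol J f D u \<longleftrightarrow> visc_sub J f D u \<and> visc_super J f D u"

text \<open>C(D): bounded continuous functions on D, with the sup norm
  (0 is inserted so that the empty set gets norm 0; it does not change the sup otherwise).\<close>
definition in_C :: "'a::metric_space set \<Rightarrow> ('a \<Rightarrow> real) \<Rightarrow> bool" where
  "in_C D f \<longleftrightarrow> continuous_on D f \<and> bounded (f ` D)"

definition sup_norm :: "'a set \<Rightarrow> ('a \<Rightarrow> real) \<Rightarrow> real" where
  "sup_norm D f = Sup (insert 0 ((\<lambda>x. \<bar>f x\<bar>) ` D))"

definition hoelder_quot :: "(real \<Rightarrow> real) \<Rightarrow> 'a::metric_space set \<Rightarrow> ('a \<Rightarrow> real) \<Rightarrow> real set" where
  "hoelder_quot h D f = {\<bar>f x - f y\<bar> / h (dist x y) | x y. x \<in> D \<and> y \<in> D \<and> x \<noteq> y}"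

definition Ch_norm :: "(real \<Rightarrow> real) \<Rightarrow> 'a::metric_space set \<Rightarrow> ('a \<Rightarrow> real) \<Rightarrow> real" where
  "Ch_norm h D f = sup_norm D f + Sup (insert 0 (hoelder_quot h D f))"

definition in_Ch :: "(real \<Rightarrow> real) \<Rightarrow> 'a::metric_space set \<Rightarrow> ('a \<Rightarrow> real) \<Rightarrow> bool" where
  "in_Ch h D f \<longleftrightarrow> in_C D f \<and> bdd_above (hoelder_quot h D f)"

text \<open>C^{1,1} open sets. For n \<ge> 2: local graph of a C^{1,1} function over the tangent
  hyperplane {w. w \<bullet> \<nu> = 0} (identified with R^{n-1} by orthonormal coordinates), with D lying
  above the graph in direction \<nu>. The gradient of \<phi>_z is represented by g (a vector in the
  hyperplane). For n = 1: union of disjoint open intervals (= connected components of the open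
  set D) of length \<ge> R0 and mutual distances \<ge> R0.\<close>
definition C11_open :: "'a::euclidean_space set \<Rightarrow> bool" where
  "C11_open D \<longleftrightarrow> open D \<and>
   (if DIM('a) = 1 then
      (\<exists>R0>0. (\<forall>x\<in>D. \<exists>a b. dist a b = R0 \<and> open_segment a b \<subseteq> connected_component_set D x)
             \<and> (\<forall>x\<in>D. \<forall>y\<in>D. connected_component_set D x \<noteq> connected_component_set D y
                                \<longrightarrow> dist x y \<ge> R0))
    else
      (\<exists>R0>0. \<exists>\<Lambda>>0. \<forall>z\<in>frontier D. \<exists>(\<nu>::'a) (\<phi>::'a \<Rightarrow> real) (g::'a \<Rightarrow> 'a).
         norm \<nu> = 1 \<and> \<phi> 0 = 0 \<and> g 0 = 0 \<and>
         (\<forall>y. y \<bullet> \<nu> = 0 \<longrightarrow> g y \<bullet> \<nu> = 0 \<and> norm (g y) \<le> \<Lambda> \<and>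
               (\<phi> has_derivative (\<lambda>h. g y \<bullet> h)) (at y within {w. w \<bullet> \<nu> = 0})) \<and>
         (\<forall>y y'. y \<bullet> \<nu> = 0 \<longrightarrow> y' \<bullet> \<nu> = 0 \<longrightarrow> norm (g y - g y') \<le> \<Lambda> * norm (y - y')) \<and>
         D \<inter> ball z R0 = {x \<in> ball z R0. (x - z) \<bullet> \<nu> > \<phi> ((x - z) - ((x - z) \<bullet> \<nu>) *\<^sub>R \<nu>)}))"

end

theory Submission
  imports Defs "HOL-Complex_Analysis.Great_Picard"
begin

text \<open>
  Truncating \<open>J\<close> near the origin gives integrable kernels, for which the Dirichlet problem is solved
  by a contraction; all estimates are uniform in the truncation.

  The barrier comes from one dimension. The projection of the kernel to a line has a Wiener-Hopf
  factorization, and its renewal function \<open>w\<close> is increasing and subadditive, satisfies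
  \<open>L w = - lam (1 - w)\<close> on the half-line, and is bounded by a multiple of
  \<open>(lam / (lam + \<Phi>(1/t)))^(1/2)\<close>. Outside a ball the function
  \<open>w(dist)\<close>, corrected by \<open>min 1 t^2\<close>, is still a supersolution: by subadditivity the curvature error is a
  dyadic sum of the terms \<open>2^(-j) \<Phi>(2^j)^(1/2)\<close>, which converges because \<open>\<alpha>2 < 1\<close>, and
  for large \<open>lam\<close> it is dominated by \<open>lam (1 - w)\<close>. The exterior ball condition then controls the
  solution at the boundary. In the interior, \<open>u(x) - u(y)\<close> is compared with the half-space barrier across the
  hyperplane reflecting \<open>x\<close> to \<open>y\<close>, using a maximum principle for antisymmetric functions, which
  holds since the kernel is radially decreasing. As \<open>J(r) r^n\<close> is at most a constant times
  \<open>\<Phi>(1/r)\<close>, this is the required modulus.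

  By compactness the solutions for the truncated kernels converge to some \<open>u\<close>. Its mollifications
  satisfy the equation up to a locally uniformly small error, so \<open>u\<close> is a viscosity
  solution, and comparing any other viscosity solution with these mollifications gives uniqueness.
\<close>

section \<open>Symmetries of Lebesgue measure\<close>

text \<open>Uniformity in the truncation is the obstacle that shapes the proof. Truncation freezes
  \<open>J\<close> near the origin instead of cutting it off, so the kernel stays radially
  decreasing; being integrable, it lets a margin in the equation replace points where a supremum is
  attained. The constants involve only tails, one truncated second moment and
  \<open>char_exp\<close>, which for the truncations are dominated by, or converge to, those of
  \<open>J\<close>. The value \<open>k 0\<close>, which may blow up, enters only a remainder that is
  driven below 1. The exponent 1/2 comes from the symmetry of the factorization: in Fourier terms 1
  - p^ = |1 - e^|^2, so the one-sided factor carries a square root. The same square root makes the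
  curvature error O(sqrt lam), against a gain of lam / 2. Hence the order of choices: exterior
  radius, \<open>lam\<close>, collar width \<open>t0\<close>, truncation index. The correction
  \<open>eta\<close> gives the barrier a lower bound beyond \<open>t0\<close> that does not depend
  on the truncation; \<open>w\<close> alone comes with no such bound.\<close>

lemma integral_lborel_translate:
  fixes f :: "'a::euclidean_space \<Rightarrow> real"
  assumes [measurable]: "f \<in> borel_measurable borel"
  shows "(\<integral>y. f (x + y) \<partial>lborel) = (\<integral>y. f y \<partial>lborel)"
proof -
  have "(\<integral>y. f y \<partial>lborel) = (\<integral>y. f y \<partial>distr lborel borel ((+) x))"
    by (simp only: lborel_distr_plus)
  also have "\<dots> = (\<integral>y. f (x + y) \<partial>lborel)"
    by (subst integral_distr) auto
  finally show ?thesis by simp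
qed

lemma integrable_lborel_translate:
  fixes f :: "'a::euclidean_space \<Rightarrow> real"
  assumes "integrable lborel f"
  shows "integrable lborel (\<lambda>y. f (x + y))"
proof -
  have [measurable]: "f \<in> borel_measurable borel"
    using assms by auto
  have "integrable (distr lborel borel ((+) x)) f"
    using assms by (simp only: lborel_distr_plus)
  then show ?thesis
    by (subst (asm) integrable_distr_eq) auto
qed

lemma lborel_distr_minus:
  "distr lborel borel uminus = (lborel :: 'a::euclidean_space measure)"
  by (subst lborel_affine[of "-1" 0]) (auto simp: density_1 one_ennreal_def[symmetric])

lemma integral_lborel_minus:
  fixes f :: "'a::euclidean_space \<Rightarrow> real"
  assumes [measurable]: "f \<in> borel_measurable borel"
  shows "(\<integral>y. f (- y) \<partial>lborel) = (\<integral>y. f y \<partial>lborel)"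
proof -
  have "(\<integral>y. f y \<partial>lborel) = (\<integral>y. f y \<partial>distr lborel borel uminus)"
    by (simp only: lborel_distr_minus)
  also have "\<dots> = (\<integral>y. f (- y) \<partial>lborel)"
    by (subst integral_distr) auto
  finally show ?thesis by simp
qed

lemma integrable_lborel_minus:
  fixes f :: "'a::euclidean_space \<Rightarrow> real"
  assumes "integrable lborel f"
  shows "integrable lborel (\<lambda>y. f (- y))"
proof -
  have [measurable]: "f \<in> borel_measurable borel"
    using assms by auto
  have "integrable (distr lborel borel uminus) f"
    using assms by (simp only: lborel_distr_minus)
  then show ?thesis
    by (subst (asm) integrable_distr_eq) auto
qed

lemma nn_integral_lborel_translate:
  fixes f :: "'a::euclidean_space \<Rightarrow> ennreal"
  assumes [measurable]: "f \<in> borel_measurable borel"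
  shows "(\<integral>\<^sup>+y. f (x + y) \<partial>lborel) = (\<integral>\<^sup>+y. f y \<partial>lborel)"
proof -
  have "(\<integral>\<^sup>+y. f y \<partial>lborel) = (\<integral>\<^sup>+y. f y \<partial>distr lborel borel ((+) x))"
    by (simp only: lborel_distr_plus)
  also have "\<dots> = (\<integral>\<^sup>+y. f (x + y) \<partial>lborel)"
    by (subst nn_integral_distr) auto
  finally show ?thesis by simp
qed

lemma nn_integral_lborel_minus:
  fixes f :: "'a::euclidean_space \<Rightarrow> ennreal"
  assumes [measurable]: "f \<in> borel_measurable borel"
  shows "(\<integral>\<^sup>+y. f (- y) \<partial>lborel) = (\<integral>\<^sup>+y. f y \<partial>lborel)"
proof -
  have "(\<integral>\<^sup>+y. f y \<partial>lborel) = (\<integral>\<^sup>+y. f y \<partial>distr lborel borel uminus)"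
    by (simp only: lborel_distr_minus)
  also have "\<dots> = (\<integral>\<^sup>+y. f (- y) \<partial>lborel)"
    by (subst nn_integral_distr) auto
  finally show ?thesis by simp
qed

section \<open>Reflections preserve Lebesgue measure\<close>

definition mirror :: "'a::euclidean_space \<Rightarrow> 'a \<Rightarrow> 'a" where
  "mirror e y = y - (2 * (y \<bullet> e)) *\<^sub>R e"

lemma mirror_involution: "norm e = 1 \<Longrightarrow> mirror e (mirror e y) = y"
  by (simp add: mirror_def inner_diff_left dot_square_norm scaleR_left_diff_distrib)

lemma mirror_add: "mirror e (x + y) = mirror e x + mirror e y"
  by (simp add: mirror_def inner_add_left algebra_simps)

lemma mirror_diff: "mirror e (x - y) = mirror e x - mirror e y"
  by (simp add: mirror_def inner_diff_left algebra_simps)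

lemma norm_mirror: "norm e = 1 \<Longrightarrow> norm (mirror e y) = norm y"
proof -
  assume e: "norm e = 1"
  have "e \<bullet> e = 1" using e by (simp add: dot_square_norm)
  then have "mirror e y \<bullet> mirror e y = y \<bullet> y"
    by (simp add: mirror_def inner_diff_left inner_diff_right inner_commute)
  then show ?thesis by (simp only: norm_eq_sqrt_inner)
qed

lemma dist_mirror: "norm e = 1 \<Longrightarrow> dist (mirror e x) (mirror e y) = dist x y"
  by (metis dist_norm norm_mirror mirror_diff)

lemma continuous_on_mirror: "continuous_on S (mirror e)"
  unfolding mirror_def by (intro continuous_intros)

lemma borel_measurable_mirror [measurable]: "mirror e \<in> borel_measurable borel"
  by (simp add: borel_measurable_continuous_onI continuous_on_mirror)

lemma inner_mirror: "norm e = 1 \<Longrightarrow> mirror e y \<bullet> e = - (y \<bullet> e)"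
  by (simp add: mirror_def inner_diff_left dot_square_norm)

lemma mirror_image_ball: "norm e = 1 \<Longrightarrow> mirror e ` ball a r = ball (mirror e a) r"
proof -
  assume e: "norm e = 1"
  show ?thesis
  proof safe
    fix x assume "x \<in> ball a r" then show "mirror e x \<in> ball (mirror e a) r" using e by (simp add: dist_mirror)
  next
    fix x assume "x \<in> ball (mirror e a) r"
    then have "dist a (mirror e x) < r" using e by (metis dist_mirror mem_ball mirror_involution)
    then show "x \<in> mirror e ` ball a r" using e by (metis imageI mem_ball mirror_involution)
  qed
qed

lemma mirror_vimage_image: "norm e = 1 \<Longrightarrow> mirror e -` S = mirror e ` S"
  by (auto simp: image_iff) (metis mirror_involution)+

text \<open>By Vitali's theorem countably many disjoint balls fill \<open>S\<close> up to a null
  set. A reflection sends them to disjoint balls of the same radii, and the measure of a ball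
  depends only on its radius. One inequality is enough, because the reflection is an
  involution.\<close>

lemma emeasure_mirror_image_ge:
  fixes S :: "'a::euclidean_space set"
  assumes "open S" "norm e = 1"
  shows "emeasure lborel S \<le> emeasure lborel (mirror e ` S)"
proof -
  define K where "K = {(a::'a, r::real). 0 < r \<and> ball a r \<subseteq> S}"
  have "\<exists>i. i \<in> K \<and> x \<in> ball (fst i) (snd i) \<and> snd i < d" if xd: "x \<in> S" "0 < d" for x d
  proof -
    obtain r where r: "r > 0" "ball x r \<subseteq> S" using openE[OF assms(1) xd(1)] by metis
    let ?r = "min r (d/2)"
    have "(x, ?r) \<in> K" using r xd by (auto simp: K_def)
    then show ?thesis using r xd by (intro exI[of _ "(x, ?r)"]) auto
  qed
  then obtain C where C: "countable C" "C \<subseteq> K"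
     "pairwise (\<lambda>i j. disjnt (ball (fst i) (snd i)) (ball (fst j) (snd j))) C"
     "negligible(S - (\<Union>i \<in> C. ball (fst i) (snd i)))"
    using Vitali_covering_theorem_balls[of S K fst snd] by blast
  let ?U = "\<Union>i \<in> C. ball (fst i) (snd i)"
  have US: "?U \<subseteq> S" using C(2) by (auto simp: K_def subset_iff)
  have US2: "S = ?U \<union> (S - ?U)" using US by auto
  have null: "emeasure lborel (S - ?U) = 0"
  proof -
    have "open ?U" by auto
    then have "S - ?U \<in> sets borel" using assms by (intro sets.Diff borel_open)
    then show ?thesis using C(4) by (simp add: negligible_iff_null_sets null_sets_def)
  qed
  have "emeasure lborel S \<le> emeasure lborel ?U + emeasure lborel (S - ?U)"
    by (subst US2, rule emeasure_subadditive) (use assms in \<open>simp_all add: open_UN sets.Diff\<close>)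
  also have "\<dots> = emeasure lborel ?U" using null by simp
  also have "\<dots> = (\<integral>\<^sup>+i. emeasure lborel (ball (fst i) (snd i)) \<partial>count_space C)"
    by (rule emeasure_UN_countable)
      (use C in \<open>auto simp: disjoint_family_on_def pairwise_def disjnt_def\<close>)
  also have "\<dots> = (\<integral>\<^sup>+i. emeasure lborel (ball (mirror e (fst i)) (snd i)) \<partial>count_space C)"
  proof (intro nn_integral_cong)
    fix i assume "i \<in> space (count_space C)"
    then have "0 \<le> snd i" using C(2) by (auto simp: K_def)
    then show "emeasure lborel (ball (fst i) (snd i)) = emeasure lborel (ball (mirror e (fst i)) (snd i))"
      using emeasure_lebesgue_ball_conv_unit_ball[of "snd i" "fst i"]
        emeasure_lebesgue_ball_conv_unit_ball[of "snd i" "mirror e (fst i)"] by simp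
  qed
  also have "\<dots> = emeasure lborel (\<Union>i \<in> C. ball (mirror e (fst i)) (snd i))"
  proof (rule emeasure_UN_countable[symmetric])
    show "disjoint_family_on (\<lambda>i. ball (mirror e (fst i)) (snd i)) C"
    proof (unfold disjoint_family_on_def, intro ballI impI)
      fix i j assume ij: "i \<in> C" "j \<in> C" "i \<noteq> j"
      then have "ball (fst i) (snd i) \<inter> ball (fst j) (snd j) = {}"
        using C(3) by (auto simp: pairwise_def disjnt_def)
      moreover have "inj (mirror e)" by (metis assms(2) injI mirror_involution)
      ultimately show "ball (mirror e (fst i)) (snd i) \<inter> ball (mirror e (fst j)) (snd j) = {}"
        using assms(2) by (simp add: mirror_image_ball[symmetric] image_Int[symmetric])
    qed
  qed (use C in auto)
  also have "\<dots> \<le> emeasure lborel (mirror e ` S)"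
  proof (rule emeasure_mono)
    show "(\<Union>i \<in> C. ball (mirror e (fst i)) (snd i)) \<subseteq> mirror e ` S"
      using US assms(2) by (auto simp: mirror_image_ball[symmetric])
    have "open (mirror e ` S)"
      using assms by (simp add: mirror_vimage_image[symmetric] open_vimage continuous_on_mirror)
    then show "mirror e ` S \<in> sets lborel" by simp
  qed
  finally show ?thesis .
qed

lemma lborel_distr_mirror:
  fixes e :: "'a::euclidean_space"
  assumes "norm e = 1"
  shows "distr lborel borel (mirror e) = lborel"
proof (rule lborel_eqI[symmetric])
  fix l u :: 'a
  assume lu: "\<And>b. b \<in> Basis \<Longrightarrow> l \<bullet> b \<le> u \<bullet> b"
  let ?S = "box l u"
  have op: "open (mirror e ` ?S)"
    using assms by (simp add: mirror_vimage_image[symmetric] open_vimage continuous_on_mirror open_box)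
  have 1: "emeasure lborel ?S \<le> emeasure lborel (mirror e ` ?S)"
    by (rule emeasure_mirror_image_ge) (use assms in \<open>auto simp: open_box\<close>)
  \<comment> \<open>The reflected box is again open, so the same inequality applies to it and leads
    back to the box.\<close>
  have "emeasure lborel (mirror e ` ?S) \<le> emeasure lborel (mirror e ` (mirror e ` ?S))"
    by (rule emeasure_mirror_image_ge) (use assms op in auto)
  also have "mirror e ` (mirror e ` ?S) = ?S"
    using assms by (simp add: image_image mirror_involution)
  finally have "emeasure lborel (mirror e ` ?S) = emeasure lborel ?S" using 1 by simp
  then show "emeasure (distr lborel borel (mirror e)) ?S = (\<Prod>b\<in>Basis. (u - l) \<bullet> b)"
    using assms lu by (simp add: emeasure_distr mirror_vimage_image emeasure_lborel_box)
qed simp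

lemma integral_lborel_mirror:
  fixes f :: "'a::euclidean_space \<Rightarrow> real"
  assumes [measurable]: "f \<in> borel_measurable borel" and "norm e = 1"
  shows "(\<integral>y. f (mirror e y) \<partial>lborel) = (\<integral>y. f y \<partial>lborel)"
proof -
  have "(\<integral>y. f y \<partial>lborel) = (\<integral>y. f y \<partial>distr lborel borel (mirror e))"
    by (simp only: lborel_distr_mirror[OF assms(2)])
  also have "\<dots> = (\<integral>y. f (mirror e y) \<partial>lborel)"
    by (subst integral_distr) auto
  finally show ?thesis by simp
qed

lemma integrable_lborel_mirror:
  fixes f :: "'a::euclidean_space \<Rightarrow> real"
  assumes "integrable lborel f" and e: "norm e = 1"
  shows "integrable lborel (\<lambda>y. f (mirror e y))"
proof -
  have [measurable]: "f \<in> borel_measurable borel"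
    using assms by auto
  have "integrable (distr lborel borel (mirror e)) f"
    using assms by (simp only: lborel_distr_mirror[OF e])
  then show ?thesis
    by (subst (asm) integrable_distr_eq) auto
qed

text \<open>The reflection along \<open>a - b\<close> swaps the two unit vectors. Reflections alone
  therefore carry any direction to any other, and rotations never have to be treated. The case
  \<open>a = b\<close> is separate since it provides no normal.\<close>

lemma mirror_exchange:
  assumes "norm a = 1" "norm b = 1"
  obtains e where "norm e = 1" "\<And>y. mirror e y \<bullet> a = y \<bullet> b" | "a = b"
proof (cases "a = b")
  case False
  define e where "e = (a - b) /\<^sub>R norm (a - b)"
  have n: "norm (a - b) > 0" using False by simp
  have e1: "norm e = 1" using n by (simp add: e_def)
  have 1: "a \<bullet> a = 1" "b \<bullet> b = 1" using assms by (simp_all add: dot_square_norm)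
  have ab: "(norm (a - b))\<^sup>2 = 2 - 2 * (a \<bullet> b)"
    unfolding power2_norm_eq_inner using 1 by (simp add: inner_diff_left inner_diff_right inner_commute)
  have ea: "(a - b) \<bullet> a = (norm (a - b))\<^sup>2 / 2"
    unfolding ab using 1 by (simp add: inner_diff_left inner_commute[of b a])
  have "mirror e y \<bullet> a = y \<bullet> b" for y
  proof -
    have "mirror e y \<bullet> a = y \<bullet> a - 2 * (y \<bullet> (a - b)) * ((a - b) \<bullet> a) / (norm (a - b))\<^sup>2"
    proof -
      have "mirror e y \<bullet> a = y \<bullet> a - 2 * (y \<bullet> e) * (e \<bullet> a)"
        by (simp add: mirror_def inner_diff_left)
      also have "y \<bullet> e = (y \<bullet> (a - b)) / norm (a - b)" by (simp add: e_def divide_inverse mult.commute)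
      also have "e \<bullet> a = ((a - b) \<bullet> a) / norm (a - b)" by (simp add: e_def divide_inverse mult.commute)
      finally show ?thesis by (simp add: power2_eq_square)
    qed
    also have "\<dots> = y \<bullet> a - y \<bullet> (a - b)"
      using n by (simp add: ea)
    finally show ?thesis by (simp add: inner_diff_right)
  qed
  with e1 that show ?thesis by blast
qed

text \<open>Neumann series: \<open>d n\<close> is its n-th term, and row masses of at most
  \<open>q < 1\<close> force decay like \<open>q ^ n * G\<close>. It serves both the renewal
  equation on the line and the Dirichlet problem for a truncated kernel.\<close>

lemma kernel_fixed_point:
  fixes K :: "'a::euclidean_space \<Rightarrow> 'a \<Rightarrow> real"
  assumes Km [measurable]: "case_prod K \<in> borel_measurable (borel \<Otimes>\<^sub>M borel)"
    and K0: "\<And>x y. 0 \<le> K x y" and Ki: "\<And>x. integrable lborel (K x)"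
    and Kq: "\<And>x. (\<integral>y. K x y \<partial>lborel) \<le> q" and q: "0 \<le> q" "q < 1"
    and gm [measurable]: "g \<in> borel_measurable borel" and gb: "\<And>x. \<bar>g x\<bar> \<le> G"
  obtains u B where "u \<in> borel_measurable borel" "\<And>x. \<bar>u x\<bar> \<le> B"
    "\<And>x. u x = g x + (\<integral>y. K x y * u y \<partial>lborel)"
proof -
  define d where "d = rec_nat g (\<lambda>_ v x. \<integral>y. K x y * v y \<partial>lborel)"
  have d0: "d 0 = g" and dS: "d (Suc n) = (\<lambda>x. \<integral>y. K x y * d n y \<partial>lborel)" for n
    by (simp_all add: d_def)
  have dm [measurable]: "d n \<in> borel_measurable borel" for n
  proof (induction n)
    case (Suc n)
    note Suc [measurable]
    show ?case unfolding dS by measurable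
  qed (simp add: d0)
  have G0: "0 \<le> G" using gb[of 0] by linarith
  have int: "integrable lborel (\<lambda>y. K x y * v y)"
    if v: "v \<in> borel_measurable borel" "\<And>y. \<bar>v y\<bar> \<le> B" for x v B
  proof (rule Bochner_Integration.integrable_bound[of lborel "\<lambda>y. K x y * B"])
    show "integrable lborel (\<lambda>y. K x y * B)" using Ki by simp
    show "AE y in lborel. norm (K x y * v y) \<le> norm (K x y * B)"
      using v(2) K0 by (auto simp: abs_mult intro!: mult_left_mono order_trans[OF v(2)])
  qed (use v in measurable)
  have bd: "\<bar>\<integral>y. K x y * v y \<partial>lborel\<bar> \<le> q * B"
    if v: "v \<in> borel_measurable borel" "\<And>y. \<bar>v y\<bar> \<le> B" for x v B
  proof -
    have B0: "0 \<le> B" using v(2)[of 0] by linarith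
    have "\<bar>\<integral>y. K x y * v y \<partial>lborel\<bar> \<le> (\<integral>y. \<bar>K x y * v y\<bar> \<partial>lborel)"
      using integral_norm_bound[of lborel "\<lambda>y. K x y * v y"] by simp
    also have "\<dots> \<le> (\<integral>y. K x y * B \<partial>lborel)"
      using integrable_abs[OF int[OF v]] Ki K0 v(2) by (intro integral_mono) (auto simp: abs_mult intro!: mult_left_mono)
    also have "\<dots> \<le> q * B" using Kq[of x] B0 by (simp add: mult_right_mono)
    finally show ?thesis .
  qed
  have db: "\<bar>d n x\<bar> \<le> q ^ n * G" for n x
  proof (induction n arbitrary: x)
    case (Suc n)
    show ?case unfolding dS using bd[OF dm Suc] by (simp add: mult.assoc)
  qed (simp add: d0 gb)
  have sumG: "summable (\<lambda>n. q ^ n * G)" using q by (intro summable_mult2 summable_geometric) simp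
  have sumd: "summable (\<lambda>n. \<bar>d n x\<bar>)" for x
    by (rule summable_comparison_test'[OF sumG]) (use db in auto)
  define u where "u x = (\<Sum>n. d n x)" for x
  have um [measurable]: "u \<in> borel_measurable borel" unfolding u_def by measurable
  have ub: "\<bar>u x\<bar> \<le> (\<Sum>n. q ^ n * G)" for x
    unfolding u_def by (rule order_trans[OF summable_rabs[OF sumd]]) (intro suminf_le db sumd sumG)
  have "u x = g x + (\<integral>y. K x y * u y \<partial>lborel)" for x
  proof -
    have "(\<integral>y. K x y * u y \<partial>lborel) = (\<integral>y. (\<Sum>n. K x y * d n y) \<partial>lborel)"
      unfolding u_def by (intro Bochner_Integration.integral_cong refl suminf_mult[symmetric] summable_rabs_cancel[OF sumd])
    also have "\<dots> = (\<Sum>n. \<integral>y. K x y * d n y \<partial>lborel)"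
    proof (rule integral_suminf)
      show "integrable lborel (\<lambda>y. K x y * d n y)" for n using int[OF dm db] .
      show "AE y in lborel. summable (\<lambda>n. norm (K x y * d n y))"
        by (auto simp: abs_mult intro!: summable_mult sumd)
      show "summable (\<lambda>n. \<integral>y. norm (K x y * d n y) \<partial>lborel)"
      proof (rule summable_comparison_test'[OF sumG])
        fix n
        have "norm (\<integral>y. norm (K x y * d n y) \<partial>lborel) = \<bar>\<integral>y. K x y * \<bar>d n y\<bar> \<partial>lborel\<bar>"
          using K0 by (simp add: abs_mult)
        also have "\<dots> \<le> q * (q ^ n * G)" by (rule bd) (use db in auto)
        also have "\<dots> \<le> 1 * (q ^ n * G)" using q G0 by (intro mult_right_mono) auto
        finally show "norm (\<integral>y. norm (K x y * d n y) \<partial>lborel) \<le> q ^ n * G" by simp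
      qed
    qed
    also have "\<dots> = (\<Sum>n. d (Suc n) x)" by (simp add: dS)
    finally have "(\<integral>y. K x y * u y \<partial>lborel) = (\<Sum>n. d (Suc n) x)" .
    moreover have "u x = d 0 x + (\<Sum>n. d (Suc n) x)"
      unfolding u_def using suminf_split_head[OF summable_rabs_cancel[OF sumd]] by simp
    ultimately show ?thesis by (simp add: d0)
  qed
  with um ub that show thesis by blast
qed

section \<open>Wiener-Hopf factorization on the line\<close>

text \<open>A contraction argument in place of a maximum principle: if every nonnegative upper bound
  improves by the factor \<open>q\<close>, iteration drives it to 0. Neither continuity nor an
  attained supremum is involved. Sign, monotonicity and subadditivity of the renewal function
  \<open>w\<close> rest on it.\<close>

lemma iterated_bound_le_0:
  fixes F :: "'b \<Rightarrow> real"
  assumes B: "\<And>x. x \<in> S \<Longrightarrow> F x \<le> B" and q: "0 \<le> q" "q < 1"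
    and step: "\<And>C x. 0 \<le> C \<Longrightarrow> (\<And>y. y \<in> S \<Longrightarrow> F y \<le> C) \<Longrightarrow> x \<in> S \<Longrightarrow> F x \<le> q * C"
    and x: "x \<in> S"
  shows "F x \<le> 0"
proof -
  have "F y \<le> q ^ n * max 0 B" if "y \<in> S" for n y
    using that
  proof (induction n arbitrary: y)
    case 0
    then show ?case using B[of y] by simp
  next
    case (Suc n)
    show ?case using step[OF _ Suc.IH Suc.prems] q by (simp add: mult.assoc)
  qed
  then have "F x \<le> q ^ n * max 0 B" for n using x by blast
  moreover have "(\<lambda>n. q ^ n * max 0 B) \<longlonglongrightarrow> 0 * max 0 B"
    using q by (intro tendsto_mult_right LIMSEQ_realpow_zero)
  ultimately show ?thesis
    using LIMSEQ_le_const[of "\<lambda>n. q ^ n * max 0 B" "0 * max 0 B" "F x"] by auto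
qed

lemma SUP_mult_ennreal:
  fixes a b :: "nat \<Rightarrow> ennreal"
  assumes "incseq a" "incseq b"
  shows "(SUP n. a n * b n) = (SUP n. a n) * (SUP n. b n)"
proof (rule antisym)
  show "(SUP n. a n * b n) \<le> (SUP n. a n) * (SUP n. b n)"
    by (intro SUP_least mult_mono SUP_upper) auto
  have "a i * b j \<le> (SUP n. a n * b n)" for i j
  proof -
    have "a i * b j \<le> a (max i j) * b (max i j)"
      using assms by (intro mult_mono) (auto simp: incseq_def)
    also have "\<dots> \<le> (SUP n. a n * b n)" by (intro SUP_upper) auto
    finally show ?thesis .
  qed
  then have "(SUP i. SUP j. a i * b j) \<le> (SUP n. a n * b n)" by (intro SUP_least)
  moreover have "(SUP n. a n) * (SUP n. b n) = (SUP i. SUP j. a i * b j)"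
    by (subst SUP_commute) (simp add: SUP_mult_right_ennreal SUP_mult_left_ennreal)
  ultimately show "(SUP n. a n) * (SUP n. b n) \<le> (SUP n. a n * b n)" by simp
qed

text \<open>The self-correlation of \<open>E\<close> tested against \<open>F\<close> on positive
  lags only. The substitution \<open>a = x + z\<close> is already made, so that exchanging
  \<open>a\<close> and \<open>z\<close> relates the two halves of the full correlation.\<close>

definition half_corr :: "(real \<Rightarrow> ennreal) \<Rightarrow> (real \<Rightarrow> ennreal) \<Rightarrow> ennreal" where
  "half_corr E F = (\<integral>\<^sup>+z. \<integral>\<^sup>+a. indicator {0<..} (a - z) * F (a - z) * (E a * E z) \<partial>lborel \<partial>lborel)"

lemma half_corr_eq:
  assumes [measurable]: "E \<in> borel_measurable borel" "F \<in> borel_measurable borel"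
  shows "(\<integral>\<^sup>+x. indicator {0<..} x * F x * (\<integral>\<^sup>+z. E (x + z) * E z \<partial>lborel) \<partial>lborel) = half_corr E F"
proof -
  have "(\<integral>\<^sup>+x. indicator {0<..} x * F x * (\<integral>\<^sup>+z. E (x + z) * E z \<partial>lborel) \<partial>lborel)
      = (\<integral>\<^sup>+x. \<integral>\<^sup>+z. indicator {0<..} x * F x * (E (x + z) * E z) \<partial>lborel \<partial>lborel)"
    by (intro nn_integral_cong nn_integral_cmult[symmetric]) measurable
  also have "\<dots> = (\<integral>\<^sup>+z. \<integral>\<^sup>+x. indicator {0<..} x * F x * (E (x + z) * E z) \<partial>lborel \<partial>lborel)"
    using lborel_pair.Fubini'[of "\<lambda>x z. indicator {0<..} x * F x * (E (x + z) * E z)"] by simp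
  also have "\<dots> = half_corr E F"
    unfolding half_corr_def
  proof (rule nn_integral_cong)
    fix z :: real
    show "(\<integral>\<^sup>+x. indicator {0<..} x * F x * (E (x + z) * E z) \<partial>lborel)
        = (\<integral>\<^sup>+a. indicator {0<..} (a - z) * F (a - z) * (E a * E z) \<partial>lborel)"
      using nn_integral_lborel_translate[of "\<lambda>a. indicator {0<..} (a - z) * F (a - z) * (E a * E z)" z]
      by (simp add: add.commute)
  qed
  finally show ?thesis .
qed

text \<open>The diagonal is a null set, and exchanging the two variables turns negative lags into
  positive ones with \<open>F\<close> reflected.\<close>

lemma half_corr_sum:
  assumes [measurable]: "E \<in> borel_measurable borel" "F \<in> borel_measurable borel"
  shows "(\<integral>\<^sup>+z. \<integral>\<^sup>+a. F (a - z) * (E a * E z) \<partial>lborel \<partial>lborel)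
     = half_corr E F + half_corr E (\<lambda>x. F (- x))"
proof -
  have "(\<integral>\<^sup>+a. F (a - z) * (E a * E z) \<partial>lborel)
      = (\<integral>\<^sup>+a. indicator {0<..} (a - z) * F (a - z) * (E a * E z) \<partial>lborel)
      + (\<integral>\<^sup>+a. indicator {0<..} (z - a) * F (a - z) * (E a * E z) \<partial>lborel)" for z :: real
  proof -
    have "(\<integral>\<^sup>+a. F (a - z) * (E a * E z) \<partial>lborel) =
      (\<integral>\<^sup>+a. indicator {0<..} (a - z) * F (a - z) * (E a * E z)
         + indicator {0<..} (z - a) * F (a - z) * (E a * E z) \<partial>lborel)"
      using AE_lborel_singleton[of z] by (intro nn_integral_cong_AE) (auto split: split_indicator)
    also have "\<dots> = (\<integral>\<^sup>+a. indicator {0<..} (a - z) * F (a - z) * (E a * E z) \<partial>lborel)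
      + (\<integral>\<^sup>+a. indicator {0<..} (z - a) * F (a - z) * (E a * E z) \<partial>lborel)"
      by (intro nn_integral_add) measurable
    finally show ?thesis .
  qed
  then have "(\<integral>\<^sup>+z. \<integral>\<^sup>+a. F (a - z) * (E a * E z) \<partial>lborel \<partial>lborel)
     = half_corr E F + (\<integral>\<^sup>+z. \<integral>\<^sup>+a. indicator {0<..} (z - a) * F (a - z) * (E a * E z) \<partial>lborel \<partial>lborel)"
    unfolding half_corr_def by (simp add: nn_integral_add)
  also have "(\<integral>\<^sup>+z. \<integral>\<^sup>+a. indicator {0<..} (z - a) * F (a - z) * (E a * E z) \<partial>lborel \<partial>lborel)
      = (\<integral>\<^sup>+a. \<integral>\<^sup>+z. indicator {0<..} (z - a) * F (a - z) * (E a * E z) \<partial>lborel \<partial>lborel)"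
    using lborel_pair.Fubini'[of "\<lambda>z a. indicator {0<..} (z - a) * F (a - z) * (E a * E z)"] by simp
  also have "\<dots> = half_corr E (\<lambda>x. F (- x))"
    unfolding half_corr_def by (simp add: mult.commute)
  finally show ?thesis .
qed

text \<open>For the even function \<open>F = 1\<close> both halves have the same weight. This
  produces the square in the quadratic relation for the mass of the factor.\<close>

lemma half_corr_mass:
  assumes [measurable]: "E \<in> borel_measurable borel"
  shows "2 * half_corr E (\<lambda>_. 1) = (\<integral>\<^sup>+z. E z \<partial>lborel) ^ 2"
proof -
  have "2 * half_corr E (\<lambda>_. 1) = (\<integral>\<^sup>+z. \<integral>\<^sup>+a. E a * E z \<partial>lborel \<partial>lborel)"
    using half_corr_sum[of E "\<lambda>_. 1"] by (simp add: mult_2)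
  also have "\<dots> = (\<integral>\<^sup>+z. E z \<partial>lborel) ^ 2"
    by (simp add: nn_integral_multc nn_integral_cmult power2_eq_square)
  finally show ?thesis .
qed

lemma nn_integral_even_half:
  fixes P F :: "real \<Rightarrow> ennreal"
  assumes [measurable]: "P \<in> borel_measurable borel" "F \<in> borel_measurable borel"
    and even: "\<And>x. P (- x) = P x"
  shows "(\<integral>\<^sup>+x. indicator {0<..} x * F x * P x \<partial>lborel) + (\<integral>\<^sup>+x. indicator {0<..} x * F (- x) * P x \<partial>lborel)
    = (\<integral>\<^sup>+x. F x * P x \<partial>lborel)"
proof -
  have "(\<integral>\<^sup>+x. indicator {0<..} x * F (- x) * P x \<partial>lborel) = (\<integral>\<^sup>+x. indicator {..<0} x * F x * P x \<partial>lborel)"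
    using nn_integral_lborel_minus[of "\<lambda>x. indicator {..<0} x * F x * P x"]
    by (simp add: even indicator_def)
  moreover have "(\<integral>\<^sup>+x. F x * P x \<partial>lborel) = (\<integral>\<^sup>+x. indicator {0<..} x * F x * P x + indicator {..<0} x * F x * P x \<partial>lborel)"
    using AE_lborel_singleton[of 0] by (intro nn_integral_cong_AE) (auto split: split_indicator)
  ultimately show ?thesis by (simp add: nn_integral_add)
qed

text \<open>The factorization \<open>\<delta> - p = (\<delta> - e) * (\<delta> - e')\<close> with \<open>e\<close> living on the positive half-line,
  where \<open>e'\<close> is the reflection of \<open>e\<close>: comparing both sides on \<open>x > 0\<close> gives the fixed point
  equation \<open>e(x) = p(x) + \<integral> e(x + z) e(z) dz\<close>, which is solved by monotone iteration. Integrating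
  it gives \<open>2 m = q + m\<^sup>2\<close> for the mass \<open>m\<close> of \<open>e\<close>.\<close>

lemma wiener_hopf_factor:
  fixes p :: "real \<Rightarrow> real"
  assumes pm [measurable]: "p \<in> borel_measurable borel" and p0: "\<And>x. 0 \<le> p x"
    and even: "\<And>x. p (- x) = p x" and pint: "integrable lborel p"
    and q: "(\<integral>x. p x \<partial>lborel) = q" "q < 1"
  obtains e where "e \<in> borel_measurable borel" "\<And>x. 0 \<le> e x" "\<And>x. x \<le> 0 \<Longrightarrow> e x = 0"
    "integrable lborel e" "(\<integral>x. e x \<partial>lborel) = 1 - sqrt (1 - q)"
    "\<And>F :: real \<Rightarrow> ennreal. F \<in> borel_measurable borel \<Longrightarrow>
      (\<integral>\<^sup>+z. \<integral>\<^sup>+a. F (a - z) * (ennreal (e a) * ennreal (e z)) \<partial>lborel \<partial>lborel) + (\<integral>\<^sup>+x. F x * ennreal (p x) \<partial>lborel)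
      = (\<integral>\<^sup>+z. F z * ennreal (e z) \<partial>lborel) + (\<integral>\<^sup>+z. F (- z) * ennreal (e z) \<partial>lborel)"
proof -
  have q0: "0 \<le> q" unfolding q(1)[symmetric] using p0 by (intro Bochner_Integration.integral_nonneg) auto
  define P where "P x = ennreal (p x)" for x
  have Pm [measurable]: "P \<in> borel_measurable borel" unfolding P_def by measurable
  have Pq: "(\<integral>\<^sup>+x. P x \<partial>lborel) = ennreal q"
    unfolding P_def using nn_integral_eq_integral[OF pint] p0 q by simp
  \<comment> \<open>The iteration starts at 0: this makes it increasing and keeps its masses below
    the smaller root \<open>s\<close> of the mass relation. Values in \<open>ennreal\<close> give
    the limit without any convergence question.\<close>
  define E where "E = rec_nat (\<lambda>_. 0 :: ennreal)
     (\<lambda>_ v x. indicator {0<..} (x::real) * (P x + (\<integral>\<^sup>+z. v (x + z) * v z \<partial>lborel)))"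
  have E0: "E 0 = (\<lambda>_. 0)" and ES: "E (Suc n) = (\<lambda>x. indicator {0<..} x * (P x + (\<integral>\<^sup>+z. E n (x + z) * E n z \<partial>lborel)))" for n
    by (simp_all add: E_def)
  have Em [measurable]: "E n \<in> borel_measurable borel" for n
  proof (induction n)
    case (Suc n)
    note Suc [measurable]
    show ?case unfolding ES by measurable
  qed (simp add: E0)
  have Einc': "E n x \<le> E (Suc n) x" for n x
  proof (induction n arbitrary: x)
    case (Suc n)
    have "E (Suc n) x = indicator {0<..} x * (P x + (\<integral>\<^sup>+z. E n (x + z) * E n z \<partial>lborel))"
      by (simp only: ES)
    also have "\<dots> \<le> indicator {0<..} x * (P x + (\<integral>\<^sup>+z. E (Suc n) (x + z) * E (Suc n) z \<partial>lborel))"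
      by (intro mult_left_mono add_left_mono nn_integral_mono mult_mono Suc) auto
    also have "\<dots> = E (Suc (Suc n)) x" by (simp only: ES[of "Suc n"])
    finally show ?case .
  qed (simp add: E0)
  have Einc: "incseq (\<lambda>n. E n x)" for x using Einc' by (intro incseq_SucI)
  define s where "s = 1 - sqrt (1 - q)"
  have s: "0 \<le> s" "s \<le> 1" "2 * s = q + s^2"
    using q0 q by (auto simp: s_def power2_diff)
  have two: "2 * ennreal x = ennreal (2 * x)" for x
    using ennreal_mult'[of 2 x] by simp
  have sq: "ennreal q + ennreal x ^ 2 = ennreal (q + x\<^sup>2)" if "0 \<le> x" for x
    using that q0 by (simp add: ennreal_power)
  define EE where "EE x = (SUP n. E n x)" for x
  have EEm [measurable]: "EE \<in> borel_measurable borel" unfolding EE_def by measurable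
  have fixp: "EE x = indicator {0<..} x * (P x + (\<integral>\<^sup>+z. EE (x + z) * EE z \<partial>lborel))" for x
  proof -
    have "EE x = (SUP n. E (Suc n) x)"
      unfolding EE_def using Einc[of x] by (intro antisym SUP_mono) (auto simp: incseq_Suc_iff intro!: exI)
    also have "\<dots> = indicator {0<..} x * (SUP n. P x + (\<integral>\<^sup>+z. E n (x + z) * E n z \<partial>lborel))"
      unfolding ES by (simp add: SUP_mult_left_ennreal)
    also have "(SUP n. P x + (\<integral>\<^sup>+z. E n (x + z) * E n z \<partial>lborel)) = P x + (SUP n. \<integral>\<^sup>+z. E n (x + z) * E n z \<partial>lborel)"
      by (simp add: ennreal_SUP_add_right)
    also have "(SUP n. \<integral>\<^sup>+z. E n (x + z) * E n z \<partial>lborel) = (\<integral>\<^sup>+z. (SUP n. E n (x + z) * E n z) \<partial>lborel)"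
      by (intro nn_integral_monotone_convergence_SUP[symmetric])
        (auto intro!: incseq_SucI le_funI mult_mono Einc')
    also have "\<dots> = (\<integral>\<^sup>+z. EE (x + z) * EE z \<partial>lborel)"
      unfolding EE_def using Einc by (intro nn_integral_cong SUP_mult_ennreal)
    finally show ?thesis .
  qed
  have Pq2: "2 * (\<integral>\<^sup>+x. indicator {0<..} x * P x \<partial>lborel) = ennreal q"
    using nn_integral_even_half[of P "\<lambda>_. 1"] Pq even by (simp add: P_def mult_2)
  have mass_le: "(\<integral>\<^sup>+x. E n x \<partial>lborel) \<le> ennreal s" for n
  proof (induction n)
    case (Suc n)
    have "(\<integral>\<^sup>+x. E (Suc n) x \<partial>lborel) = (\<integral>\<^sup>+x. indicator {0<..} x * P x + indicator {0<..} x * 1 * (\<integral>\<^sup>+z. E n (x + z) * E n z \<partial>lborel) \<partial>lborel)"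
      unfolding ES by (simp add: distrib_left)
    also have "\<dots> = (\<integral>\<^sup>+x. indicator {0<..} x * P x \<partial>lborel) + half_corr (E n) (\<lambda>_. 1)"
      by (subst nn_integral_add) (simp_all add: half_corr_eq[of "E n" "\<lambda>_. 1", simplified])
    finally have "2 * (\<integral>\<^sup>+x. E (Suc n) x \<partial>lborel) = ennreal q + (\<integral>\<^sup>+z. E n z \<partial>lborel) ^ 2"
      by (simp add: distrib_left Pq2 half_corr_mass)
    also have "\<dots> \<le> ennreal q + ennreal s ^ 2"
      by (intro add_left_mono power_mono Suc) simp
    also have "\<dots> = 2 * ennreal s"
      using s by (simp only: two sq)
    finally show ?case by (subst (asm) ennreal_mult_le_mult_iff) auto
  qed (simp add: E0)
  have "(\<integral>\<^sup>+x. EE x \<partial>lborel) = (SUP n. \<integral>\<^sup>+x. E n x \<partial>lborel)"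
    unfolding EE_def by (intro nn_integral_monotone_convergence_SUP) (auto intro!: incseq_SucI le_funI Einc')
  then have EEs: "(\<integral>\<^sup>+x. EE x \<partial>lborel) \<le> ennreal s" using mass_le by (simp add: SUP_least)
  then obtain m where m: "(\<integral>\<^sup>+x. EE x \<partial>lborel) = ennreal m" "0 \<le> m" "m \<le> s"
    using s by (cases "\<integral>\<^sup>+x. EE x \<partial>lborel") (auto simp: top_unique)
  have split: "(\<integral>\<^sup>+x. F x * EE x \<partial>lborel) = (\<integral>\<^sup>+x. indicator {0<..} x * F x * P x \<partial>lborel) + half_corr EE F"
    if [measurable]: "F \<in> borel_measurable borel" for F
  proof -
    have "(\<integral>\<^sup>+x. F x * EE x \<partial>lborel) = (\<integral>\<^sup>+x. indicator {0<..} x * F x * P x + indicator {0<..} x * F x * (\<integral>\<^sup>+z. EE (x + z) * EE z \<partial>lborel) \<partial>lborel)"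
      by (intro nn_integral_cong, subst fixp) (auto simp: distrib_left split: split_indicator)
    also have "\<dots> = (\<integral>\<^sup>+x. indicator {0<..} x * F x * P x \<partial>lborel) + half_corr EE F"
      by (subst nn_integral_add) (simp_all add: half_corr_eq)
    finally show ?thesis .
  qed
  \<comment> \<open>The mass relation is quadratic; the bound \<open>m \<le> s\<close> inherited
    from the iteration excludes the larger root.\<close>
  have "m = s"
  proof -
    have "2 * ennreal m = ennreal q + ennreal m ^ 2"
      using split[of "\<lambda>_. 1"] by (simp add: distrib_left Pq2 half_corr_mass flip: m(1))
    then have "ennreal (2 * m) = ennreal (q + m^2)"
      using m by (simp only: two sq)
    then have "2 * m = q + m^2" using m q0 by (subst (asm) ennreal_inj) auto
    then have "(1 - m)^2 = 1 - q" by (simp add: power2_eq_square algebra_simps)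
    then have "1 - m = sqrt (1 - q)" using m s by (metis diff_ge_0_iff_ge order.trans real_sqrt_unique)
    then show ?thesis by (simp add: s_def)
  qed
  \<comment> \<open>The limit may be infinite on a null set, where \<open>enn2real\<close> returns
    0. The factorization is stated in integrated form, so this changes nothing.\<close>
  define e where "e x = enn2real (EE x)" for x
  have em [measurable]: "e \<in> borel_measurable borel" unfolding e_def by measurable
  have "AE x in lborel. EE x \<noteq> \<infinity>"
    using m by (intro nn_integral_noteq_infinite) auto
  then have eE: "AE x in lborel. ennreal (e x) = EE x"
    unfolding e_def by eventually_elim (auto simp: less_top)
  have e0: "0 \<le> e x" for x by (simp add: e_def)
  have en: "e x = 0" if "x \<le> 0" for x using fixp[of x] that by (simp add: e_def)
  have em2: "(\<integral>\<^sup>+x. ennreal (e x) \<partial>lborel) = ennreal s"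
    using m \<open>m = s\<close> eE by (simp add: nn_integral_cong_AE)
  have eint: "integrable lborel e"
    using em2 e0 by (intro integrableI_bounded) auto
  have eint2: "(\<integral>x. e x \<partial>lborel) = s"
    using em2 e0 s by (simp add: integral_eq_nn_integral)
  have ident: "(\<integral>\<^sup>+z. \<integral>\<^sup>+a. F (a - z) * (ennreal (e a) * ennreal (e z)) \<partial>lborel \<partial>lborel) + (\<integral>\<^sup>+x. F x * ennreal (p x) \<partial>lborel)
      = (\<integral>\<^sup>+z. F z * ennreal (e z) \<partial>lborel) + (\<integral>\<^sup>+z. F (- z) * ennreal (e z) \<partial>lborel)"
    if [measurable]: "F \<in> borel_measurable borel" for F
  proof -
    have "(\<integral>\<^sup>+z. \<integral>\<^sup>+a. F (a - z) * (ennreal (e a) * ennreal (e z)) \<partial>lborel \<partial>lborel)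
       = (\<integral>\<^sup>+z. \<integral>\<^sup>+a. F (a - z) * (EE a * EE z) \<partial>lborel \<partial>lborel)"
    proof (rule nn_integral_cong_AE, use eE in eventually_elim)
      case (elim z)
      show ?case by (rule nn_integral_cong_AE, use eE in eventually_elim) (simp add: elim)
    qed
    also have "\<dots> = half_corr EE F + half_corr EE (\<lambda>x. F (- x))" by (rule half_corr_sum) measurable
    finally have 1: "(\<integral>\<^sup>+z. \<integral>\<^sup>+a. F (a - z) * (ennreal (e a) * ennreal (e z)) \<partial>lborel \<partial>lborel) = \<dots>" .
    have 2: "(\<integral>\<^sup>+z. F z * ennreal (e z) \<partial>lborel) = (\<integral>\<^sup>+x. F x * EE x \<partial>lborel)"
      by (rule nn_integral_cong_AE, use eE in eventually_elim) simp
    have 3: "(\<integral>\<^sup>+z. F (- z) * ennreal (e z) \<partial>lborel) = (\<integral>\<^sup>+x. F (- x) * EE x \<partial>lborel)"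
      by (rule nn_integral_cong_AE, use eE in eventually_elim) simp
    have 4: "(\<integral>\<^sup>+x. F x * ennreal (p x) \<partial>lborel) = (\<integral>\<^sup>+x. indicator {0<..} x * F x * P x \<partial>lborel) + (\<integral>\<^sup>+x. indicator {0<..} x * F (- x) * P x \<partial>lborel)"
      using nn_integral_even_half[of P F] even by (simp add: P_def)
    show ?thesis unfolding 1 2 3 4 by (simp add: split add_ac)
  qed
  show thesis
    by (rule that[OF em e0 en eint]) (use eint2 ident in \<open>auto simp: s_def\<close>)
qed

section \<open>The renewal function of the ladder density\<close>

lemma one_minus_cos_le: "1 - cos x \<le> x\<^sup>2 / 2" for x :: real
proof -
  have "1 - cos x = 2 * (sin (x / 2))\<^sup>2" using cos_double_sin[of "x / 2"] by simp
  also have "(sin (x / 2))\<^sup>2 \<le> (x / 2)\<^sup>2"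
    using abs_sin_x_le_abs_x[of "x / 2"] by (simp only: abs_le_square_iff)
  finally show ?thesis by (simp add: power_divide)
qed

lemma integrable_bounded_mult:
  fixes g F :: "'a::euclidean_space \<Rightarrow> real"
  assumes g: "integrable lborel g" and F [measurable]: "F \<in> borel_measurable borel" and B: "\<And>x. \<bar>F x\<bar> \<le> B"
  shows "integrable lborel (\<lambda>x. g x * F x)"
proof (rule Bochner_Integration.integrable_bound[of lborel "\<lambda>y. g y * B"])
  have [measurable]: "g \<in> borel_measurable borel" using g by auto
  show "integrable lborel (\<lambda>y. g y * B)" using g by simp
  show "AE y in lborel. norm (g y * F y) \<le> norm (g y * B)"
    by (auto simp: abs_mult intro!: mult_left_mono order_trans[OF B])
  show "(\<lambda>x. g x * F x) \<in> borel_measurable lborel" by measurable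
qed

text \<open>\<open>e\<close> plays the role of the ladder height density of a walk with step density
  \<open>p\<close>, killed with probability \<open>1 - q\<close> at each step.
  \<open>efactor\<close> is the convolution identity e * e' + p = e + e', where e' is the reflection
  of \<open>e\<close>, tested against nonnegative functions so that integrability is no
  issue.\<close>

locale wiener_hopf =
  fixes p e :: "real \<Rightarrow> real" and q :: real
  assumes pm [measurable]: "p \<in> borel_measurable borel" and p0: "0 \<le> p x"
    and pint: "integrable lborel p" and pq: "(\<integral>x. p x \<partial>lborel) = q" and q1: "q < 1"
    and em [measurable]: "e \<in> borel_measurable borel" and e0: "0 \<le> e x"
    and eneg: "x \<le> 0 \<Longrightarrow> e x = 0" and eint: "integrable lborel e"
    and emass: "(\<integral>x. e x \<partial>lborel) = 1 - sqrt (1 - q)"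
    and efactor: "F \<in> borel_measurable borel \<Longrightarrow>
      (\<integral>\<^sup>+z. \<integral>\<^sup>+a. F (a - z) * (ennreal (e a) * ennreal (e z)) \<partial>lborel \<partial>lborel) + (\<integral>\<^sup>+x. F x * ennreal (p x) \<partial>lborel)
      = (\<integral>\<^sup>+z. F z * ennreal (e z) \<partial>lborel) + (\<integral>\<^sup>+z. F (- z) * ennreal (e z) \<partial>lborel)"
begin

definition m :: real where "m = (\<integral>x. e x \<partial>lborel)"

text \<open>The one-sided factor carries the square root of the killing probability
  \<open>1 - q\<close>: the first appearance of the exponent 1/2.\<close>

lemma m_bounds: "0 \<le> m" "m < 1" "(1 - m)\<^sup>2 = 1 - q"
proof -
  show "0 \<le> m" unfolding m_def using e0 by (intro Bochner_Integration.integral_nonneg) auto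
  show "m < 1" "(1 - m)\<^sup>2 = 1 - q" using q1 unfolding m_def emass by auto
qed

lemma e_integral_le:
  assumes F [measurable]: "F \<in> borel_measurable borel" and B: "\<And>x. \<bar>F x\<bar> \<le> B"
    and C: "\<And>z. 0 < z \<Longrightarrow> F z \<le> C"
  shows "(\<integral>z. e z * F z \<partial>lborel) \<le> m * C"
proof -
  have "(\<integral>z. e z * F z \<partial>lborel) \<le> (\<integral>z. e z * C \<partial>lborel)"
  proof (rule integral_mono)
    show "integrable lborel (\<lambda>z. e z * F z)" by (rule integrable_bounded_mult[OF eint F B])
    show "e z * F z \<le> e z * C" for z
      using C[of z] e0[of z] eneg[of z] by (cases "0 < z") (auto intro: mult_left_mono)
  qed (use eint in simp)
  then show ?thesis by (simp add: m_def)
qed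

lemma factor_real:
  assumes F [measurable]: "F \<in> borel_measurable borel" and F0: "\<And>x. 0 \<le> F x" and B: "\<And>x. F x \<le> B"
  shows "(\<integral>z. e z * (\<integral>a. e a * F (a - z) \<partial>lborel) \<partial>lborel) + (\<integral>x. p x * F x \<partial>lborel)
     = (\<integral>z. e z * F z \<partial>lborel) + (\<integral>z. e z * F (- z) \<partial>lborel)"
proof -
  have B': "\<bar>F x\<bar> \<le> B" for x using F0 B by simp
  have int: "integrable lborel (\<lambda>a. g a * F (h a))" if "integrable lborel g" and [measurable]: "h \<in> borel_measurable borel" for g h :: "real \<Rightarrow> real"
    by (rule integrable_bounded_mult[OF that(1)]) (use B' in auto)
  have nn: "(\<integral>\<^sup>+a. F (h a) * ennreal (g a) \<partial>lborel) = ennreal (\<integral>a. g a * F (h a) \<partial>lborel)"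
    if "integrable lborel g" "\<And>a. 0 \<le> g a" "h \<in> borel_measurable borel" for g h :: "real \<Rightarrow> real"
    using nn_integral_eq_integral[OF int[OF that(1,3)]] that F0
    by (simp add: ennreal_mult' mult.commute)
  have inner: "(\<integral>\<^sup>+a. F (a - z) * (ennreal (e a) * ennreal (e z)) \<partial>lborel) = ennreal (e z * (\<integral>a. e a * F (a - z) \<partial>lborel))" for z
  proof -
    have "(\<integral>\<^sup>+a. F (a - z) * (ennreal (e a) * ennreal (e z)) \<partial>lborel) = (\<integral>\<^sup>+a. F (a - z) * ennreal (e a) * ennreal (e z) \<partial>lborel)"
      by (simp add: mult.assoc)
    also have "\<dots> = ennreal (\<integral>a. e a * F (a - z) \<partial>lborel) * ennreal (e z)"
      by (subst nn_integral_multc) (use nn[OF eint e0, of "\<lambda>a. a - z"] in auto)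
    also have "\<dots> = ennreal (e z * (\<integral>a. e a * F (a - z) \<partial>lborel))"
      using e0 by (simp add: ennreal_mult' mult.commute)
    finally show ?thesis .
  qed
  have in0: "0 \<le> (\<integral>a. e a * F (a - z) \<partial>lborel)" for z
    using e0 F0 by (intro Bochner_Integration.integral_nonneg) auto
  have in1: "(\<integral>a. e a * F (a - z) \<partial>lborel) \<le> m * B" for z
    by (rule e_integral_le[where B=B]) (use B B' in auto)
  have "integrable lborel (\<lambda>z. e z * (\<integral>a. e a * F (a - z) \<partial>lborel))"
    by (rule integrable_bounded_mult[OF eint, where B="m * B"]) (use in0 in1 in auto)
  then have outer: "(\<integral>\<^sup>+z. \<integral>\<^sup>+a. F (a - z) * (ennreal (e a) * ennreal (e z)) \<partial>lborel \<partial>lborel)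
     = ennreal (\<integral>z. e z * (\<integral>a. e a * F (a - z) \<partial>lborel) \<partial>lborel)"
    unfolding inner using in0 e0 by (intro nn_integral_eq_integral) auto
  have "ennreal (\<integral>z. e z * (\<integral>a. e a * F (a - z) \<partial>lborel) \<partial>lborel) + ennreal (\<integral>x. p x * F x \<partial>lborel)
     = ennreal (\<integral>z. e z * F z \<partial>lborel) + ennreal (\<integral>z. e z * F (- z) \<partial>lborel)"
    using efactor[of "\<lambda>x. ennreal (F x)"] nn[OF pint p0, of "\<lambda>x. x"] nn[OF eint e0, of "\<lambda>x. x"] nn[OF eint e0, of uminus]
    by (simp add: outer)
  moreover have "0 \<le> (\<integral>z. e z * (\<integral>a. e a * F (a - z) \<partial>lborel) \<partial>lborel)" "0 \<le> (\<integral>x. p x * F x \<partial>lborel)"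
    "0 \<le> (\<integral>z. e z * F z \<partial>lborel)" "0 \<le> (\<integral>z. e z * F (- z) \<partial>lborel)"
    using in0 e0 F0 p0 by (auto intro!: Bochner_Integration.integral_nonneg)
  ultimately show ?thesis
    by (simp flip: ennreal_plus)
qed

lemma renewal_exists:
  obtains w where "w \<in> borel_measurable borel" "bounded (range w)"
    "\<And>x. w x = (1 - m) * indicator {0<..} x + (\<integral>z. e z * w (x - z) \<partial>lborel)"
proof -
  have "integrable lborel (\<lambda>y. e (- y))" "(\<integral>y. e (- y) \<partial>lborel) = m"
    using integrable_lborel_minus[OF eint] integral_lborel_minus[of e] by (auto simp: m_def)
  then have Ki: "integrable lborel (\<lambda>y. e (x - y))" and Kq: "(\<integral>y. e (x - y) \<partial>lborel) \<le> m" for x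
    using integrable_lborel_translate[of "\<lambda>y. e (- y)" "-x"] integral_lborel_translate[of "\<lambda>y. e (- y)" "-x"]
    by simp_all
  have Km: "(\<lambda>(x, y). e (x - y)) \<in> borel_measurable (borel \<Otimes>\<^sub>M borel)" by measurable
  have gm: "(\<lambda>x. (1 - m) * indicator {0<..} x) \<in> borel_measurable (borel :: real measure)" by measurable
  have gb: "\<bar>(1 - m) * indicator {0<..} x\<bar> \<le> 1 - m" for x :: real using m_bounds by (auto split: split_indicator)
  obtain w B where w: "w \<in> borel_measurable borel" "\<And>x. \<bar>w x\<bar> \<le> B"
    "\<And>x. w x = (1 - m) * indicator {0<..} x + (\<integral>y. e (x - y) * w y \<partial>lborel)"
    by (rule kernel_fixed_point[OF Km e0 Ki Kq m_bounds(1,2) gm gb]) (rule that)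
  have eq: "(\<integral>y. e (x - y) * w y \<partial>lborel) = (\<integral>z. e z * w (x - z) \<partial>lborel)" for x
  proof -
    note w(1) [measurable]
    have "(\<integral>y. e (x - y) * w y \<partial>lborel) = (\<integral>y. e (- y) * w (x + y) \<partial>lborel)"
      using integral_lborel_translate[of "\<lambda>y. e (x - y) * w y" x] by simp
    also have "\<dots> = (\<integral>z. e z * w (x - z) \<partial>lborel)"
      using integral_lborel_minus[of "\<lambda>z. e z * w (x - z)"] by simp
    finally show ?thesis .
  qed
  show thesis
  proof (rule that[OF w(1)])
    show "bounded (range w)" using w(2) by (auto simp: bounded_iff)
    show "w x = (1 - m) * indicator {0<..} x + (\<integral>z. e z * w (x - z) \<partial>lborel)" for x
      by (rule trans[OF w(3)]) (simp only: eq)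
  qed
qed

text \<open>Up to the factor \<open>1 - m\<close> this is the renewal function of \<open>e\<close>:
  iterating the equation sums the convolution powers of \<open>e\<close> over (0, x). The factor
  normalizes the limit at infinity to 1.\<close>

definition w :: "real \<Rightarrow> real" where
  "w = (SOME w. w \<in> borel_measurable borel \<and> bounded (range w) \<and>
    (\<forall>x. w x = (1 - m) * indicator {0<..} x + (\<integral>z. e z * w (x - z) \<partial>lborel)))"

lemma w_props: "w \<in> borel_measurable borel \<and> bounded (range w) \<and>
    (\<forall>x. w x = (1 - m) * indicator {0<..} x + (\<integral>z. e z * w (x - z) \<partial>lborel))"
proof -
  have ex: "\<exists>w. w \<in> borel_measurable borel \<and> bounded (range w) \<and>
    (\<forall>x. w x = (1 - m) * indicator {0<..} x + (\<integral>z. e z * w (x - z) \<partial>lborel))"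
    by (rule renewal_exists) blast
  show ?thesis unfolding w_def by (rule someI_ex[OF ex])
qed

lemma w_measurable [measurable]: "w \<in> borel_measurable borel" using w_props by blast

lemma w_bounded: obtains B where "\<And>x. \<bar>w x\<bar> \<le> B"
  using conjunct1[OF conjunct2[OF w_props]] by (auto simp: bounded_iff)

lemma w_eq: "w x = (1 - m) * indicator {0<..} x + (\<integral>z. e z * w (x - z) \<partial>lborel)"
  using w_props by blast

text \<open>For \<open>x \<le> 0\<close> the source vanishes and, as \<open>e\<close> lives on the
  positive half-line, the equation involves only values further to the left. So \<open>{..0}\<close>
  is closed under the iteration, which contracts with factor \<open>m\<close>.\<close>

lemma w_neg: assumes "x \<le> 0" shows "w x = 0"
proof -
  obtain B where B: "\<And>x. \<bar>w x\<bar> \<le> B" using w_bounded by blast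
  have "\<bar>w x\<bar> \<le> 0"
  proof (rule iterated_bound_le_0[of "{..0}" "\<lambda>x. \<bar>w x\<bar>" B m])
    fix C x assume C: "0 \<le> C" "\<And>y. y \<in> {..0} \<Longrightarrow> \<bar>w y\<bar> \<le> C" and x: "x \<in> {..(0::real)}"
    have wx: "w x = (\<integral>z. e z * w (x - z) \<partial>lborel)" using w_eq[of x] x by simp
    have C': "\<bar>w (x - z)\<bar> \<le> C" if "0 < z" for z using C(2)[of "x - z"] x that by simp
    have 1: "w x \<le> m * C"
      unfolding wx by (rule e_integral_le[where B=B]) (use C' B in \<open>auto simp: abs_le_iff\<close>)
    have "(\<integral>z. e z * (- w (x - z)) \<partial>lborel) \<le> m * C"
      by (rule e_integral_le[where B=B]) (use C' B in \<open>auto simp: abs_le_iff\<close>)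
    then have "- w x \<le> m * C" using wx by simp
    with 1 show "\<bar>w x\<bar> \<le> m * C" by simp
  qed (use B m_bounds assms in auto)
  then show ?thesis by simp
qed

lemma w_int: "integrable lborel (\<lambda>z. e z * w (h z))" if [measurable]: "h \<in> borel_measurable borel"
proof -
  obtain B where B: "\<And>x. \<bar>w x\<bar> \<le> B" using w_bounded by blast
  show ?thesis by (rule integrable_bounded_mult[OF eint]) (use B in auto)
qed

text \<open>The increment over a fixed step \<open>h\<close> solves the renewal equation with a
  source of one sign.\<close>

lemma w_mono: assumes "x \<le> y" shows "w x \<le> w y"
proof -
  obtain B where B: "\<And>x. \<bar>w x\<bar> \<le> B" using w_bounded by blast
  define h where "h = y - x"
  have h: "0 \<le> h" using assms by (simp add: h_def)
  have B2: "\<bar>w x - w (x + h)\<bar> \<le> 2 * B" for x using B[of x] B[of "x + h"] by linarith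
  have "w x - w (x + h) \<le> 0"
  proof (rule iterated_bound_le_0[of UNIV "\<lambda>x. w x - w (x + h)" "2 * B" m])
    fix C x assume C: "0 \<le> C" "\<And>y. y \<in> UNIV \<Longrightarrow> w y - w (y + h) \<le> C"
    have "w x - w (x + h) \<le> (\<integral>z. e z * w (x - z) \<partial>lborel) - (\<integral>z. e z * w (x + h - z) \<partial>lborel)"
      using w_eq[of x] w_eq[of "x + h"] h m_bounds by (auto split: split_indicator)
    also have "\<dots> = (\<integral>z. e z * (w (x - z) - w (x - z + h)) \<partial>lborel)"
      using w_int[of "\<lambda>z. x - z"] w_int[of "\<lambda>z. x + h - z"]
      by (subst Bochner_Integration.integral_diff[symmetric]) (auto simp: right_diff_distrib algebra_simps)
    also have "\<dots> \<le> m * C"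
      using C(2) B2 by (intro e_integral_le[where B="2 * B"]) auto
    finally show "w x - w (x + h) \<le> m * C" .
  next
    show "w x - w (x + h) \<le> 2 * B" for x using B2[of x] by linarith
  qed (use m_bounds in auto)
  then show ?thesis by (simp add: h_def)
qed

lemma w_nonneg: "0 \<le> w x"
  using w_mono[of "min x 0" x] w_neg[of "min x 0"] by simp

lemma w_le_1: "w x \<le> 1"
proof -
  obtain B where B: "\<And>x. \<bar>w x\<bar> \<le> B" using w_bounded by blast
  have "w x - 1 \<le> 0"
  proof (rule iterated_bound_le_0[of UNIV "\<lambda>x. w x - 1" "B" m])
    fix C x assume C: "0 \<le> C" "\<And>y. y \<in> UNIV \<Longrightarrow> w y - 1 \<le> C"
    have "(\<integral>z. e z * (w (x - z)) \<partial>lborel) \<le> m * (C + 1)"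
      using C(2) B by (intro e_integral_le[where B="B"]) (auto simp: algebra_simps)
    then show "w x - 1 \<le> m * C"
      using w_eq[of x] m_bounds by (auto simp: algebra_simps split: split_indicator_asm)
  next
    show "w x - 1 \<le> B" for x using B[of x] by linarith
  qed (use m_bounds in auto)
  then show ?thesis by simp
qed

lemma w_abs: "\<bar>w x\<bar> \<le> 1" using w_nonneg w_le_1 by simp

text \<open>For \<open>x > 0\<close> the source terms of \<open>w (x + y)\<close> and
  \<open>w x\<close> cancel. Under the integral, jumps \<open>z < x\<close> lead back to the defect
  at \<open>x - z\<close>, while for \<open>z \<ge> x\<close> monotonicity gives
  \<open>w (x + y - z) \<le> w y\<close>. Subadditivity later takes the place of any regularity of
  \<open>w\<close> in the curvature estimate.\<close>

lemma w_subadd: assumes "0 \<le> x" "0 \<le> y" shows "w (x + y) \<le> w x + w y"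
proof (cases "x = 0")
  case False
  have "w (x + y) - w x - w y \<le> 0"
  proof (rule iterated_bound_le_0[of "{0<..}" "\<lambda>x. w (x + y) - w x - w y" 1 m])
    fix C x assume C: "0 \<le> C" "\<And>x. x \<in> {0<..} \<Longrightarrow> w (x + y) - w x - w y \<le> C" and x: "x \<in> {0::real<..}"
    have "w (x + y) - w x = (\<integral>z. e z * w (x + y - z) \<partial>lborel) - (\<integral>z. e z * w (x - z) \<partial>lborel)"
      using w_eq[of x] w_eq[of "x + y"] assms x by simp
    also have "\<dots> = (\<integral>z. e z * (w (x + y - z) - w (x - z)) \<partial>lborel)"
      using w_int[of "\<lambda>z. x - z"] w_int[of "\<lambda>z. x + y - z"]
      by (subst Bochner_Integration.integral_diff[symmetric]) (auto simp: right_diff_distrib)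
    also have "\<dots> \<le> m * (C + w y)"
    proof (rule e_integral_le[where B=2])
      show "\<bar>w (x + y - z) - w (x - z)\<bar> \<le> 2" for z
        using w_abs[of "x + y - z"] w_abs[of "x - z"] by linarith
      fix z :: real assume "0 < z"
      show "w (x + y - z) - w (x - z) \<le> C + w y"
      proof (cases "z < x")
        case True
        then show ?thesis using C(2)[of "x - z"] by (simp add: algebra_simps)
      next
        case False
        then have "w (x + y - z) \<le> w y" by (intro w_mono) simp
        then show ?thesis using C(1) w_nonneg[of "x - z"] by linarith
      qed
    qed measurable
    also have "\<dots> \<le> m * C + 1 * w y"
      unfolding distrib_left using m_bounds w_nonneg by (intro add_left_mono mult_right_mono) auto
    finally show "w (x + y) - w x - w y \<le> m * C" by simp
  next
    show "w (x + y) - w x - w y \<le> 1" for x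
      using w_abs[of "x + y"] w_nonneg[of x] w_nonneg[of y] by linarith
  qed (use m_bounds assms False in auto)
  then show ?thesis by simp
qed (simp add: w_neg)

text \<open>Testing the factorization with \<open>F s = w (x - s)\<close> produces inner integrals
  that the renewal equation at \<open>x + z > 0\<close> evaluates. The terms with
  \<open>w (x + z)\<close> cancel and only masses remain.\<close>

lemma w_equation:
  assumes "0 < x"
  shows "w x - (\<integral>z. p z * w (x - z) \<partial>lborel) = 1 - q"
proof -
  have 1: "(\<integral>z. e z * (\<integral>a. e a * w (x - (a - z)) \<partial>lborel) \<partial>lborel) + (\<integral>z. p z * w (x - z) \<partial>lborel)
     = (\<integral>z. e z * w (x - z) \<partial>lborel) + (\<integral>z. e z * w (x + z) \<partial>lborel)"
    using factor_real[of "\<lambda>s. w (x - s)" 1] w_nonneg w_le_1 by simp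
  have 2: "e z * (\<integral>a. e a * w (x - (a - z)) \<partial>lborel) = e z * w (x + z) - e z * (1 - m)" for z
  proof (cases "z \<le> 0")
    case False
    then have "w (x + z) = (1 - m) + (\<integral>a. e a * w (x + z - a) \<partial>lborel)"
      using w_eq[of "x + z"] assms by simp
    then have "(\<integral>a. e a * w (x - (a - z)) \<partial>lborel) = w (x + z) - (1 - m)" by (simp add: algebra_simps)
    then show ?thesis by (simp only: right_diff_distrib)
  qed (simp add: eneg)
  have "(\<integral>z. e z * (\<integral>a. e a * w (x - (a - z)) \<partial>lborel) \<partial>lborel) = (\<integral>z. e z * w (x + z) \<partial>lborel) - m * (1 - m)"
    unfolding 2 using w_int[of "\<lambda>z. x + z"] eint by (simp add: m_def)
  then have "w x - (\<integral>z. p z * w (x - z) \<partial>lborel) = (1 - m) - m * (1 - m)"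
    using 1 w_eq[of x] assms by simp
  also have "\<dots> = (1 - m)\<^sup>2" by (simp add: power2_eq_square algebra_simps)
  finally show ?thesis using m_bounds by simp
qed

text \<open>A real substitute for the ladder exponent 1 - e^ at frequency \<open>1 / X\<close>: the
  killing part plus a truncated first moment. It links \<open>w X\<close> to the symbol of
  \<open>p\<close>, since both are estimated through it.\<close>

definition bexp :: "real \<Rightarrow> real" where
  "bexp X = (1 - m) + (\<integral>z. e z * min 1 (max 0 (z / X)) \<partial>lborel)"

lemma bexp_pos: "0 < X \<Longrightarrow> 0 < bexp X"
  unfolding bexp_def using m_bounds e0 by (intro add_pos_nonneg Bochner_Integration.integral_nonneg) auto

lemma w_set_int: "integrable lborel (\<lambda>x. indicator {0..X} x * w (h x))" if [measurable]: "h \<in> borel_measurable borel" for X :: real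
proof (rule integrable_bounded_mult)
  show "integrable lborel (indicator {0..X} :: real \<Rightarrow> real)"
    by (cases "0 \<le> X") (auto intro!: integrable_real_indicator)
  show "(\<lambda>x. w (h x)) \<in> borel_measurable borel" by measurable
qed (rule w_abs)

text \<open>On \<open>[z, X]\<close> the argument \<open>x - z\<close> runs over
  \<open>[0, X - z]\<close>. Rescaling this interval to \<open>[0, X]\<close> yields the factor
  \<open>1 - z / X\<close>, and monotonicity removes the contraction of the argument.\<close>

lemma w_shift_integral:
  assumes X: "0 < X" and z: "0 \<le> z"
  shows "(\<integral>x. indicator {0..X} x * w (x - z) \<partial>lborel)
     \<le> (1 - min 1 (max 0 (z / X))) * (\<integral>x. indicator {0..X} x * w x \<partial>lborel)"
proof (cases "z < X")
  case False
  then have "(\<lambda>x. indicator {0..X} x * w (x - z)) = (\<lambda>x. 0)" by (auto simp: w_neg split: split_indicator)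
  then have "(\<integral>x. indicator {0..X} x * w (x - z) \<partial>lborel) = 0" by simp
  then show ?thesis using False X by simp
next
  case True
  define t where "t = 1 - z / X"
  have t: "0 < t" "t \<le> 1" using True X z by (auto simp: t_def)
  have tX: "t * X = X - z" using X by (simp add: t_def field_simps)
  have "(\<integral>x. indicator {0..X} x * w (x - z) \<partial>lborel) \<le> (\<integral>x. indicator {0..t * X} (x - z) * w (x - z) \<partial>lborel)"
  proof (rule integral_mono)
    show "integrable lborel (\<lambda>x. indicator {0..t * X} (x - z) * w (x - z))"
      using integrable_lborel_translate[OF w_set_int[of "\<lambda>x. x" "t * X"], of "-z"] by simp
    show "indicator {0..X} x * w (x - z) \<le> indicator {0..t * X} (x - z) * w (x - z)" for x
      by (cases "x \<le> z") (auto simp: w_neg tX w_nonneg split: split_indicator)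
  qed (use w_set_int in simp)
  also have "\<dots> = (\<integral>x. indicator {0..t * X} x * w x \<partial>lborel)"
    using integral_lborel_translate[of "\<lambda>x. indicator {0..t * X} x * w x" "-z"] by simp
  also have "\<dots> = t * (\<integral>x. indicator {0..t * X} (t * x) * w (t * x) \<partial>lborel)"
    using lborel_integral_real_affine[of t "\<lambda>x. indicator {0..t * X} x * w x" 0] t by simp
  also have "\<dots> = t * (\<integral>x. indicator {0..X} x * w (t * x) \<partial>lborel)"
  proof -
    have "indicator {0..t * X} (t * x) = (indicator {0..X} x :: real)" for x
      using t by (auto simp: indicator_def zero_le_mult_iff)
    then show ?thesis by simp
  qed
  also have "\<dots> \<le> t * (\<integral>x. indicator {0..X} x * w x \<partial>lborel)"
  proof (rule mult_left_mono, rule integral_mono)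
    show "indicator {0..X} x * w (t * x) \<le> indicator {0..X} x * w x" for x
      using t by (auto split: split_indicator intro!: w_mono mult_left_le_one_le)
  qed (use t w_set_int[of "\<lambda>x. t * x" X] w_set_int[of "\<lambda>x. x" X] in auto)
  finally show ?thesis using True X z by (simp add: t_def)
qed

text \<open>Integrating the renewal equation over \<open>[0, X]\<close> and using
  \<open>w_shift_integral\<close> inside gives \<open>I * bexp X \<le> (1 - m) * X\<close> for the
  integral \<open>I\<close> of \<open>w\<close>. The constant is 2 * 2: monotonicity on
  \<open>[X / 2, X]\<close> bounds \<open>w (X / 2)\<close>, and subadditivity doubles the
  argument.\<close>

lemma w_bexp: assumes X: "0 < X" shows "w X * bexp X \<le> 4 * (1 - m)"
proof -
  define I where "I = (\<integral>x. indicator {0..X} x * w x \<partial>lborel)"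
  have I0: "0 \<le> I" unfolding I_def using w_nonneg by (intro Bochner_Integration.integral_nonneg) auto
  let ?f = "\<lambda>x z. indicator {0..X} x * (e z * w (x - z))"
  have indX: "integrable lborel (indicator {0..X} :: real \<Rightarrow> real)" "(\<integral>x. indicator {0..X} x \<partial>lborel) = X"
    using X by (auto intro!: integrable_real_indicator)
  have "integrable (lborel \<Otimes>\<^sub>M lborel) (\<lambda>(x, z). indicator {0..X} x * e z)"
    by (rule lborel_pair.Fubini_integrable)
       (use eint e0 indX in \<open>auto simp: abs_mult\<close>)
  then have fi: "integrable (lborel \<Otimes>\<^sub>M lborel) (case_prod ?f)"
  proof (rule Bochner_Integration.integrable_bound)
    have "\<bar>?f x z\<bar> \<le> \<bar>indicator {0..X} x * e z\<bar>" for x z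
      using w_abs[of "x - z"] e0[of z] by (auto simp: abs_mult mult_left_le split: split_indicator)
    then show "AE x in lborel \<Otimes>\<^sub>M lborel. norm (case x of (x, z) \<Rightarrow> ?f x z) \<le> norm (case x of (x, z) \<Rightarrow> indicator {0..X} x * e z)"
      by auto
  qed measurable
  have "I = (\<integral>x. (1 - m) * indicator {0..X} x + indicator {0..X} x * (\<integral>z. e z * w (x - z) \<partial>lborel) \<partial>lborel)"
    unfolding I_def
  proof (rule integral_cong_AE)
    show "AE x in lborel. indicator {0..X} x * w x = (1 - m) * indicator {0..X} x + indicator {0..X} x * (\<integral>z. e z * w (x - z) \<partial>lborel)"
      using AE_lborel_singleton[of 0] by eventually_elim (subst w_eq, auto split: split_indicator)
  qed measurable
  also have "\<dots> = (1 - m) * X + (\<integral>x. indicator {0..X} x * (\<integral>z. e z * w (x - z) \<partial>lborel) \<partial>lborel)"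
  proof (subst Bochner_Integration.integral_add)
    show "integrable lborel (\<lambda>x. indicator {0..X} x * (\<integral>z. e z * w (x - z) \<partial>lborel))"
    proof (rule integrable_bounded_mult[OF indX(1), where B=1])
      fix x
      have "(\<integral>z. e z * w (x - z) \<partial>lborel) \<le> m * 1"
        by (rule e_integral_le[where B=1]) (use w_abs w_le_1 in auto)
      moreover have "0 \<le> (\<integral>z. e z * w (x - z) \<partial>lborel)"
        using e0 w_nonneg by (intro Bochner_Integration.integral_nonneg) auto
      ultimately show "\<bar>\<integral>z. e z * w (x - z) \<partial>lborel\<bar> \<le> 1" using m_bounds by auto
    qed measurable
  qed (use indX in auto)
  also have "(\<integral>x. indicator {0..X} x * (\<integral>z. e z * w (x - z) \<partial>lborel) \<partial>lborel) = (\<integral>x. \<integral>z. ?f x z \<partial>lborel \<partial>lborel)"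
    by simp
  also have "\<dots> = (\<integral>z. \<integral>x. ?f x z \<partial>lborel \<partial>lborel)"
    using lborel_pair.Fubini_integral[OF fi] by simp
  also have "\<dots> = (\<integral>z. e z * (\<integral>x. indicator {0..X} x * w (x - z) \<partial>lborel) \<partial>lborel)"
    by (subst integral_mult_right_zero[symmetric]) (simp add: mult.left_commute)
  also have "\<dots> \<le> (\<integral>z. e z * ((1 - min 1 (max 0 (z / X))) * I) \<partial>lborel)"
  proof (rule integral_mono)
    show "integrable lborel (\<lambda>z. e z * (\<integral>x. indicator {0..X} x * w (x - z) \<partial>lborel))"
    proof (rule integrable_bounded_mult[OF eint, where B=X])
      fix z
      have "(\<integral>x. indicator {0..X} x * w (x - z) \<partial>lborel) \<le> (\<integral>x. indicator {0..X} x \<partial>lborel)"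
        using w_set_int[of "\<lambda>x. x - z" X] indX w_le_1 by (intro integral_mono) (auto split: split_indicator)
      moreover have "0 \<le> (\<integral>x. indicator {0..X} x * w (x - z) \<partial>lborel)"
        using w_nonneg by (intro Bochner_Integration.integral_nonneg) auto
      ultimately show "\<bar>\<integral>x. indicator {0..X} x * w (x - z) \<partial>lborel\<bar> \<le> X" using indX by simp
    qed measurable
    show "integrable lborel (\<lambda>z. e z * ((1 - min 1 (max 0 (z / X))) * I))"
      by (rule integrable_bounded_mult[OF eint, where B="I"]) (use I0 in \<open>auto simp: abs_mult mult_left_le_one_le\<close>)
    show "e z * (\<integral>x. indicator {0..X} x * w (x - z) \<partial>lborel) \<le> e z * ((1 - min 1 (max 0 (z / X))) * I)" for z
      using w_shift_integral[OF X, of z] e0[of z] eneg[of z] by (cases "0 \<le> z") (auto simp: I_def intro: mult_left_mono)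
  qed
  also have "\<dots> = I * (m - (\<integral>z. e z * min 1 (max 0 (z / X)) \<partial>lborel))"
  proof -
    have "integrable lborel (\<lambda>z. e z * min 1 (max 0 (z / X)))"
      by (rule integrable_bounded_mult[OF eint, where B=1]) auto
    then have "(\<integral>z. e z * (1 - min 1 (max 0 (z / X))) \<partial>lborel) = m - (\<integral>z. e z * min 1 (max 0 (z / X)) \<partial>lborel)"
      using eint by (simp add: right_diff_distrib m_def)
    then show ?thesis by (simp flip: mult.assoc)
  qed
  finally have IB: "I * bexp X \<le> (1 - m) * X" by (simp add: bexp_def algebra_simps)
  have "w (X / 2) * (X / 2) = (\<integral>x. w (X / 2) * indicator {X / 2..X} x \<partial>lborel)"
    using X by simp
  also have "\<dots> \<le> I"
    unfolding I_def using w_set_int[of "\<lambda>x. x"] X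
    by (intro integral_mono) (auto split: split_indicator intro!: w_mono w_nonneg)
  finally have "w (X / 2) * (X / 2) * bexp X \<le> (1 - m) * X"
    using IB bexp_pos[OF X] by (meson mult_right_mono less_imp_le order_trans)
  then have "X * (w (X / 2) * bexp X) \<le> X * (2 * (1 - m))" by (simp add: algebra_simps)
  then have "w (X / 2) * bexp X \<le> 2 * (1 - m)" using X by (subst (asm) mult_le_cancel_left_pos)
  moreover have "w X \<le> 2 * w (X / 2)" using w_subadd[of "X / 2" "X / 2"] X by simp
  then have "w X * bexp X \<le> 2 * w (X / 2) * bexp X" using bexp_pos[OF X] by (intro mult_right_mono) auto
  ultimately show ?thesis by simp
qed

text \<open>In Fourier terms 1 - p^ = |1 - e^|^2 = (1 - c)^2 + s^2. The constant is 2^2 + 1, from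
  \<open>1 - c \<le> 2 * bexp X\<close> and \<open>\<bar>s\<bar> \<le> bexp X\<close>.\<close>

lemma cos_p_bexp: assumes X: "0 < X" shows "1 - (\<integral>s. p s * cos (s / X) \<partial>lborel) \<le> 5 * (bexp X)\<^sup>2"
proof -
  define c s where "c = (\<integral>z. e z * cos (z / X) \<partial>lborel)" and "s = (\<integral>z. e z * sin (z / X) \<partial>lborel)"
  have ci: "integrable lborel (\<lambda>z. e z * cos (z / X))" and si: "integrable lborel (\<lambda>z. e z * sin (z / X))"
    by (rule integrable_bounded_mult[OF eint, where B=1]; simp)+
  have cp: "integrable lborel (\<lambda>z. p z * cos (z / X))"
    by (rule integrable_bounded_mult[OF pint, where B=1]) auto
  have mi: "integrable lborel (\<lambda>z. e z * min 1 (max 0 (z / X)))"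
    by (rule integrable_bounded_mult[OF eint, where B=1]) auto
  let ?b = "\<integral>z. e z * min 1 (max 0 (z / X)) \<partial>lborel"
  have inner: "(\<integral>a. e a * (1 + cos ((a - z) / X)) \<partial>lborel) = m + (cos (z / X) * c + sin (z / X) * s)" for z
  proof -
    have "(\<integral>a. e a * (1 + cos ((a - z) / X)) \<partial>lborel)
       = (\<integral>a. e a + (cos (z / X) * (e a * cos (a / X)) + sin (z / X) * (e a * sin (a / X))) \<partial>lborel)"
      by (simp add: diff_divide_distrib cos_diff algebra_simps)
    also have "\<dots> = m + (cos (z / X) * c + sin (z / X) * s)"
      using eint ci si by (simp add: m_def c_def s_def)
    finally show ?thesis .
  qed
  \<comment> \<open>\<open>factor_real\<close> accepts nonnegative functions only, hence
    \<open>1 + cos\<close>; the constants drop out through \<open>m * m + q = 2 * m\<close>.\<close>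
  have "(\<integral>z. e z * (\<integral>a. e a * (1 + cos ((a - z) / X)) \<partial>lborel) \<partial>lborel) + (\<integral>x. p x * (1 + cos (x / X)) \<partial>lborel)
     = (\<integral>z. e z * (1 + cos (z / X)) \<partial>lborel) + (\<integral>z. e z * (1 + cos (- z / X)) \<partial>lborel)"
  proof -
    have "0 \<le> 1 + cos (x / X)" "1 + cos (x / X) \<le> 2" for x
      using cos_ge_minus_one[of "x / X"] cos_le_one[of "x / X"] by linarith+
    then show ?thesis using factor_real[of "\<lambda>x. 1 + cos (x / X)" 2] by simp
  qed
  moreover have "(\<integral>z. e z * (m + (cos (z / X) * c + sin (z / X) * s)) \<partial>lborel)
     = (\<integral>z. m * e z + (c * (e z * cos (z / X)) + s * (e z * sin (z / X))) \<partial>lborel)"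
    by (simp add: algebra_simps)
  moreover have "\<dots> = m * m + (c * c + s * s)"
    using eint ci si by (simp add: m_def c_def s_def)
  moreover have "(\<integral>x. p x * (1 + cos (x / X)) \<partial>lborel) = q + (\<integral>x. p x * cos (x / X) \<partial>lborel)"
    using pint cp by (simp add: distrib_left pq)
  moreover have "(\<integral>z. e z * (1 + cos (z / X)) \<partial>lborel) = m + c"
    using eint ci by (simp add: distrib_left m_def c_def)
  ultimately have "m * m + (c * c + s * s) + (q + (\<integral>x. p x * cos (x / X) \<partial>lborel)) = 2 * (m + c)"
    by (simp add: inner)
  moreover have "m * m + q = 2 * m"
    using m_bounds(3) by (simp add: power2_eq_square algebra_simps)
  ultimately have "1 - (\<integral>x. p x * cos (x / X) \<partial>lborel) = (1 - c)\<^sup>2 + s\<^sup>2"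
    by (simp add: power2_eq_square algebra_simps)
  moreover have "1 - c \<le> 2 * bexp X"
  proof -
    have "m - c = (\<integral>z. e z * (1 - cos (z / X)) \<partial>lborel)"
      using eint ci by (simp add: right_diff_distrib m_def c_def)
    also have "\<dots> \<le> (\<integral>z. 2 * (e z * min 1 (max 0 (z / X))) \<partial>lborel)"
    proof (rule integral_mono)
      show "integrable lborel (\<lambda>z. e z * (1 - cos (z / X)))"
        using eint ci by (simp add: right_diff_distrib)
      fix z :: real
      show "e z * (1 - cos (z / X)) \<le> 2 * (e z * min 1 (max 0 (z / X)))"
      proof (cases "0 < z")
        case True
        have "1 - cos (z / X) \<le> 2 * min 1 (z / X)"
        proof (cases "z / X \<le> 1")
          case small: True
          have "1 - cos (z / X) \<le> (z / X)\<^sup>2 / 2" by (rule one_minus_cos_le)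
          also have "\<dots> \<le> 2 * (z / X)" using small True X by (simp add: power2_eq_square field_simps)
          finally show ?thesis using small by simp
        next
          case False
          then show ?thesis using cos_ge_minus_one[of "z / X"] by (simp add: min_def)
        qed
        then show ?thesis using e0[of z] True X mult_left_mono[of "1 - cos (z / X)" "2 * min 1 (z / X)" "e z"]
          by (simp add: mult.left_commute)
      qed (simp add: eneg)
    qed (use mi in simp)
    finally have "m - c \<le> 2 * ?b" by simp
    then show ?thesis using m_bounds by (simp add: bexp_def)
  qed
  moreover have "0 \<le> 1 - c"
  proof -
    have "c \<le> m * 1" unfolding c_def by (rule e_integral_le[where B=1]) auto
    then show ?thesis using m_bounds by simp
  qed
  moreover have "\<bar>s\<bar> \<le> bexp X"
  proof -
    have "\<bar>s\<bar> \<le> (\<integral>z. \<bar>e z * sin (z / X)\<bar> \<partial>lborel)" unfolding s_def by (rule integral_abs_bound)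
    also have "\<dots> \<le> ?b"
    proof (rule integral_mono)
      show "integrable lborel (\<lambda>z. \<bar>e z * sin (z / X)\<bar>)" using si by (rule integrable_abs)
      fix z :: real
      show "\<bar>e z * sin (z / X)\<bar> \<le> e z * min 1 (max 0 (z / X))"
      proof (cases "0 < z")
        case True
        have "\<bar>sin (z / X)\<bar> \<le> min 1 (max 0 (z / X))"
          using abs_sin_le_one[of "z / X"] abs_sin_x_le_abs_x[of "z / X"] True X by simp
        then show ?thesis using e0[of z] by (simp add: abs_mult mult_left_mono)
      qed (simp add: eneg)
    qed (rule mi)
    finally show ?thesis using m_bounds by (simp add: bexp_def)
  qed
  ultimately have f: "1 - (\<integral>x. p x * cos (x / X) \<partial>lborel) = (1 - c)\<^sup>2 + s\<^sup>2" "1 - c \<le> 2 * bexp X" "0 \<le> 1 - c" "\<bar>s\<bar> \<le> bexp X"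
    by auto
  have "(1 - c)\<^sup>2 \<le> (2 * bexp X)\<^sup>2" using f by (intro power_mono) auto
  moreover have "s\<^sup>2 \<le> (bexp X)\<^sup>2" using power_mono[OF f(4), of 2] by simp
  ultimately show ?thesis using f(1) by (simp add: power_mult_distrib)
qed

text \<open>\<open>bexp X\<close> is eliminated between \<open>w_bexp\<close> and
  \<open>cos_p_bexp\<close>; 80 is 5 * 4^2.\<close>

lemma w_square_bound:
  assumes X: "0 < X" shows "(w X)\<^sup>2 * (1 - (\<integral>s. p s * cos (s / X) \<partial>lborel)) \<le> 80 * (1 - q)"
proof -
  have "(w X)\<^sup>2 * (1 - (\<integral>s. p s * cos (s / X) \<partial>lborel)) \<le> (w X)\<^sup>2 * (5 * (bexp X)\<^sup>2)"
    by (intro mult_left_mono cos_p_bexp[OF X]) simp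
  also have "\<dots> = 5 * (w X * bexp X)\<^sup>2" by (simp add: power_mult_distrib)
  also have "\<dots> \<le> 5 * (4 * (1 - m))\<^sup>2"
    using w_bexp[OF X] w_nonneg[of X] bexp_pos[OF X] by (intro mult_left_mono power_mono) auto
  also have "\<dots> = 80 * (1 - m)\<^sup>2" by (simp add: power_mult_distrib del: right_diff_distrib_numeral)
  also have "\<dots> = 80 * (1 - q)" using m_bounds(3) by simp
  finally show ?thesis .
qed

end

section \<open>Integrable radial kernels\<close>

text \<open>Translating by \<open>s *\<^sub>R b\<close> and averaging over \<open>s\<close> in
  \<open>[0, 1]\<close> does not change the integral. By Fubini one may integrate in
  \<open>s\<close> first, which meets only a translate of the null set \<open>A\<close>. Absolute
  continuity of the projected kernel follows without coordinates adapted to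
  \<open>b\<close>.\<close>

lemma null_set_inner_vimage:
  fixes b :: "'a::euclidean_space"
  assumes b: "norm b = 1" and A: "A \<in> null_sets lborel"
  shows "(\<integral>\<^sup>+y. indicator A (y \<bullet> b) \<partial>lborel) = 0"
proof -
  have [measurable]: "A \<in> sets borel" using A by (auto simp: null_sets_def)
  define G :: "'a \<Rightarrow> ennreal" where "G y = indicator A (y \<bullet> b)" for y
  have Gm [measurable]: "G \<in> borel_measurable borel" unfolding G_def by measurable
  have bb: "b \<bullet> b = 1" using b by (simp add: dot_square_norm)
  have shift: "(\<integral>\<^sup>+y. indicator A (y \<bullet> b + s) \<partial>lborel) = (\<integral>\<^sup>+y. G y \<partial>lborel)" for s
    using nn_integral_lborel_translate[OF Gm, of "s *\<^sub>R b"]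
    by (simp add: G_def inner_add_left bb add.commute)
  have inner: "(\<integral>\<^sup>+s. indicator {0..1} s * indicator A (t + s) \<partial>lborel) = 0" for t :: real
  proof -
    have "(\<integral>\<^sup>+s. indicator {0..1} s * indicator A (t + s) \<partial>lborel) \<le> (\<integral>\<^sup>+s. indicator A (t + s) \<partial>lborel)"
      by (intro nn_integral_mono) (auto split: split_indicator)
    also have "\<dots> = (\<integral>\<^sup>+s. indicator A s \<partial>lborel)"
      by (rule nn_integral_lborel_translate) measurable
    also have "\<dots> = 0" using A by (simp add: null_sets_def)
    finally show ?thesis by simp
  qed
  have "(\<integral>\<^sup>+y. G y \<partial>lborel) = (\<integral>\<^sup>+s. indicator {0..1::real} s * (\<integral>\<^sup>+y. G y \<partial>lborel) \<partial>lborel)"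
    by (subst nn_integral_multc) simp_all
  also have "\<dots> = (\<integral>\<^sup>+s. \<integral>\<^sup>+y. indicator {0..1} s * indicator A (y \<bullet> b + s) \<partial>lborel \<partial>lborel)"
    by (subst nn_integral_cmult) (simp_all add: shift)
  also have "\<dots> = (\<integral>\<^sup>+y. \<integral>\<^sup>+s. indicator {0..1} s * indicator A (y \<bullet> b + s) \<partial>lborel \<partial>lborel)"
    by (rule lborel_pair.Fubini') measurable
  also have "\<dots> = 0" by (simp add: inner)
  finally show ?thesis by (simp add: G_def)
qed

text \<open>\<open>b\<close> is a reference direction along which radial quantities such as the
  exponent are evaluated. \<open>kmono\<close> includes \<open>r = 0\<close>, so \<open>k\<close> is
  bounded by \<open>k 0\<close> on the half-line: the locale is made for truncated kernels, not for
  \<open>J\<close> itself.\<close>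

locale radial_kernel =
  fixes k :: "real \<Rightarrow> real" and b :: "'a::euclidean_space"
  assumes b1: "norm b = 1" and k0: "0 \<le> k r"
    and kmono: "0 \<le> r \<Longrightarrow> r \<le> s \<Longrightarrow> k s \<le> k r"
    and kint: "integrable lborel (\<lambda>y::'a. k (norm y))"
begin

lemma km [measurable]: "(\<lambda>y::'a. k (norm y)) \<in> borel_measurable borel"
  using kint by auto

lemma km' [measurable]: "f \<in> borel_measurable N \<Longrightarrow> (\<lambda>x. k (norm (f x :: 'a))) \<in> borel_measurable N"
  using measurable_compose[OF _ km] by blast

definition mass :: real where "mass = (\<integral>y. k (norm (y::'a)) \<partial>lborel)"

lemma mass_nonneg: "0 \<le> mass"
  unfolding mass_def using k0 by (intro Bochner_Integration.integral_nonneg) auto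

text \<open>First differences suffice because \<open>k\<close> is integrable; \<open>Lk_symm\<close>
  recovers the second-difference form.\<close>

definition Lk :: "('a \<Rightarrow> real) \<Rightarrow> 'a \<Rightarrow> real" where
  "Lk u x = (\<integral>y. (u (x + y) - u x) * k (norm y) \<partial>lborel)"

lemma kint_bdd:
  fixes F :: "'a \<Rightarrow> real"
  assumes [measurable]: "F \<in> borel_measurable borel" and "\<And>x. \<bar>F x\<bar> \<le> B"
  shows "integrable lborel (\<lambda>y. F y * k (norm y))"
  using integrable_bounded_mult[OF kint assms] by (simp add: mult.commute)

lemma Lk_int:
  fixes u :: "'a \<Rightarrow> real"
  assumes [measurable]: "u \<in> borel_measurable borel" and B: "\<And>x. \<bar>u x\<bar> \<le> B"
  shows "integrable lborel (\<lambda>y. (u (x + y) - u x) * k (norm y))"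
proof (rule kint_bdd[where B="2 * B"])
  fix y show "\<bar>u (x + y) - u x\<bar> \<le> 2 * B" using B[of "x + y"] B[of x] by linarith
qed measurable

lemma Lk_eq:
  assumes [measurable]: "u \<in> borel_measurable borel" and B: "\<And>x. \<bar>u x\<bar> \<le> B"
  shows "Lk u x = (\<integral>y. u (x + y) * k (norm y) \<partial>lborel) - u x * mass"
proof -
  have "integrable lborel (\<lambda>y. u (x + y) * k (norm y))" by (rule kint_bdd[where B=B]) (use B in auto)
  then show ?thesis unfolding Lk_def mass_def left_diff_distrib using kint by simp
qed

lemma Lk_diff_scale:
  assumes "u \<in> borel_measurable borel" "\<And>x. \<bar>u x\<bar> \<le> B" "v \<in> borel_measurable borel" "\<And>x. \<bar>v x\<bar> \<le> C"
  shows "Lk (\<lambda>x. u x - c * v x) x = Lk u x - c * Lk v x"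
proof -
  have "Lk (\<lambda>x. u x - c * v x) x = (\<integral>y. (u (x + y) - u x) * k (norm y) - c * ((v (x + y) - v x) * k (norm y)) \<partial>lborel)"
    unfolding Lk_def by (intro Bochner_Integration.integral_cong) (auto simp: algebra_simps)
  then show ?thesis using Lk_int[OF assms(1,2)] Lk_int[OF assms(3,4)] by (simp add: Lk_def)
qed

lemma Lk_minus: "Lk (\<lambda>x. - u x) x = - Lk u x"
proof -
  have "Lk (\<lambda>x. - u x) x = (\<integral>y. - ((u (x + y) - u x) * k (norm y)) \<partial>lborel)"
    unfolding Lk_def by (intro Bochner_Integration.integral_cong) (auto simp: algebra_simps)
  then show ?thesis by (simp add: Lk_def)
qed

lemma Lk_mirror:
  assumes [measurable]: "u \<in> borel_measurable borel" and e: "norm e = 1"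
  shows "Lk (\<lambda>x. u (c + mirror e x)) x = Lk u (c + mirror e x)"
proof -
  have "Lk u (c + mirror e x) = (\<integral>y. (u (c + mirror e x + mirror e y) - u (c + mirror e x)) * k (norm (mirror e y)) \<partial>lborel)"
    unfolding Lk_def by (rule integral_lborel_mirror[symmetric]) (use e in measurable)
  then show ?thesis by (simp add: Lk_def mirror_add norm_mirror[OF e] add.assoc)
qed

lemma Lk_translate: "Lk (\<lambda>x. u (c + x)) x = Lk u (c + x)"
  unfolding Lk_def by (simp add: add.assoc)

text \<open>The supremum \<open>S\<close> need not be attained. At a point \<open>p\<close> with
  \<open>Z p\<close> within \<open>\<theta> / (mass + 1)\<close> of it, integrability of the kernel
  gives \<open>Lk Z p \<le> (S - Z p) * mass < \<theta>\<close>, against the margin. Adding 1 to the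
  mass avoids a case distinction when it is 0.\<close>

lemma max_principle:
  assumes Zm [measurable]: "Z \<in> borel_measurable borel" and B: "\<And>x. \<bar>Z x\<bar> \<le> B" and th: "0 < \<theta>"
    and pos: "\<And>x. 0 < Z x \<Longrightarrow> \<theta> \<le> Lk Z x"
  shows "Z x \<le> 0"
proof (rule ccontr)
  assume neg: "\<not> Z x \<le> 0"
  define S where "S = Sup (range Z)"
  have bdd: "bdd_above (range Z)" using B by (auto simp: bdd_above_def abs_le_iff)
  have ZS: "Z y \<le> S" for y unfolding S_def using bdd by (intro cSup_upper) auto
  have S0: "0 < S" using neg ZS[of x] by linarith
  have "max 0 (S - \<theta> / (mass + 1)) < S" using S0 th mass_nonneg by auto
  then obtain p where p: "Z p > max 0 (S - \<theta> / (mass + 1))"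
    unfolding S_def by (subst (asm) less_cSup_iff[OF _ bdd]) auto
  have "Lk Z p \<le> (\<integral>y. (S - Z p) * k (norm (y::'a)) \<partial>lborel)"
    unfolding Lk_def using Lk_int[OF Zm B] kint ZS k0
    by (intro integral_mono) (auto intro!: mult_right_mono)
  also have "\<dots> = (S - Z p) * mass" by (simp add: mass_def)
  also have "\<dots> \<le> (S - Z p) * (mass + 1)" using ZS[of p] by (intro mult_left_mono) auto
  also have "\<dots> < \<theta>" using p mass_nonneg by (simp add: field_simps)
  finally show False using pos[of p] p by simp
qed

text \<open>Averaging the integral with its reflection replaces the kernel by
  \<open>k (norm (z - p)) - k (norm (mirror e z - p))\<close>, which is nonnegative on the side of
  \<open>p\<close> and nonpositive on the other because \<open>k\<close> is decreasing. A bound for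
  \<open>Z\<close> on the half-space alone therefore controls \<open>Lk Z p\<close>, and the
  argument of \<open>max_principle\<close> goes through.\<close>

lemma antisym_max_principle:
  assumes Zm [measurable]: "Z \<in> borel_measurable borel" and B: "\<And>x. \<bar>Z x\<bar> \<le> B" and th: "0 < \<theta>"
    and e: "norm e = 1" and anti: "\<And>x. Z (mirror e x) = - Z x"
    and pos: "\<And>x. 0 < x \<bullet> e \<Longrightarrow> 0 < Z x \<Longrightarrow> \<theta> \<le> Lk Z x"
    and x: "0 < x \<bullet> e"
  shows "Z x \<le> 0"
proof (rule ccontr)
  assume neg: "\<not> Z x \<le> 0"
  let ?H = "{x. 0 < x \<bullet> e}"
  define S where "S = Sup (Z ` ?H)"
  have bdd: "bdd_above (Z ` ?H)" using B by (auto simp: bdd_above_def abs_le_iff)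
  have ZS: "Z y \<le> S" if "0 < y \<bullet> e" for y unfolding S_def using bdd that by (intro cSup_upper) auto
  have S0: "0 < S" using neg ZS[OF x] by linarith
  have "max 0 (S - \<theta> / (mass + 1)) < S" using S0 th mass_nonneg by auto
  then obtain p where p: "0 < p \<bullet> e" "Z p > max 0 (S - \<theta> / (mass + 1))"
    unfolding S_def by (subst (asm) less_cSup_iff[OF _ bdd]) (use x in auto)
  have int1: "integrable lborel (\<lambda>z. k (norm (z - p)))"
    using integrable_lborel_translate[OF kint, of "-p"] by simp
  have mass1: "(\<integral>z. k (norm (z - p)) \<partial>lborel) = mass"
    using integral_lborel_translate[of "\<lambda>y. k (norm y)" "-p"] by (simp add: mass_def)
  have int2: "integrable lborel (\<lambda>z. k (norm (mirror e z - p)))"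
    by (rule integrable_lborel_mirror[OF int1 e])
  have mass2: "(\<integral>z. k (norm (mirror e z - p)) \<partial>lborel) = mass"
    using integral_lborel_mirror[of "\<lambda>z. k (norm (z - p))" e] e by (simp add: mass1)
  have Zi1: "integrable lborel (\<lambda>z. Z z * k (norm (z - p)))"
    using integrable_bounded_mult[OF int1 Zm B] by (simp add: mult.commute)
  have Zi2: "integrable lborel (\<lambda>z. Z z * k (norm (mirror e z - p)))"
    using integrable_bounded_mult[OF int2 Zm B] by (simp add: mult.commute)
  have "(\<integral>z. Z z * k (norm (mirror e z - p)) \<partial>lborel) = (\<integral>z. - (Z z * k (norm (z - p))) \<partial>lborel)"
    using integral_lborel_mirror[of "\<lambda>z. Z z * k (norm (mirror e z - p))" e] e
    by (simp add: anti mirror_involution)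
  then have "2 * (\<integral>z. Z z * k (norm (z - p)) \<partial>lborel)
     = (\<integral>z. Z z * k (norm (z - p)) - Z z * k (norm (mirror e z - p)) \<partial>lborel)"
    using Zi1 Zi2 by simp
  also have "\<dots> \<le> (\<integral>z. S * (k (norm (z - p)) + k (norm (mirror e z - p))) \<partial>lborel)"
  proof (rule integral_mono)
    show "integrable lborel (\<lambda>z. S * (k (norm (z - p)) + k (norm (mirror e z - p))))"
      using int1 int2 by simp
    fix z :: 'a
    \<comment> \<open>Since \<open>p \<bullet> e > 0\<close>, this identity orders the two distances
      by the sign of \<open>z \<bullet> e\<close>.\<close>
    have nn: "(norm (mirror e z - p))\<^sup>2 = (norm (z - p))\<^sup>2 + 4 * (z \<bullet> e) * (p \<bullet> e)"
    proof -
      have "e \<bullet> e = 1" using e by (simp add: dot_square_norm)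
      then show ?thesis
        unfolding power2_norm_eq_inner mirror_def
        by (simp add: inner_diff_left inner_diff_right inner_commute algebra_simps)
    qed
    have ka: "k (norm (z - p)) \<ge> 0" "k (norm (mirror e z - p)) \<ge> 0" using k0 by auto
    consider "0 < z \<bullet> e" | "z \<bullet> e = 0" | "z \<bullet> e < 0" by linarith
    then show "Z z * k (norm (z - p)) - Z z * k (norm (mirror e z - p)) \<le> S * (k (norm (z - p)) + k (norm (mirror e z - p)))"
    proof cases
      case 1
      then have "norm (z - p) \<le> norm (mirror e z - p)"
        using nn p by - (rule power2_le_imp_le, auto)
      then have "k (norm (mirror e z - p)) \<le> k (norm (z - p))" by (intro kmono) auto
      then have "Z z * (k (norm (z - p)) - k (norm (mirror e z - p))) \<le> S * (k (norm (z - p)) - k (norm (mirror e z - p)))"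
        using ZS[OF 1] by (intro mult_right_mono) auto
      also have "\<dots> \<le> S * (k (norm (z - p)) + k (norm (mirror e z - p)))"
        using S0 ka by (intro mult_left_mono) auto
      finally show ?thesis by (simp add: right_diff_distrib)
    next
      case 2
      then have "mirror e z = z" by (simp add: mirror_def)
      then show ?thesis using S0 ka by simp
    next
      case 3
      then have "0 < mirror e z \<bullet> e" using e by (simp add: inner_mirror)
      then have Z2: "- Z z \<le> S" using ZS[of "mirror e z"] anti by simp
      have "norm (mirror e z - p) \<le> norm (z - p)"
        using nn p 3 by - (rule power2_le_imp_le, auto simp: mult_le_0_iff)
      then have "k (norm (z - p)) \<le> k (norm (mirror e z - p))" by (intro kmono) auto
      then have "- Z z * (k (norm (mirror e z - p)) - k (norm (z - p))) \<le> S * (k (norm (mirror e z - p)) - k (norm (z - p)))"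
        using Z2 by (intro mult_right_mono) auto
      also have "\<dots> \<le> S * (k (norm (z - p)) + k (norm (mirror e z - p)))"
        using S0 ka by (intro mult_left_mono) auto
      finally show ?thesis by (simp add: right_diff_distrib)
    qed
  qed (use Zi1 Zi2 in simp)
  also have "\<dots> = 2 * (S * mass)" using int1 int2 by (simp add: mass1 mass2)
  finally have "(\<integral>z. Z z * k (norm (z - p)) \<partial>lborel) \<le> S * mass" by simp
  moreover have "(\<integral>y. Z (p + y) * k (norm y) \<partial>lborel) = (\<integral>z. Z z * k (norm (z - p)) \<partial>lborel)"
    using integral_lborel_translate[of "\<lambda>z. Z z * k (norm (z - p))" p] by simp
  ultimately have "Lk Z p \<le> S * mass - Z p * mass"
    using Lk_eq[OF Zm B] by simp
  also have "\<dots> = (S - Z p) * mass" by (simp add: left_diff_distrib)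
  also have "\<dots> \<le> (S - Z p) * (mass + 1)" using ZS[OF p(1)] by (intro mult_left_mono) auto
  also have "\<dots> < \<theta>" using p mass_nonneg by (simp add: field_simps)
  finally show False using pos[OF p(1)] p by simp
qed

text \<open>Solving the equation for \<open>u x\<close> gives a fixed point problem whose kernel is
  restricted to \<open>D\<close>. Jumps of length at least \<open>R\<close> leave \<open>D\<close>,
  so mass of at least \<open>\<kappa>\<close> is lost and the row masses are at most
  \<open>(mass - \<kappa>) / mass < 1\<close>.\<close>

lemma dirichlet_exists:
  assumes D: "D \<in> sets borel" and DR: "\<And>x y. x \<in> D \<Longrightarrow> y \<in> D \<Longrightarrow> dist x y < R"
    and kap: "0 < \<kappa>" "\<kappa> \<le> (\<integral>y. indicator {y. R \<le> norm y} y * k (norm (y::'a)) \<partial>lborel)"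
    and f: "(\<lambda>x. indicator D x * f x) \<in> borel_measurable borel" and N: "\<And>x. x \<in> D \<Longrightarrow> \<bar>f x\<bar> \<le> N"
  obtains u B where "u \<in> borel_measurable borel" "\<And>x. \<bar>u x\<bar> \<le> B" "\<And>x. x \<notin> D \<Longrightarrow> u x = 0"
    "\<And>x. x \<in> D \<Longrightarrow> Lk u x = f x"
proof -
  note D [measurable]
  let ?T = "{y::'a. R \<le> norm y}"
  have [measurable]: "?T \<in> sets borel" by measurable
  have Ti: "integrable lborel (\<lambda>y. indicator ?T y * k (norm (y::'a)))"
    by (rule kint_bdd[where B=1]) (auto split: split_indicator)
  have "(\<integral>y. indicator ?T y * k (norm (y::'a)) \<partial>lborel) \<le> mass"
    unfolding mass_def using Ti kint k0 by (intro integral_mono) (auto split: split_indicator)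
  then have M: "\<kappa> \<le> mass" using kap by linarith
  then have M0: "0 < mass" using kap by linarith
  define K where "K x y = indicator D x * indicator D y * (k (norm (y - x)) / mass)" for x y :: 'a
  define g where "g x = - (indicator D x * f x) / mass" for x
  define G where "G = \<bar>N\<bar> / mass"
  have Km: "case_prod K \<in> borel_measurable (borel \<Otimes>\<^sub>M borel)" unfolding K_def by measurable
  have Kn: "0 \<le> K x y" for x y using k0 M0 by (auto simp: K_def)
  have ksh: "integrable lborel (\<lambda>y. k (norm (y - x)))" for x :: 'a
    using integrable_lborel_translate[OF kint, of "-x"] by simp
  have Tsh: "integrable lborel (\<lambda>y. indicator ?T (y - x) * k (norm (y - x)))"
    "(\<integral>y. indicator ?T (y - x) * k (norm (y - x)) \<partial>lborel) = (\<integral>y. indicator ?T y * k (norm (y::'a)) \<partial>lborel)" for x :: 'a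
    using integrable_lborel_translate[OF Ti, of "-x"] integral_lborel_translate[of "\<lambda>y. indicator ?T y * k (norm y)" "-x"]
    by simp_all
  have msh: "(\<integral>y. k (norm (y - x)) \<partial>lborel) = mass" for x :: 'a
    using integral_lborel_translate[of "\<lambda>y. k (norm y)" "-x"] by (simp add: mass_def)
  have Ki: "integrable lborel (K x)" for x
  proof -
    have "integrable lborel (\<lambda>y. k (norm (y - x)) * (indicator D x * indicator D y / mass))"
      by (rule integrable_bounded_mult[OF ksh, where B="1 / mass"]) (use M0 in \<open>auto split: split_indicator\<close>)
    then show ?thesis by (simp add: K_def[abs_def] mult_ac)
  qed
  have Kq: "(\<integral>y. K x y \<partial>lborel) \<le> (mass - \<kappa>) / mass" for x
  proof -
    have "(\<integral>y. K x y \<partial>lborel) \<le> (\<integral>y. (k (norm (y - x)) - indicator ?T (y - x) * k (norm (y - x))) / mass \<partial>lborel)"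
    proof (rule integral_mono)
      fix y
      show "K x y \<le> (k (norm (y - x)) - indicator ?T (y - x) * k (norm (y - x))) / mass"
      proof (cases "x \<in> D \<and> y \<in> D")
        case True
        then have "y - x \<notin> ?T" using DR[of y x] by (simp add: dist_norm)
        then show ?thesis using True by (simp add: K_def)
      next
        case False
        then show ?thesis using k0 M0 by (auto simp: K_def split: split_indicator)
      qed
    qed (use Ki ksh Tsh in auto)
    also have "\<dots> = (mass - (\<integral>y. indicator ?T y * k (norm (y::'a)) \<partial>lborel)) / mass"
      using ksh[of x] Tsh[of x] msh[of x] by simp
    also have "\<dots> \<le> (mass - \<kappa>) / mass" using kap M0 by (intro divide_right_mono) auto
    finally show ?thesis .
  qed
  have q: "0 \<le> (mass - \<kappa>) / mass" "(mass - \<kappa>) / mass < 1" using M M0 kap by auto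
  have gm: "g \<in> borel_measurable borel" unfolding g_def using f by measurable
  have gb: "\<bar>g x\<bar> \<le> G" for x
    unfolding g_def G_def using N[of x] M0 by (auto simp: divide_right_mono split: split_indicator)
  obtain u B where u: "u \<in> borel_measurable borel" "\<And>x. \<bar>u x\<bar> \<le> B"
    "\<And>x. u x = g x + (\<integral>y. K x y * u y \<partial>lborel)"
    by (rule kernel_fixed_point[OF Km Kn Ki Kq q gm gb]) (rule that)
  note u(1) [measurable]
  have zero: "u x = 0" if "x \<notin> D" for x
    using u(3)[of x] that by (simp add: g_def K_def)
  have "Lk u x = f x" if x: "x \<in> D" for x
  proof -
    have "(\<integral>y. K x y * u y \<partial>lborel) = (\<integral>y. u y * k (norm (y - x)) / mass \<partial>lborel)"
      by (intro Bochner_Integration.integral_cong) (auto simp: K_def x zero split: split_indicator)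
    also have "\<dots> = (\<integral>y. u (x + y) * k (norm y) / mass \<partial>lborel)"
      using integral_lborel_translate[of "\<lambda>y. u y * k (norm (y - x)) / mass" x, symmetric] by simp
    finally have "u x * mass = - f x + (\<integral>y. u (x + y) * k (norm y) \<partial>lborel)"
      using u(3)[of x] x M0 by (simp add: g_def field_simps)
    then show ?thesis using Lk_eq[OF u(1,2)] by simp
  qed
  with u zero that show thesis by blast
qed

section \<open>Projection of the kernel to a line\<close>

lemma integral_inner_rotate:
  fixes e :: 'a
  assumes [measurable]: "F \<in> borel_measurable borel" and e: "norm e = 1"
  shows "(\<integral>y. F (y \<bullet> e) * k (norm y) \<partial>lborel) = (\<integral>y. F (y \<bullet> b) * k (norm y) \<partial>lborel)"
proof (rule mirror_exchange[OF e b1])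
  fix d assume d: "norm d = 1" "\<And>y. mirror d y \<bullet> e = y \<bullet> b"
  show ?thesis
    using integral_lborel_mirror[of "\<lambda>y. F (y \<bullet> e) * k (norm y)" d] d by (simp add: norm_mirror)
qed simp

text \<open>The image measure of the kernel is absolutely continuous by
  \<open>null_set_inner_vimage\<close>, so Radon-Nikodym provides a density.\<close>

lemma projected_density:
  obtains m where "m \<in> borel_measurable borel" "\<And>s. 0 \<le> m s" "\<And>s. m (- s) = m s" "integrable lborel m"
    "\<forall>F B. F \<in> borel_measurable borel \<longrightarrow> (\<forall>s. \<bar>F s\<bar> \<le> B) \<longrightarrow>
      (\<integral>y. F (y \<bullet> b) * k (norm y) \<partial>lborel) = (\<integral>s. m s * F s \<partial>lborel)"
proof -
  define N where "N = distr (density lborel (\<lambda>y. ennreal (k (norm (y::'a))))) borel (\<lambda>y. y \<bullet> b)"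
  have emN: "emeasure N A = (\<integral>\<^sup>+y. ennreal (k (norm y)) * indicator A (y \<bullet> b) \<partial>lborel)" if [measurable]: "A \<in> sets borel" for A
  proof -
    have [measurable]: "(\<lambda>y. y \<bullet> b) -` A \<in> sets (borel :: 'a measure)"
      using measurable_sets[of "\<lambda>y. y \<bullet> b" borel borel A] by simp
    have "emeasure N A = (\<integral>\<^sup>+y. ennreal (k (norm y)) * indicator ((\<lambda>y. y \<bullet> b) -` A) y \<partial>lborel)"
      unfolding N_def by (simp add: emeasure_distr emeasure_density)
    then show ?thesis by (simp add: indicator_def)
  qed
  have ac: "absolutely_continuous lborel N"
    unfolding absolutely_continuous_def
  proof
    fix A :: "real set" assume A: "A \<in> null_sets lborel"
    then have [measurable]: "A \<in> sets borel" by (auto simp: null_sets_def)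
    have "AE y in lborel. (indicator A (y \<bullet> b) :: ennreal) = 0"
      using null_set_inner_vimage[OF b1 A] by (subst (asm) nn_integral_0_iff_AE) auto
    then have "(\<integral>\<^sup>+y. ennreal (k (norm y)) * indicator A (y \<bullet> b) \<partial>lborel) = 0"
      by (subst nn_integral_0_iff_AE) auto
    then have "emeasure N A = 0" using emN by simp
    then show "A \<in> null_sets N" by (auto simp: null_sets_def N_def)
  qed
  define R where "R = RN_deriv lborel N"
  have Rm [measurable]: "R \<in> borel_measurable borel" unfolding R_def by measurable
  have RN: "density lborel R = N"
    unfolding R_def using ac by (intro sigma_finite_measure.density_RN_deriv[OF sigma_finite_lborel]) (auto simp: N_def)
  have "(\<integral>\<^sup>+s. R s \<partial>lborel) = emeasure N UNIV"
    unfolding RN[symmetric] by (simp add: emeasure_density)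
  also have "\<dots> = ennreal mass"
    unfolding mass_def using emN[of UNIV] nn_integral_eq_integral[OF kint] k0 by simp
  finally have RI: "(\<integral>\<^sup>+s. R s \<partial>lborel) = ennreal mass" .
  define m0 where "m0 s = enn2real (R s)" for s
  have m0m [measurable]: "m0 \<in> borel_measurable borel" unfolding m0_def by measurable
  have "AE s in lborel. R s \<noteq> \<infinity>" using RI by (intro nn_integral_noteq_infinite) auto
  then have m0R: "AE s in lborel. ennreal (m0 s) = R s"
    unfolding m0_def by eventually_elim (auto simp: less_top)
  have m00: "0 \<le> m0 s" for s by (simp add: m0_def)
  have m0N: "density lborel (\<lambda>s. ennreal (m0 s)) = N"
    unfolding RN[symmetric] by (rule density_cong) (use m0R in auto)
  have "(\<integral>\<^sup>+s. ennreal (m0 s) \<partial>lborel) = ennreal mass"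
    using RI m0R by (simp add: nn_integral_cong_AE)
  then have m0i: "integrable lborel m0" using m00 by (intro integrableI_bounded) auto
  have m0F: "(\<integral>y. F (y \<bullet> b) * k (norm y) \<partial>lborel) = (\<integral>s. m0 s * F s \<partial>lborel)"
    if [measurable]: "F \<in> borel_measurable borel" for F :: "real \<Rightarrow> real"
  proof -
    have "(\<integral>s. m0 s * F s \<partial>lborel) = (\<integral>s. F s \<partial>N)"
      unfolding m0N[symmetric] using m00 by (subst integral_density) auto
    also have "\<dots> = (\<integral>y. k (norm y) * F (y \<bullet> b) \<partial>lborel)"
      unfolding N_def using k0 by (subst integral_distr) (auto simp: integral_density)
    finally show ?thesis by (simp add: mult.commute)
  qed
  \<comment> \<open>The Radon-Nikodym density is even only almost everywhere, whereas
    \<open>wiener_hopf_factor\<close> asks for evenness at every point.\<close>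
  define m where "m s = (m0 s + m0 (- s)) / 2" for s
  show thesis
  proof (rule that[of m])
    show "m \<in> borel_measurable borel" unfolding m_def by measurable
    show "0 \<le> m s" "m (- s) = m s" for s using m00 by (auto simp: m_def)
    have m0i': "integrable lborel (\<lambda>s. m0 (- s))" by (rule integrable_lborel_minus[OF m0i])
    show "integrable lborel m" unfolding m_def using m0i m0i' by auto
    show "\<forall>F B. F \<in> borel_measurable borel \<longrightarrow> (\<forall>s. \<bar>F s\<bar> \<le> B) \<longrightarrow>
      (\<integral>y. F (y \<bullet> b) * k (norm y) \<partial>lborel) = (\<integral>s. m s * F s \<partial>lborel)"
    proof (intro allI impI)
    fix F :: "real \<Rightarrow> real" and B assume F [measurable]: "F \<in> borel_measurable borel" and "\<forall>s. \<bar>F s\<bar> \<le> B"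
    then have B: "\<And>s. \<bar>F s\<bar> \<le> B" by blast
    have "(\<integral>y. F (y \<bullet> b) * k (norm y) \<partial>lborel) = (\<integral>y. F (- (y \<bullet> b)) * k (norm y) \<partial>lborel)"
      using integral_lborel_minus[of "\<lambda>y. F (y \<bullet> b) * k (norm y)"] by simp
    also have "\<dots> = (\<integral>s. m0 s * F (- s) \<partial>lborel)" using m0F[of "\<lambda>s. F (- s)"] by simp
    also have "\<dots> = (\<integral>s. m0 (- s) * F s \<partial>lborel)"
      using integral_lborel_minus[of "\<lambda>s. m0 s * F (- s)"] by simp
    finally have "2 * (\<integral>y. F (y \<bullet> b) * k (norm y) \<partial>lborel) = (\<integral>s. m0 s * F s \<partial>lborel) + (\<integral>s. m0 (- s) * F s \<partial>lborel)"
      using m0F[OF F] by simp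
    also have "\<dots> = (\<integral>s. m0 s * F s + m0 (- s) * F s \<partial>lborel)"
      using integrable_bounded_mult[OF m0i F B] integrable_bounded_mult[OF m0i' F B] by simp
    also have "\<dots> = (\<integral>s. 2 * (m s * F s) \<partial>lborel)"
      by (intro Bochner_Integration.integral_cong) (auto simp: m_def distrib_right)
    finally show "(\<integral>y. F (y \<bullet> b) * k (norm y) \<partial>lborel) = (\<integral>s. m s * F s \<partial>lborel)" by simp
    qed
  qed
qed

text \<open>In probabilistic terms \<open>w t = 1 - E\<^sub>t[exp (- lam \<tau>)]\<close>, where \<open>\<tau>\<close> is the exit time of the
  projected process from the half-line.\<close>

lemma half_line_function:
  assumes lam: "0 < lam"
  obtains w :: "real \<Rightarrow> real" where "w \<in> borel_measurable borel" "\<And>x. x \<le> 0 \<Longrightarrow> w x = 0"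
    "\<And>x y. x \<le> y \<Longrightarrow> w x \<le> w y" "\<And>x. w x \<le> 1"
    "\<And>x y. 0 \<le> x \<Longrightarrow> 0 \<le> y \<Longrightarrow> w (x + y) \<le> w x + w y"
    "\<And>t (e::'a). 0 < t \<Longrightarrow> norm e = 1 \<Longrightarrow> (\<integral>y. (w (t + y \<bullet> e) - w t) * k (norm y) \<partial>lborel) = - lam * (1 - w t)"
    "\<And>t. 0 < t \<Longrightarrow> (w t)\<^sup>2 * (lam + char_exp k (b /\<^sub>R t)) \<le> 80 * lam"
proof -
  obtain m where m: "m \<in> borel_measurable borel" "\<And>s. 0 \<le> m s" "\<And>s. m (- s) = m s" "integrable lborel m"
    and mF': "\<forall>F B. F \<in> borel_measurable borel \<longrightarrow> (\<forall>s. \<bar>F s\<bar> \<le> B) \<longrightarrow>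
      (\<integral>y. F (y \<bullet> b) * k (norm y) \<partial>lborel) = (\<integral>s. m s * F s \<partial>lborel)"
    by (rule projected_density) (rule that)
  note mF = mF'[rule_format]
  note m(1) [measurable]
  \<comment> \<open>Killing at rate \<open>lam\<close> turns the projected kernel into a
    sub-probability density: the total rate is \<open>c\<close>, each step survives with probability
    \<open>q = mass / c\<close> and is killed with probability \<open>lam / c\<close>.\<close>
  define c where "c = lam + mass"
  have c0: "0 < c" using lam mass_nonneg by (simp add: c_def)
  define p where "p s = m s / c" for s
  define q where "q = mass / c"
  have q: "q < 1" "1 - q = lam / c" using lam c0 by (auto simp: q_def c_def field_simps)
  have pm: "p \<in> borel_measurable borel" unfolding p_def by measurable
  have p0: "0 \<le> p s" "p (- s) = p s" for s using m c0 by (auto simp: p_def)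
  have pint: "integrable lborel p" unfolding p_def using m by auto
  have pq: "(\<integral>s. p s \<partial>lborel) = q"
    using mF[of "\<lambda>_. 1" 1] by (simp add: p_def q_def mass_def)
  obtain e where e: "e \<in> borel_measurable borel" "\<And>x. 0 \<le> e x" "\<And>x. x \<le> 0 \<Longrightarrow> e x = 0"
    "integrable lborel e" "(\<integral>x. e x \<partial>lborel) = 1 - sqrt (1 - q)"
    "\<And>F :: real \<Rightarrow> ennreal. F \<in> borel_measurable borel \<Longrightarrow>
      (\<integral>\<^sup>+z. \<integral>\<^sup>+a. F (a - z) * (ennreal (e a) * ennreal (e z)) \<partial>lborel \<partial>lborel) + (\<integral>\<^sup>+x. F x * ennreal (p x) \<partial>lborel)
      = (\<integral>\<^sup>+z. F z * ennreal (e z) \<partial>lborel) + (\<integral>\<^sup>+z. F (- z) * ennreal (e z) \<partial>lborel)"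
    by (rule wiener_hopf_factor[OF pm p0 pint pq q(1)]) (rule that)
  interpret W: wiener_hopf p e q
    by standard (use pm p0 pint pq q e in auto)
  have [measurable]: "W.w \<in> borel_measurable borel" by (rule W.w_measurable)
  have eq: "(\<integral>y. (W.w (t + y \<bullet> d) - W.w t) * k (norm y) \<partial>lborel) = - lam * (1 - W.w t)"
    if t: "0 < t" and d: "norm d = 1" for t and d :: 'a
  proof -
    have "(\<integral>y. W.w (t + y \<bullet> d) * k (norm y) \<partial>lborel) = (\<integral>y. W.w (t - y \<bullet> (- d)) * k (norm y) \<partial>lborel)" by simp
    also have "\<dots> = (\<integral>y. W.w (t - y \<bullet> b) * k (norm y) \<partial>lborel)"
      using integral_inner_rotate[of "\<lambda>s. W.w (t - s)" "- d"] d by simp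
    also have "\<dots> = (\<integral>s. m s * W.w (t - s) \<partial>lborel)"
      using W.w_abs by (intro mF[where B=1]) auto
    also have "\<dots> = c * (\<integral>s. p s * W.w (t - s) \<partial>lborel)"
      using c0 by (simp add: p_def)
    also have "\<dots> = c * (W.w t - lam / c)" using W.w_equation[OF t] q by (simp add: algebra_simps)
    also have "\<dots> = c * W.w t - lam" using c0 by (simp add: right_diff_distrib)
    finally have 1: "(\<integral>y. W.w (t + y \<bullet> d) * k (norm y) \<partial>lborel) = c * W.w t - lam" .
    have "integrable lborel (\<lambda>y. W.w (t + y \<bullet> d) * k (norm y))"
      by (rule kint_bdd[where B=1]) (use W.w_abs in auto)
    then have "(\<integral>y. (W.w (t + y \<bullet> d) - W.w t) * k (norm y) \<partial>lborel) = c * W.w t - lam - W.w t * mass"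
      using kint 1 by (simp add: left_diff_distrib mass_def)
    then show ?thesis by (simp add: c_def algebra_simps)
  qed
  have bd: "(W.w t)\<^sup>2 * (lam + char_exp k (b /\<^sub>R t)) \<le> 80 * lam" if t: "0 < t" for t
  proof -
    have ic: "integrable lborel (\<lambda>y. cos (y \<bullet> b / t) * k (norm y))"
      by (rule kint_bdd[where B=1]) auto
    have "char_exp k (b /\<^sub>R t) = (\<integral>y. k (norm y) - cos (y \<bullet> b / t) * k (norm (y::'a)) \<partial>lborel)"
      unfolding char_exp_def
      by (intro Bochner_Integration.integral_cong) (auto simp: algebra_simps inner_commute divide_inverse)
    also have "\<dots> = mass - (\<integral>y. cos (y \<bullet> b / t) * k (norm y) \<partial>lborel)"
      using ic kint by (simp add: mass_def)
    also have "(\<integral>y. cos (y \<bullet> b / t) * k (norm y) \<partial>lborel) = (\<integral>s. m s * cos (s / t) \<partial>lborel)"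
      by (rule mF[of "\<lambda>s. cos (s / t)" 1]) auto
    also have "\<dots> = c * (\<integral>s. p s * cos (s / t) \<partial>lborel)" using c0 by (simp add: p_def)
    \<comment> \<open>Up to the factor \<open>c\<close>, the symbol of the killed walk is the killed
      exponent; this turns \<open>w_square_bound\<close> into a bound by
      \<open>char_exp\<close>.\<close>
    finally have "lam + char_exp k (b /\<^sub>R t) = c * (1 - (\<integral>s. p s * cos (s / t) \<partial>lborel))"
      by (simp add: c_def algebra_simps)
    then have "(W.w t)\<^sup>2 * (lam + char_exp k (b /\<^sub>R t)) = c * ((W.w t)\<^sup>2 * (1 - (\<integral>s. p s * cos (s / t) \<partial>lborel)))"
      by simp
    also have "\<dots> \<le> c * (80 * (1 - q))"
      using W.w_square_bound[OF t] c0 by (intro mult_left_mono) auto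
    also have "\<dots> = 80 * lam" using c0 by (simp add: q)
    finally show ?thesis .
  qed
  show thesis
    by (rule that[of W.w]) (use W.w_neg W.w_mono W.w_le_1 W.w_subadd eq bd in auto)
qed

end

section \<open>Barriers outside balls\<close>

lemma integral_lborel_scale:
  fixes f :: "'a::euclidean_space \<Rightarrow> real"
  assumes [measurable]: "f \<in> borel_measurable borel" and c: "0 < c"
  shows "(\<integral>y. f y \<partial>lborel) = c ^ DIM('a) * (\<integral>y. f (c *\<^sub>R y) \<partial>lborel)"
proof -
  have "(\<integral>y. f y \<partial>lborel) = (\<integral>y. f y \<partial>density (distr lborel borel (\<lambda>x::'a. 0 + c *\<^sub>R x)) (\<lambda>_. ennreal (\<bar>c\<bar> ^ DIM('a))))"
    using lborel_affine[of c "0::'a"] c by (simp add: ennreal_power)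
  also have "\<dots> = (\<integral>y. \<bar>c\<bar> ^ DIM('a) *\<^sub>R f (c *\<^sub>R y) \<partial>lborel)"
    using c by (subst integral_density) (auto simp: integral_distr)
  also have "\<dots> = c ^ DIM('a) * (\<integral>y. f (c *\<^sub>R y) \<partial>lborel)" using c by simp
  finally show ?thesis .
qed

text \<open>The constant that relates \<open>k \<rho> * \<rho> ^ DIM('a)\<close> to the exponent at
  frequency \<open>1 / \<rho>\<close> in \<open>char_exp_lower\<close>, after scaling to the unit
  ball.\<close>

definition cosvol :: "'a::euclidean_space \<Rightarrow> real" where
  "cosvol b = (\<integral>y. indicator (ball 0 1) y * (1 - cos (b \<bullet> y)) \<partial>lborel)"

lemma ball_sets_borel [measurable]: "ball (a::'a::metric_space) r \<in> sets borel"
  by simp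

lemma integrable_indicator_ball:
  fixes a :: "'a::euclidean_space"
  shows "integrable lborel (indicator (ball a r) :: 'a \<Rightarrow> real)"
  using emeasure_lborel_ball_finite[of a r] by (intro integrable_real_indicator) auto

lemma cosvol_pos:
  fixes b :: "'a::euclidean_space"
  assumes b: "norm b = 1"
  shows "0 < cosvol b"
proof -
  \<comment> \<open>This ball stays inside the unit ball, and on it \<open>b \<bullet> y\<close>
    lies between 1/4 and 3/4.\<close>
  let ?B = "ball (b /\<^sub>R 2) (1/4) :: 'a set"
  have bb: "b \<bullet> b = 1" using b by (simp add: dot_square_norm)
  have c14: "cos (1/4::real) < 1"
    using cos_monotone_0_pi[of 0 "1/4"] pi_gt3 by simp
  have "0 < (1 - cos (1/4)) * measure lborel ?B"
    using content_ball_pos[of "1/4" "b /\<^sub>R 2"] c14 by simp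
  also have "\<dots> = (\<integral>y. (1 - cos (1/4)) * indicator ?B y \<partial>lborel)" by simp
  also have "\<dots> \<le> cosvol b"
    unfolding cosvol_def
  proof (rule integral_mono)
    show "integrable lborel (\<lambda>y. (1 - cos (1/4::real)) * indicator ?B y)"
      using integrable_indicator_ball[of "b /\<^sub>R 2" "1/4"] by simp
    show "integrable lborel (\<lambda>y. indicator (ball 0 1) y * (1 - cos (b \<bullet> y)))"
    proof (rule integrable_bounded_mult[OF integrable_indicator_ball, where B=2])
      show "\<bar>1 - cos (b \<bullet> y)\<bar> \<le> 2" for y
        using cos_ge_minus_one[of "b \<bullet> y"] cos_le_one[of "b \<bullet> y"] by linarith
    qed measurable
    fix y :: 'a
    show "(1 - cos (1/4)) * indicator ?B y \<le> indicator (ball 0 1) y * (1 - cos (b \<bullet> y))"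
    proof (cases "y \<in> ?B")
      case True
      then have d: "norm (y - b /\<^sub>R 2) < 1/4" by (simp add: dist_norm norm_minus_commute)
      have "norm y \<le> norm (y - b /\<^sub>R 2) + norm (b /\<^sub>R 2)" by (metis norm_triangle_sub add.commute)
      then have ny: "norm y < 1" using d b by simp
      have "\<bar>b \<bullet> (y - b /\<^sub>R 2)\<bar> \<le> norm b * norm (y - b /\<^sub>R 2)" by (rule Cauchy_Schwarz_ineq2)
      then have "\<bar>b \<bullet> y - 1/2\<bar> < 1/4" using d b by (simp add: inner_diff_right bb)
      then have "1/4 \<le> b \<bullet> y" "b \<bullet> y \<le> pi" using pi_gt3 by linarith+
      then have "cos (b \<bullet> y) \<le> cos (1/4)" by (intro cos_monotone_0_pi_le) auto
      then show ?thesis using True ny by simp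
    qed (simp add: mult_nonneg_nonneg)
  qed
  finally show ?thesis .
qed

lemma power_one_plus_le: "0 \<le> s \<Longrightarrow> s \<le> 1 \<Longrightarrow> (1 + s) ^ n \<le> 1 + (2 ^ n - 1) * s" for s :: real
proof (induction n)
  case (Suc n)
  have "(1 + s) ^ Suc n \<le> (1 + s) * (1 + (2 ^ n - 1) * s)"
    using Suc by (simp add: mult_left_mono)
  also have "\<dots> = 1 + 2 ^ n * s + (2 ^ n - 1) * (s * s)" by (simp add: algebra_simps)
  also have "\<dots> \<le> 1 + 2 ^ n * s + (2 ^ n - 1) * s"
    using Suc.prems by (intro add_left_mono mult_left_mono) (auto simp: mult_left_le)
  finally show ?case by (simp add: algebra_simps)
qed simp

lemma content_ball_annulus_le:
  assumes "0 < \<rho>" "0 \<le> \<beta>" "\<beta> \<le> \<rho>"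
  shows "measure lborel (ball (0::'a::euclidean_space) (\<rho> + \<beta>)) - measure lborel (ball (0::'a) \<rho>)
    \<le> measure lborel (ball (0::'a) 1) * (\<rho> ^ DIM('a) * (2 ^ DIM('a) * (\<beta> / \<rho>)))"
proof -
  let ?n = "DIM('a)" and ?V = "measure lborel (ball (0::'a) 1)"
  have eq: "measure lborel (ball (0::'a) r) = r ^ ?n * ?V" if "0 \<le> r" for r
    using content_ball_conv_unit_ball[of r "0::'a"] that by simp
  have "(\<rho> + \<beta>) ^ ?n = \<rho> ^ ?n * (1 + \<beta> / \<rho>) ^ ?n"
    using assms by (simp add: power_mult_distrib[symmetric] distrib_left)
  also have "\<dots> \<le> \<rho> ^ ?n * (1 + (2 ^ ?n - 1) * (\<beta> / \<rho>))"
    using assms by (intro mult_left_mono power_one_plus_le) auto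
  also have "\<dots> \<le> \<rho> ^ ?n * (1 + 2 ^ ?n * (\<beta> / \<rho>))"
    using assms by (intro mult_left_mono add_left_mono mult_right_mono) auto
  finally have "(\<rho> + \<beta>) ^ ?n - \<rho> ^ ?n \<le> \<rho> ^ ?n * (2 ^ ?n * (\<beta> / \<rho>))" by (simp add: distrib_left)
  then have "((\<rho> + \<beta>) ^ ?n - \<rho> ^ ?n) * ?V \<le> \<rho> ^ ?n * (2 ^ ?n * (\<beta> / \<rho>)) * ?V"
    by (intro mult_right_mono) auto
  moreover have "measure lborel (ball (0::'a) (\<rho> + \<beta>)) - measure lborel (ball (0::'a) \<rho>) = ((\<rho> + \<beta>) ^ ?n - \<rho> ^ ?n) * ?V"
    using eq[of "\<rho> + \<beta>"] eq[of \<rho>] assms by (simp add: left_diff_distrib)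
  ultimately show ?thesis by (metis mult.commute)
qed

text \<open>Integrating an increment of a monotone function over a ball only costs the width of the
  annulus that the ball sweeps out.\<close>

lemma ball_increment_le:
  fixes w :: "real \<Rightarrow> real" and e :: "'a::euclidean_space"
  assumes wm [measurable]: "w \<in> borel_measurable borel" and mono: "\<And>x y. x \<le> y \<Longrightarrow> w x \<le> w y"
    and bd: "\<And>x. \<bar>w x\<bar> \<le> 1" and e: "norm e = 1" and rho: "0 < \<rho>" "0 \<le> \<beta>"
  shows "(\<integral>y. indicator (ball 0 \<rho>) y * (w (t + y \<bullet> e + \<beta>) - w (t + y \<bullet> e)) \<partial>lborel)
    \<le> (measure lborel (ball (0::'a) (\<rho> + \<beta>)) - measure lborel (ball (0::'a) \<rho>)) * (w (t + \<rho> + \<beta>) - w (t - \<rho>))"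
proof -
  \<comment> \<open>Subtracting \<open>w (t - \<rho>)\<close> makes \<open>W\<close> nonnegative on
    the ball of radius \<open>\<rho>\<close>. After one term is translated by
    \<open>\<beta> *\<^sub>R e\<close>, two overlapping balls are compared, and the part of the
    original ball that is not covered only lowers the difference.\<close>
  define W where "W y = w (t + y \<bullet> e) - w (t - \<rho>)" for y :: 'a
  have Wm [measurable]: "W \<in> borel_measurable borel" unfolding W_def by measurable
  have Wb: "\<bar>W y\<bar> \<le> 2" for y using bd[of "t + y \<bullet> e"] bd[of "t - \<rho>"] by (simp add: W_def)
  have ee: "e \<bullet> e = 1" using e by (simp add: dot_square_norm)
  have ye: "\<bar>y \<bullet> e\<bar> \<le> norm y" for y using Cauchy_Schwarz_ineq2[of y e] e by simp
  have i1: "integrable lborel (\<lambda>y. indicator (ball a r) y * W (h y))" if [measurable]: "h \<in> borel_measurable borel" for a r h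
    by (rule integrable_bounded_mult[OF integrable_indicator_ball, where B=2]) (use Wb in auto)
  have sh: "(\<integral>y. indicator (ball 0 \<rho>) y * W (\<beta> *\<^sub>R e + y) \<partial>lborel) = (\<integral>y. indicator (ball (\<beta> *\<^sub>R e) \<rho>) y * W y \<partial>lborel)"
  proof -
    have "indicator (ball (\<beta> *\<^sub>R e) \<rho>) (\<beta> *\<^sub>R e + y) = (indicator (ball 0 \<rho>) y :: real)" for y
      by (simp add: indicator_def dist_norm)
    moreover have "(\<lambda>y. indicator (ball (\<beta> *\<^sub>R e) \<rho>) y * W y) \<in> borel_measurable borel" by measurable
    ultimately show ?thesis
      using integral_lborel_translate[of "\<lambda>y. indicator (ball (\<beta> *\<^sub>R e) \<rho>) y * W y" "\<beta> *\<^sub>R e", symmetric] by simp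
  qed
  have "(\<integral>y. indicator (ball 0 \<rho>) y * (w (t + y \<bullet> e + \<beta>) - w (t + y \<bullet> e)) \<partial>lborel)
      = (\<integral>y. indicator (ball 0 \<rho>) y * W (\<beta> *\<^sub>R e + y) - indicator (ball 0 \<rho>) y * W y \<partial>lborel)"
    by (intro Bochner_Integration.integral_cong) (auto simp: W_def inner_add_left ee algebra_simps)
  also have "\<dots> = (\<integral>y. indicator (ball (\<beta> *\<^sub>R e) \<rho>) y * W y - indicator (ball 0 \<rho>) y * W y \<partial>lborel)"
    using i1[of "\<lambda>y. \<beta> *\<^sub>R e + y" 0 \<rho>] i1[of "\<lambda>y. y" 0 \<rho>] i1[of "\<lambda>y. y" "\<beta> *\<^sub>R e" \<rho>] sh by simp
  also have "\<dots> \<le> (\<integral>y. (indicator (ball (0::'a) (\<rho> + \<beta>)) y - indicator (ball 0 \<rho>) y) * (w (t + \<rho> + \<beta>) - w (t - \<rho>)) \<partial>lborel)"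
  proof (rule integral_mono)
    show "integrable lborel (\<lambda>y. indicator (ball (\<beta> *\<^sub>R e) \<rho>) y * W y - indicator (ball 0 \<rho>) y * W y)"
      using i1[of "\<lambda>y. y" 0 \<rho>] i1[of "\<lambda>y. y" "\<beta> *\<^sub>R e" \<rho>] by simp
    show "integrable lborel (\<lambda>y::'a. (indicator (ball 0 (\<rho> + \<beta>)) y - indicator (ball 0 \<rho>) y) * (w (t + \<rho> + \<beta>) - w (t - \<rho>)))"
      by (intro integrable_mult_left Bochner_Integration.integrable_diff integrable_indicator_ball)
    fix y :: 'a
    have C0: "0 \<le> w (t + \<rho> + \<beta>) - w (t - \<rho>)" using mono[of "t - \<rho>" "t + \<rho> + \<beta>"] rho by simp
    show "indicator (ball (\<beta> *\<^sub>R e) \<rho>) y * W y - indicator (ball 0 \<rho>) y * W y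
       \<le> (indicator (ball 0 (\<rho> + \<beta>)) y - indicator (ball 0 \<rho>) y) * (w (t + \<rho> + \<beta>) - w (t - \<rho>))"
    proof (cases "norm y < \<rho>")
      case True
      then have "0 \<le> W y" using ye[of y] mono[of "t - \<rho>" "t + y \<bullet> e"] by (simp add: W_def)
      then show ?thesis using True rho by (auto split: split_indicator)
    next
      case False
      show ?thesis
      proof (cases "y \<in> ball (\<beta> *\<^sub>R e) \<rho>")
        case True
        then have d: "norm (y - \<beta> *\<^sub>R e) < \<rho>" by (simp add: dist_norm norm_minus_commute)
        have "norm y \<le> norm (y - \<beta> *\<^sub>R e) + norm (\<beta> *\<^sub>R e)" by (metis norm_triangle_sub add.commute)
        then have ny: "norm y < \<rho> + \<beta>" using d e rho by simp
        then have "W y \<le> w (t + \<rho> + \<beta>) - w (t - \<rho>)"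
          using ye[of y] mono[of "t + y \<bullet> e" "t + \<rho> + \<beta>"] by (simp add: W_def)
        then show ?thesis using True False ny by simp
      next
        case 2: False
        then show ?thesis using False C0 by (auto split: split_indicator)
      qed
    qed
  qed
  also have "\<dots> = (measure lborel (ball (0::'a) (\<rho> + \<beta>)) - measure lborel (ball (0::'a) \<rho>)) * (w (t + \<rho> + \<beta>) - w (t - \<rho>))"
    using integrable_indicator_ball[of "0::'a"] by simp
  finally show ?thesis .
qed

text \<open>Added to \<open>w\<close>, it guarantees that the barrier is at least
  \<open>t0\<^sup>2\<close> beyond \<open>t0\<close> for every truncation; the cut at 1 keeps it
  bounded.\<close>

definition eta :: "real \<Rightarrow> real" where "eta t = min 1 ((max 0 t)\<^sup>2)"

lemma eta_basic: "0 \<le> eta t" "eta t \<le> 1" "eta t \<le> t\<^sup>2" "t \<le> 0 \<Longrightarrow> eta t = 0" "0 \<le> t \<Longrightarrow> t \<le> 1 \<Longrightarrow> eta t = t\<^sup>2"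
  by (auto simp: eta_def max_def abs_square_le_1)

lemma eta_mono: "s \<le> t \<Longrightarrow> eta s \<le> eta t"
  unfolding eta_def by (intro min.mono power_mono max.mono) auto

lemma eta_double: "eta (2 * t) \<le> 4 * eta t"
  by (auto simp: eta_def max_def min_def power2_eq_square)

lemma eta_measurable [measurable]: "eta \<in> borel_measurable borel"
  unfolding eta_def by measurable

text \<open>For \<open>t \<le> 1\<close> the square dominates \<open>eta\<close> everywhere and
  agrees with it at \<open>t\<close>; for \<open>t > 1\<close> the value \<open>eta t\<close> is
  already maximal, so the second difference is not positive.\<close>

lemma eta_second_difference:
  assumes t: "0 \<le> t" and s: "0 \<le> s" and q: "p\<^sup>2 + q\<^sup>2 - 2 * t\<^sup>2 \<le> 2 * s"
  shows "eta p + eta q - 2 * eta t \<le> 2 * min 1 s"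
proof (cases "t \<le> 1")
  case True
  then have "eta t = t\<^sup>2" using t eta_basic by simp
  moreover have "0 \<le> t\<^sup>2" by simp
  ultimately have "eta p + eta q - 2 * eta t \<le> 2" "eta p + eta q - 2 * eta t \<le> 2 * s"
    using eta_basic(2,3)[of p] eta_basic(2,3)[of q] q by linarith+
  then show ?thesis by (simp add: min_def)
next
  case False
  then have "eta t = 1" using eta_mono[of 1 t] eta_basic(5)[of 1] eta_basic(2)[of t] by simp
  then show ?thesis using s eta_basic(2)[of p] eta_basic(2)[of q] by (simp add: min_def)
qed

section \<open>Bounds for the exponent and the curvature error\<close>

context radial_kernel
begin

lemma Lk_symm:
  assumes um [measurable]: "u \<in> borel_measurable borel" and B: "\<And>x. \<bar>u x\<bar> \<le> B"
  shows "integrable lborel (\<lambda>y. (u (x + y) + u (x - y) - 2 * u x) * k (norm y))"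
    and "Lk u x = (1/2) * (\<integral>y. (u (x + y) + u (x - y) - 2 * u x) * k (norm y) \<partial>lborel)"
proof -
  have i1: "integrable lborel (\<lambda>y. (u (x + y) - u x) * k (norm y))" by (rule Lk_int[OF um B])
  have i2: "integrable lborel (\<lambda>y. (u (x - y) - u x) * k (norm y))"
    using integrable_lborel_minus[OF i1] by simp
  have e2: "(\<integral>y. (u (x - y) - u x) * k (norm y) \<partial>lborel) = Lk u x"
    using integral_lborel_minus[of "\<lambda>y. (u (x + y) - u x) * k (norm y)"] by (simp add: Lk_def)
  have eq: "(\<lambda>y. (u (x + y) + u (x - y) - 2 * u x) * k (norm y)) = (\<lambda>y. (u (x + y) - u x) * k (norm y) + (u (x - y) - u x) * k (norm y))"
    by (auto simp: algebra_simps)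
  show "integrable lborel (\<lambda>y. (u (x + y) + u (x - y) - 2 * u x) * k (norm y))"
    unfolding eq using i1 i2 by simp
  show "Lk u x = (1/2) * (\<integral>y. (u (x + y) + u (x - y) - 2 * u x) * k (norm y) \<partial>lborel)"
    unfolding eq using i1 i2 e2 by (simp add: Lk_def)
qed

lemma Lk_eta_le:
  fixes d :: "'a \<Rightarrow> real"
  assumes dm [measurable]: "d \<in> borel_measurable borel" and d0: "0 \<le> d x"
    and sec: "\<And>y. (d (x + y))\<^sup>2 + (d (x - y))\<^sup>2 - 2 * (d x)\<^sup>2 \<le> 2 * (norm y)\<^sup>2"
  shows "Lk (\<lambda>x. eta (d x)) x \<le> (\<integral>y. min 1 ((norm y)\<^sup>2) * k (norm (y::'a)) \<partial>lborel)"
proof -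
  have em: "(\<lambda>x. eta (d x)) \<in> borel_measurable borel" by measurable
  have eb: "\<bar>eta (d x)\<bar> \<le> 1" for x using eta_basic(1,2)[of "d x"] by simp
  have mi: "integrable lborel (\<lambda>y. min 1 ((norm y)\<^sup>2) * k (norm (y::'a)))"
    by (rule kint_bdd[where B=1]) auto
  have "(\<integral>y. (eta (d (x + y)) + eta (d (x - y)) - 2 * eta (d x)) * k (norm y) \<partial>lborel)
     \<le> (\<integral>y. 2 * (min 1 ((norm y)\<^sup>2) * k (norm (y::'a))) \<partial>lborel)"
  proof (rule integral_mono)
    show "integrable lborel (\<lambda>y. (eta (d (x + y)) + eta (d (x - y)) - 2 * eta (d x)) * k (norm y))"
      by (rule Lk_symm(1)[OF em eb])
    show "integrable lborel (\<lambda>y. 2 * (min 1 ((norm y)\<^sup>2) * k (norm (y::'a))))" using mi by simp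
    fix y :: 'a
    have "(eta (d (x + y)) + eta (d (x - y)) - 2 * eta (d x)) * k (norm y) \<le> 2 * min 1 ((norm y)\<^sup>2) * k (norm y)"
      using eta_second_difference[OF d0 _ sec[of y]] k0[of "norm y"] by (intro mult_right_mono) auto
    then show "(eta (d (x + y)) + eta (d (x - y)) - 2 * eta (d x)) * k (norm y) \<le> 2 * (min 1 ((norm y)\<^sup>2) * k (norm y))"
      by simp
  qed
  then show ?thesis unfolding Lk_symm(2)[OF em eb] by simp
qed

lemma char_exp_int: "integrable lborel (\<lambda>y. (1 - cos (z \<bullet> y)) * k (norm (y::'a)))"
proof (rule kint_bdd[where B=2])
  show "\<bar>1 - cos (z \<bullet> y)\<bar> \<le> 2" for y
    using cos_ge_minus_one[of "z \<bullet> y"] cos_le_one[of "z \<bullet> y"] by linarith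
qed measurable

lemma char_exp_nonneg: "0 \<le> char_exp k (z::'a)"
  unfolding char_exp_def using k0 by (intro Bochner_Integration.integral_nonneg) auto

lemma char_exp_double: "char_exp k (2 *\<^sub>R z) \<le> 4 * char_exp k (z::'a)"
proof -
  have "char_exp k (2 *\<^sub>R z) \<le> (\<integral>y. 4 * ((1 - cos (z \<bullet> y)) * k (norm (y::'a))) \<partial>lborel)"
    unfolding char_exp_def
  proof (rule integral_mono)
    fix y :: 'a
    define c where "c = cos (z \<bullet> y)"
    have c: "- 1 \<le> c" "c \<le> 1" by (auto simp: c_def)
    have "1 - cos (2 *\<^sub>R z \<bullet> y) = 2 * (1 - c) * (1 + c)"
      using cos_double_cos[of "z \<bullet> y"] by (simp add: c_def power2_eq_square algebra_simps)
    also have "\<dots> \<le> 2 * (1 - c) * 2" using c by (intro mult_left_mono) auto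
    finally have "(1 - cos (2 *\<^sub>R z \<bullet> y)) * k (norm y) \<le> (2 * (1 - c) * 2) * k (norm y)"
      using k0 by (intro mult_right_mono)
    also have "\<dots> = 4 * ((1 - cos (z \<bullet> y)) * k (norm y))" by (simp add: c_def algebra_simps)
    finally show "(1 - cos (2 *\<^sub>R z \<bullet> y)) * k (norm y) \<le> 4 * ((1 - cos (z \<bullet> y)) * k (norm y))" .
  next
    show "integrable lborel (\<lambda>y. (1 - cos (2 *\<^sub>R z \<bullet> y)) * k (norm (y::'a)))" by (rule char_exp_int)
    show "integrable lborel (\<lambda>y. 4 * ((1 - cos (z \<bullet> y)) * k (norm (y::'a))))" using char_exp_int by simp
  qed
  then show ?thesis by (simp add: char_exp_def)
qed

text \<open>On the ball of radius \<open>\<rho>\<close> the kernel is at least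
  \<open>k \<rho>\<close>; scaling that ball to the unit ball produces
  \<open>cosvol b\<close>.\<close>

lemma char_exp_lower:
  assumes rho: "0 < \<rho>"
  shows "k \<rho> * (\<rho> ^ DIM('a) * cosvol b) \<le> char_exp k (b /\<^sub>R \<rho>)"
proof -
  let ?g = "\<lambda>y. indicator (ball 0 \<rho>) y * (1 - cos ((b /\<^sub>R \<rho>) \<bullet> y))"
  have gm: "?g \<in> borel_measurable borel" by measurable
  have gi: "integrable lborel ?g"
  proof (rule integrable_bounded_mult[OF integrable_indicator_ball, where B=2])
    show "\<bar>1 - cos ((b /\<^sub>R \<rho>) \<bullet> y)\<bar> \<le> 2" for y
      using cos_ge_minus_one[of "(b /\<^sub>R \<rho>) \<bullet> y"] cos_le_one[of "(b /\<^sub>R \<rho>) \<bullet> y"] by linarith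
  qed measurable
  have "(\<integral>y. ?g y \<partial>lborel) = \<rho> ^ DIM('a) * (\<integral>y. ?g (\<rho> *\<^sub>R y) \<partial>lborel)"
    by (rule integral_lborel_scale[OF gm rho])
  also have "(\<integral>y. ?g (\<rho> *\<^sub>R y) \<partial>lborel) = cosvol b"
    unfolding cosvol_def using rho by (intro Bochner_Integration.integral_cong) (auto simp: indicator_def field_simps)
  finally have "k \<rho> * (\<rho> ^ DIM('a) * cosvol b) = (\<integral>y. k \<rho> * ?g y \<partial>lborel)" by simp
  also have "\<dots> \<le> char_exp k (b /\<^sub>R \<rho>)"
    unfolding char_exp_def
  proof (rule integral_mono)
    show "integrable lborel (\<lambda>y. k \<rho> * ?g y)" using gi by simp
    fix y :: 'a
    have c: "0 \<le> 1 - cos ((b /\<^sub>R \<rho>) \<bullet> y)" by simp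
    show "k \<rho> * ?g y \<le> (1 - cos ((b /\<^sub>R \<rho>) \<bullet> y)) * k (norm y)"
    proof (cases "norm y < \<rho>")
      case True
      then have "k \<rho> \<le> k (norm y)" by (intro kmono) auto
      then have "(1 - cos ((b /\<^sub>R \<rho>) \<bullet> y)) * k \<rho> \<le> (1 - cos ((b /\<^sub>R \<rho>) \<bullet> y)) * k (norm y)"
        using c by (intro mult_left_mono)
      then show ?thesis using True by (simp add: mult.commute)
    next
      case False
      then have "indicator (ball 0 \<rho>) y = (0::real)" by simp
      moreover have "0 \<le> (1 - cos ((b /\<^sub>R \<rho>) \<bullet> y)) * k (norm y)" using c k0 by (intro mult_nonneg_nonneg)
      ultimately show ?thesis by (simp only: mult_zero_left mult_zero_right)
    qed
  qed (rule char_exp_int)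
  finally show ?thesis .
qed

text \<open>The factors met in \<open>shell_estimate\<close>: volume of the annulus, the bound of
  \<open>k (\<rho> / 2) * \<rho> ^ DIM('a)\<close> by the exponent, and \<open>3 * sqrt 80\<close>
  from the increment of \<open>w\<close>. The value depends on \<open>b\<close> and the dimension
  but not on \<open>k\<close>, hence not on the truncation.\<close>

definition curv_const :: real where
  "curv_const = measure lborel (ball (0::'a) 1) * 2 ^ DIM('a) * (2 ^ DIM('a) * 4 / cosvol b) * (3 * sqrt 80)"

lemma curv_const_nonneg: "0 \<le> curv_const"
  unfolding curv_const_def using cosvol_pos[OF b1] by simp

text \<open>The annulus has relative volume of order \<open>\<beta> / \<rho>\<close>, the increment
  is at most \<open>3 * w \<rho>\<close>, and \<open>k (\<rho> / 2) * \<rho> ^ DIM('a)\<close> is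
  bounded by a multiple of the exponent \<open>P\<close> at frequency \<open>1 / \<rho>\<close>.
  Since \<open>w \<rho> * sqrt P\<close> is of order \<open>sqrt lam\<close>, only
  \<open>sqrt P\<close> survives. Without this saving the dyadic sum would converge only for orders
  below 1/2.\<close>

lemma shell_estimate:
  assumes neg: "\<And>x. x \<le> 0 \<Longrightarrow> w x = 0"
    and mono: "\<And>x y. x \<le> y \<Longrightarrow> w x \<le> w y"
    and sub: "\<And>x y. 0 \<le> x \<Longrightarrow> 0 \<le> y \<Longrightarrow> w (x + y) \<le> w x + w y"
    and bound: "\<And>t. 0 < t \<Longrightarrow> (w t)\<^sup>2 * (lam + char_exp k (b /\<^sub>R t)) \<le> 80 * lam" and lam: "0 < lam"
    and rho: "0 < \<rho>" "0 \<le> \<beta>" "\<beta> \<le> \<rho>" and t: "0 \<le> t"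
  shows "k (\<rho> / 2) * ((measure lborel (ball (0::'a) (\<rho> + \<beta>)) - measure lborel (ball (0::'a) \<rho>)) * (w (t + \<rho> + \<beta>) - w (t - \<rho>)))
     \<le> curv_const * sqrt lam * ((\<beta> / \<rho>) * sqrt (char_exp k (b /\<^sub>R \<rho>)))"
proof -
  let ?n = "DIM('a)" and ?V = "measure lborel (ball (0::'a) 1)"
  define P where "P = char_exp k (b /\<^sub>R \<rho>)"
  have P0: "0 \<le> P" unfolding P_def by (rule char_exp_nonneg)
  have w0: "0 \<le> w x" for x using mono[of "min x 0" x] neg[of "min x 0"] by simp
  have c0: "0 < cosvol b" by (rule cosvol_pos[OF b1])
  \<comment> \<open>As \<open>\<beta> \<le> \<rho>\<close>, the increment is covered by three steps
    of length \<open>\<rho>\<close>.\<close>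
  have "w (2 * \<rho> + \<beta>) \<le> w (\<rho> + (\<rho> + \<rho>))" using rho by (intro mono) auto
  also have "\<dots> \<le> w \<rho> + w (\<rho> + \<rho>)" using rho by (intro sub) auto
  also have "\<dots> \<le> w \<rho> + (w \<rho> + w \<rho>)" using rho by (intro add_left_mono sub) auto
  finally have w3: "w (2 * \<rho> + \<beta>) \<le> 3 * w \<rho>" by simp
  have dw: "w (t + \<rho> + \<beta>) - w (t - \<rho>) \<le> 3 * w \<rho>"
  proof (cases "\<rho> \<le> t")
    case True
    have "(t - \<rho>) + (2 * \<rho> + \<beta>) = t + \<rho> + \<beta>" by simp
    then have "w (t + \<rho> + \<beta>) \<le> w (t - \<rho>) + w (2 * \<rho> + \<beta>)" using sub[of "t - \<rho>" "2 * \<rho> + \<beta>"] True rho by (simp add: add_ac)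
    then show ?thesis using w3 by linarith
  next
    case False
    then have "w (t + \<rho> + \<beta>) \<le> w (2 * \<rho> + \<beta>)" by (intro mono) auto
    then show ?thesis using w3 w0[of "t - \<rho>"] by linarith
  qed
  have "k (\<rho> / 2) * ((\<rho> / 2) ^ ?n * cosvol b) \<le> char_exp k (b /\<^sub>R (\<rho> / 2))"
    using rho by (intro char_exp_lower) auto
  also have "b /\<^sub>R (\<rho> / 2) = 2 *\<^sub>R (b /\<^sub>R \<rho>)"
  proof -
    have "inverse (\<rho> / 2) = 2 * inverse \<rho>" using rho by (simp add: field_simps)
    then show ?thesis by (simp only: scaleR_scaleR)
  qed
  also have "char_exp k (2 *\<^sub>R (b /\<^sub>R \<rho>)) \<le> 4 * P" unfolding P_def by (rule char_exp_double)
  finally have "k (\<rho> / 2) * \<rho> ^ ?n * cosvol b \<le> 2 ^ ?n * (4 * P)"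
    by (simp add: power_divide field_simps)
  then have kr: "k (\<rho> / 2) * \<rho> ^ ?n \<le> 2 ^ ?n * 4 / cosvol b * P"
    using c0 by (simp add: field_simps)
  have "w \<rho> * sqrt P \<le> sqrt (80 * lam)"
  proof (rule real_le_rsqrt)
    have "(w \<rho> * sqrt P)\<^sup>2 = (w \<rho>)\<^sup>2 * P" using P0 by (simp add: power_mult_distrib)
    also have "\<dots> \<le> (w \<rho>)\<^sup>2 * (lam + P)" using lam by (intro mult_left_mono) auto
    also have "\<dots> \<le> 80 * lam" unfolding P_def by (rule bound[OF rho(1)])
    finally show "(w \<rho> * sqrt P)\<^sup>2 \<le> 80 * lam" .
  qed
  then have "w \<rho> * sqrt P * sqrt P \<le> sqrt (80 * lam) * sqrt P" by (intro mult_right_mono) (use P0 in auto)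
  moreover have "w \<rho> * sqrt P * sqrt P = P * w \<rho>" using P0 by (simp add: mult.assoc)
  ultimately have wP: "P * w \<rho> \<le> sqrt 80 * sqrt lam * sqrt P" by (simp add: real_sqrt_mult)
  have "(measure lborel (ball (0::'a) (\<rho> + \<beta>)) - measure lborel (ball (0::'a) \<rho>)) * (w (t + \<rho> + \<beta>) - w (t - \<rho>))
     \<le> (?V * (\<rho> ^ ?n * (2 ^ ?n * (\<beta> / \<rho>)))) * (3 * w \<rho>)"
  proof (rule mult_mono)
    show "0 \<le> w (t + \<rho> + \<beta>) - w (t - \<rho>)" using mono[of "t - \<rho>" "t + \<rho> + \<beta>"] rho by simp
  qed (use content_ball_annulus_le[OF rho] dw rho in auto)
  then have "k (\<rho> / 2) * ((measure lborel (ball (0::'a) (\<rho> + \<beta>)) - measure lborel (ball (0::'a) \<rho>)) * (w (t + \<rho> + \<beta>) - w (t - \<rho>)))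
     \<le> k (\<rho> / 2) * ((?V * (\<rho> ^ ?n * (2 ^ ?n * (\<beta> / \<rho>)))) * (3 * w \<rho>))"
    using k0 by (intro mult_left_mono)
  also have "\<dots> = (?V * 2 ^ ?n * (\<beta> / \<rho>) * 3 * w \<rho>) * (k (\<rho> / 2) * \<rho> ^ ?n)" by simp
  also have "\<dots> \<le> (?V * 2 ^ ?n * (\<beta> / \<rho>) * 3 * w \<rho>) * (2 ^ ?n * 4 / cosvol b * P)"
    using kr rho w0 by (intro mult_left_mono) auto
  also have "\<dots> = (?V * 2 ^ ?n * (\<beta> / \<rho>) * 3 * (2 ^ ?n * 4 / cosvol b)) * (P * w \<rho>)" by simp
  also have "\<dots> \<le> (?V * 2 ^ ?n * (\<beta> / \<rho>) * 3 * (2 ^ ?n * 4 / cosvol b)) * (sqrt 80 * sqrt lam * sqrt P)"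
    using wP rho c0 by (intro mult_left_mono) auto
  also have "\<dots> = curv_const * sqrt lam * ((\<beta> / \<rho>) * sqrt P)"
    by (simp only: curv_const_def mult_ac)
  finally show ?thesis by (simp only: P_def)
qed

text \<open>The ball is peeled dyadically. On the shell at radius \<open>\<rho> j\<close> the
  quadratic shift is at most \<open>\<beta> = (\<rho> j)\<^sup>2 / r0\<close>, so
  \<open>\<beta> / \<rho> j\<close> is of order 2^(-j) and \<open>shell_estimate\<close> gives one
  term of the sum bounded by \<open>Sg\<close>.\<close>

lemma curvature_error:
  fixes e :: 'a
  assumes wm [measurable]: "w \<in> borel_measurable borel" and neg: "\<And>x. x \<le> 0 \<Longrightarrow> w x = 0"
    and mono: "\<And>x y. x \<le> y \<Longrightarrow> w x \<le> w y" and le1: "\<And>x. w x \<le> 1"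
    and sub: "\<And>x y. 0 \<le> x \<Longrightarrow> 0 \<le> y \<Longrightarrow> w (x + y) \<le> w x + w y"
    and bound: "\<And>t. 0 < t \<Longrightarrow> (w t)\<^sup>2 * (lam + char_exp k (b /\<^sub>R t)) \<le> 80 * lam" and lam: "0 < lam"
    and e: "norm e = 1" and r0: "0 < r0" "r0 \<le> 1" and t: "0 \<le> t"
    and Sig: "\<And>N. (\<Sum>j<N. (1/2)^j * sqrt (char_exp k (b /\<^sub>R (r0 / 2 * (1/2)^j)))) \<le> Sg"
  shows "(\<integral>y. indicator (ball 0 (r0/2)) y * (w (t + y \<bullet> e + (norm y)\<^sup>2 / r0) - w (t + y \<bullet> e)) * k (norm y) \<partial>lborel)
    \<le> curv_const * sqrt lam * Sg + 1"
proof -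
  have w0: "0 \<le> w x" for x using mono[of "min x 0" x] neg[of "min x 0"] by simp
  have wb: "\<bar>w x\<bar> \<le> 1" for x using w0 le1 by simp
  define \<rho> where "\<rho> j = r0 / 2 * (1/2)^j" for j :: nat
  have rho: "0 < \<rho> j" "\<rho> j \<le> r0 / 2" "\<rho> (Suc j) = \<rho> j / 2" for j
    using r0 by (auto simp: \<rho>_def power_le_one mult_left_le)
  define g where "g y = w (t + y \<bullet> e + (norm y)\<^sup>2 / r0) - w (t + y \<bullet> e)" for y :: 'a
  have gm [measurable]: "g \<in> borel_measurable borel" unfolding g_def by measurable
  have g0: "0 \<le> g y" for y using mono[of "t + y \<bullet> e" "t + y \<bullet> e + (norm y)\<^sup>2 / r0"] r0 by (simp add: g_def)
  have g1: "g y \<le> 1" for y using le1[of "t + y \<bullet> e + (norm y)\<^sup>2 / r0"] w0[of "t + y \<bullet> e"] by (simp add: g_def)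
  have gi: "integrable lborel (\<lambda>y. indicator (ball 0 r) y * g y * k (norm y))" for r
    by (rule kint_bdd[where B=1]) (use g0 g1 in \<open>auto split: split_indicator\<close>)
  define I where "I j = (\<integral>y. indicator (ball 0 (\<rho> j)) y * g y * k (norm y) \<partial>lborel)" for j
  define c where "c j = curv_const * sqrt lam * ((1/2)^j * sqrt (char_exp k (b /\<^sub>R \<rho> j)))" for j
  have step: "I j \<le> c j + I (Suc j)" for j
  proof -
    define \<beta> where "\<beta> = (\<rho> j)\<^sup>2 / r0"
    have be: "\<beta> / \<rho> j = (1/2)^j / 2" using r0 by (simp add: \<beta>_def \<rho>_def power2_eq_square field_simps)
    have "(1/2::real)^j \<le> 1" by (simp add: power_le_one)
    then have "\<beta> / \<rho> j \<le> 1" unfolding be by linarith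
    then have b3: "0 \<le> \<beta>" "\<beta> \<le> \<rho> j" using rho[of j] r0 by (auto simp: \<beta>_def field_simps)
    have di: "integrable lborel (\<lambda>y. indicator (ball 0 (\<rho> j)) y * (w (t + y \<bullet> e + \<beta>) - w (t + y \<bullet> e)))"
    proof (rule integrable_bounded_mult[OF integrable_indicator_ball, where B=2])
      show "\<bar>w (t + y \<bullet> e + \<beta>) - w (t + y \<bullet> e)\<bar> \<le> 2" for y
        using wb[of "t + y \<bullet> e + \<beta>"] wb[of "t + y \<bullet> e"] by linarith
    qed measurable
    have "I j \<le> (\<integral>y. k (\<rho> j / 2) * (indicator (ball 0 (\<rho> j)) y * (w (t + y \<bullet> e + \<beta>) - w (t + y \<bullet> e)))
        + indicator (ball 0 (\<rho> (Suc j))) y * g y * k (norm y) \<partial>lborel)"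
      unfolding I_def
    proof (rule integral_mono)
      fix y :: 'a
      \<comment> \<open>Nonnegativity allows the shell to be enlarged to the whole ball, where
        \<open>ball_increment_le\<close> applies.\<close>
      have d0: "0 \<le> w (t + y \<bullet> e + \<beta>) - w (t + y \<bullet> e)" using mono[of "t + y \<bullet> e" "t + y \<bullet> e + \<beta>"] b3 by simp
      consider "norm y < \<rho> (Suc j)" | "\<rho> (Suc j) \<le> norm y" "norm y < \<rho> j" | "\<rho> j \<le> norm y" by linarith
      then show "indicator (ball 0 (\<rho> j)) y * g y * k (norm y) \<le>
          k (\<rho> j / 2) * (indicator (ball 0 (\<rho> j)) y * (w (t + y \<bullet> e + \<beta>) - w (t + y \<bullet> e)))
        + indicator (ball 0 (\<rho> (Suc j))) y * g y * k (norm y)"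
      proof cases
        case 1
        then have "norm y < \<rho> j" using rho[of j] by simp
        with 1 show ?thesis using k0 d0 by simp
      next
        case 2
        have "(norm y)\<^sup>2 \<le> (\<rho> j)\<^sup>2" using 2 by (intro power_mono) auto
        then have "g y \<le> w (t + y \<bullet> e + \<beta>) - w (t + y \<bullet> e)"
          unfolding g_def \<beta>_def using r0 by (intro diff_right_mono mono add_left_mono divide_right_mono) auto
        moreover have "k (norm y) \<le> k (\<rho> j / 2)" using 2 rho by (intro kmono) auto
        ultimately have "g y * k (norm y) \<le> (w (t + y \<bullet> e + \<beta>) - w (t + y \<bullet> e)) * k (\<rho> j / 2)"
          using k0 d0 by (intro mult_mono) auto
        then show ?thesis using 2 by (simp add: mult.commute)
      next
        case 3
        then have "\<rho> (Suc j) \<le> norm y" using rho[of j] by simp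
        with 3 show ?thesis by simp
      qed
    qed (use gi di in auto)
    also have "\<dots> = k (\<rho> j / 2) * (\<integral>y. indicator (ball 0 (\<rho> j)) y * (w (t + y \<bullet> e + \<beta>) - w (t + y \<bullet> e)) \<partial>lborel) + I (Suc j)"
      using gi di by (simp add: I_def)
    also have "\<dots> \<le> k (\<rho> j / 2) * ((measure lborel (ball (0::'a) (\<rho> j + \<beta>)) - measure lborel (ball (0::'a) (\<rho> j))) * (w (t + \<rho> j + \<beta>) - w (t - \<rho> j))) + I (Suc j)"
      by (intro add_right_mono mult_left_mono ball_increment_le[OF wm mono wb e rho(1) b3(1)] k0)
    also have "\<dots> \<le> curv_const * sqrt lam * ((\<beta> / \<rho> j) * sqrt (char_exp k (b /\<^sub>R \<rho> j))) + I (Suc j)"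
      by (intro add_right_mono shell_estimate[OF neg mono sub bound lam rho(1) b3 t])
    also have "\<dots> \<le> c j + I (Suc j)"
      unfolding c_def be using curv_const_nonneg lam char_exp_nonneg
      by (intro add_right_mono mult_left_mono mult_right_mono) auto
    finally show ?thesis .
  qed
  have I0: "I 0 \<le> (\<Sum>j<N. c j) + I N" for N
  proof (induction N)
    case (Suc N)
    then show ?case using step[of N] by simp
  qed simp
  have cs: "(\<Sum>j<N. c j) \<le> curv_const * sqrt lam * Sg" for N
    unfolding c_def sum_distrib_left[symmetric] using Sig[of N] curv_const_nonneg lam
    by (intro mult_left_mono) (auto simp: \<rho>_def)
  \<comment> \<open>\<open>k 0\<close> depends on the truncation, but \<open>N\<close> is chosen
    after it, so the remainder is at most 1 whatever \<open>k 0\<close> is. This is the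
    \<open>+ 1\<close> in the conclusion.\<close>
  define V where "V = k 0 * measure lborel (ball (0::'a) 1)"
  have V0: "0 \<le> V" unfolding V_def using k0 by simp
  have IN: "I N \<le> V * (1/2)^N" for N
  proof -
    have "I N \<le> (\<integral>y. k 0 * indicator (ball (0::'a) (\<rho> N)) y \<partial>lborel)"
      unfolding I_def
    proof (rule integral_mono)
      fix y :: 'a
      have "g y * k (norm y) \<le> 1 * k 0" using g0 g1 k0 kmono[of 0 "norm y"] by (intro mult_mono) auto
      then show "indicator (ball 0 (\<rho> N)) y * g y * k (norm y) \<le> k 0 * indicator (ball 0 (\<rho> N)) y"
        by (auto split: split_indicator)
    qed (use gi integrable_indicator_ball[of "0::'a"] in auto)
    also have "\<dots> = k 0 * ((\<rho> N) ^ DIM('a) * measure lborel (ball (0::'a) 1))"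
      using content_ball_conv_unit_ball[of "\<rho> N" "0::'a"] rho(1)[of N] by simp
    also have "\<dots> = V * (\<rho> N) ^ DIM('a)" by (simp add: V_def)
    also have "\<dots> \<le> V * (\<rho> N) ^ 1"
      using V0 rho[of N] r0 by (intro mult_left_mono power_decreasing) (auto simp: Suc_le_eq)
    also have "\<dots> \<le> V * (1/2)^N"
      using V0 r0 unfolding \<rho>_def power_one_right by (intro mult_left_mono mult_left_le_one_le) auto
    finally show ?thesis .
  qed
  obtain N where "(1/2::real)^N < 1 / (V + 1)"
    using real_arch_pow_inv[of "1 / (V + 1)" "1/2"] V0 by auto
  then have "V * (1/2)^N \<le> 1" using V0 by (simp add: field_simps)
  then have "I 0 \<le> curv_const * sqrt lam * Sg + 1" using I0[of N] cs[of N] IN[of N] by linarith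
  then show ?thesis by (simp add: I_def g_def \<rho>_def)
qed

end

section \<open>The barrier outside a ball and in a half-space\<close>

lemma parallelogram_norm:
  fixes a y :: "'a::real_inner"
  shows "(norm (a + y))\<^sup>2 + (norm (a - y))\<^sup>2 = 2 * (norm a)\<^sup>2 + 2 * (norm y)\<^sup>2"
  unfolding power2_norm_eq_inner
  by (simp add: inner_add_left inner_add_right inner_diff_left inner_diff_right inner_commute)

context radial_kernel
begin

text \<open>After squaring, with \<open>q = (norm y)\<^sup>2 / r0\<close>, the cross term
  \<open>q * (2 * (l + s))\<close> of the right side covers
  \<open>(norm y)\<^sup>2 = q * r0\<close>, because \<open>l + s \<ge> r0 / 2\<close> when
  \<open>norm y < r0 / 2\<close>.\<close>

lemma curved_distance:
  fixes x c y :: 'a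
  assumes x: "r0 < norm (x - c)" and r0: "0 < r0" and y: "norm y < r0 / 2"
  shows "norm (x + y - c) - norm (x - c) \<le> y \<bullet> ((x - c) /\<^sub>R norm (x - c)) + (norm y)\<^sup>2 / r0"
proof -
  define l where "l = norm (x - c)"
  define e where "e = (x - c) /\<^sub>R l"
  have l: "r0 < l" "0 < l" using x r0 by (auto simp: l_def)
  have e: "norm e = 1" "x - c = l *\<^sub>R e" using l by (auto simp: e_def l_def)
  have ee: "e \<bullet> e = 1" using e by (simp add: dot_square_norm)
  define s where "s = y \<bullet> e"
  have s: "\<bar>s\<bar> \<le> norm y" using Cauchy_Schwarz_ineq2[of y e] e by (simp add: s_def)
  have pos: "0 \<le> l + s + (norm y)\<^sup>2 / r0"
  proof -
    have "0 \<le> (norm y)\<^sup>2 / r0" using r0 by simp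
    then show ?thesis using s y l r0 by linarith
  qed
  have "(norm (x + y - c))\<^sup>2 = (l *\<^sub>R e + y) \<bullet> (l *\<^sub>R e + y)"
    unfolding power2_norm_eq_inner e(2)[symmetric] by (simp add: algebra_simps)
  also have "\<dots> = l\<^sup>2 + 2 * l * s + (norm y)\<^sup>2"
    by (simp add: inner_add_left inner_add_right ee s_def inner_commute power2_eq_square norm_eq_sqrt_inner algebra_simps)
  also have "\<dots> \<le> (l + s + (norm y)\<^sup>2 / r0)\<^sup>2"
  proof -
    define q where "q = (norm y)\<^sup>2 / r0"
    have q0: "0 \<le> q" using r0 by (simp add: q_def)
    have qy: "(norm y)\<^sup>2 = q * r0" using r0 by (simp add: q_def)
    have "q * r0 \<le> q * (2 * (l + s))" using q0 s y l by (intro mult_left_mono) auto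
    moreover have "0 \<le> s\<^sup>2" "0 \<le> q\<^sup>2" by auto
    moreover have "(l + s + q)\<^sup>2 = l\<^sup>2 + 2 * l * s + s\<^sup>2 + q * (2 * (l + s)) + q\<^sup>2"
      by (simp add: power2_eq_square algebra_simps)
    ultimately have "l\<^sup>2 + 2 * l * s + q * r0 \<le> (l + s + q)\<^sup>2" by linarith
    then show ?thesis unfolding qy[symmetric] by (simp only: q_def)
  qed
  finally have "norm (x + y - c) \<le> l + s + (norm y)\<^sup>2 / r0"
    using pos by (rule power2_le_imp_le)
  then show ?thesis by (simp add: l_def[symmetric] e_def[symmetric] s_def)
qed

text \<open>Three contributions: the half-space equation in the direction of \<open>x - c\<close>,
  the curvature shift for jumps shorter than \<open>r0 / 2\<close>, and for longer jumps the trivial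
  increment 1, which costs the tail \<open>T\<close>.\<close>

lemma Lk_ball_le:
  fixes c x :: 'a
  assumes wm [measurable]: "w \<in> borel_measurable borel" and neg: "\<And>x. x \<le> 0 \<Longrightarrow> w x = 0"
    and mono: "\<And>x y. x \<le> y \<Longrightarrow> w x \<le> w y" and le1: "\<And>x. w x \<le> 1"
    and sub: "\<And>x y. 0 \<le> x \<Longrightarrow> 0 \<le> y \<Longrightarrow> w (x + y) \<le> w x + w y"
    and Lw: "\<And>t (e::'a). 0 < t \<Longrightarrow> norm e = 1 \<Longrightarrow> (\<integral>y. (w (t + y \<bullet> e) - w t) * k (norm y) \<partial>lborel) = - lam * (1 - w t)"
    and bound: "\<And>t. 0 < t \<Longrightarrow> (w t)\<^sup>2 * (lam + char_exp k (b /\<^sub>R t)) \<le> 80 * lam" and lam: "0 < lam"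
    and r0: "0 < r0" "r0 \<le> 1" and x: "r0 < norm (x - c)"
    and Sig: "\<And>N. (\<Sum>j<N. (1/2)^j * sqrt (char_exp k (b /\<^sub>R (r0 / 2 * (1/2)^j)))) \<le> Sg"
    and T: "(\<integral>y. indicator {y. r0 / 2 \<le> norm y} y * k (norm (y::'a)) \<partial>lborel) \<le> T"
  shows "Lk (\<lambda>x. w (norm (x - c) - r0)) x \<le> - lam * (1 - w (norm (x - c) - r0)) + (curv_const * sqrt lam * Sg + 1) + T"
proof -
  have w0: "0 \<le> w x" for x using mono[of "min x 0" x] neg[of "min x 0"] by simp
  have wb: "\<bar>w x\<bar> \<le> 1" for x using w0 le1 by simp
  have wd: "\<bar>w x - w y\<bar> \<le> 2" for x y using wb[of x] wb[of y] by linarith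
  define t where "t = norm (x - c) - r0"
  define e where "e = (x - c) /\<^sub>R norm (x - c)"
  have t: "0 < t" using x by (simp add: t_def)
  have "norm (x - c) \<noteq> 0" using x r0 by linarith
  then have e: "norm e = 1" by (simp add: e_def)
  have Tm [measurable]: "{y::'a. r0 / 2 \<le> norm y} \<in> sets borel" by measurable
  have i1: "integrable lborel (\<lambda>y. (w (t + y \<bullet> e) - w t) * k (norm y))"
    by (rule kint_bdd[where B=2]) (use wd in auto)
  have i2: "integrable lborel (\<lambda>y. indicator (ball 0 (r0/2)) y * (w (t + y \<bullet> e + (norm y)\<^sup>2 / r0) - w (t + y \<bullet> e)) * k (norm y))"
    by (rule kint_bdd[where B=2]) (use wd in \<open>auto simp: abs_mult split: split_indicator\<close>)
  have i3: "integrable lborel (\<lambda>y. indicator {y. r0 / 2 \<le> norm y} y * k (norm (y::'a)))"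
    by (rule kint_bdd[where B=1]) (auto split: split_indicator)
  have "Lk (\<lambda>x. w (norm (x - c) - r0)) x \<le> (\<integral>y. ((w (t + y \<bullet> e) - w t) * k (norm y)
      + indicator (ball 0 (r0/2)) y * (w (t + y \<bullet> e + (norm y)\<^sup>2 / r0) - w (t + y \<bullet> e)) * k (norm y))
      + indicator {y. r0 / 2 \<le> norm y} y * k (norm (y::'a)) \<partial>lborel)"
    unfolding Lk_def
  proof (rule integral_mono)
    show "integrable lborel (\<lambda>y. (w (norm (x + y - c) - r0) - w (norm (x - c) - r0)) * k (norm y))"
      by (rule kint_bdd[where B=2]) (use wd in auto)
    fix y :: 'a
    have "w (norm (x + y - c) - r0) - w t \<le> (w (t + y \<bullet> e) - w t)
      + indicator (ball 0 (r0/2)) y * (w (t + y \<bullet> e + (norm y)\<^sup>2 / r0) - w (t + y \<bullet> e))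
      + indicator {y. r0 / 2 \<le> norm y} y"
    proof (cases "norm y < r0 / 2")
      case True
      have "w (norm (x + y - c) - r0) \<le> w (t + y \<bullet> e + (norm y)\<^sup>2 / r0)"
        using curved_distance[OF x r0(1) True] by (intro mono) (simp add: t_def e_def)
      then show ?thesis using True by simp
    next
      case False
      then show ?thesis using le1[of "norm (x + y - c) - r0"] w0[of "t + y \<bullet> e"] by simp
    qed
    then have "(w (norm (x + y - c) - r0) - w t) * k (norm y) \<le> ((w (t + y \<bullet> e) - w t)
      + indicator (ball 0 (r0/2)) y * (w (t + y \<bullet> e + (norm y)\<^sup>2 / r0) - w (t + y \<bullet> e))
      + indicator {y. r0 / 2 \<le> norm y} y) * k (norm y)"
      using k0 by (intro mult_right_mono)
    then show "(w (norm (x + y - c) - r0) - w (norm (x - c) - r0)) * k (norm y) \<le> ((w (t + y \<bullet> e) - w t) * k (norm y)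
      + indicator (ball 0 (r0/2)) y * (w (t + y \<bullet> e + (norm y)\<^sup>2 / r0) - w (t + y \<bullet> e)) * k (norm y))
      + indicator {y. r0 / 2 \<le> norm y} y * k (norm y)"
      by (simp only: t_def distrib_right)
  qed (use i1 i2 i3 in simp)
  also have "\<dots> = - lam * (1 - w t) + (\<integral>y. indicator (ball 0 (r0/2)) y * (w (t + y \<bullet> e + (norm y)\<^sup>2 / r0) - w (t + y \<bullet> e)) * k (norm y) \<partial>lborel)
      + (\<integral>y. indicator {y. r0 / 2 \<le> norm y} y * k (norm (y::'a)) \<partial>lborel)"
    using i1 i2 i3 Lw[OF t e] by simp
  also have "\<dots> \<le> - lam * (1 - w t) + (curv_const * sqrt lam * Sg + 1) + T"
    using curvature_error[OF wm neg mono le1 sub bound lam e r0 less_imp_le[OF t] Sig] T by (intro add_mono) auto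
  finally show ?thesis by (simp add: t_def)
qed

text \<open>\<open>small\<close> keeps \<open>w \<le> 1/2\<close> up to \<open>t0\<close> (320 is 4
  * 80), so the main term is at most \<open>- lam / 2\<close> there. \<open>big\<close> lets it
  absorb the curvature error, the tail and the contribution \<open>K2\<close> of \<open>eta\<close>,
  with 1 to spare. One function serves all exterior balls of radius \<open>r0\<close> and all
  half-spaces.\<close>

lemma barrier_exists:
  assumes lam: "0 < lam" and r0: "0 < r0" "r0 \<le> 1"
    and Sig: "\<And>N. (\<Sum>j<N. (1/2)^j * sqrt (char_exp k (b /\<^sub>R (r0 / 2 * (1/2)^j)))) \<le> Sg"
    and T: "(\<integral>y. indicator {y. r0 / 2 \<le> norm y} y * k (norm (y::'a)) \<partial>lborel) \<le> T" and T0: "0 \<le> T"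
    and K2: "(\<integral>y. min 1 ((norm y)\<^sup>2) * k (norm (y::'a)) \<partial>lborel) \<le> K2"
    and big: "(curv_const * sqrt lam * Sg + 1) + T + K2 + 1 \<le> lam / 2"
    and t0: "0 < t0" "t0 \<le> 1" and small: "320 * lam \<le> lam + char_exp k (b /\<^sub>R t0)"
  obtains v where "v \<in> borel_measurable borel" "\<And>x. x \<le> 0 \<Longrightarrow> v x = 0" "\<And>x y. x \<le> y \<Longrightarrow> v x \<le> v y"
    "\<And>x. v x \<le> 2" "\<And>x. v (2 * x) \<le> 4 * v x" "\<And>x. t0 \<le> x \<Longrightarrow> t0\<^sup>2 \<le> v x"
    "\<And>c x. r0 < norm (x - c) \<Longrightarrow> norm (x - c) < r0 + t0 \<Longrightarrow> Lk (\<lambda>x. v (norm (x - c) - r0)) x \<le> - 1"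
    "\<And>e x. norm e = 1 \<Longrightarrow> 0 < x \<bullet> e \<Longrightarrow> x \<bullet> e < t0 \<Longrightarrow> Lk (\<lambda>x. v (x \<bullet> e)) x \<le> - 1"
    "\<And>t. 0 < t \<Longrightarrow> v t \<le> sqrt (80 * lam / (lam + char_exp k (b /\<^sub>R t))) + t\<^sup>2"
proof -
  obtain w :: "real \<Rightarrow> real" where wm: "w \<in> borel_measurable borel" and neg: "\<And>x. x \<le> 0 \<Longrightarrow> w x = 0"
    and mono: "\<And>x y. x \<le> y \<Longrightarrow> w x \<le> w y" and le1: "\<And>x. w x \<le> 1"
    and sub: "\<And>x y. 0 \<le> x \<Longrightarrow> 0 \<le> y \<Longrightarrow> w (x + y) \<le> w x + w y"
    and Lw: "\<And>t (e::'a). 0 < t \<Longrightarrow> norm e = 1 \<Longrightarrow> (\<integral>y. (w (t + y \<bullet> e) - w t) * k (norm y) \<partial>lborel) = - lam * (1 - w t)"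
    and bound: "\<And>t. 0 < t \<Longrightarrow> (w t)\<^sup>2 * (lam + char_exp k (b /\<^sub>R t)) \<le> 80 * lam"
    by (rule half_line_function[OF lam]) (rule that)
  note wm [measurable]
  have w0: "0 \<le> w x" for x using mono[of "min x 0" x] neg[of "min x 0"] by simp
  have wb: "\<bar>w x\<bar> \<le> 1" for x using w0 le1 by simp
  have eb: "\<bar>eta x\<bar> \<le> 1" for x using eta_basic(1,2)[of x] by simp
  have wt0: "w t0 \<le> 1/2"
  proof -
    have "(w t0)\<^sup>2 * (320 * lam) \<le> (w t0)\<^sup>2 * (lam + char_exp k (b /\<^sub>R t0))"
      using small by (intro mult_left_mono) auto
    also have "\<dots> \<le> 80 * lam" by (rule bound[OF t0(1)])
    finally have "(w t0)\<^sup>2 \<le> (1/2)\<^sup>2" using lam by (simp add: power2_eq_square)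
    then show ?thesis by (rule power2_le_imp_le) simp
  qed
  have C0: "0 \<le> curv_const * sqrt lam * Sg + 1"
    using Sig[of 0] curv_const_nonneg lam by simp
  \<comment> \<open>in the shape of \<open>Lk_diff_scale\<close>\<close>
  define v where "v t = w t - (- 1) * eta t" for t
  show thesis
  proof (rule that[of v])
    show "v \<in> borel_measurable borel" unfolding v_def by measurable
    show "v x = 0" if "x \<le> 0" for x using neg that eta_basic(4) by (simp add: v_def)
    show "v x \<le> v y" if "x \<le> y" for x y using mono[OF that] eta_mono[OF that] by (simp add: v_def)
    show "v x \<le> 2" for x using le1[of x] eta_basic(2)[of x] by (simp add: v_def)
    show "v (2 * x) \<le> 4 * v x" for x
    proof (cases "0 \<le> x")
      case True
      then have "w (2 * x) \<le> 2 * w x" using sub[of x x] by simp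
      then show ?thesis using eta_double[of x] w0[of x] by (simp add: v_def)
    next
      case False
      then show ?thesis using neg[of x] neg[of "2 * x"] eta_basic(4)[of x] eta_basic(4)[of "2 * x"] by (simp add: v_def)
    qed
    show "t0\<^sup>2 \<le> v x" if "t0 \<le> x" for x
      using eta_mono[OF that] eta_basic(5)[of t0] t0 w0[of x] by (simp add: v_def)
    show "v t \<le> sqrt (80 * lam / (lam + char_exp k (b /\<^sub>R t))) + t\<^sup>2" if t: "0 < t" for t
    proof -
      have p: "0 < lam + char_exp k (b /\<^sub>R t)" using lam char_exp_nonneg[of "b /\<^sub>R t"] by linarith
      have "w t \<le> sqrt (80 * lam / (lam + char_exp k (b /\<^sub>R t)))"
        using bound[OF t] p by (intro real_le_rsqrt) (simp add: field_simps)
      then show ?thesis using eta_basic(3)[of t] by (simp add: v_def)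
    qed
    show "Lk (\<lambda>x. v (norm (x - c) - r0)) x \<le> - 1" if x: "r0 < norm (x - c)" "norm (x - c) < r0 + t0" for c x :: 'a
    proof -
      have "w (norm (x - c) - r0) \<le> w t0" using x by (intro mono) auto
      then have wh: "lam * (1/2) \<le> lam * (1 - w (norm (x - c) - r0))" using wt0 lam by (intro mult_left_mono) auto
      have "Lk (\<lambda>x. eta (norm (x - c) - r0)) x \<le> (\<integral>y. min 1 ((norm y)\<^sup>2) * k (norm (y::'a)) \<partial>lborel)"
      proof (rule Lk_eta_le)
        fix y :: 'a
        have "(norm (x + y - c))\<^sup>2 + (norm (x - y - c))\<^sup>2 = 2 * (norm (x - c))\<^sup>2 + 2 * (norm y)\<^sup>2"
        proof -
          have "x + y - c = (x - c) + y" "x - y - c = (x - c) - y" by simp_all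
          then show ?thesis using parallelogram_norm[of "x - c" y] by (simp only:)
        qed
        \<comment> \<open>In the expanded squares the terms linear in the norms carry
          \<open>- 2 * r0\<close>; convexity of the norm gives them the favourable sign.\<close>
        moreover have "2 * norm (x - c) \<le> norm (x + y - c) + norm (x - y - c)"
        proof -
          have "norm (2 *\<^sub>R (x - c)) = norm ((x + y - c) + (x - y - c))" by (simp add: algebra_simps scaleR_2)
          also have "\<dots> \<le> norm (x + y - c) + norm (x - y - c)" by (rule norm_triangle_ineq)
          finally show ?thesis by simp
        qed
        then have "r0 * (2 * norm (x - c)) \<le> r0 * (norm (x + y - c) + norm (x - y - c))"
          using r0 by (intro mult_left_mono) auto
        ultimately show "(norm (x + y - c) - r0)\<^sup>2 + (norm (x - y - c) - r0)\<^sup>2 - 2 * (norm (x - c) - r0)\<^sup>2 \<le> 2 * (norm y)\<^sup>2"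
          by (simp add: power2_diff algebra_simps)
      qed (use x in auto)
      then have 1: "Lk (\<lambda>x. eta (norm (x - c) - r0)) x \<le> K2" using K2 by linarith
      have "Lk (\<lambda>x. v (norm (x - c) - r0)) x = Lk (\<lambda>x. w (norm (x - c) - r0)) x - (- 1) * Lk (\<lambda>x. eta (norm (x - c) - r0)) x"
        unfolding v_def by (rule Lk_diff_scale[where B=1 and C=1]) (use wb eb in auto)
      also have "\<dots> \<le> - lam * (1 - w (norm (x - c) - r0)) + (curv_const * sqrt lam * Sg + 1) + T + K2"
        using Lk_ball_le[OF wm neg mono le1 sub Lw bound lam r0 x(1) Sig T] 1 by linarith
      also have "\<dots> \<le> - 1" using wh big by linarith
      finally show ?thesis .
    qed
    show "Lk (\<lambda>x. v (x \<bullet> e)) x \<le> - 1" if e: "norm e = 1" and x: "0 < x \<bullet> e" "x \<bullet> e < t0" for e x :: 'a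
    proof -
      have "w (x \<bullet> e) \<le> w t0" using x by (intro mono) auto
      then have wh: "lam * (1/2) \<le> lam * (1 - w (x \<bullet> e))" using wt0 lam by (intro mult_left_mono) auto
      have "Lk (\<lambda>x. eta (x \<bullet> e)) x \<le> (\<integral>y. min 1 ((norm y)\<^sup>2) * k (norm (y::'a)) \<partial>lborel)"
      proof (rule Lk_eta_le)
        fix y :: 'a
        have "\<bar>y \<bullet> e\<bar> \<le> norm y" using Cauchy_Schwarz_ineq2[of y e] e by simp
        then have "(y \<bullet> e)\<^sup>2 \<le> (norm y)\<^sup>2" using power_mono[of "\<bar>y \<bullet> e\<bar>" "norm y" 2] by simp
        then show "((x + y) \<bullet> e)\<^sup>2 + ((x - y) \<bullet> e)\<^sup>2 - 2 * (x \<bullet> e)\<^sup>2 \<le> 2 * (norm y)\<^sup>2"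
          by (simp add: inner_add_left inner_diff_left power2_eq_square algebra_simps)
      qed (use x in auto)
      then have 1: "Lk (\<lambda>x. eta (x \<bullet> e)) x \<le> K2" using K2 by linarith
      have 2: "Lk (\<lambda>x. w (x \<bullet> e)) x = - lam * (1 - w (x \<bullet> e))"
        unfolding Lk_def using Lw[OF x(1) e] by (simp add: inner_add_left)
      have "Lk (\<lambda>x. v (x \<bullet> e)) x = Lk (\<lambda>x. w (x \<bullet> e)) x - (- 1) * Lk (\<lambda>x. eta (x \<bullet> e)) x"
        unfolding v_def by (rule Lk_diff_scale[where B=1 and C=1]) (use wb eb in auto)
      then show ?thesis using 1 2 wh big C0 T0 by linarith
    qed
  qed
qed

end

section \<open>Modulus of continuity for integrable kernels\<close>

text \<open>Collects what is used of the barrier, so that the modulus is derived without reference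
  to its construction from \<open>w\<close>.\<close>

locale barrier_dirichlet = radial_kernel k b for k and b :: "'a::euclidean_space" +
  fixes D :: "'a set" and R \<kappa> r0 t0 :: real and v :: "real \<Rightarrow> real"
  assumes D_open: "open D" and D_diam: "\<And>x y. x \<in> D \<Longrightarrow> y \<in> D \<Longrightarrow> dist x y < R"
    and kap: "0 < \<kappa>" "\<kappa> \<le> (\<integral>y. indicator {y. R \<le> norm y} y * k (norm (y::'a)) \<partial>lborel)"
    and r0: "0 < r0" and t0: "0 < t0"
    and ext_ball: "\<And>z. z \<in> frontier D \<Longrightarrow> \<exists>c. dist z c = r0 \<and> ball c r0 \<inter> D = {}"
    and vm [measurable]: "v \<in> borel_measurable borel" and vneg: "x \<le> 0 \<Longrightarrow> v x = 0"
    and vmono: "x \<le> y \<Longrightarrow> v x \<le> v y" and v2: "v x \<le> 2" and vdouble: "v (2 * x) \<le> 4 * v x"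
    and vt0: "t0 \<le> x \<Longrightarrow> t0\<^sup>2 \<le> v x"
    and v_ball: "r0 < norm (p - c) \<Longrightarrow> norm (p - c) < r0 + t0 \<Longrightarrow> Lk (\<lambda>x. v (norm (x - c) - r0)) p \<le> - 1"
    and v_half: "norm e = 1 \<Longrightarrow> 0 < p \<bullet> e \<Longrightarrow> p \<bullet> e < t0 \<Longrightarrow> Lk (\<lambda>x. v (x \<bullet> e)) p \<le> - 1"
begin

lemma v0: "0 \<le> v x"
  using vmono[of "min x 0" x] vneg[of "min x 0"] by simp

lemma v_abs: "\<bar>v x\<bar> \<le> 2"
  using v0 v2 by simp

text \<open>The summand 2 beats the right side and leaves the margin \<open>N\<close>; the second
  summand makes \<open>K1 * N * v\<close> at least the sup bound \<open>2 * N / \<kappa>\<close>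
  wherever \<open>v \<ge> t0\<^sup>2\<close>.\<close>

definition K1 :: real where "K1 = 2 + 2 / (\<kappa> * t0\<^sup>2)"
text \<open>The 4 is the loss in \<open>vdouble\<close>; the 3 covers two right sides of size
  \<open>N\<close> and the margin \<open>N\<close>.\<close>

definition K3 :: real where "K3 = 4 * K1 + 3"

lemma K1: "2 \<le> K1" "2 / \<kappa> \<le> K1 * t0\<^sup>2"
proof -
  show "2 \<le> K1" using kap t0 by (simp add: K1_def)
  have "K1 * t0\<^sup>2 = 2 * t0\<^sup>2 + 2 / \<kappa>" using kap t0 by (simp add: K1_def distrib_right)
  then show "2 / \<kappa> \<le> K1 * t0\<^sup>2" by simp
qed

lemma K3: "3 \<le> K3" "4 * K1 \<le> K3" "4 / \<kappa> \<le> K3 * t0\<^sup>2"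
proof -
  show "3 \<le> K3" "4 * K1 \<le> K3" using K1 by (auto simp: K3_def)
  have "2 / \<kappa> + 2 / \<kappa> \<le> K1 * t0\<^sup>2 + K1 * t0\<^sup>2" using K1(2) by linarith
  also have "\<dots> = (2 * K1) * t0\<^sup>2" by simp
  also have "\<dots> \<le> K3 * t0\<^sup>2" using K1 by (intro mult_right_mono) (auto simp: K3_def)
  finally show "4 / \<kappa> \<le> K3 * t0\<^sup>2" by simp
qed

text \<open>\<open>N\<close> is strictly positive since it serves as the margin
  \<open>\<theta>\<close> in the maximum principles.\<close>

definition dirichlet_sol :: "('a \<Rightarrow> real) \<Rightarrow> real \<Rightarrow> ('a \<Rightarrow> real) \<Rightarrow> bool" where
  "dirichlet_sol f N u \<longleftrightarrow> 0 < N \<and> (\<forall>x\<in>D. \<bar>f x\<bar> \<le> N) \<and> u \<in> borel_measurable borel \<and> (\<exists>B. \<forall>x. \<bar>u x\<bar> \<le> B)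
    \<and> (\<forall>x. x \<notin> D \<longrightarrow> u x = 0) \<and> (\<forall>x\<in>D. Lk u x = f x)"

lemma dirichlet_sol_minus: "dirichlet_sol f N u \<Longrightarrow> dirichlet_sol (\<lambda>x. - f x) N (\<lambda>x. - u x)"
  by (auto simp: dirichlet_sol_def Lk_minus)

text \<open>\<open>indicator D\<close> is a strict supersolution: from a point of \<open>D\<close>
  every jump of length at least \<open>R\<close> leads out, so \<open>Lk\<close> takes it to at most
  \<open>- \<kappa>\<close>. The multiple \<open>2 * N / \<kappa>\<close> beats \<open>f\<close> and
  leaves the margin \<open>N\<close>.\<close>

lemma sup_bound_upper:
  assumes "dirichlet_sol f N u" shows "u x \<le> 2 * N / \<kappa>"
proof -
  from assms obtain B where um: "u \<in> borel_measurable borel" and B: "\<And>x. \<bar>u x\<bar> \<le> B" and N: "0 < N" "\<And>x. x \<in> D \<Longrightarrow> \<bar>f x\<bar> \<le> N"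
    and off: "\<And>x. x \<notin> D \<Longrightarrow> u x = 0" and eq: "\<And>x. x \<in> D \<Longrightarrow> Lk u x = f x"
    unfolding dirichlet_sol_def by blast
  note um [measurable]
  have Dm [measurable]: "D \<in> sets borel" using D_open by simp
  let ?c = "2 * N / \<kappa>"
  have im: "indicator D \<in> borel_measurable (borel :: 'a measure)" by measurable
  have ib: "\<bar>indicator D x :: real\<bar> \<le> 1" for x :: 'a by (simp add: indicator_def)
  have LD: "Lk (indicator D) x \<le> - \<kappa>" if x: "x \<in> D" for x
  proof -
    have [measurable]: "{y::'a. R \<le> norm y} \<in> sets borel" by measurable
    have i: "integrable lborel (\<lambda>y. indicator {y. R \<le> norm y} y * k (norm (y::'a)))"
      by (rule kint_bdd[where B=1]) (auto split: split_indicator)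
    have "Lk (indicator D) x \<le> (\<integral>y. - (indicator {y. R \<le> norm y} y * k (norm (y::'a))) \<partial>lborel)"
      unfolding Lk_def
    proof (rule integral_mono)
      show "integrable lborel (\<lambda>y. (indicator D (x + y) - indicator D x) * k (norm y))"
        by (rule Lk_int[OF im ib])
      fix y :: 'a
      show "(indicator D (x + y) - indicator D x) * k (norm y) \<le> - (indicator {y. R \<le> norm y} y * k (norm y))"
      proof (cases "x + y \<in> D")
        case True
        then have "norm y < R" using D_diam[OF True x] by (simp add: dist_norm)
        then show ?thesis using True x by simp
      next
        case False
        then show ?thesis using x k0[of "norm y"] by (auto split: split_indicator)
      qed
    qed (use i in simp)
    then show ?thesis using kap by simp
  qed
  have "u x - ?c * indicator D x \<le> 0"
  proof (rule max_principle[where \<theta>=N and B="B + ?c"])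
    show "(\<lambda>x. u x - ?c * indicator D x) \<in> borel_measurable borel" by measurable
    show "\<bar>u x - ?c * indicator D x\<bar> \<le> B + ?c" for x
    proof -
      have "0 \<le> ?c" using N kap by simp
      then show ?thesis using B[of x] by (cases "x \<in> D") auto
    qed
    show "0 < N" by (rule N)
    fix x assume pos: "0 < u x - ?c * indicator D x"
    then have x: "x \<in> D" using off[of x] by (cases "x \<in> D") auto
    have "Lk (\<lambda>x. u x - ?c * indicator D x) x = f x - ?c * Lk (indicator D) x"
      by (simp only: Lk_diff_scale[OF um B im ib] eq[OF x])
    also have "\<dots> \<ge> - N + ?c * \<kappa>"
    proof -
      have "?c * Lk (indicator D) x \<le> ?c * (- \<kappa>)" using LD[OF x] N kap by (intro mult_left_mono) auto
      then show ?thesis using N(2)[OF x] by (simp add: abs_le_iff)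
    qed
    finally show "N \<le> Lk (\<lambda>x. u x - ?c * indicator D x) x" using kap by simp
  qed
  then show ?thesis using off[of x] N kap by (cases "x \<in> D") auto
qed

lemma sup_bound:
  assumes "dirichlet_sol f N u" shows "\<bar>u x\<bar> \<le> 2 * N / \<kappa>"
  using sup_bound_upper[OF assms, of x] sup_bound_upper[OF dirichlet_sol_minus[OF assms], of x] by simp

text \<open>Where \<open>u\<close> exceeds the multiple of the barrier, the point lies in the open
  set \<open>D\<close>, hence outside the closed ball, and within \<open>t0\<close> of it, since
  farther away the sup bound and \<open>vt0\<close> exclude an excess. There the barrier is a strict
  supersolution.\<close>

lemma ext_ball_bound:
  assumes sol: "dirichlet_sol f N u" and c: "ball c r0 \<inter> D = {}"
  shows "u x \<le> K1 * N * v (norm (x - c) - r0)"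
proof -
  from sol have um: "u \<in> borel_measurable borel" and N: "0 < N" "\<And>x. x \<in> D \<Longrightarrow> \<bar>f x\<bar> \<le> N"
    and off: "\<And>x. x \<notin> D \<Longrightarrow> u x = 0" and eq: "\<And>x. x \<in> D \<Longrightarrow> Lk u x = f x"
    unfolding dirichlet_sol_def by blast+
  note um [measurable]
  note B = sup_bound[OF sol]
  define W where "W x = v (norm (x - c) - r0)" for x
  have Wm [measurable]: "W \<in> borel_measurable borel" unfolding W_def by measurable
  have Wb: "\<bar>W x\<bar> \<le> 2" for x unfolding W_def by (rule v_abs)
  have KN: "0 \<le> K1 * N" using K1 N by simp
  have "u x - (K1 * N) * W x \<le> 0"
  proof (rule max_principle[where \<theta>=N and B="2 * N / \<kappa> + K1 * N * 2"])
    show "(\<lambda>x. u x - (K1 * N) * W x) \<in> borel_measurable borel" by measurable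
    show "\<bar>u x - (K1 * N) * W x\<bar> \<le> 2 * N / \<kappa> + K1 * N * 2" for x
    proof -
      have "\<bar>(K1 * N) * W x\<bar> \<le> K1 * N * 2" using mult_left_mono[OF Wb[of x] KN] KN by (simp only: abs_mult[of "K1 * N"] abs_of_nonneg)
      then show ?thesis using B[of x] by linarith
    qed
    show "0 < N" by (rule N)
    fix x assume pos: "0 < u x - (K1 * N) * W x"
    have KW: "0 \<le> (K1 * N) * W x" unfolding W_def by (intro mult_nonneg_nonneg KN v0)
    have x: "x \<in> D"
    proof (rule ccontr)
      assume "x \<notin> D"
      then show False using off[of x] pos KW by simp
    qed
    have xr: "r0 < norm (x - c)"
    proof (rule ccontr)
      assume "\<not> r0 < norm (x - c)"
      then have "x \<in> cball c r0" by (simp add: dist_norm norm_minus_commute)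
      then have "x \<in> closure (ball c r0)" using r0 by (simp add: closure_ball)
      then show False using c D_open x open_Int_closure_eq_empty[of D "ball c r0"] by blast
    qed
    have xt: "norm (x - c) < r0 + t0"
    proof (rule ccontr)
      assume "\<not> norm (x - c) < r0 + t0"
      then have "t0\<^sup>2 \<le> W x" unfolding W_def by (intro vt0) simp
      then have "(K1 * N) * t0\<^sup>2 \<le> (K1 * N) * W x" using KN by (intro mult_left_mono)
      moreover have "2 / \<kappa> * N \<le> K1 * t0\<^sup>2 * N" using K1 N by (intro mult_right_mono) auto
      ultimately show False using pos B[of x] by (simp add: mult_ac)
    qed
    have LW: "Lk W x \<le> - 1" using v_ball[OF xr xt] by (simp add: W_def[abs_def])
    have "Lk (\<lambda>x. u x - (K1 * N) * W x) x = f x - (K1 * N) * Lk W x"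
      using Lk_diff_scale[OF um B Wm Wb] eq[OF x] by simp
    moreover have "(K1 * N) * Lk W x \<le> (K1 * N) * (- 1)" using LW KN by (intro mult_left_mono)
    moreover have "2 * N \<le> K1 * N" using K1 N by simp
    ultimately show "N \<le> Lk (\<lambda>x. u x - (K1 * N) * W x) x" using N(2)[OF x] by (simp add: abs_le_iff)
  qed
  then show ?thesis by (simp add: W_def)
qed

text \<open>The segment from \<open>x\<close> to \<open>y\<close> meets the frontier at some
  \<open>z\<close> no farther from \<open>x\<close> than \<open>y\<close> is, and the exterior ball
  at \<open>z\<close> gives a barrier argument of at most \<open>dist x y\<close>.\<close>

lemma boundary_bound_upper:
  assumes sol: "dirichlet_sol f N u" and y: "y \<notin> D"
  shows "u x \<le> K1 * N * v (dist x y)"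
proof (cases "x \<in> D")
  case True
  have "closed_segment x y \<inter> frontier D \<noteq> {}"
    using True y by (intro connected_Int_frontier) auto
  then obtain z where z: "z \<in> closed_segment x y" "z \<in> frontier D" by blast
  obtain c where c: "dist z c = r0" "ball c r0 \<inter> D = {}" using ext_ball[OF z(2)] by blast
  have "norm (x - c) \<le> dist x z + dist z c" by (metis dist_norm dist_triangle)
  moreover have "dist x z \<le> dist x y"
    using z(1) by (metis dist_in_closed_segment dist_commute)
  ultimately have "v (norm (x - c) - r0) \<le> v (dist x y)" using c by (intro vmono) auto
  moreover have "0 \<le> K1 * N" using K1 sol by (auto simp: dirichlet_sol_def)
  ultimately show ?thesis using ext_ball_bound[OF sol c(2), of x] by (meson mult_left_mono order_trans)
next
  case False
  moreover have "0 \<le> K1 * N * v (dist x y)" using K1 sol v0 by (auto simp: dirichlet_sol_def)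
  ultimately show ?thesis using sol by (auto simp: dirichlet_sol_def)
qed

lemma boundary_bound:
  assumes sol: "dirichlet_sol f N u" and y: "y \<notin> D"
  shows "\<bar>u x\<bar> \<le> K1 * N * v (dist x y)"
  using boundary_bound_upper[OF sol y, of x] boundary_bound_upper[OF dirichlet_sol_minus[OF sol] y, of x] by simp

text \<open>With the origin moved to the midpoint \<open>h\<close>, both \<open>g\<close>, the
  difference of \<open>u\<close> and its reflection, and \<open>W\<close> are odd. Where
  \<open>g\<close> exceeds the multiple of \<open>W\<close>, the sup bound forces
  \<open>p \<bullet> e < t0\<close>, and \<open>boundary_bound\<close> forces \<open>h + p\<close>
  and \<open>h + mirror e p\<close> into \<open>D\<close>. So both equations are available exactly
  where \<open>antisym_max_principle\<close> asks for them.\<close>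

lemma modulus_upper:
  assumes sol: "dirichlet_sol f N u"
  shows "u x - u y \<le> K3 * N * v (dist x y)"
proof (cases "x = y")
  case True
  then show ?thesis by (simp add: vneg)
next
  case False
  from sol have um: "u \<in> borel_measurable borel" and N: "0 < N" "\<And>x. x \<in> D \<Longrightarrow> \<bar>f x\<bar> \<le> N"
    and off: "\<And>x. x \<notin> D \<Longrightarrow> u x = 0" and eq: "\<And>x. x \<in> D \<Longrightarrow> Lk u x = f x"
    unfolding dirichlet_sol_def by blast+
  note um [measurable]
  note B = sup_bound[OF sol]
  define e where "e = (x - y) /\<^sub>R norm (x - y)"
  define h where "h = (x + y) /\<^sub>R 2"
  define p0 where "p0 = (x - y) /\<^sub>R 2"
  have e: "norm e = 1" using False by (simp add: e_def)
  have pe: "p0 = (norm (x - y) / 2) *\<^sub>R e" using False by (simp add: p0_def e_def)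
  have ee: "e \<bullet> e = 1" using e by (simp add: dot_square_norm)
  have p0e: "p0 \<bullet> e = norm (x - y) / 2" by (simp add: pe ee)
  have p0m: "mirror e p0 = - p0" by (simp add: mirror_def p0e pe ee)
      (simp add: scaleR_left_diff_distrib[symmetric] flip: scaleR_minus_left)
  have hx: "h + p0 = x" "h - p0 = y"
    by (simp_all add: h_def p0_def scaleR_add_right scaleR_diff_right) (simp_all flip: scaleR_add_left)
  define g where "g p = u (h + p) - 1 * u (h + mirror e p)" for p
  \<comment> \<open>The odd extension of the half-space barrier. The subtracted part vanishes for
    \<open>p \<bullet> e > 0\<close> and is nonnegative elsewhere, so it can only lower
    \<open>Lk W\<close> on that side.\<close>
  define W where "W p = v (p \<bullet> e) - 1 * v (- (p \<bullet> e))" for p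
  have gm [measurable]: "g \<in> borel_measurable borel" unfolding g_def by measurable
  have Wm [measurable]: "W \<in> borel_measurable borel" unfolding W_def by measurable
  have gb: "\<bar>g p\<bar> \<le> 4 * N / \<kappa>" for p
    using B[of "h + p"] B[of "h + mirror e p"] by (simp add: g_def)
  have Wb: "\<bar>W p\<bar> \<le> 2" for p
    using v0[of "p \<bullet> e"] v0[of "- (p \<bullet> e)"] v2[of "p \<bullet> e"] v2[of "- (p \<bullet> e)"] by (simp add: W_def)
  have KN: "0 \<le> K3 * N" using K3 N by simp
  have "g p0 - (K3 * N) * W p0 \<le> 0"
  proof (rule antisym_max_principle[where \<theta>=N and B="4 * N / \<kappa> + K3 * N * 2" and e=e])
    show "(\<lambda>p. g p - (K3 * N) * W p) \<in> borel_measurable borel" by measurable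
    show "\<bar>g x - (K3 * N) * W x\<bar> \<le> 4 * N / \<kappa> + K3 * N * 2" for x
    proof -
      have "\<bar>(K3 * N) * W x\<bar> \<le> K3 * N * 2" using mult_left_mono[OF Wb[of x] KN] KN by (simp only: abs_mult[of "K3 * N"] abs_of_nonneg)
      then show ?thesis using gb[of x] by linarith
    qed
    show "0 < N" by (rule N)
    show "norm e = 1" by (rule e)
    show "g (mirror e x) - (K3 * N) * W (mirror e x) = - (g x - (K3 * N) * W x)" for x
      by (simp add: g_def W_def inner_mirror[OF e] mirror_involution[OF e] algebra_simps)
    show "0 < p0 \<bullet> e" using False by (simp add: p0e)
    fix p assume p: "0 < p \<bullet> e" and pos: "0 < g p - (K3 * N) * W p"
    have Wp: "W p = v (p \<bullet> e)" using p by (simp add: W_def vneg)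
    have small: "p \<bullet> e < t0"
    proof (rule ccontr)
      assume "\<not> p \<bullet> e < t0"
      then have "t0\<^sup>2 \<le> W p" unfolding Wp by (intro vt0) simp
      then have "(K3 * N) * t0\<^sup>2 \<le> (K3 * N) * W p" using KN by (intro mult_left_mono)
      moreover have "4 / \<kappa> * N \<le> K3 * t0\<^sup>2 * N" using K3 N by (intro mult_right_mono) auto
      ultimately show False using pos gb[of p] by (simp add: mult_ac)
    qed
    have dd: "dist p (mirror e p) = 2 * (p \<bullet> e)"
      using p e by (simp add: dist_norm mirror_def)
    \<comment> \<open>A point and its mirror image are \<open>2 * (p \<bullet> e)\<close> apart;
      \<open>vdouble\<close> converts the boundary bound at that distance into one at
      \<open>p \<bullet> e\<close>.\<close>
    have vb: "K1 * N * v (2 * (p \<bullet> e)) \<le> (K3 * N) * W p"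
    proof -
      have "K1 * N * v (2 * (p \<bullet> e)) \<le> K1 * N * (4 * v (p \<bullet> e))"
        using vdouble K1 N by (intro mult_left_mono) auto
      also have "\<dots> = (4 * K1) * (N * v (p \<bullet> e))" by simp
      also have "\<dots> \<le> K3 * (N * v (p \<bullet> e))" using K3 N v0 by (intro mult_right_mono) auto
      finally show ?thesis by (simp add: Wp)
    qed
    have in1: "h + mirror e p \<in> D"
    proof (rule ccontr)
      assume n: "h + mirror e p \<notin> D"
      then have "g p \<le> K1 * N * v (2 * (p \<bullet> e))"
        using boundary_bound[OF sol n, of "h + p"] off[OF n] by (simp add: g_def dd)
      then show False using pos vb by linarith
    qed
    have in2: "h + p \<in> D"
    proof (rule ccontr)
      assume n: "h + p \<notin> D"
      then have "g p \<le> K1 * N * v (2 * (p \<bullet> e))"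
        using boundary_bound[OF sol n, of "h + mirror e p"] off[OF n] by (simp add: g_def dist_commute[of "mirror e p"] dd)
      then show False using pos vb by linarith
    qed
    have "Lk g p = Lk (\<lambda>p. u (h + p)) p - 1 * Lk (\<lambda>p. u (h + mirror e p)) p"
      unfolding g_def[abs_def] by (rule Lk_diff_scale[where B="2 * N / \<kappa>" and C="2 * N / \<kappa>"]) (use B in auto)
    then have Lg: "- 2 * N \<le> Lk g p"
      using N(2)[OF in1] N(2)[OF in2] eq[OF in1] eq[OF in2] Lk_mirror[OF um e, of h p] Lk_translate[of u h p]
      by (simp add: abs_le_iff)
    have "Lk W p = Lk (\<lambda>p. v (p \<bullet> e)) p - 1 * Lk (\<lambda>p. v (- (p \<bullet> e))) p"
      unfolding W_def[abs_def] by (rule Lk_diff_scale[where B=2 and C=2]) (use v_abs in auto)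
    moreover have "0 \<le> Lk (\<lambda>p. v (- (p \<bullet> e))) p"
      unfolding Lk_def using p v0 k0 by (intro Bochner_Integration.integral_nonneg) (simp add: vneg)
    ultimately have LW: "Lk W p \<le> - 1" using v_half[OF e p small] by simp
    have "Lk (\<lambda>p. g p - (K3 * N) * W p) p = Lk g p - (K3 * N) * Lk W p"
      by (rule Lk_diff_scale[OF gm gb Wm Wb])
    moreover have "(K3 * N) * Lk W p \<le> (K3 * N) * (- 1)" using LW KN by (intro mult_left_mono)
    moreover have "3 * N \<le> K3 * N" using K3 N by simp
    ultimately show "N \<le> Lk (\<lambda>p. g p - (K3 * N) * W p) p" using Lg by linarith
  qed
  moreover have "g p0 = u x - u y" using hx by (simp add: g_def p0m)
  moreover have "W p0 \<le> v (dist x y)"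
    using v0[of "- (p0 \<bullet> e)"] vmono[of "p0 \<bullet> e" "dist x y"] by (simp add: W_def p0e dist_norm)
  then have "(K3 * N) * W p0 \<le> (K3 * N) * v (dist x y)" using KN by (intro mult_left_mono)
  ultimately show ?thesis by linarith
qed

lemma modulus:
  assumes sol: "dirichlet_sol f N u"
  shows "\<bar>u x - u y\<bar> \<le> K3 * N * v (dist x y)"
  using modulus_upper[OF sol, of x y] modulus_upper[OF sol, of y x] by (simp add: dist_commute)

end

section \<open>Truncation of the Levy kernel\<close>

lemma C11_exterior_ball:
  fixes D :: "'a::euclidean_space set"
  assumes "C11_open D"
  obtains r1 where "0 < r1"
    "\<And>r z. 0 < r \<Longrightarrow> r \<le> r1 \<Longrightarrow> z \<in> frontier D \<Longrightarrow> \<exists>c. dist z c = r \<and> ball c r \<inter> D = {}"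
proof (cases "DIM('a) = 1")
  case True
  then obtain b :: 'a where Bb: "Basis = {b}" by (auto simp: card_1_singleton_iff)
  have nb: "norm b = 1" using Bb by (metis norm_Basis insertI1)
  have rep: "x = (x \<bullet> b) *\<^sub>R b" for x :: 'a
  proof -
    have "(\<Sum>b\<in>{b}. (x \<bullet> b) *\<^sub>R b) = x" using euclidean_representation[of x] unfolding Bb .
    then have "(x \<bullet> b) *\<^sub>R b = x" by simp
    then show ?thesis by (rule sym)
  qed
  have bb: "b \<bullet> b = 1" using nb by (simp add: dot_square_norm)
  have dst: "dist x y = \<bar>x \<bullet> b - y \<bullet> b\<bar>" for x y :: 'a
  proof -
    have "x - y = ((x - y) \<bullet> b) *\<^sub>R b" by (rule rep)
    then have "norm (x - y) = \<bar>(x - y) \<bullet> b\<bar>" using nb by (metis norm_scaleR mult.right_neutral)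
    then show ?thesis by (simp add: dist_norm inner_diff_left)
  qed
  from assms True obtain R0 where R0: "R0 > 0" and sep: "\<And>x y. x \<in> D \<Longrightarrow> y \<in> D \<Longrightarrow>
      connected_component_set D x \<noteq> connected_component_set D y \<Longrightarrow> dist x y \<ge> R0" and op: "open D"
    unfolding C11_open_def by auto
  show thesis
  proof (rule that[of "R0 / 4"])
    show "0 < R0 / 4" using R0 by simp
    fix r z assume r: "0 < r" "r \<le> R0 / 4" and z: "z \<in> frontier D"
    have zD: "z \<notin> D" using z op by (simp add: frontier_def interior_open)
    show "\<exists>c. dist z c = r \<and> ball c r \<inter> D = {}"
    proof (rule ccontr)
      assume no: "\<not> ?thesis"
      have "dist z (z + r *\<^sub>R b) = r" "dist z (z - r *\<^sub>R b) = r" using r nb by (auto simp: dist_norm)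
      with no obtain x1 x2 where x1: "x1 \<in> ball (z + r *\<^sub>R b) r" "x1 \<in> D"
        and x2: "x2 \<in> ball (z - r *\<^sub>R b) r" "x2 \<in> D" by blast
      have 1: "\<bar>z \<bullet> b + r - x1 \<bullet> b\<bar> < r" using x1(1) by (simp add: dst inner_add_left bb)
      have 2: "\<bar>z \<bullet> b - r - x2 \<bullet> b\<bar> < r" using x2(1) by (simp add: dst inner_diff_left bb)
      have "dist x1 x2 < R0" using 1 2 r by (simp add: dst)
      then have same: "connected_component_set D x1 = connected_component_set D x2"
        using sep[OF x1(2) x2(2)] by linarith
      have m: "x1 \<in> connected_component_set D x1" "x2 \<in> connected_component_set D x1"
        using x1(2) x2(2) same by auto
      have "\<exists>w\<in>connected_component_set D x1. b \<bullet> w = z \<bullet> b"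
        by (rule connected_ivt_hyperplane[OF connected_connected_component m(2,1)])
           (use 1 2 in \<open>simp_all add: inner_commute\<close>)
      then obtain w where w: "w \<in> connected_component_set D x1" "b \<bullet> w = z \<bullet> b" by blast
      then have "w = z" using rep[of w] rep[of z] by (simp add: inner_commute)
      then show False using w(1) zD connected_component_subset by fastforce
    qed
  qed
next
  case False
  with assms obtain R0 \<Lambda> where R0: "0 < R0" and Lam: "0 < \<Lambda>" and graph: "\<And>z. z \<in> frontier D \<Longrightarrow> \<exists>(\<nu>::'a) (\<phi>::'a \<Rightarrow> real) (g::'a \<Rightarrow> 'a).
         norm \<nu> = 1 \<and> \<phi> 0 = 0 \<and> g 0 = 0 \<and>
         (\<forall>y. y \<bullet> \<nu> = 0 \<longrightarrow> g y \<bullet> \<nu> = 0 \<and> norm (g y) \<le> \<Lambda> \<and>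
               (\<phi> has_derivative (\<lambda>h. g y \<bullet> h)) (at y within {w. w \<bullet> \<nu> = 0})) \<and>
         (\<forall>y y'. y \<bullet> \<nu> = 0 \<longrightarrow> y' \<bullet> \<nu> = 0 \<longrightarrow> norm (g y - g y') \<le> \<Lambda> * norm (y - y')) \<and>
         D \<inter> ball z R0 = {x \<in> ball z R0. (x - z) \<bullet> \<nu> > \<phi> ((x - z) - ((x - z) \<bullet> \<nu>) *\<^sub>R \<nu>)}"
    unfolding C11_open_def by auto
  show thesis
  proof (rule that[of "min (R0 / 2) (1 / (2 * \<Lambda>))"])
    show "0 < min (R0 / 2) (1 / (2 * \<Lambda>))" using R0 Lam by simp
    fix r z assume r: "0 < r" "r \<le> min (R0 / 2) (1 / (2 * \<Lambda>))" and z: "z \<in> frontier D"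
    from graph[OF z] obtain \<nu> :: 'a and \<phi> :: "'a \<Rightarrow> real" and g :: "'a \<Rightarrow> 'a" where nu: "norm \<nu> = 1"
      and phi0: "\<phi> 0 = 0" and g0: "g 0 = 0"
      and der: "\<And>y. y \<bullet> \<nu> = 0 \<Longrightarrow> (\<phi> has_derivative (\<lambda>h. g y \<bullet> h)) (at y within {w. w \<bullet> \<nu> = 0})"
      and lip: "\<And>y y'. y \<bullet> \<nu> = 0 \<Longrightarrow> y' \<bullet> \<nu> = 0 \<Longrightarrow> norm (g y - g y') \<le> \<Lambda> * norm (y - y')"
      and loc: "D \<inter> ball z R0 = {x \<in> ball z R0. (x - z) \<bullet> \<nu> > \<phi> ((x - z) - ((x - z) \<bullet> \<nu>) *\<^sub>R \<nu>)}"
      by blast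
    have nn: "\<nu> \<bullet> \<nu> = 1" using nu by (simp add: dot_square_norm)
    \<comment> \<open>The gradient vanishes at 0 and is Lipschitz, so it is at most
      \<open>\<Lambda> * norm y\<close> on the segment from 0 to \<open>y\<close>; the mean value
      inequality gives the quadratic bound.\<close>
    have quad: "- (\<Lambda> * (norm y)\<^sup>2) \<le> \<phi> y" if y: "y \<bullet> \<nu> = 0" for y
    proof -
      let ?S = "closed_segment 0 y"
      have S: "?S \<subseteq> {w. w \<bullet> \<nu> = 0}" using y by (auto simp: closed_segment_def)
      have "norm (\<phi> y - \<phi> 0) \<le> (\<Lambda> * norm y) * norm (y - 0)"
      proof (rule differentiable_bound[where S="?S" and f'="\<lambda>w h. g w \<bullet> h"])
        show "(\<phi> has_derivative (\<lambda>h. g w \<bullet> h)) (at w within ?S)" if "w \<in> ?S" for w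
          by (rule has_derivative_subset[OF der S]) (use S that in auto)
        show "onorm (\<lambda>h. g w \<bullet> h) \<le> \<Lambda> * norm y" if "w \<in> ?S" for w
        proof (rule onorm_bound)
          fix h :: 'a
          have nw: "norm w \<le> norm y" using that segment_bound1[of w 0 y] by simp
          have "norm (g w) \<le> \<Lambda> * norm w" using lip[of w 0] S that g0 by auto
          also have "\<dots> \<le> \<Lambda> * norm y" using nw Lam by simp
          finally have "norm (g w) * norm h \<le> \<Lambda> * norm y * norm h" by (intro mult_right_mono) auto
          then show "norm (g w \<bullet> h) \<le> \<Lambda> * norm y * norm h"
            using Cauchy_Schwarz_ineq2[of "g w" h] by simp
        qed (use Lam in simp)
      qed auto
      then show ?thesis by (simp add: phi0 power2_eq_square abs_le_iff)
    qed
    let ?c = "z - r *\<^sub>R \<nu>"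
    have "ball ?c r \<inter> D = {}"
    proof (rule ccontr)
      assume "ball ?c r \<inter> D \<noteq> {}"
      then obtain x where x: "x \<in> ball ?c r" "x \<in> D" by blast
      define s where "s = (x - z) \<bullet> \<nu>"
      define y where "y = (x - z) - s *\<^sub>R \<nu>"
      have yn: "y \<bullet> \<nu> = 0" by (simp add: y_def s_def inner_diff_left nn)
      have "norm (x - ?c) < r" using x(1) by (simp add: dist_norm norm_minus_commute)
      moreover have "x - ?c = y + (s + r) *\<^sub>R \<nu>" by (simp add: y_def algebra_simps)
      ultimately have "(norm (y + (s + r) *\<^sub>R \<nu>))\<^sup>2 < r\<^sup>2" using r by (intro power_strict_mono) auto
      moreover have "(norm (y + (s + r) *\<^sub>R \<nu>))\<^sup>2 = (norm y)\<^sup>2 + (s + r)\<^sup>2"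
        unfolding power2_norm_eq_inner using yn nn
        by (simp add: inner_add_left inner_add_right inner_commute[of \<nu> y] power2_eq_square)
      ultimately have 1: "(norm y)\<^sup>2 + s\<^sup>2 < - 2 * r * s" by (simp add: power2_eq_square algebra_simps)
      then have 2: "(norm y)\<^sup>2 < 2 * r * (- s)" by (smt (verit) zero_le_power2 mult_minus_right mult_minus_left)
      have s0: "0 < - s"
      proof -
        have "0 < 2 * r * (- s)" using 2 by (smt (verit) zero_le_power2)
        then show ?thesis by (rule zero_less_mult_pos) (use r in simp)
      qed
      have "\<Lambda> * (2 * r) \<le> 1" using r Lam by (simp add: field_simps)
      then have "\<Lambda> * (2 * r) * (- s) \<le> 1 * (- s)" using s0 by (intro mult_right_mono) auto
      moreover have "\<Lambda> * (norm y)\<^sup>2 < \<Lambda> * (2 * r * (- s))" using 2 Lam by (intro mult_strict_left_mono)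
      ultimately have 3: "\<Lambda> * (norm y)\<^sup>2 < - s" by (simp add: mult.assoc)
      have "dist z x \<le> dist z ?c + dist ?c x" by (rule dist_triangle)
      also have "\<dots> < r + r" using x(1) r nu by (simp add: dist_norm)
      also have "\<dots> \<le> R0" using r by simp
      finally have "x \<in> D \<inter> ball z R0" using x(2) by simp
      then have "s > \<phi> y" unfolding loc by (simp add: s_def y_def)
      then show False using quad[OF yn] 3 by linarith
    qed
    then show "\<exists>c. dist z c = r \<and> ball c r \<inter> D = {}"
      using r nu by (intro exI[of _ ?c]) (simp add: dist_norm)
  qed
qed

section \<open>The Levy operator and its truncations\<close>

locale levy_op =
  fixes J :: "real \<Rightarrow> real" and b :: "'a::euclidean_space"
  assumes b1: "norm b = 1" and J_pos: "0 < r \<Longrightarrow> 0 < J r"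
    and J_mono: "0 < r \<Longrightarrow> r \<le> s \<Longrightarrow> J s \<le> J r"
    and levy: "integrable lborel (\<lambda>y::'a. min 1 (norm y ^ 2) * J (norm y))"
begin

text \<open>Dividing the integrable function by its weight recovers \<open>J (norm y)\<close> off
  the origin, and at the origin \<open>J 0\<close> is just a constant.\<close>

lemma Jm [measurable]: "(\<lambda>y::'a. J (norm y)) \<in> borel_measurable borel"
proof -
  have m [measurable]: "(\<lambda>y::'a. min 1 (norm y ^ 2) * J (norm y)) \<in> borel_measurable borel" using levy by auto
  have "(\<lambda>y::'a. J (norm y)) = (\<lambda>y. if y = 0 then J 0 else (min 1 (norm y ^ 2) * J (norm y)) / min 1 (norm y ^ 2))"
    by (auto simp: fun_eq_iff min_def)
  then show ?thesis by simp
qed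

lemma Jm' [measurable]: "f \<in> borel_measurable N \<Longrightarrow> (\<lambda>x. J (norm (f x :: 'a))) \<in> borel_measurable N"
  using measurable_compose[OF _ Jm] by blast

definition K2 :: real where "K2 = (\<integral>y. min 1 (norm (y::'a) ^ 2) * J (norm y) \<partial>lborel)"

text \<open>\<open>J 0\<close> is unconstrained, so estimates against \<open>J (norm y)\<close> are
  made almost everywhere, off the origin.\<close>

lemma AE_ne0: "AE y::'a in lborel. y \<noteq> 0" by (rule AE_lborel_singleton)

lemma J_nonneg: "y \<noteq> 0 \<Longrightarrow> 0 \<le> J (norm y)" for y :: 'a
  using J_pos[of "norm y"] by simp

lemma levy_int:
  fixes F :: "'a \<Rightarrow> real"
  assumes [measurable]: "F \<in> borel_measurable borel" and F: "\<And>y. \<bar>F y\<bar> \<le> C * min 1 (norm y ^ 2)"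
  shows "integrable lborel (\<lambda>y. F y * J (norm y))"
proof (rule Bochner_Integration.integrable_bound)
  show "integrable lborel (\<lambda>y. C * (min 1 (norm y ^ 2) * J (norm (y::'a))))" using levy by simp
  show "AE y in lborel. norm (F y * J (norm y)) \<le> norm (C * (min 1 (norm y ^ 2) * J (norm y)))"
    using AE_ne0
  proof eventually_elim
    case (elim y)
    have "norm (F y * J (norm y)) = \<bar>F y\<bar> * J (norm y)" using J_nonneg[OF elim] by (simp add: abs_mult)
    also have "\<dots> \<le> (C * min 1 (norm y ^ 2)) * J (norm y)"
      using J_nonneg[OF elim] by (intro mult_right_mono F)
    also have "\<dots> \<le> norm (C * (min 1 (norm y ^ 2) * J (norm y)))"
      unfolding mult.assoc real_norm_def by (rule abs_ge_self)
    finally show ?case .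
  qed
qed measurable

lemma tail_int: "0 < r \<Longrightarrow> integrable lborel (\<lambda>y::'a. indicator {y. r \<le> norm y} y * J (norm y))"
proof (rule levy_int[where C="1 / min 1 (r\<^sup>2)"])
  assume r: "0 < r"
  fix y :: 'a
  have m: "0 < min 1 (r\<^sup>2)" using r by simp
  show "\<bar>indicator {y. r \<le> norm y} y :: real\<bar> \<le> 1 / min 1 (r\<^sup>2) * min 1 (norm y ^ 2)"
  proof (cases "r \<le> norm y")
    case True
    then have "r\<^sup>2 \<le> norm y ^ 2" using r by (intro power_mono) auto
    then have "min 1 (r\<^sup>2) \<le> min 1 (norm y ^ 2)" by (intro min.mono) auto
    then show ?thesis using True m by (simp add: pos_le_divide_eq)
  qed (use m in simp)
qed measurable

lemma tail_pos: assumes "0 < r" shows "0 < (\<integral>y. indicator {y. r \<le> norm y} y * J (norm (y::'a)) \<partial>lborel)"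
proof -
  \<comment> \<open>This unit ball lies in the shell between radii \<open>r\<close> and
    \<open>r + 2\<close>, where \<open>J\<close> is at least \<open>J (r + 2)\<close>.\<close>
  let ?B = "ball ((r + 1) *\<^sub>R b) 1"
  have "0 < J (r + 2) * measure lborel ?B" using content_ball_pos[of 1 "(r + 1) *\<^sub>R b"] J_pos[of "r + 2"] assms by simp
  also have "\<dots> = (\<integral>y. J (r + 2) * indicator ?B y \<partial>lborel)" by simp
  also have "\<dots> \<le> (\<integral>y. indicator {y. r \<le> norm y} y * J (norm (y::'a)) \<partial>lborel)"
  proof (rule integral_mono_AE)
    show "integrable lborel (\<lambda>y. J (r + 2) * indicator ?B y)" using integrable_indicator_ball[of "(r + 1) *\<^sub>R b" 1] by simp
    show "integrable lborel (\<lambda>y::'a. indicator {y. r \<le> norm y} y * J (norm y))" by (rule tail_int[OF assms])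
    show "AE y in lborel. J (r + 2) * indicator ?B y \<le> indicator {y. r \<le> norm y} y * J (norm y)"
      using AE_ne0
    proof eventually_elim
      case (elim y)
      show ?case
      proof (cases "y \<in> ?B")
        case True
        then have d: "norm ((r + 1) *\<^sub>R b - y) < 1" by (simp add: dist_norm)
        have n: "norm ((r + 1) *\<^sub>R b) = r + 1" using b1 assms by simp
        have "r \<le> norm y" "norm y \<le> r + 2"
          using d n norm_triangle_ineq2[of "(r + 1) *\<^sub>R b" y] norm_triangle_ineq3[of "(r + 1) *\<^sub>R b" y] by linarith+
        then show ?thesis using True J_mono[of "norm y" "r + 2"] elim by simp
      qed (use J_nonneg[OF elim] in simp)
    qed
  qed
  finally show ?thesis .
qed

text \<open>Freezing the kernel below \<open>1 / (n + 1)\<close> instead of setting it to 0 keeps it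
  decreasing, as \<open>antisym_max_principle\<close> requires, and leaves it unchanged away from
  the origin.\<close>

definition trunc :: "nat \<Rightarrow> real \<Rightarrow> real" where "trunc n r = J (max (1 / real (Suc n)) r)"

lemma trunc_le: "y \<noteq> 0 \<Longrightarrow> trunc n (norm y) \<le> J (norm y)" for y :: 'a
  unfolding trunc_def by (intro J_mono) auto

lemma trunc_eq: "1 / real (Suc n) \<le> r \<Longrightarrow> trunc n r = J r"
  by (simp add: trunc_def max_def)

lemma trunc_tendsto: fixes y :: 'a assumes "y \<noteq> 0" shows "(\<lambda>n. trunc n (norm y)) \<longlonglongrightarrow> J (norm y)"
proof (rule tendsto_eventually)
  obtain N where N: "inverse (real (Suc N)) < norm y" using reals_Archimedean[of "norm y"] assms by auto
  show "\<forall>\<^sub>F n in sequentially. trunc n (norm y) = J (norm y)"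
  proof (rule eventually_sequentiallyI[of N])
    fix n assume "N \<le> n"
    then have "1 / real (Suc n) \<le> 1 / real (Suc N)" by (simp add: field_simps)
    moreover have "1 / real (Suc N) < norm y" using N by (simp add: divide_inverse)
    ultimately show "trunc n (norm y) = J (norm y)" by (intro trunc_eq) linarith
  qed
qed

sublocale T: radial_kernel "trunc n" b for n
proof
  let ?e = "1 / real (Suc n)"
  have e: "0 < ?e" by simp
  show "norm b = 1" by (rule b1)
  show "0 \<le> trunc n r" for r
    unfolding trunc_def by (rule less_imp_le[OF J_pos]) (use e in \<open>simp add: less_max_iff_disj\<close>)
  show "trunc n s \<le> trunc n r" if "0 \<le> r" "r \<le> s" for r s
    unfolding trunc_def using that by (intro J_mono) (auto simp: less_max_iff_disj)
  have tm: "trunc n \<in> borel_measurable borel"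
  proof -
    have "mono (\<lambda>r. - trunc n r)" unfolding trunc_def
    proof (rule monoI, simp, rule J_mono)
      fix x y :: real assume "x \<le> y"
      then show "max (1 / (1 + real n)) x \<le> max (1 / (1 + real n)) y" by auto
    qed (use e in \<open>simp add: less_max_iff_disj\<close>)
    then have "(\<lambda>r. - trunc n r) \<in> borel_measurable borel" by (rule borel_measurable_mono)
    then show ?thesis by simp
  qed
  show "integrable lborel (\<lambda>y::'a. trunc n (norm y))"
  proof (rule Bochner_Integration.integrable_bound)
    show "integrable lborel (\<lambda>y::'a. J ?e * indicator (ball 0 ?e) y + indicator {y. ?e \<le> norm y} y * J (norm y))"
      using tail_int[OF e] integrable_indicator_ball[of "0::'a" ?e] by simp
    show "AE y in lborel. norm (trunc n (norm y)) \<le> norm (J ?e * indicator (ball 0 ?e) (y::'a) + indicator {y. ?e \<le> norm y} y * J (norm y))"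
      by (rule AE_I2) (auto simp: trunc_def max_def split: split_indicator)
    show "(\<lambda>y::'a. trunc n (norm y)) \<in> borel_measurable lborel" using tm by measurable
  qed
qed

lemma cos_bound: "\<bar>1 - cos (z \<bullet> y)\<bar> \<le> (2 + (norm z)\<^sup>2) * min 1 (norm y ^ 2)" for y z :: 'a
proof -
  have "(z \<bullet> y)\<^sup>2 \<le> (norm z * norm y)\<^sup>2"
    using Cauchy_Schwarz_ineq2[of z y] power_mono[of "\<bar>z \<bullet> y\<bar>" "norm z * norm y" 2] by simp
  then have q: "1 - cos (z \<bullet> y) \<le> (norm z)\<^sup>2 * (norm y)\<^sup>2"
    using one_minus_cos_le[of "z \<bullet> y"] by (simp add: power_mult_distrib) (smt (verit) zero_le_power2)
  have t: "0 \<le> 1 - cos (z \<bullet> y)" "1 - cos (z \<bullet> y) \<le> 2"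
    using cos_ge_minus_one[of "z \<bullet> y"] cos_le_one[of "z \<bullet> y"] by linarith+
  show ?thesis
  proof (cases "norm y ^ 2 \<le> 1")
    case True
    have "(norm z)\<^sup>2 * (norm y)\<^sup>2 \<le> (2 + (norm z)\<^sup>2) * (norm y)\<^sup>2" by (intro mult_right_mono) auto
    then show ?thesis using True q t by (simp add: min_def)
  next
    case False
    then show ?thesis using t by (simp add: min_def add_increasing2)
  qed
qed

lemma char_exp_int: "integrable lborel (\<lambda>y. (1 - cos (z \<bullet> y)) * J (norm (y::'a)))"
  by (rule levy_int[OF _ cos_bound]) measurable

text \<open>Upper bounds for the exponent pass to all truncations at once; lower bounds at a fixed
  frequency hold for late truncations, by \<open>char_exp_tendsto\<close>.\<close>

lemma char_exp_trunc_le: "char_exp (trunc n) z \<le> char_exp J (z::'a)"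
  unfolding char_exp_def
proof (rule integral_mono_AE)
  show "integrable lborel (\<lambda>y::'a. (1 - cos (z \<bullet> y)) * trunc n (norm y))" by (rule T.char_exp_int)
  show "AE y in lborel. (1 - cos (z \<bullet> y)) * trunc n (norm y) \<le> (1 - cos (z \<bullet> y)) * J (norm y)"
    using AE_ne0 by eventually_elim (intro mult_left_mono trunc_le, auto)
qed (rule char_exp_int)

lemma char_exp_upper: "char_exp J z \<le> (2 + (norm z)\<^sup>2) * K2" for z :: 'a
proof -
  have "char_exp J z \<le> (\<integral>y. (2 + (norm z)\<^sup>2) * (min 1 (norm y ^ 2) * J (norm (y::'a))) \<partial>lborel)"
    unfolding char_exp_def
  proof (rule integral_mono_AE[OF char_exp_int])
    show "AE y in lborel. (1 - cos (z \<bullet> y)) * J (norm y) \<le> (2 + (norm z)\<^sup>2) * (min 1 (norm y ^ 2) * J (norm y))"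
      using AE_ne0
    proof eventually_elim
      case (elim y)
      have "(1 - cos (z \<bullet> y)) * J (norm y) \<le> ((2 + (norm z)\<^sup>2) * min 1 (norm y ^ 2)) * J (norm y)"
        using cos_bound[of z y] J_nonneg[OF elim] by (intro mult_right_mono) auto
      then show ?case by simp
    qed
  qed (use levy in simp)
  then show ?thesis by (simp add: K2_def)
qed

lemma char_exp_lower: assumes "0 < \<rho>" shows "J \<rho> * (\<rho> ^ DIM('a) * cosvol b) \<le> char_exp J (b /\<^sub>R \<rho>)"
proof -
  obtain n where n: "inverse (real (Suc n)) < \<rho>" using reals_Archimedean[OF assms] by auto
  have "J \<rho> * (\<rho> ^ DIM('a) * cosvol b) = trunc n \<rho> * (\<rho> ^ DIM('a) * cosvol b)"
    using n by (subst trunc_eq) (auto simp: divide_inverse)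
  also have "\<dots> \<le> char_exp (trunc n) (b /\<^sub>R \<rho>)" by (rule T.char_exp_lower[OF assms])
  also have "\<dots> \<le> char_exp J (b /\<^sub>R \<rho>)" by (rule char_exp_trunc_le)
  finally show ?thesis .
qed

lemma char_exp_pos: assumes "0 < s" shows "0 < char_exp J (s *\<^sub>R b)"
proof -
  have "0 < J (1 / s) * ((1 / s) ^ DIM('a) * cosvol b)"
    using assms J_pos[of "1 / s"] cosvol_pos[OF b1] by simp
  also have "\<dots> \<le> char_exp J (b /\<^sub>R (1 / s))" using assms by (intro char_exp_lower) simp
  finally show ?thesis by (simp add: divide_inverse)
qed

lemma char_exp_tendsto: "(\<lambda>n. char_exp (trunc n) z) \<longlonglongrightarrow> char_exp J (z::'a)"
  unfolding char_exp_def
proof (rule integral_dominated_convergence[where w="\<lambda>y. (1 - cos (z \<bullet> y)) * J (norm y)"])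
  show "integrable lborel (\<lambda>y. (1 - cos (z \<bullet> y)) * J (norm (y::'a)))" by (rule char_exp_int)
  show "AE y in lborel. (\<lambda>n. (1 - cos (z \<bullet> y)) * trunc n (norm y)) \<longlonglongrightarrow> (1 - cos (z \<bullet> y)) * J (norm y)"
    using AE_ne0 by eventually_elim (intro tendsto_mult_left trunc_tendsto)
  show "AE y in lborel. norm ((1 - cos (z \<bullet> y)) * trunc n (norm y)) \<le> (1 - cos (z \<bullet> y)) * J (norm y)" for n
    using AE_ne0
  proof eventually_elim
    case (elim y)
    show ?case using trunc_le[OF elim] T.k0[of n "norm y"] by (simp add: abs_mult mult_left_mono)
  qed
qed (use T.km' in measurable)

end

section \<open>Estimates uniform in the truncation\<close>

locale levy_dirichlet = levy_op J b for J and b :: "'a::euclidean_space" +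
  fixes D :: "'a set" and a1 \<alpha>1 \<alpha>2 :: real
  assumes a1: "1 \<le> a1" and al1: "0 < \<alpha>1" and al2: "\<alpha>2 < 1"
    and scaling: "1 < norm (z::'a) \<Longrightarrow> norm z \<le> norm (w::'a) \<Longrightarrow>
        (norm w / norm z) powr (2 * \<alpha>1) / a1 \<le> char_exp J w / char_exp J z \<and>
        char_exp J w / char_exp J z \<le> a1 * (norm w / norm z) powr (2 * \<alpha>2)"
    and D_bdd: "bounded D" and D_C11: "C11_open D"
begin

lemma D_open: "open D"
  using D_C11 by (simp add: C11_open_def)

text \<open>The lower scaling bound with \<open>\<alpha>1 > 0\<close> forces growth. The reference
  vector \<open>2 *\<^sub>R b\<close> has modulus above 1, where scaling is assumed;
  \<open>Q\<close> and \<open>Y\<close> locate a frequency beyond which the lower bound exceeds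
  \<open>M\<close>.\<close>

lemma char_exp_large:
  obtains T where "0 < T" "T \<le> 1" "\<And>t. 0 < t \<Longrightarrow> t \<le> T \<Longrightarrow> M < char_exp J (b /\<^sub>R t)"
proof -
  define c where "c = char_exp J (2 *\<^sub>R b)"
  have c: "0 < c" unfolding c_def by (rule char_exp_pos) simp
  define Q where "Q = max 1 (M * a1 / c + 1)"
  define Y where "Y = Q powr (1 / (2 * \<alpha>1))"
  have Q1: "1 \<le> Q" by (simp add: Q_def)
  have Y1: "1 \<le> Y" unfolding Y_def using Q1 al1 by (intro ge_one_powr_ge_zero) auto
  have YQ: "Y powr (2 * \<alpha>1) = Q" unfolding Y_def using al1 Q1 by (simp add: powr_powr)
  show thesis
  proof (rule that[of "1 / (2 * Y)"])
    show "0 < 1 / (2 * Y)" "1 / (2 * Y) \<le> 1" using Y1 by auto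
    fix t assume t: "0 < t" "t \<le> 1 / (2 * Y)"
    have tY: "Y \<le> 1 / (2 * t)" using t Y1 by (simp add: field_simps)
    have nb: "norm (b /\<^sub>R t) = 1 / t" "norm (2 *\<^sub>R b) = 2" using t b1 by (simp_all add: inverse_eq_divide)
    have "1 \<le> 1 / (2 * t)" using tY Y1 by linarith
    then have ge: "2 \<le> 1 / t" using t by (simp add: field_simps)
    have "Q \<le> (1 / (2 * t)) powr (2 * \<alpha>1)"
      unfolding YQ[symmetric] using tY Y1 al1 by (intro powr_mono2) auto
    moreover have "M * a1 / c < Q" by (simp add: Q_def less_max_iff_disj)
    ultimately have "M * a1 / c < (1 / (2 * t)) powr (2 * \<alpha>1)" by linarith
    moreover have "(norm (b /\<^sub>R t) / norm (2 *\<^sub>R b)) powr (2 * \<alpha>1) / a1 \<le> char_exp J (b /\<^sub>R t) / c"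
      unfolding c_def using ge nb by (intro conjunct1[OF scaling]) auto
    then have "(1 / (2 * t)) powr (2 * \<alpha>1) / a1 \<le> char_exp J (b /\<^sub>R t) / c"
      unfolding nb by (simp add: mult.commute)
    moreover have "M * a1 / c / a1 < (1 / (2 * t)) powr (2 * \<alpha>1) / a1"
      using calculation(1) a1 by (intro divide_strict_right_mono) auto
    ultimately have "M * a1 / c / a1 < char_exp J (b /\<^sub>R t) / c" by linarith
    then have "M / c < char_exp J (b /\<^sub>R t) / c" using a1 by simp
    then show "M < char_exp J (b /\<^sub>R t)" using c by (simp add: divide_less_cancel)
  qed
qed

lemma dyadic_sum:
  assumes r0: "0 < r0" "r0 \<le> 1"
  obtains Sg where "\<And>N n. (\<Sum>j<N. (1/2)^j * sqrt (char_exp (trunc n) (b /\<^sub>R (r0 / 2 * (1/2)^j)))) \<le> Sg"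
proof -
  \<comment> \<open>As \<open>r0 \<le> 1\<close>, the first frequency has modulus
    \<open>2 / r0 > 1\<close>, inside the range of the scaling condition.\<close>
  define z where "z = b /\<^sub>R (r0 / 2)"
  have nz: "norm z = 2 / r0" using b1 r0 by (simp add: z_def)
  have nz1: "1 < norm z" unfolding nz using r0 by (simp add: field_simps)
  define c where "c = char_exp J z"
  have c: "0 < c" unfolding c_def z_def using char_exp_pos[of "inverse (r0 / 2)"] r0 by simp
  \<comment> \<open>The square root of the exponent grows at most by \<open>q\<close> per dyadic
    step, so the weighted sum is dominated by a geometric series of ratio
    \<open>q / 2 < 1\<close>.\<close>
  define q :: real where "q = 2 powr \<alpha>2"
  have q0: "0 < q" "q < 2" using al2 powr_less_mono[of \<alpha>2 1 2] by (auto simp: q_def)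
  have ce: "char_exp J (b /\<^sub>R (r0 / 2 * (1/2)^j)) \<le> a1 * c * (q ^ j)\<^sup>2" for j :: nat
  proof -
    have eq: "b /\<^sub>R (r0 / 2 * (1/2)^j) = (2 ^ j) *\<^sub>R z"
    proof -
      have "inverse (r0 / 2 * (1/2)^j) = 2 ^ j * inverse (r0 / 2)" by (simp add: power_one_over)
      then show ?thesis unfolding z_def by (simp only: scaleR_scaleR)
    qed
    have nw: "norm ((2 ^ j) *\<^sub>R z) = 2 ^ j * norm z" by simp
    have le: "norm z \<le> norm ((2 ^ j) *\<^sub>R z)" unfolding nw by (simp add: mult_le_cancel_right1)
    have "char_exp J ((2 ^ j) *\<^sub>R z) / c \<le> a1 * (norm ((2 ^ j) *\<^sub>R z) / norm z) powr (2 * \<alpha>2)"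
      unfolding c_def by (rule conjunct2[OF scaling[OF nz1 le]])
    also have "norm ((2 ^ j) *\<^sub>R z) / norm z = 2 ^ j"
    proof -
      have "norm z \<noteq> 0" using nz1 by linarith
      then show ?thesis by (simp add: nw)
    qed
    also have "(2 ^ j :: real) powr (2 * \<alpha>2) = (q ^ j)\<^sup>2"
      by (simp add: q_def powr_realpow[symmetric] powr_powr mult_ac flip: powr_power)
    finally show ?thesis unfolding eq using c by (simp add: field_simps)
  qed
  have sq: "sqrt (char_exp (trunc n) (b /\<^sub>R (r0 / 2 * (1/2)^j))) \<le> sqrt (a1 * c) * q ^ j" for n j
  proof -
    have "sqrt (char_exp (trunc n) (b /\<^sub>R (r0 / 2 * (1/2)^j))) \<le> sqrt (a1 * c * (q ^ j)\<^sup>2)"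
      using char_exp_trunc_le[of n "b /\<^sub>R (r0 / 2 * (1/2)^j)"] ce[of j] by (intro real_sqrt_le_mono) linarith
    then show ?thesis using q0 by (simp add: real_sqrt_mult)
  qed
  show thesis
  proof (rule that[of "sqrt (a1 * c) * (\<Sum>j. (q / 2) ^ j)"])
    fix N n
    have s: "summable (\<lambda>j. (q / 2) ^ j)" using q0 by (intro summable_geometric) auto
    have "(\<Sum>j<N. (1/2)^j * sqrt (char_exp (trunc n) (b /\<^sub>R (r0 / 2 * (1/2)^j)))) \<le> (\<Sum>j<N. (1/2)^j * (sqrt (a1 * c) * q ^ j))"
      by (intro sum_mono mult_left_mono sq) auto
    also have "\<dots> = sqrt (a1 * c) * (\<Sum>j<N. (q / 2) ^ j)"
      by (simp add: sum_distrib_left power_divide power_one_over field_simps)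
    also have "\<dots> \<le> sqrt (a1 * c) * (\<Sum>j. (q / 2) ^ j)"
      using s q0 a1 c by (intro mult_left_mono sum_le_suminf) auto
    finally show "(\<Sum>j<N. (1/2)^j * sqrt (char_exp (trunc n) (b /\<^sub>R (r0 / 2 * (1/2)^j)))) \<le> sqrt (a1 * c) * (\<Sum>j. (q / 2) ^ j)" .
  qed
qed

lemma D_diam:
  obtains R where "1 \<le> R" "\<And>x y. x \<in> D \<Longrightarrow> y \<in> D \<Longrightarrow> dist x y < R"
proof -
  obtain C where C: "\<And>x. x \<in> D \<Longrightarrow> norm x \<le> C" using D_bdd by (auto simp: bounded_iff)
  show thesis
  proof (rule that[of "2 * \<bar>C\<bar> + 1"])
    fix x y assume "x \<in> D" "y \<in> D"
    then have "norm x \<le> C" "norm y \<le> C" using C by auto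
    then show "dist x y < 2 * \<bar>C\<bar> + 1" using norm_triangle_ineq4[of x y] by (simp add: dist_norm)
  qed simp
qed

text \<open>The choices are made in the order \<open>r0\<close>, the sums and tails it determines,
  \<open>lam\<close>, \<open>t0\<close>, and finally \<open>n0\<close>. None of them depends on
  \<open>f\<close> or \<open>N\<close>, which is what makes the final constant uniform in
  \<open>f\<close>.\<close>

lemma uniform_approximations:
  obtains K lam n0 where "0 < K" "0 < lam"
    "\<forall>f N. in_C D f \<longrightarrow> 0 < N \<longrightarrow> (\<forall>x\<in>D. \<bar>f x\<bar> \<le> N) \<longrightarrow>
      (\<forall>n\<ge>n0. \<exists>u. u \<in> borel_measurable borel \<and> (\<forall>x. \<bar>u x\<bar> \<le> K * N) \<and> (\<forall>x. x \<notin> D \<longrightarrow> u x = 0)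
        \<and> (\<forall>x\<in>D. T.Lk n u x = f x)
        \<and> (\<forall>x y. x \<noteq> y \<longrightarrow> \<bar>u x - u y\<bar> \<le> K * N * (sqrt (80 * lam / (lam + char_exp (trunc n) (b /\<^sub>R dist x y))) + (dist x y)\<^sup>2)))"
proof -
  obtain r1 where r1: "0 < r1" "\<And>r z. 0 < r \<Longrightarrow> r \<le> r1 \<Longrightarrow> z \<in> frontier D \<Longrightarrow> \<exists>c. dist z c = r \<and> ball c r \<inter> D = {}"
    by (rule C11_exterior_ball[OF D_C11]) (rule that)
  define r0 where "r0 = min r1 1"
  have r0: "0 < r0" "r0 \<le> 1" "r0 \<le> r1" using r1 by (auto simp: r0_def)
  obtain Sg where Sg: "\<And>N n. (\<Sum>j<N. (1/2)^j * sqrt (char_exp (trunc n) (b /\<^sub>R (r0 / 2 * (1/2)^j)))) \<le> Sg"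
    by (rule dyadic_sum[OF r0(1,2)]) (rule that)
  obtain R where R: "1 \<le> R" "\<And>x y. x \<in> D \<Longrightarrow> y \<in> D \<Longrightarrow> dist x y < R"
    by (rule D_diam) (rule that)
  define \<kappa> where "\<kappa> = (\<integral>y. indicator {y. R \<le> norm y} y * J (norm (y::'a)) \<partial>lborel)"
  have kap: "0 < \<kappa>" unfolding \<kappa>_def using R by (intro tail_pos) simp
  define Tl where "Tl = (\<integral>y. indicator {y. r0 / 2 \<le> norm y} y * J (norm (y::'a)) \<partial>lborel)"
  have Tl0: "0 \<le> Tl" unfolding Tl_def using tail_pos[of "r0 / 2"] r0 by simp
  have K20: "0 \<le> K2" unfolding K2_def
  proof (rule integral_nonneg_AE)
    show "AE y::'a in lborel. 0 \<le> min 1 (norm y ^ 2) * J (norm y)"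
      using AE_ne0 by eventually_elim (intro mult_nonneg_nonneg J_nonneg, auto)
  qed
  define C where "C = radial_kernel.curv_const b * Sg"
  have Sg0: "0 \<le> Sg" using Sg[of _ 0] by simp
  have C0: "0 \<le> C" unfolding C_def using T.curv_const_nonneg Sg0 by simp
  define E where "E = 1 + Tl + K2 + 1"
  have E0: "1 \<le> E" using Tl0 K20 by (simp add: E_def)
  \<comment> \<open>\<open>lam\<close> is taken as a square so that \<open>sqrt lam = s\<close>.
    Then \<open>lam / 2 = s * C + s * (1 + E)\<close> absorbs the curvature error
    \<open>s * C\<close> and the fixed error \<open>E\<close>.\<close>
  define s where "s = 2 * C + 2 + 2 * E"
  define lam where "lam = s\<^sup>2"
  have s0: "1 \<le> s" using C0 E0 by (simp add: s_def)
  have lam0: "0 < lam" using s0 by (simp add: lam_def)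
  have big: "(radial_kernel.curv_const b * sqrt lam * Sg + 1) + Tl + K2 + 1 \<le> lam / 2"
  proof -
    have "lam = s * (2 * C + 2 + 2 * E)" unfolding lam_def power2_eq_square by (subst s_def) (simp add: s_def)
    then have "lam / 2 = s * C + s * (1 + E)" by (simp add: distrib_left)
    moreover have "E \<le> s * (1 + E)"
    proof -
      have "1 * (1 + E) \<le> s * (1 + E)" using s0 E0 by (intro mult_right_mono) auto
      then show ?thesis by simp
    qed
    ultimately have "s * C + E \<le> lam / 2" by (simp only: add_left_mono)
    moreover have "radial_kernel.curv_const b * sqrt lam * Sg = s * C" using s0 by (simp add: lam_def C_def)
    moreover have "E = 1 + Tl + K2 + 1" by (simp add: E_def)
    ultimately show ?thesis by linarith
  qed
  \<comment> \<open>The threshold required by \<open>barrier_exists\<close> is met strictly by the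
    exponent of \<open>J\<close>, hence by that of all late truncations.\<close>
  obtain t0 where t0: "0 < t0" "t0 \<le> 1" "320 * lam < char_exp J (b /\<^sub>R t0)"
    using char_exp_large[of "320 * lam"] by (metis order_refl)
  have "\<forall>\<^sub>F n in sequentially. 320 * lam < char_exp (trunc n) (b /\<^sub>R t0)"
    using char_exp_tendsto t0(3) by (rule order_tendstoD)
  then obtain n0 where n0: "\<And>n. n \<ge> n0 \<Longrightarrow> 320 * lam < char_exp (trunc n) (b /\<^sub>R t0)"
    by (auto simp: eventually_sequentially)
  \<comment> \<open>The first entry is the sup bound, the second is \<open>K3\<close> of
    \<open>barrier_dirichlet\<close> written out, since \<open>K\<close> has to be fixed before the
    locale is interpreted for each \<open>n\<close>.\<close>
  define K where "K = max (2 / \<kappa>) (4 * (2 + 2 / (\<kappa> * t0\<^sup>2)) + 3)"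
  have K: "0 < K" "2 / \<kappa> \<le> K" "4 * (2 + 2 / (\<kappa> * t0\<^sup>2)) + 3 \<le> K" using kap by (auto simp: K_def less_max_iff_disj)
  have main: "\<exists>u. u \<in> borel_measurable borel \<and> (\<forall>x. \<bar>u x\<bar> \<le> K * N) \<and> (\<forall>x. x \<notin> D \<longrightarrow> u x = 0)
        \<and> (\<forall>x\<in>D. T.Lk n u x = f x)
        \<and> (\<forall>x y. x \<noteq> y \<longrightarrow> \<bar>u x - u y\<bar> \<le> K * N * (sqrt (80 * lam / (lam + char_exp (trunc n) (b /\<^sub>R dist x y))) + (dist x y)\<^sup>2))"
    if f: "in_C D f" and N: "0 < N" "\<And>x. x \<in> D \<Longrightarrow> \<bar>f x\<bar> \<le> N" and n: "n \<ge> n0" for f N n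
  proof -
    have tailn: "(\<integral>y. indicator {y. r0 / 2 \<le> norm y} y * trunc n (norm (y::'a)) \<partial>lborel) \<le> Tl"
      unfolding Tl_def
    proof (rule integral_mono_AE)
      show "integrable lborel (\<lambda>y::'a. indicator {y. r0 / 2 \<le> norm y} y * trunc n (norm y))"
        by (rule T.kint_bdd[where B=1]) (auto split: split_indicator)
      show "integrable lborel (\<lambda>y::'a. indicator {y. r0 / 2 \<le> norm y} y * J (norm y))" using r0 by (intro tail_int) simp
      show "AE y::'a in lborel. indicator {y. r0 / 2 \<le> norm y} y * trunc n (norm y) \<le> indicator {y. r0 / 2 \<le> norm y} y * J (norm y)"
        using AE_ne0 by eventually_elim (auto intro!: mult_left_mono trunc_le)
    qed
    have K2n: "(\<integral>y. min 1 ((norm y)\<^sup>2) * trunc n (norm (y::'a)) \<partial>lborel) \<le> K2"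
      unfolding K2_def
    proof (rule integral_mono_AE)
      show "integrable lborel (\<lambda>y::'a. min 1 ((norm y)\<^sup>2) * trunc n (norm y))"
        by (rule T.kint_bdd[where B=1]) auto
      show "AE y::'a in lborel. min 1 ((norm y)\<^sup>2) * trunc n (norm y) \<le> min 1 ((norm y)\<^sup>2) * J (norm y)"
        using AE_ne0 by eventually_elim (auto intro!: mult_left_mono trunc_le)
    qed (rule levy)
    have small: "320 * lam \<le> lam + char_exp (trunc n) (b /\<^sub>R t0)" using n0[OF n] lam0 by linarith
    \<comment> \<open>\<open>R \<ge> 1\<close> is at least the truncation radius, so this tail does
      not see the truncation.\<close>
    have kapn: "\<kappa> \<le> (\<integral>y. indicator {y. R \<le> norm y} y * trunc n (norm (y::'a)) \<partial>lborel)"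
    proof -
      have "indicator {y. R \<le> norm y} y * trunc n (norm y) = indicator {y. R \<le> norm y} y * J (norm y)" for y :: 'a
      proof (cases "R \<le> norm y")
        case True
        have "1 / real (Suc n) \<le> 1" by simp
        then have "trunc n (norm y) = J (norm y)" using True R by (intro trunc_eq) linarith
        then show ?thesis by simp
      qed simp
      then show ?thesis unfolding \<kappa>_def by (simp only: order_refl)
    qed
    obtain v where v: "v \<in> borel_measurable borel" "\<And>x. x \<le> 0 \<Longrightarrow> v x = 0" "\<And>x y. x \<le> y \<Longrightarrow> v x \<le> v y"
      "\<And>x. v x \<le> 2" "\<And>x. v (2 * x) \<le> 4 * v x" "\<And>x. t0 \<le> x \<Longrightarrow> t0\<^sup>2 \<le> v x"
      "\<And>c x. r0 < norm (x - c) \<Longrightarrow> norm (x - c) < r0 + t0 \<Longrightarrow> T.Lk n (\<lambda>x. v (norm (x - c) - r0)) x \<le> - 1"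
      "\<And>e x. norm e = 1 \<Longrightarrow> 0 < x \<bullet> e \<Longrightarrow> x \<bullet> e < t0 \<Longrightarrow> T.Lk n (\<lambda>x. v (x \<bullet> e)) x \<le> - 1"
      "\<And>t. 0 < t \<Longrightarrow> v t \<le> sqrt (80 * lam / (lam + char_exp (trunc n) (b /\<^sub>R t))) + t\<^sup>2"
      by (rule T.barrier_exists[OF lam0 r0(1,2) Sg tailn Tl0 K2n big t0(1,2) small]) (rule that)
    interpret B: barrier_dirichlet "trunc n" b D R \<kappa> r0 t0 v
      by unfold_locales (use D_open R kap kapn r0 t0 r1(2)[OF r0(1,3)] v in auto)
    have fm: "(\<lambda>x. indicator D x * f x) \<in> borel_measurable borel"
    proof -
      have "f \<in> borel_measurable (restrict_space borel D)"
        using f D_open by (auto simp: in_C_def intro!: borel_measurable_continuous_on_restrict)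
      then have "(\<lambda>x. indicator D x *\<^sub>R f x) \<in> borel_measurable borel"
        using D_open by (subst (asm) borel_measurable_restrict_space_iff) auto
      then show ?thesis by simp
    qed
    obtain u B where u: "u \<in> borel_measurable borel" "\<And>x. \<bar>u x\<bar> \<le> B" "\<And>x. x \<notin> D \<Longrightarrow> u x = 0" "\<And>x. x \<in> D \<Longrightarrow> T.Lk n u x = f x"
      by (rule T.dirichlet_exists[OF borel_open[OF D_open] R(2) kap kapn fm N(2)]) (assumption | rule that)+
    have sol: "B.dirichlet_sol f N u" unfolding B.dirichlet_sol_def using u N by blast
    have "\<bar>u x\<bar> \<le> K * N" for x
    proof -
      have "\<bar>u x\<bar> \<le> 2 / \<kappa> * N" using B.sup_bound[OF sol, of x] by simp
      also have "\<dots> \<le> K * N" using K N by (intro mult_right_mono) auto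
      finally show ?thesis .
    qed
    moreover have "\<bar>u x - u y\<bar> \<le> K * N * (sqrt (80 * lam / (lam + char_exp (trunc n) (b /\<^sub>R dist x y))) + (dist x y)\<^sup>2)" if "x \<noteq> y" for x y
    proof -
      have "\<bar>u x - u y\<bar> \<le> B.K3 * N * v (dist x y)" by (rule B.modulus[OF sol])
      also have "\<dots> \<le> K * N * v (dist x y)"
        using K N B.v0 by (intro mult_right_mono) (auto simp: B.K3_def B.K1_def)
      also have "\<dots> \<le> K * N * (sqrt (80 * lam / (lam + char_exp (trunc n) (b /\<^sub>R dist x y))) + (dist x y)\<^sup>2)"
        using v(9)[of "dist x y"] that K N by (intro mult_left_mono) auto
      finally show ?thesis .
    qed
    ultimately show ?thesis using u by blast
  qed
  show thesis
    by (rule that[OF K(1) lam0, of n0]) (use main in blast)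
qed

section \<open>Passage to the limit in the truncation\<close>

definition omega :: "real \<Rightarrow> real \<Rightarrow> real" where
  "omega lam t = sqrt (80 * lam / (lam + char_exp J (b /\<^sub>R t))) + t\<^sup>2"

lemma char_exp_nonneg: "0 \<le> char_exp J (z::'a)"
  using char_exp_trunc_le[of 0 z] T.char_exp_nonneg[of 0 z] by linarith

lemma omega_small:
  assumes lam: "0 < lam" and e: "0 < e"
  obtains d where "0 < d" "\<And>t. 0 < t \<Longrightarrow> t < d \<Longrightarrow> omega lam t < e"
proof -
  define M where "M = 320 * lam / e\<^sup>2"
  have M0: "0 < M" using lam e by (simp add: M_def)
  obtain T where T: "0 < T" "T \<le> 1" "\<And>t. 0 < t \<Longrightarrow> t \<le> T \<Longrightarrow> M < char_exp J (b /\<^sub>R t)"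
    by (rule char_exp_large[of M]) (rule that)
  show thesis
  proof (rule that[of "min T (e / 2)"])
    show "0 < min T (e / 2)" using T e by simp
    fix t assume t: "0 < t" "t < min T (e / 2)"
    have ch: "M < char_exp J (b /\<^sub>R t)" using T(3)[of t] t by simp
    have "80 * lam / (lam + char_exp J (b /\<^sub>R t)) \<le> 80 * lam / M"
      using ch M0 lam by (intro divide_left_mono) auto
    also have "\<dots> = (e / 2)\<^sup>2" using lam e by (simp add: M_def power_divide)
    finally have "sqrt (80 * lam / (lam + char_exp J (b /\<^sub>R t))) \<le> e / 2"
      using e by (intro real_le_lsqrt) auto
    moreover have "t\<^sup>2 \<le> t * 1" unfolding power2_eq_square using t T by (intro mult_left_mono) auto
    ultimately show "omega lam t < e" using t unfolding omega_def by linarith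
  qed
qed

text \<open>A diagonal subsequence converges on a countable dense set. The moduli still depend on
  the truncation, but they converge pointwise to \<open>omega\<close>, which is small near 0; this
  extends the convergence to every point. The approximating solutions are part of the conclusion
  because the equation is passed to the limit only after mollification.\<close>

lemma limit_solution:
  obtains K lam where "0 < K" "0 < lam"
    "\<forall>f N. in_C D f \<longrightarrow> 0 < N \<longrightarrow> (\<forall>x\<in>D. \<bar>f x\<bar> \<le> N) \<longrightarrow>
      (\<exists>(U :: nat \<Rightarrow> 'a \<Rightarrow> real) u0 (m :: nat \<Rightarrow> nat). filterlim m at_top sequentially
        \<and> (\<forall>n. U n \<in> borel_measurable borel \<and> (\<forall>x. \<bar>U n x\<bar> \<le> K * N) \<and> (\<forall>x\<in>D. T.Lk (m n) (U n) x = f x))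
        \<and> (\<forall>x. (\<lambda>n. U n x) \<longlonglongrightarrow> u0 x) \<and> (\<forall>x. \<bar>u0 x\<bar> \<le> K * N) \<and> (\<forall>x. x \<notin> D \<longrightarrow> u0 x = 0)
        \<and> (\<forall>x y. x \<noteq> y \<longrightarrow> \<bar>u0 x - u0 y\<bar> \<le> K * N * omega lam (dist x y)))"
proof -
  obtain K lam n0 where K: "0 < K" and lam: "0 < lam" and main: "\<forall>f N. in_C D f \<longrightarrow> 0 < N \<longrightarrow> (\<forall>x\<in>D. \<bar>f x\<bar> \<le> N) \<longrightarrow>
      (\<forall>n\<ge>n0. \<exists>u. u \<in> borel_measurable borel \<and> (\<forall>x. \<bar>u x\<bar> \<le> K * N) \<and> (\<forall>x. x \<notin> D \<longrightarrow> u x = 0)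
        \<and> (\<forall>x\<in>D. T.Lk n u x = f x)
        \<and> (\<forall>x y. x \<noteq> y \<longrightarrow> \<bar>u x - u y\<bar> \<le> K * N * (sqrt (80 * lam / (lam + char_exp (trunc n) (b /\<^sub>R dist x y))) + (dist x y)\<^sup>2)))"
    by (rule uniform_approximations) (rule that)
  show thesis
  proof (rule that[OF K lam], intro allI impI)
    fix f N assume f: "in_C D f" and N: "0 < N" and fN: "\<forall>x\<in>D. \<bar>f x\<bar> \<le> N"
    define om where "om n t = sqrt (80 * lam / (lam + char_exp (trunc n) (b /\<^sub>R t))) + t\<^sup>2" for n t
    have "\<forall>n. \<exists>u. u \<in> borel_measurable borel \<and> (\<forall>x. \<bar>u x\<bar> \<le> K * N) \<and> (\<forall>x. x \<notin> D \<longrightarrow> u x = 0)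
        \<and> (\<forall>x\<in>D. T.Lk (n + n0) u x = f x)
        \<and> (\<forall>x y. x \<noteq> y \<longrightarrow> \<bar>u x - u y\<bar> \<le> K * N * om (n + n0) (dist x y))"
      unfolding om_def using main[rule_format, OF f N fN[rule_format]] by simp
    from choice[OF this] obtain V where V: "\<And>n. V n \<in> borel_measurable borel" "\<And>n x. \<bar>V n x\<bar> \<le> K * N"
      "\<And>n x. x \<notin> D \<Longrightarrow> V n x = 0" "\<And>n x. x \<in> D \<Longrightarrow> T.Lk (n + n0) (V n) x = f x"
      "\<And>n x y. x \<noteq> y \<Longrightarrow> \<bar>V n x - V n y\<bar> \<le> K * N * om (n + n0) (dist x y)" by blast
    obtain S :: "'a set" where S: "countable S" "\<And>X. open X \<Longrightarrow> X \<noteq> {} \<Longrightarrow> \<exists>d\<in>S. d \<in> X"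
      using countable_dense_exists by blast
    have Vn: "norm (V n x) \<le> K * N" for n x using V(2) by simp
    obtain r where r: "strict_mono (r::nat \<Rightarrow> nat)" "\<And>x. x \<in> S \<Longrightarrow> \<exists>l. (\<lambda>n. V (r n) x) \<longlonglongrightarrow> l"
      by (rule function_convergent_subsequence[OF S(1) Vn]) (rule that)
    define m where "m n = r n + n0" for n
    have mtop: "filterlim m at_top sequentially"
    proof (rule filterlim_at_top_mono[OF filterlim_ident])
      show "\<forall>\<^sub>F n in sequentially. n \<le> m n"
        using seq_suble[OF r(1)] by (intro always_eventually) (auto simp: m_def intro: trans_le_add1)
    qed
    have omlim: "(\<lambda>n. om (m n) t) \<longlonglongrightarrow> omega lam t" for t
    proof -
      have "(\<lambda>n. char_exp (trunc (m n)) (b /\<^sub>R t)) \<longlonglongrightarrow> char_exp J (b /\<^sub>R t)"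
        by (rule filterlim_compose[OF char_exp_tendsto mtop])
      moreover have "lam + char_exp J (b /\<^sub>R t) \<noteq> 0" using lam char_exp_nonneg[of "b /\<^sub>R t"] by linarith
      ultimately show ?thesis unfolding om_def omega_def by (intro tendsto_intros) auto
    qed
    have KN: "0 < K * N" using K N by simp
    have conv: "convergent (\<lambda>n. V (r n) x)" for x
    proof (rule Cauchy_convergent, rule metric_CauchyI)
      fix e :: real assume e: "0 < e"
      have e': "0 < e / (4 * (K * N))" using e KN by simp
      obtain d where d: "0 < d" "\<And>t. 0 < t \<Longrightarrow> t < d \<Longrightarrow> omega lam t < e / (4 * (K * N))"
        by (rule omega_small[OF lam e']) (rule that)
      obtain q where q: "q \<in> S" "q \<in> ball x d" using S(2)[of "ball x d"] d by auto
      have ev: "\<forall>\<^sub>F n in sequentially. \<bar>V (r n) x - V (r n) q\<bar> < e / 3"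
      proof (cases "x = q")
        case False
        then have "omega lam (dist x q) < e / (4 * (K * N))" using q d(2)[of "dist x q"] by simp
        then have "\<forall>\<^sub>F n in sequentially. om (m n) (dist x q) < e / (4 * (K * N))"
          by (rule order_tendstoD(2)[OF omlim])
        then show ?thesis
        proof eventually_elim
          case (elim n)
          have "\<bar>V (r n) x - V (r n) q\<bar> \<le> (K * N) * om (m n) (dist x q)" using V(5)[OF False] by (simp add: m_def)
          also have "\<dots> \<le> (K * N) * (e / (4 * (K * N)))" using elim KN by (intro mult_left_mono) auto
          also have "\<dots> = e / 4" using K N by simp
          finally show ?case using e by linarith
        qed
      qed (use e in simp)
      obtain l where "(\<lambda>n. V (r n) q) \<longlonglongrightarrow> l" using r(2)[OF q(1)] by blast
      then have "Cauchy (\<lambda>n. V (r n) q)" by (rule LIMSEQ_imp_Cauchy)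
      then obtain M1 where M1: "\<And>i j. i \<ge> M1 \<Longrightarrow> j \<ge> M1 \<Longrightarrow> dist (V (r i) q) (V (r j) q) < e / 3"
        using metric_CauchyD[of "\<lambda>n. V (r n) q" "e / 3"] e by auto
      obtain M2 where M2: "\<And>n. n \<ge> M2 \<Longrightarrow> \<bar>V (r n) x - V (r n) q\<bar> < e / 3"
        using ev by (auto simp: eventually_sequentially)
      show "\<exists>M. \<forall>i\<ge>M. \<forall>j\<ge>M. dist (V (r i) x) (V (r j) x) < e"
      proof (intro exI allI impI)
        fix i j assume "i \<ge> max M1 M2" "j \<ge> max M1 M2"
        then have "dist (V (r i) q) (V (r j) q) < e / 3" "\<bar>V (r i) x - V (r i) q\<bar> < e / 3" "\<bar>V (r j) x - V (r j) q\<bar> < e / 3"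
          using M1[of i j] M2[of i] M2[of j] by auto
        then show "dist (V (r i) x) (V (r j) x) < e" unfolding dist_real_def by linarith
      qed
    qed
    define u0 where "u0 x = lim (\<lambda>n. V (r n) x)" for x
    have u0: "(\<lambda>n. V (r n) x) \<longlonglongrightarrow> u0 x" for x
      using conv[of x] unfolding u0_def by (simp add: convergent_LIMSEQ_iff)
    have "\<bar>u0 x\<bar> \<le> K * N" for x
      by (rule LIMSEQ_le_const2[OF tendsto_rabs[OF u0]]) (use V(2) in auto)
    moreover have "u0 x = 0" if "x \<notin> D" for x
      using u0[of x] V(3)[OF that] by (simp add: LIMSEQ_const_iff)
    moreover have "\<bar>u0 x - u0 y\<bar> \<le> K * N * omega lam (dist x y)" if "x \<noteq> y" for x y
    proof (rule LIMSEQ_le)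
      show "(\<lambda>n. \<bar>V (r n) x - V (r n) y\<bar>) \<longlonglongrightarrow> \<bar>u0 x - u0 y\<bar>" by (intro tendsto_intros u0)
      show "(\<lambda>n. K * N * om (m n) (dist x y)) \<longlonglongrightarrow> K * N * omega lam (dist x y)" by (intro tendsto_intros omlim)
      show "\<exists>M. \<forall>n\<ge>M. \<bar>V (r n) x - V (r n) y\<bar> \<le> K * N * om (m n) (dist x y)"
        using V(5)[OF that] by (auto simp: m_def)
    qed
    ultimately show "\<exists>(U :: nat \<Rightarrow> 'a \<Rightarrow> real) u0 (m :: nat \<Rightarrow> nat). filterlim m at_top sequentially
        \<and> (\<forall>n. U n \<in> borel_measurable borel \<and> (\<forall>x. \<bar>U n x\<bar> \<le> K * N) \<and> (\<forall>x\<in>D. T.Lk (m n) (U n) x = f x))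
        \<and> (\<forall>x. (\<lambda>n. U n x) \<longlonglongrightarrow> u0 x) \<and> (\<forall>x. \<bar>u0 x\<bar> \<le> K * N) \<and> (\<forall>x. x \<notin> D \<longrightarrow> u0 x = 0)
        \<and> (\<forall>x y. x \<noteq> y \<longrightarrow> \<bar>u0 x - u0 y\<bar> \<le> K * N * omega lam (dist x y))"
      using V u0 mtop
      by (intro exI[of _ "\<lambda>n. V (r n)"] exI[of _ u0] exI[of _ m]) (auto simp: m_def)
  qed
qed

end

section \<open>Mollification\<close>

text \<open>A bump of class C^(1,1) only: bounded second differences are enough, and the square of a
  positive part permits explicit Taylor estimates. It is not normalized; \<open>bump_mass\<close> is
  divided out at the end.\<close>

definition bump :: "real \<Rightarrow> 'a::euclidean_space \<Rightarrow> real" where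
  "bump \<delta> z = (max 0 (\<delta>\<^sup>2 - (norm z)\<^sup>2))\<^sup>2"

definition bump_mass :: "'a::euclidean_space itself \<Rightarrow> real \<Rightarrow> real" where
  "bump_mass _ \<delta> = (\<integral>z. bump \<delta> (z::'a) \<partial>lborel)"

definition moll :: "real \<Rightarrow> ('a::euclidean_space \<Rightarrow> real) \<Rightarrow> 'a \<Rightarrow> real" where
  "moll \<delta> u x = (\<integral>z. bump \<delta> z * u (x + z) \<partial>lborel)"

lemma bump_measurable [measurable]: "bump \<delta> \<in> borel_measurable borel"
  unfolding bump_def[abs_def] by measurable

lemma bump_nonneg: "0 \<le> bump \<delta> z"
  by (simp add: bump_def)

lemma bump_zero: "0 < \<delta> \<Longrightarrow> \<delta> \<le> norm z \<Longrightarrow> bump \<delta> z = 0"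
  using power_mono[of \<delta> "norm z" 2] by (simp add: bump_def)

lemma bump_le: "bump \<delta> z \<le> (\<delta>\<^sup>2)\<^sup>2"
  unfolding bump_def by (intro power_mono) auto

lemma bump_integrable:
  assumes "0 < \<delta>"
  shows "integrable lborel (bump \<delta> :: 'a::euclidean_space \<Rightarrow> real)"
proof -
  have "integrable lborel (\<lambda>z::'a. indicator (ball 0 \<delta>) z * bump \<delta> z)"
  proof (rule integrable_bounded_mult[OF integrable_indicator_ball, where B="(\<delta>\<^sup>2)\<^sup>2"])
    show "\<bar>bump \<delta> z\<bar> \<le> (\<delta>\<^sup>2)\<^sup>2" for z :: 'a
      by (simp only: abs_of_nonneg[OF bump_nonneg] bump_le)
  qed measurable
  moreover have "(\<lambda>z::'a. indicator (ball 0 \<delta>) z * bump \<delta> z) = bump \<delta>"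
    using bump_zero[OF assms] by (auto simp: fun_eq_iff not_less split: split_indicator)
  ultimately show ?thesis by simp
qed

lemma bump_mass_pos:
  assumes "0 < \<delta>"
  shows "0 < bump_mass TYPE('a::euclidean_space) \<delta>"
proof -
  have "0 < (\<delta>\<^sup>2 / 2)\<^sup>2 * measure lborel (ball (0::'a) (\<delta> / 2))"
    using content_ball_pos[of "\<delta> / 2" "0::'a"] assms by simp
  also have "\<dots> = (\<integral>z. (\<delta>\<^sup>2 / 2)\<^sup>2 * indicator (ball (0::'a) (\<delta> / 2)) z \<partial>lborel)" by simp
  also have "\<dots> \<le> bump_mass TYPE('a) \<delta>"
    unfolding bump_mass_def
  proof (rule integral_mono)
    show "integrable lborel (\<lambda>z. (\<delta>\<^sup>2 / 2)\<^sup>2 * indicator (ball (0::'a) (\<delta> / 2)) z)"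
      using integrable_indicator_ball[of "0::'a" "\<delta> / 2"] by simp
    fix z :: 'a
    show "(\<delta>\<^sup>2 / 2)\<^sup>2 * indicator (ball 0 (\<delta> / 2)) z \<le> bump \<delta> z"
    proof (cases "norm z < \<delta> / 2")
      case True
      have "(norm z)\<^sup>2 \<le> (\<delta> / 2)\<^sup>2" using True by (intro power_mono) auto
      then have "(norm z)\<^sup>2 \<le> \<delta>\<^sup>2 / 4" by (simp add: power_divide)
      then have "\<delta>\<^sup>2 / 2 \<le> \<delta>\<^sup>2 - (norm z)\<^sup>2" using zero_le_power2[of "norm z"] by linarith
      then have "(\<delta>\<^sup>2 / 2)\<^sup>2 \<le> (max 0 (\<delta>\<^sup>2 - (norm z)\<^sup>2))\<^sup>2" by (intro power_mono max.coboundedI2) auto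
      then show ?thesis using True by (simp add: bump_def)
    qed (simp add: bump_nonneg)
  qed (rule bump_integrable[OF assms])
  finally show ?thesis .
qed

text \<open>The derivative of the squared positive part is Lipschitz with constant 2, also across
  the kink.\<close>

lemma pos_part_square_taylor:
  fixes a c :: real
  shows "\<bar>(max 0 c)\<^sup>2 - (max 0 a)\<^sup>2 - 2 * max 0 a * (c - a)\<bar> \<le> (c - a)\<^sup>2"
proof -
  consider "0 \<le> a" "0 \<le> c" | "0 \<le> a" "c < 0" | "a < 0" "0 \<le> c" | "a < 0" "c < 0" by linarith
  then show ?thesis
  proof cases
    case 1
    have "c\<^sup>2 - a\<^sup>2 - 2 * a * (c - a) = (c - a)\<^sup>2" by (simp add: power2_eq_square algebra_simps)
    then show ?thesis using 1 by simp
  next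
    case 2
    have ac: "a * c \<le> 0" using 2 by (simp add: mult_nonneg_nonpos)
    have eq: "(c - a)\<^sup>2 = c\<^sup>2 - 2 * (a * c) + a\<^sup>2" "0\<^sup>2 - a\<^sup>2 - 2 * a * (c - a) = a\<^sup>2 - 2 * (a * c)"
      by (simp_all add: power2_eq_square algebra_simps)
    have m: "max 0 c = 0" "max 0 a = a" using 2 by auto
    show ?thesis unfolding m eq using ac zero_le_power2[of a] zero_le_power2[of c] by linarith
  next
    case 3
    then have m: "max 0 c = c" "max 0 a = 0" by auto
    have "c\<^sup>2 \<le> (c - a)\<^sup>2" using 3 by (intro power_mono) auto
    then show ?thesis unfolding m by simp
  qed simp
qed

text \<open>The increment of \<open>\<delta>\<^sup>2 - (norm z)\<^sup>2\<close> is at most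
  \<open>5 * norm y\<close>, which gives 25. The other 2 comes from the quadratic part of that
  increment, multiplied by twice a positive part of at most 1. For \<open>norm z \<ge> 2\<close>
  every term vanishes.\<close>

lemma bump_taylor:
  fixes z y :: "'a::euclidean_space"
  assumes d: "0 < \<delta>" "\<delta> \<le> 1" and y: "norm y \<le> 1"
  shows "\<bar>bump \<delta> (z - y) - bump \<delta> z - 4 * max 0 (\<delta>\<^sup>2 - (norm z)\<^sup>2) * (z \<bullet> y)\<bar> \<le> indicator (ball 0 2) z * (27 * (norm y)\<^sup>2)"
proof (cases "norm z < 2")
  case True
  define a c where "a = \<delta>\<^sup>2 - (norm z)\<^sup>2" and "c = \<delta>\<^sup>2 - (norm (z - y))\<^sup>2"
  have ca: "c - a = 2 * (z \<bullet> y) - (norm y)\<^sup>2"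
    unfolding a_def c_def power2_norm_eq_inner by (simp add: inner_diff_left inner_diff_right inner_commute)
  have zy: "\<bar>z \<bullet> y\<bar> \<le> 2 * norm y"
    using Cauchy_Schwarz_ineq2[of z y] mult_right_mono[of "norm z" 2 "norm y"] True by simp
  have y2: "(norm y)\<^sup>2 \<le> norm y" unfolding power2_eq_square using y mult_left_le[of "norm y" "norm y"] by simp
  have "\<bar>c - a\<bar> \<le> 5 * norm y" unfolding ca using zy y2 zero_le_power2[of "norm y"] by linarith
  then have "\<bar>c - a\<bar>\<^sup>2 \<le> (5 * norm y)\<^sup>2" by (intro power_mono) auto
  then have ca2: "(c - a)\<^sup>2 \<le> 25 * (norm y)\<^sup>2" by (simp add: power_mult_distrib)
  have "\<delta>\<^sup>2 \<le> 1" using d by (simp add: power_le_one)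
  then have a1: "max 0 a \<le> 1" "0 \<le> max 0 a" unfolding a_def using zero_le_power2[of "norm z"] by linarith+
  have "bump \<delta> (z - y) - bump \<delta> z - 4 * max 0 a * (z \<bullet> y)
      = ((max 0 c)\<^sup>2 - (max 0 a)\<^sup>2 - 2 * max 0 a * (c - a)) - 2 * max 0 a * (norm y)\<^sup>2"
    unfolding ca by (simp add: bump_def a_def c_def algebra_simps)
  moreover have "max 0 a * (norm y)\<^sup>2 \<le> 1 * (norm y)\<^sup>2" using a1 by (intro mult_right_mono) auto
  moreover have "0 \<le> max 0 a * (norm y)\<^sup>2" using a1 by (intro mult_nonneg_nonneg) auto
  ultimately have "\<bar>bump \<delta> (z - y) - bump \<delta> z - 4 * max 0 a * (z \<bullet> y)\<bar> \<le> 27 * (norm y)\<^sup>2"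
    using pos_part_square_taylor[of c a] ca2 by linarith
  then show ?thesis using True by (simp add: a_def)
next
  case False
  then have "\<delta> \<le> norm z" using d by simp
  moreover have "\<delta> \<le> norm (z - y)" using norm_triangle_ineq2[of z y] False y d by linarith
  moreover have "\<delta>\<^sup>2 \<le> (norm z)\<^sup>2" using \<open>\<delta> \<le> norm z\<close> d by (intro power_mono) auto
  ultimately show ?thesis using d by (simp add: bump_zero)
qed

lemma moll_integrable:
  fixes u :: "'a::euclidean_space \<Rightarrow> real"
  assumes "0 < \<delta>" "u \<in> borel_measurable borel" "\<And>x. \<bar>u x\<bar> \<le> B"
  shows "integrable lborel (\<lambda>z. bump \<delta> z * u (x + z))"
  by (rule integrable_bounded_mult[OF bump_integrable[OF assms(1)], where B=B]) (use assms(2,3) in auto)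

lemma moll_measurable:
  fixes u :: "'a::euclidean_space \<Rightarrow> real"
  assumes [measurable]: "u \<in> borel_measurable borel"
  shows "moll \<delta> u \<in> borel_measurable borel"
  unfolding moll_def[abs_def] by measurable

lemma moll_abs:
  fixes u :: "'a::euclidean_space \<Rightarrow> real"
  assumes d: "0 < \<delta>" and um: "u \<in> borel_measurable borel" and B: "\<And>x. \<bar>u x\<bar> \<le> B"
  shows "\<bar>moll \<delta> u x\<bar> \<le> bump_mass TYPE('a) \<delta> * B"
proof -
  have "\<bar>moll \<delta> u x\<bar> \<le> (\<integral>z. \<bar>bump \<delta> z * u (x + z)\<bar> \<partial>lborel)"
    unfolding moll_def by (rule integral_abs_bound)
  also have "\<dots> \<le> (\<integral>z. bump \<delta> (z::'a) * B \<partial>lborel)"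
    using integrable_abs[OF moll_integrable[OF d um B, of x]] bump_integrable[OF d] B
    by (intro integral_mono) (auto simp: abs_mult bump_nonneg intro!: mult_left_mono)
  finally show ?thesis by (simp add: bump_mass_def)
qed

text \<open>The increment is moved from \<open>u\<close> to the bump, so \<open>u\<close> need only
  be bounded and measurable; \<open>p\<close> is assembled from its components along
  \<open>Basis\<close>. The constant is independent of \<open>x\<close> and involves
  \<open>u\<close> only through \<open>B\<close>.\<close>

lemma moll_taylor:
  fixes u :: "'a::euclidean_space \<Rightarrow> real"
  assumes d: "0 < \<delta>" "\<delta> \<le> 1" and um [measurable]: "u \<in> borel_measurable borel" and B: "\<And>x. \<bar>u x\<bar> \<le> B"
  shows "\<exists>p. \<forall>y. norm y \<le> 1 \<longrightarrow> \<bar>moll \<delta> u (x + y) - moll \<delta> u x - p \<bullet> y\<bar> \<le> 27 * measure lborel (ball (0::'a) 2) * B * (norm y)\<^sup>2"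
proof -
  define h where "h z = 4 * max 0 (\<delta>\<^sup>2 - (norm z)\<^sup>2)" for z :: 'a
  have hm [measurable]: "h \<in> borel_measurable borel" unfolding h_def by measurable
  have hz: "h z = 0" if "\<delta> \<le> norm z" for z
    using power_mono[OF that, of 2] d by (simp add: h_def)
  have hb: "\<bar>h z * (z \<bullet> y)\<bar> \<le> 4 * norm y" for z y
  proof (cases "norm z < \<delta>")
    case True
    have "\<delta>\<^sup>2 \<le> 1" using d by (simp add: power_le_one)
    then have "\<delta>\<^sup>2 - (norm z)\<^sup>2 \<le> 1" using zero_le_power2[of "norm z"] by linarith
    then have h4: "0 \<le> h z" "h z \<le> 4" by (simp_all add: h_def)
    have "\<bar>z \<bullet> y\<bar> \<le> norm z * norm y" by (rule Cauchy_Schwarz_ineq2)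
    also have "\<dots> \<le> 1 * norm y" using True d by (intro mult_right_mono) auto
    finally have "\<bar>z \<bullet> y\<bar> \<le> norm y" by simp
    then show ?thesis unfolding abs_mult using h4 by (intro mult_mono) auto
  qed (simp add: hz)
  have hi: "integrable lborel (\<lambda>z. (h z * (z \<bullet> y)) * u (x + z))" for y
  proof -
    have "integrable lborel (\<lambda>z. indicator (ball 0 1) z * ((h z * (z \<bullet> y)) * u (x + z)))"
    proof (rule integrable_bounded_mult[OF integrable_indicator_ball, where B="4 * norm y * B"])
      show "\<bar>(h z * (z \<bullet> y)) * u (x + z)\<bar> \<le> 4 * norm y * B" for z
        unfolding abs_mult[of _ "u (x + z)"] using hb B by (intro mult_mono) auto
    qed measurable
    moreover have "(\<lambda>z. indicator (ball 0 1) z * ((h z * (z \<bullet> y)) * u (x + z))) = (\<lambda>z. (h z * (z \<bullet> y)) * u (x + z))"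
      using hz d by (auto simp: fun_eq_iff split: split_indicator)
    ultimately show ?thesis by simp
  qed
  define p where "p = (\<Sum>i\<in>Basis. (\<integral>z. (h z * (z \<bullet> i)) * u (x + z) \<partial>lborel) *\<^sub>R i)"
  have py: "p \<bullet> y = (\<integral>z. (h z * (z \<bullet> y)) * u (x + z) \<partial>lborel)" for y
  proof -
    have "(\<integral>z. (h z * (z \<bullet> y)) * u (x + z) \<partial>lborel) = (\<integral>z. (\<Sum>i\<in>Basis. (y \<bullet> i) * ((h z * (z \<bullet> i)) * u (x + z))) \<partial>lborel)"
      by (intro Bochner_Integration.integral_cong refl)
         (subst euclidean_inner[of _ y], simp add: sum_distrib_left sum_distrib_right mult_ac)
    also have "\<dots> = (\<Sum>i\<in>Basis. (y \<bullet> i) * (\<integral>z. (h z * (z \<bullet> i)) * u (x + z) \<partial>lborel))"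
      using hi by (subst Bochner_Integration.integral_sum) auto
    also have "\<dots> = p \<bullet> y" by (simp add: p_def inner_sum_left inner_commute[of y] mult.commute)
    finally show ?thesis by simp
  qed
  have "\<bar>moll \<delta> u (x + y) - moll \<delta> u x - p \<bullet> y\<bar> \<le> 27 * measure lborel (ball (0::'a) 2) * B * (norm y)\<^sup>2" if y: "norm y \<le> 1" for y
  proof -
    have i1: "integrable lborel (\<lambda>z. bump \<delta> (z - y) * u (x + z))"
      using integrable_lborel_translate[OF moll_integrable[OF d(1) um B, of "x + y"], of "- y"] by (simp add: algebra_simps)
    have "moll \<delta> u (x + y) = (\<integral>z. bump \<delta> (z - y) * u (x + z) \<partial>lborel)"
      unfolding moll_def using integral_lborel_translate[of "\<lambda>z. bump \<delta> z * u (x + y + z)" "- y"]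
      by (simp add: algebra_simps)
    then have eq: "moll \<delta> u (x + y) - moll \<delta> u x - p \<bullet> y
        = (\<integral>z. bump \<delta> (z - y) * u (x + z) - bump \<delta> z * u (x + z) - (h z * (z \<bullet> y)) * u (x + z) \<partial>lborel)"
      using i1 moll_integrable[OF d(1) um B, of x] hi[of y] by (simp add: moll_def py)
    have "\<bar>moll \<delta> u (x + y) - moll \<delta> u x - p \<bullet> y\<bar> \<le> (\<integral>z. \<bar>bump \<delta> (z - y) * u (x + z) - bump \<delta> z * u (x + z) - (h z * (z \<bullet> y)) * u (x + z)\<bar> \<partial>lborel)"
      unfolding eq by (rule integral_abs_bound)
    also have "\<dots> \<le> (\<integral>z. 27 * (norm y)\<^sup>2 * B * indicator (ball (0::'a) 2) z \<partial>lborel)"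
    proof (rule integral_mono)
      show "integrable lborel (\<lambda>z. \<bar>bump \<delta> (z - y) * u (x + z) - bump \<delta> z * u (x + z) - (h z * (z \<bullet> y)) * u (x + z)\<bar>)"
        by (intro integrable_abs Bochner_Integration.integrable_diff i1 moll_integrable[OF d(1) um B] hi)
      show "integrable lborel (\<lambda>z. 27 * (norm y)\<^sup>2 * B * indicator (ball (0::'a) 2) z)"
        using integrable_indicator_ball[of "0::'a" 2] by simp
      fix z :: 'a
      have "\<bar>bump \<delta> (z - y) * u (x + z) - bump \<delta> z * u (x + z) - (h z * (z \<bullet> y)) * u (x + z)\<bar>
         = \<bar>bump \<delta> (z - y) - bump \<delta> z - h z * (z \<bullet> y)\<bar> * \<bar>u (x + z)\<bar>"
        unfolding abs_mult[symmetric] by (simp add: algebra_simps)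
      also have "\<dots> \<le> (indicator (ball 0 2) z * (27 * (norm y)\<^sup>2)) * B"
        using bump_taylor[OF d y, of z] B[of "x + z"] by (intro mult_mono) (auto simp: h_def)
      finally show "\<bar>bump \<delta> (z - y) * u (x + z) - bump \<delta> z * u (x + z) - (h z * (z \<bullet> y)) * u (x + z)\<bar>
         \<le> 27 * (norm y)\<^sup>2 * B * indicator (ball (0::'a) 2) z" by (simp add: mult_ac)
    qed
    also have "\<dots> = 27 * measure lborel (ball (0::'a) 2) * B * (norm y)\<^sup>2" by simp
    finally show ?thesis .
  qed
  then show ?thesis by blast
qed

lemma taylor_second_difference:
  fixes U :: "'a::euclidean_space \<Rightarrow> real"
  assumes "\<And>y. norm y \<le> 1 \<Longrightarrow> \<bar>U (x + y) - U x - p \<bullet> y\<bar> \<le> C * (norm y)\<^sup>2" and "norm y \<le> 1"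
  shows "\<bar>U (x + y) + U (x - y) - 2 * U x\<bar> \<le> 2 * C * (norm y)\<^sup>2"
  using assms(1)[of y] assms(1)[of "- y"] assms(2) by simp

lemma moll_second_difference:
  fixes u :: "'a::euclidean_space \<Rightarrow> real"
  assumes d: "0 < \<delta>" "\<delta> \<le> 1" and um: "u \<in> borel_measurable borel" and B: "\<And>x. \<bar>u x\<bar> \<le> B"
  shows "\<bar>moll \<delta> u (x + y) + moll \<delta> u (x - y) - 2 * moll \<delta> u x\<bar>
    \<le> (54 * measure lborel (ball (0::'a) 2) * B + 4 * bump_mass TYPE('a) \<delta> * B) * min 1 (norm y ^ 2)"
proof -
  let ?C = "27 * measure lborel (ball (0::'a) 2) * B"
  have B0: "0 \<le> B" using B[of 0] by linarith
  have m0: "0 \<le> bump_mass TYPE('a) \<delta> * B" using bump_mass_pos[OF d(1), where 'a='a] B0 by simp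
  have v0: "0 \<le> measure lborel (ball (0::'a) 2) * B" using B0 by simp
  show ?thesis
  proof (cases "norm y \<le> 1")
    case True
    obtain p where "\<forall>y. norm y \<le> 1 \<longrightarrow> \<bar>moll \<delta> u (x + y) - moll \<delta> u x - p \<bullet> y\<bar> \<le> ?C * (norm y)\<^sup>2"
      using moll_taylor[OF d um B] by blast
    then have "\<bar>moll \<delta> u (x + y) + moll \<delta> u (x - y) - 2 * moll \<delta> u x\<bar> \<le> 2 * ?C * (norm y)\<^sup>2"
      using True by (intro taylor_second_difference[where p=p]) auto
    also have "\<dots> \<le> (54 * measure lborel (ball (0::'a) 2) * B + 4 * bump_mass TYPE('a) \<delta> * B) * (norm y)\<^sup>2"
      using m0 by (intro mult_right_mono) (auto simp: mult_ac)
    also have "(norm y)\<^sup>2 = min 1 (norm y ^ 2)" using True by (simp add: power_le_one)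
    finally show ?thesis .
  next
    case False
    then have "1 \<le> norm y ^ 2" by simp
    then have m1: "min 1 (norm y ^ 2) = 1" by simp
    have "\<bar>moll \<delta> u (x + y) + moll \<delta> u (x - y) - 2 * moll \<delta> u x\<bar> \<le> 4 * (bump_mass TYPE('a) \<delta> * B)"
      using moll_abs[OF d(1) um B, of "x + y"] moll_abs[OF d(1) um B, of "x - y"] moll_abs[OF d(1) um B, of x] by linarith
    then show ?thesis unfolding m1 using v0 by simp
  qed
qed

lemma (in radial_kernel) Lk_moll:
  fixes u :: "'a \<Rightarrow> real"
  assumes d: "0 < \<delta>" and um [measurable]: "u \<in> borel_measurable borel" and B: "\<And>x. \<bar>u x\<bar> \<le> B"
  shows "Lk (moll \<delta> u) x = (\<integral>z. bump \<delta> z * Lk u (x + z) \<partial>lborel)"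
proof -
  let ?F = "\<lambda>y z. (bump \<delta> z * (u (x + z + y) - u (x + z))) * k (norm y)"
  have bi: "integrable lborel (bump \<delta> :: 'a \<Rightarrow> real)" by (rule bump_integrable[OF d])
  have "integrable (lborel \<Otimes>\<^sub>M lborel) (\<lambda>(y::'a, z::'a). k (norm y) * (2 * B * bump \<delta> z))"
    by (rule lborel_pair.Fubini_integrable) (use bi kint in \<open>auto simp: abs_mult\<close>)
  then have Fi: "integrable (lborel \<Otimes>\<^sub>M lborel) (case_prod ?F)"
  proof (rule Bochner_Integration.integrable_bound)
    have "\<bar>?F y z\<bar> \<le> \<bar>k (norm y) * (2 * B * bump \<delta> z)\<bar>" for y z
    proof -
      have "\<bar>u (x + z + y) - u (x + z)\<bar> \<le> 2 * B" using B[of "x + z + y"] B[of "x + z"] by linarith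
      then have "(bump \<delta> z * \<bar>u (x + z + y) - u (x + z)\<bar>) * k (norm y) \<le> (bump \<delta> z * (2 * B)) * k (norm y)"
        using k0 bump_nonneg by (intro mult_right_mono mult_left_mono)
      also have "\<dots> \<le> \<bar>k (norm y) * (2 * B * bump \<delta> z)\<bar>" by (simp add: mult_ac abs_ge_self)
      finally show ?thesis using k0[of "norm y"] bump_nonneg[of \<delta> z] by (simp add: abs_mult)
    qed
    then show "AE p in lborel \<Otimes>\<^sub>M lborel. norm (case p of (y, z) \<Rightarrow> ?F y z) \<le> norm (case p of (y, z) \<Rightarrow> k (norm y) * (2 * B * bump \<delta> z))"
      by auto
  qed measurable
  have "Lk (moll \<delta> u) x = (\<integral>y. (\<integral>z. ?F y z \<partial>lborel) \<partial>lborel)"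
    unfolding Lk_def
  proof (rule Bochner_Integration.integral_cong[OF refl])
    fix y :: 'a
    have "moll \<delta> u (x + y) - moll \<delta> u x = (\<integral>z. bump \<delta> z * u (x + y + z) - bump \<delta> z * u (x + z) \<partial>lborel)"
      unfolding moll_def using moll_integrable[OF d um B] by simp
    also have "\<dots> = (\<integral>z. bump \<delta> z * (u (x + z + y) - u (x + z)) \<partial>lborel)"
      by (simp add: right_diff_distrib add_ac)
    finally show "(moll \<delta> u (x + y) - moll \<delta> u x) * k (norm y) = (\<integral>z. ?F y z \<partial>lborel)" by simp
  qed
  also have "\<dots> = (\<integral>z. (\<integral>y. ?F y z \<partial>lborel) \<partial>lborel)"
    using lborel_pair.Fubini_integral[OF Fi] by simp
  also have "\<dots> = (\<integral>z. bump \<delta> z * Lk u (x + z) \<partial>lborel)"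
    by (simp add: Lk_def mult.assoc)
  finally show ?thesis .
qed

lemma moll_close:
  fixes g :: "'a::euclidean_space \<Rightarrow> real"
  assumes d: "0 < \<delta>" and gm [measurable]: "g \<in> borel_measurable borel" and B: "\<And>x. \<bar>g x\<bar> \<le> B"
    and close: "\<And>z. norm z < \<delta> \<Longrightarrow> \<bar>g (x + z) - g x\<bar> \<le> \<tau>"
  shows "\<bar>moll \<delta> g x / bump_mass TYPE('a) \<delta> - g x\<bar> \<le> \<tau>"
proof -
  let ?m = "bump_mass TYPE('a) \<delta>"
  have m: "0 < ?m" by (rule bump_mass_pos[OF d])
  have gi: "integrable lborel (\<lambda>z. bump \<delta> z * g (x + z))" by (rule moll_integrable[OF d gm B])
  have bi: "integrable lborel (bump \<delta> :: 'a \<Rightarrow> real)" by (rule bump_integrable[OF d])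
  have eq: "moll \<delta> g x - ?m * g x = (\<integral>z. bump \<delta> z * g (x + z) - bump \<delta> z * g x \<partial>lborel)"
    using gi bi by (simp add: moll_def bump_mass_def)
  have "\<bar>moll \<delta> g x - ?m * g x\<bar> \<le> (\<integral>z. \<bar>bump \<delta> z * g (x + z) - bump \<delta> z * g x\<bar> \<partial>lborel)"
    unfolding eq by (rule integral_abs_bound)
  also have "\<dots> \<le> (\<integral>z. bump \<delta> (z::'a) * \<tau> \<partial>lborel)"
  proof (rule integral_mono)
    show "integrable lborel (\<lambda>z. \<bar>bump \<delta> z * g (x + z) - bump \<delta> z * g x\<bar>)" using gi bi by auto
    show "integrable lborel (\<lambda>z. bump \<delta> (z::'a) * \<tau>)" using bi by simp
    fix z :: 'a
    show "\<bar>bump \<delta> z * g (x + z) - bump \<delta> z * g x\<bar> \<le> bump \<delta> z * \<tau>"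
    proof (cases "norm z < \<delta>")
      case True
      have "\<bar>bump \<delta> z * g (x + z) - bump \<delta> z * g x\<bar> = bump \<delta> z * \<bar>g (x + z) - g x\<bar>"
        using bump_nonneg[of \<delta> z] by (simp flip: right_diff_distrib add: abs_mult)
      then show ?thesis using close[OF True] bump_nonneg[of \<delta> z] by (simp add: mult_left_mono)
    qed (use bump_zero[OF d, of z] in \<open>simp add: not_less\<close>)
  qed
  also have "\<dots> = ?m * \<tau>" by (simp add: bump_mass_def)
  finally have "\<bar>moll \<delta> g x - ?m * g x\<bar> \<le> ?m * \<tau>" .
  moreover have "moll \<delta> g x / ?m - g x = (moll \<delta> g x - ?m * g x) / ?m" using m by (simp add: diff_divide_distrib)
  ultimately show ?thesis using m by (simp add: pos_divide_le_eq mult.commute)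
qed

lemma Lop_cdiv: "Lop J (\<lambda>x. u x / c) x = Lop J u x / c"
proof -
  have "(\<lambda>y. (u (x + y) / c + u (x - y) / c - 2 * (u x / c)) * J (norm y)) = (\<lambda>y. ((u (x + y) + u (x - y) - 2 * u x) * J (norm y)) / c)"
    by (auto simp: fun_eq_iff diff_divide_distrib add_divide_distrib left_diff_distrib distrib_right)
  then show ?thesis by (simp add: Lop_def)
qed

section \<open>The equation for the mollified limit\<close>

context levy_dirichlet
begin

text \<open>Mollification commutes with \<open>Lk\<close>, so each mollified approximation has
  exactly the mollified right side at \<open>x\<close>. Its second differences are bounded by a
  multiple of \<open>min 1 (norm y ^ 2)\<close> uniformly in \<open>n\<close>, and dominated
  convergence passes to the limit in solution and kernel at once. The only error left is the
  oscillation of \<open>f\<close> within \<open>\<delta>\<close>.\<close>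

lemma smooth_equation:
  assumes f: "in_C D f" and N: "\<And>x. x \<in> D \<Longrightarrow> \<bar>f x\<bar> \<le> N" and mt: "filterlim m at_top sequentially"
    and Um: "\<And>n. U n \<in> borel_measurable borel" and Ub: "\<And>n x. \<bar>U n x\<bar> \<le> B"
    and Ueq: "\<And>n x. x \<in> D \<Longrightarrow> T.Lk (m n) (U n) x = f x"
    and lim: "\<And>x. (\<lambda>n. U n x) \<longlonglongrightarrow> u0 x" and u0b: "\<And>x. \<bar>u0 x\<bar> \<le> B"
    and d: "0 < \<delta>" "\<delta> \<le> 1" and x: "ball x \<delta> \<subseteq> D"
    and close: "\<And>z. norm z < \<delta> \<Longrightarrow> \<bar>f (x + z) - f x\<bar> \<le> \<tau>"
  shows "\<bar>Lop J (\<lambda>x. moll \<delta> u0 x / bump_mass TYPE('a) \<delta>) x - f x\<bar> \<le> \<tau>"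
proof -
  note Um [measurable]
  have u0m [measurable]: "u0 \<in> borel_measurable borel"
    by (rule borel_measurable_LIMSEQ_real[OF lim]) (use Um in auto)
  define g where "g x = indicator D x * f x" for x
  have gm: "g \<in> borel_measurable borel"
  proof -
    have "f \<in> borel_measurable (restrict_space borel D)"
      using f D_open by (auto simp: in_C_def intro!: borel_measurable_continuous_on_restrict)
    then have "(\<lambda>x. indicator D x *\<^sub>R f x) \<in> borel_measurable borel"
      using D_open by (subst (asm) borel_measurable_restrict_space_iff) auto
    then show ?thesis by (simp add: g_def[abs_def])
  qed
  have gb: "\<bar>g x\<bar> \<le> \<bar>N\<bar>" for x
    using N[of x] by (cases "x \<in> D") (auto simp: g_def)
  have inD: "x + z \<in> D" if "norm z < \<delta>" for z using x that by (auto simp: dist_norm)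
  have xD: "x \<in> D" using inD[of 0] d by simp
  have eqn: "T.Lk (m n) (moll \<delta> (U n)) x = moll \<delta> g x" for n
    unfolding T.Lk_moll[OF d(1) Um Ub] moll_def
  proof (rule Bochner_Integration.integral_cong[OF refl])
    fix z :: 'a
    show "bump \<delta> z * T.Lk (m n) (U n) (x + z) = bump \<delta> z * g (x + z)"
      using inD[of z] Ueq[of "x + z" n] bump_zero[OF d(1), of z] by (cases "norm z < \<delta>") (auto simp: g_def)
  qed
  define C where "C = 54 * measure lborel (ball (0::'a) 2) * B + 4 * bump_mass TYPE('a) \<delta> * B"
  have mlim: "(\<lambda>n. moll \<delta> (U n) p) \<longlonglongrightarrow> moll \<delta> u0 p" for p
    unfolding moll_def
  proof (rule integral_dominated_convergence[where w="\<lambda>z. bump \<delta> z * B"])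
    show "integrable lborel (\<lambda>z. bump \<delta> (z::'a) * B)" using bump_integrable[OF d(1), where 'a='a] by simp
    show "AE z in lborel. (\<lambda>n. bump \<delta> z * U n (p + z)) \<longlonglongrightarrow> bump \<delta> z * u0 (p + z)"
      by (intro AE_I2 tendsto_mult_left lim)
    show "AE z in lborel. norm (bump \<delta> z * U n (p + z)) \<le> bump \<delta> z * B" for n
      using mult_left_mono[OF Ub bump_nonneg] by (intro AE_I2) (simp add: abs_mult abs_of_nonneg[OF bump_nonneg])
  qed measurable
  let ?S = "\<lambda>u y. moll \<delta> u (x + y) + moll \<delta> u (x - y) - 2 * moll \<delta> u x"
  have Sb: "\<bar>?S (U n) y\<bar> \<le> C * min 1 (norm y ^ 2)" for n y
    unfolding C_def by (rule moll_second_difference[OF d Um Ub])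
  have mm [measurable]: "moll \<delta> (U n) \<in> borel_measurable borel" "moll \<delta> u0 \<in> borel_measurable borel" for n
    by (rule moll_measurable, measurable)+
  have "(\<lambda>n. \<integral>y. ?S (U n) y * trunc (m n) (norm y) \<partial>lborel) \<longlonglongrightarrow> (\<integral>y. ?S u0 y * J (norm y) \<partial>lborel)"
  proof (rule integral_dominated_convergence[where w="\<lambda>y. C * (min 1 (norm y ^ 2) * J (norm y))"])
    show "integrable lborel (\<lambda>y::'a. C * (min 1 (norm y ^ 2) * J (norm y)))" using levy by simp
    show "AE y in lborel. (\<lambda>n. ?S (U n) y * trunc (m n) (norm y)) \<longlonglongrightarrow> ?S u0 y * J (norm y)"
      using AE_ne0
    proof eventually_elim
      case (elim y)
      show ?case
        by (intro tendsto_intros mlim filterlim_compose[OF trunc_tendsto[OF elim] mt])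
    qed
    show "AE y in lborel. norm (?S (U n) y * trunc (m n) (norm y)) \<le> C * (min 1 (norm y ^ 2) * J (norm y))" for n
      using AE_ne0
    proof eventually_elim
      case (elim y)
      have "norm (?S (U n) y * trunc (m n) (norm y)) = \<bar>?S (U n) y\<bar> * trunc (m n) (norm y)"
        using T.k0[of "m n" "norm y"] by (simp add: abs_mult)
      also have "\<dots> \<le> (C * min 1 (norm y ^ 2)) * J (norm y)"
        using Sb[of n y] trunc_le[OF elim] T.k0 J_nonneg[OF elim] by (intro mult_mono) (auto intro: order_trans[OF abs_ge_zero])
      finally show ?case by (simp add: mult.assoc)
    qed
  qed (use T.km' in measurable)
  then have "(\<lambda>n. (1/2) * (\<integral>y. ?S (U n) y * trunc (m n) (norm y) \<partial>lborel)) \<longlonglongrightarrow> Lop J (moll \<delta> u0) x"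
    unfolding Lop_def by (intro tendsto_mult_left)
  moreover have "(1/2) * (\<integral>y. ?S (U n) y * trunc (m n) (norm y) \<partial>lborel) = moll \<delta> g x" for n
    using T.Lk_symm(2)[OF mm(1) moll_abs[OF d(1) Um Ub], of "m n" n x] eqn[of n] by simp
  ultimately have "Lop J (moll \<delta> u0) x = moll \<delta> g x" by (simp add: LIMSEQ_const_iff)
  then have "Lop J (\<lambda>x. moll \<delta> u0 x / bump_mass TYPE('a) \<delta>) x = moll \<delta> g x / bump_mass TYPE('a) \<delta>"
    by (simp add: Lop_cdiv)
  moreover have "\<bar>moll \<delta> g x / bump_mass TYPE('a) \<delta> - g x\<bar> \<le> \<tau>"
    by (rule moll_close[OF d(1) gm gb]) (use close inD xD in \<open>auto simp: g_def\<close>)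
  ultimately show ?thesis using xD by (simp add: g_def)
qed

end

section \<open>Viscosity solutions\<close>

text \<open>\<open>Dv\<close> is Lipschitz on a compact ball, and the second difference is the
  increment over \<open>[0, 1]\<close> of the even function \<open>\<phi>\<close>, whose derivative
  is a difference of values of \<open>Dv\<close>. Uniformity in the centre \<open>x'\<close> is
  needed because the contact points of the approximations move.\<close>

lemma C2_second_difference:
  fixes v :: "'a::euclidean_space \<Rightarrow> real"
  assumes "C2_near v x"
  obtains e C where "0 < e" "e \<le> 1" "0 \<le> C" "continuous_on (ball x e) v"
    "\<And>x' y. x' \<in> ball x e \<Longrightarrow> norm y < e \<Longrightarrow> \<bar>v (x' + y) + v (x' - y) - 2 * v x'\<bar> \<le> C * (norm y)\<^sup>2"
proof -
  from assms obtain e0 Dv and D2v :: "'a \<Rightarrow> ('a \<Rightarrow>\<^sub>L ('a \<Rightarrow>\<^sub>L real))" where e0: "0 < e0"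
    and dv: "\<And>y. y \<in> ball x e0 \<Longrightarrow> (v has_derivative blinfun_apply (Dv y)) (at y)"
    and d2v: "\<And>y. y \<in> ball x e0 \<Longrightarrow> (Dv has_derivative blinfun_apply (D2v y)) (at y)"
    and cont: "continuous_on (ball x e0) D2v"
    unfolding C2_near_def by blast
  let ?K = "cball x (e0 / 2)"
  have K: "?K \<subseteq> ball x e0" using e0 by auto
  have "compact (D2v ` ?K)" using continuous_on_subset[OF cont K] by (intro compact_continuous_image) auto
  then obtain C where "\<forall>w\<in>D2v ` ?K. norm w \<le> C"
    using compact_imp_bounded bounded_iff by blast
  then have C: "\<And>y. y \<in> ?K \<Longrightarrow> norm (D2v y) \<le> C" by blast
  have C0: "0 \<le> C" using C[of x] e0 norm_ge_zero[of "D2v x"] by (meson centre_in_cball divide_nonneg_nonneg less_imp_le order_trans zero_le_numeral)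
  have lip: "norm (Dv a - Dv c) \<le> C * norm (a - c)" if ac: "a \<in> ?K" "c \<in> ?K" for a c
  proof (rule differentiable_bound[where f=Dv and S="?K" and f'="\<lambda>y. blinfun_apply (D2v y)"])
    show "convex ?K" "a \<in> ?K" "c \<in> ?K" using ac by auto
    show "(Dv has_derivative blinfun_apply (D2v y)) (at y within ?K)" if "y \<in> ?K" for y
      by (rule has_derivative_at_withinI, rule d2v) (use K that in blast)
    show "onorm (blinfun_apply (D2v y)) \<le> C" if "y \<in> ?K" for y
      using C[OF that] by (simp add: norm_blinfun.rep_eq)
  qed
  define e where "e = min 1 (e0 / 4)"
  have e: "0 < e" "e \<le> 1" "e \<le> e0 / 4" using e0 by (auto simp: e_def)
  show thesis
  proof (rule that[of e "2 * C"])
    show "0 < e" "e \<le> 1" "0 \<le> 2 * C" using e C0 by auto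
    show "continuous_on (ball x e) v"
    proof (rule continuous_at_imp_continuous_on, rule ballI)
      fix y assume "y \<in> ball x e"
      then have "y \<in> ball x e0" using e e0 by auto
      then show "isCont v y" by (rule has_derivative_continuous[OF dv])
    qed
    fix x' y :: 'a assume x': "x' \<in> ball x e" and y: "norm y < e"
    have in_K: "x' + t *\<^sub>R y \<in> ?K" "x' - t *\<^sub>R y \<in> ?K" if "0 \<le> t" "t \<le> 1" for t
    proof -
      have "norm (t *\<^sub>R y) \<le> norm y" using that by (simp add: mult_left_le_one_le)
      moreover have "norm (x - x') < e" using x' by (simp add: dist_norm)
      ultimately have "norm ((x - x') - t *\<^sub>R y) \<le> e0 / 2" "norm ((x - x') + t *\<^sub>R y) \<le> e0 / 2"
        using norm_triangle_ineq4[of "x - x'" "t *\<^sub>R y"] norm_triangle_ineq[of "x - x'" "t *\<^sub>R y"] y e by linarith+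
      then show "x' + t *\<^sub>R y \<in> ?K" "x' - t *\<^sub>R y \<in> ?K" by (simp_all add: dist_norm algebra_simps)
    qed
    define \<phi> where "\<phi> t = v (x' + t *\<^sub>R y) + v (x' - t *\<^sub>R y)" for t
    define \<phi>' where "\<phi>' t = blinfun_apply (Dv (x' + t *\<^sub>R y)) y - blinfun_apply (Dv (x' - t *\<^sub>R y)) y" for t
    have "norm (\<phi> 1 - \<phi> 0) \<le> (2 * C * (norm y)\<^sup>2) * norm (1 - 0 :: real)"
    proof (rule differentiable_bound[where S="{0..1}" and f'="\<lambda>t h. h * \<phi>' t"])
      fix t :: real assume t: "t \<in> {0..1}"
      have t01: "0 \<le> t" "t \<le> 1" using t by auto
      have m1: "x' + t *\<^sub>R y \<in> ball x e0" "x' - t *\<^sub>R y \<in> ball x e0" using in_K[OF t01] K by blast+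
      have "((\<lambda>t. v (x' + t *\<^sub>R y)) has_derivative (\<lambda>h. blinfun_apply (Dv (x' + t *\<^sub>R y)) (h *\<^sub>R y))) (at t within {0..1})"
        using dv[OF m1(1)] by (intro has_derivative_compose[where f="\<lambda>t. x' + t *\<^sub>R y" and f'="\<lambda>h. h *\<^sub>R y" and g=v]) (auto intro!: derivative_eq_intros)
      moreover have "((\<lambda>t. v (x' - t *\<^sub>R y)) has_derivative (\<lambda>h. blinfun_apply (Dv (x' - t *\<^sub>R y)) (- (h *\<^sub>R y)))) (at t within {0..1})"
        using dv[OF m1(2)] by (intro has_derivative_compose[where f="\<lambda>t. x' - t *\<^sub>R y" and f'="\<lambda>h. - (h *\<^sub>R y)" and g=v]) (auto intro!: derivative_eq_intros)
      ultimately have "(\<phi> has_derivative (\<lambda>h. blinfun_apply (Dv (x' + t *\<^sub>R y)) (h *\<^sub>R y) + blinfun_apply (Dv (x' - t *\<^sub>R y)) (- (h *\<^sub>R y)))) (at t within {0..1})"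
        unfolding \<phi>_def by (rule has_derivative_add)
      moreover have "(\<lambda>h. blinfun_apply (Dv (x' + t *\<^sub>R y)) (h *\<^sub>R y) + blinfun_apply (Dv (x' - t *\<^sub>R y)) (- (h *\<^sub>R y))) = (\<lambda>h. h * \<phi>' t)"
        by (auto simp: fun_eq_iff \<phi>'_def blinfun.scaleR_right blinfun.minus_right right_diff_distrib)
      ultimately show "(\<phi> has_derivative (\<lambda>h. h * \<phi>' t)) (at t within {0..1})" by simp
      have "\<bar>\<phi>' t\<bar> = norm (blinfun_apply (Dv (x' + t *\<^sub>R y) - Dv (x' - t *\<^sub>R y)) y)"
        by (simp add: \<phi>'_def blinfun.diff_left)
      also have "\<dots> \<le> norm (Dv (x' + t *\<^sub>R y) - Dv (x' - t *\<^sub>R y)) * norm y" by (rule norm_blinfun)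
      also have "\<dots> \<le> (C * norm ((x' + t *\<^sub>R y) - (x' - t *\<^sub>R y))) * norm y"
        by (intro mult_right_mono lip in_K[OF t01] norm_ge_zero)
      also have "(x' + t *\<^sub>R y) - (x' - t *\<^sub>R y) = (2 * t) *\<^sub>R y" by (simp only: scaleR_scaleR[symmetric] scaleR_2) simp
      also have "(C * norm ((2 * t) *\<^sub>R y)) * norm y = t * (2 * C * (norm y)\<^sup>2)"
        using t01 by (simp add: power2_eq_square)
      also have "\<dots> \<le> 1 * (2 * C * (norm y)\<^sup>2)" using t01 C0 by (intro mult_right_mono) auto
      finally have "\<bar>\<phi>' t\<bar> \<le> 2 * C * (norm y)\<^sup>2" by simp
      then show "onorm (\<lambda>h. h * \<phi>' t) \<le> 2 * C * (norm y)\<^sup>2"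
        using C0 by (intro onorm_bound) (auto simp: abs_mult mult.commute intro!: mult_left_mono)
    qed auto
    then show "\<bar>v (x' + y) + v (x' - y) - 2 * v x'\<bar> \<le> 2 * C * (norm y)\<^sup>2"
      by (simp add: \<phi>_def)
  qed
qed

text \<open>Certifies the quadratic piece of the glued test function in
  \<open>comparison\<close>.\<close>

lemma C2_near_quadratic:
  fixes p :: "'a::euclidean_space"
  assumes s: "0 < s" and v: "\<And>y. norm y < s \<Longrightarrow> v (x + y) = a + p \<bullet> y + c * (norm y)\<^sup>2"
  shows "C2_near v x"
proof -
  define Dv where "Dv y = blinfun_inner_left p + (2 * c) *\<^sub>R blinfun_inner_left (y - x)" for y :: 'a
  define L :: "'a \<Rightarrow>\<^sub>L ('a \<Rightarrow>\<^sub>L real)" where "L = Blinfun (\<lambda>h. (2 * c) *\<^sub>R blinfun_inner_left h)"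
  have bl: "bounded_linear (\<lambda>h::'a. (2 * c) *\<^sub>R blinfun_inner_left h)"
    by (intro bounded_linear_scaleR_right bounded_linear_compose[OF bounded_linear_scaleR_right] bounded_linear_blinfun_inner_left)
  have L: "blinfun_apply L = (\<lambda>h. (2 * c) *\<^sub>R blinfun_inner_left h)"
    unfolding L_def by (rule bounded_linear_Blinfun_apply[OF bl])
  have "(v has_derivative blinfun_apply (Dv y)) (at y)" if y: "y \<in> ball x s" for y
  proof -
    have "((\<lambda>y. a + p \<bullet> (y - x) + c * ((y - x) \<bullet> (y - x))) has_derivative (\<lambda>h. p \<bullet> h + c * ((y - x) \<bullet> h + h \<bullet> (y - x)))) (at y)"
      by (auto intro!: derivative_eq_intros)
    moreover have "(\<lambda>h. p \<bullet> h + c * ((y - x) \<bullet> h + h \<bullet> (y - x))) = blinfun_apply (Dv y)"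
      by (auto simp: Dv_def fun_eq_iff blinfun.add_left blinfun.scaleR_left inner_commute algebra_simps)
    ultimately have 1: "((\<lambda>y. a + p \<bullet> (y - x) + c * ((y - x) \<bullet> (y - x))) has_derivative blinfun_apply (Dv y)) (at y)" by simp
    show ?thesis
    proof (rule has_derivative_transform_within_open[OF 1 open_ball y])
      fix z assume "z \<in> ball x s"
      then have "norm (z - x) < s" by (simp add: dist_norm norm_minus_commute)
      then show "a + p \<bullet> (z - x) + c * ((z - x) \<bullet> (z - x)) = v z" using v[of "z - x"] by (simp add: power2_norm_eq_inner)
    qed
  qed
  moreover have "(Dv has_derivative blinfun_apply L) (at y)" for y
  proof -
    have "((\<lambda>y. (2 * c) *\<^sub>R blinfun_inner_left y) has_derivative (\<lambda>h. (2 * c) *\<^sub>R blinfun_inner_left h)) (at y)"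
      by (rule bounded_linear_imp_has_derivative[OF bl])
    moreover have "Dv = (\<lambda>y. (blinfun_inner_left p - (2 * c) *\<^sub>R blinfun_inner_left x) + (2 * c) *\<^sub>R blinfun_inner_left y)"
      by (rule ext, rule blinfun_eqI)
         (simp add: Dv_def blinfun.add_left blinfun.diff_left blinfun.scaleR_left inner_diff_right algebra_simps)
    ultimately show ?thesis unfolding L by (auto intro!: derivative_eq_intros)
  qed
  ultimately show ?thesis
    unfolding C2_near_def using s
    by (intro exI[of _ s] conjI exI[of _ Dv] exI[of _ "\<lambda>_. L"]) auto
qed

section \<open>Small and large jumps\<close>

context levy_op
begin

definition small_jumps :: "real \<Rightarrow> real" where
  "small_jumps s = (\<integral>y. indicator (ball 0 s) y * (min 1 (norm y ^ 2) * J (norm (y::'a))) \<partial>lborel)"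

lemma small_jumps_int: "integrable lborel (\<lambda>y::'a. indicator (ball 0 s) y * (min 1 (norm y ^ 2) * J (norm y)))"
proof -
  have "integrable lborel (\<lambda>y::'a. (indicator (ball 0 s) y * min 1 (norm y ^ 2)) * J (norm y))"
    by (rule levy_int[where C=1]) (auto split: split_indicator)
  then show ?thesis by (simp add: mult.assoc)
qed

lemma small_jumps_mono: "s \<le> t \<Longrightarrow> small_jumps s \<le> small_jumps t"
  unfolding small_jumps_def
proof (rule integral_mono_AE[OF small_jumps_int small_jumps_int])
  assume st: "s \<le> t"
  show "AE y::'a in lborel. indicator (ball 0 s) y * (min 1 (norm y ^ 2) * J (norm y)) \<le> indicator (ball 0 t) y * (min 1 (norm y ^ 2) * J (norm y))"
    using AE_ne0
  proof eventually_elim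
    case (elim y)
    have "0 \<le> min 1 (norm y ^ 2) * J (norm y)" using J_nonneg[OF elim] by simp
    moreover have "indicator (ball 0 s) y \<le> (indicator (ball 0 t) y :: real)" using st by (auto split: split_indicator)
    ultimately show ?case by (rule mult_right_mono[rotated])
  qed
qed

lemma small_jumps_small:
  assumes e: "0 < e"
  obtains s0 where "0 < s0" "\<And>s. s \<le> s0 \<Longrightarrow> small_jumps s < e"
proof -
  have "(\<lambda>n. small_jumps (1 / real (Suc n))) \<longlonglongrightarrow> (\<integral>y. (0::real) \<partial>(lborel::'a measure))"
    unfolding small_jumps_def
  proof (rule integral_dominated_convergence[where w="\<lambda>y. min 1 (norm y ^ 2) * J (norm y)"])
    show "integrable lborel (\<lambda>y::'a. min 1 (norm y ^ 2) * J (norm y))" by (rule levy)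
    show "AE y::'a in lborel. (\<lambda>n. indicator (ball 0 (1 / real (Suc n))) y * (min 1 (norm y ^ 2) * J (norm y))) \<longlonglongrightarrow> 0"
      using AE_ne0
    proof eventually_elim
      case (elim y)
      obtain N where N: "inverse (real (Suc N)) < norm y" using reals_Archimedean[of "norm y"] elim by auto
      show ?case
      proof (rule tendsto_eventually, rule eventually_sequentiallyI[of N])
        fix n assume "N \<le> n"
        then have "1 / real (Suc n) \<le> 1 / real (Suc N)" by (simp add: field_simps)
        moreover have "1 / real (Suc N) < norm y" using N by (simp add: divide_inverse)
        ultimately have "y \<notin> ball 0 (1 / real (Suc n))" by simp
        then show "indicator (ball 0 (1 / real (Suc n))) y * (min 1 (norm y ^ 2) * J (norm y)) = 0" by simp
      qed
    qed
    show "AE y::'a in lborel. norm (indicator (ball 0 (1 / real (Suc n))) y * (min 1 (norm y ^ 2) * J (norm y))) \<le> min 1 (norm y ^ 2) * J (norm y)" for n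
      using AE_ne0
    proof eventually_elim
      case (elim y)
      have "0 \<le> min 1 (norm y ^ 2) * J (norm y)" using J_nonneg[OF elim] by simp
      then show ?case by (auto split: split_indicator)
    qed
  qed measurable
  then have "(\<lambda>n. small_jumps (1 / real (Suc n))) \<longlonglongrightarrow> 0" by simp
  then have "\<forall>\<^sub>F n in sequentially. small_jumps (1 / real (Suc n)) < e" using e by (rule order_tendstoD(2))
  then obtain n where n: "small_jumps (1 / real (Suc n)) < e" by (auto simp: eventually_sequentially)
  show thesis
    by (rule that[of "1 / real (Suc n)"]) (use n small_jumps_mono in \<open>auto intro: le_less_trans\<close>)
qed

text \<open>Near the point a quadratic excess is allowed, which small jumps make negligible; away
  from it a constant excess is allowed, weighted by the tail. The 2 in \<open>2 * \<theta>\<close>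
  counts the two shifted points of a second difference.\<close>

lemma Lop_split:
  fixes u v :: "'a \<Rightarrow> real"
  defines "\<Delta> \<equiv> \<lambda>u x y. u (x + y) + u (x - y) - 2 * u x"
  assumes um: "u \<in> borel_measurable borel" and u: "\<And>y. \<bar>\<Delta> u x y\<bar> \<le> C * min 1 (norm y ^ 2)"
    and vm: "v \<in> borel_measurable borel" and v: "\<And>y. \<bar>\<Delta> v x y\<bar> \<le> C' * min 1 (norm y ^ 2)"
    and s: "0 < s" and E: "0 \<le> E"
    and near: "\<And>y. norm y < s \<Longrightarrow> \<Delta> u x y \<le> \<Delta> v x y + E * min 1 (norm y ^ 2)"
    and far: "\<And>y. s \<le> norm y \<Longrightarrow> \<Delta> u x y \<le> \<Delta> v x y + 2 * \<theta>"
  shows "Lop J u x \<le> Lop J v x + E / 2 * small_jumps s + \<theta> * (\<integral>y. indicator {y. s \<le> norm y} y * J (norm (y::'a)) \<partial>lborel)"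
proof -
  note um [measurable] vm [measurable]
  have iu: "integrable lborel (\<lambda>y. \<Delta> u x y * J (norm y))"
    by (rule levy_int[OF _ u]) (simp add: \<Delta>_def)
  have iv: "integrable lborel (\<lambda>y. \<Delta> v x y * J (norm y))"
    by (rule levy_int[OF _ v]) (simp add: \<Delta>_def)
  note it = tail_int[OF s] and ij = small_jumps_int[of s]
  have "(\<integral>y. \<Delta> u x y * J (norm y) \<partial>lborel) \<le> (\<integral>y. \<Delta> v x y * J (norm y)
      + E * (indicator (ball 0 s) y * (min 1 (norm y ^ 2) * J (norm y))) + (2 * \<theta>) * (indicator {y. s \<le> norm y} y * J (norm y)) \<partial>lborel)"
  proof (rule integral_mono_AE[OF iu])
    show "integrable lborel (\<lambda>y. \<Delta> v x y * J (norm y)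
      + E * (indicator (ball 0 s) y * (min 1 (norm y ^ 2) * J (norm y))) + (2 * \<theta>) * (indicator {y. s \<le> norm y} y * J (norm y)))"
      by (intro Bochner_Integration.integrable_add iv integrable_mult_right it ij)
    show "AE y in lborel. \<Delta> u x y * J (norm y) \<le> \<Delta> v x y * J (norm y)
      + E * (indicator (ball 0 s) y * (min 1 (norm y ^ 2) * J (norm y))) + (2 * \<theta>) * (indicator {y. s \<le> norm y} y * J (norm y))"
      using AE_ne0
    proof eventually_elim
      case (elim y)
      show ?case
      proof (cases "norm y < s")
        case True
        have "\<Delta> u x y * J (norm y) \<le> (\<Delta> v x y + E * min 1 (norm y ^ 2)) * J (norm y)"
          using near[OF True] J_nonneg[OF elim] by (rule mult_right_mono)
        then show ?thesis using True by (simp add: distrib_right mult.assoc)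
      next
        case False
        have "\<Delta> u x y * J (norm y) \<le> (\<Delta> v x y + 2 * \<theta>) * J (norm y)"
          using far[of y] False J_nonneg[OF elim] by (intro mult_right_mono) auto
        then show ?thesis using False by (simp add: distrib_right)
      qed
    qed
  qed
  also have "\<dots> = (\<integral>y. \<Delta> v x y * J (norm y) \<partial>lborel) + E * small_jumps s + 2 * \<theta> * (\<integral>y. indicator {y. s \<le> norm y} y * J (norm (y::'a)) \<partial>lborel)"
    using iv it ij by (simp add: small_jumps_def)
  finally show ?thesis by (simp add: Lop_def \<Delta>_def algebra_simps)
qed

lemma test_fun_second_difference:
  fixes v :: "'a \<Rightarrow> real"
  assumes "test_fun v x"
  obtains C where "\<And>y. \<bar>v (x + y) + v (x - y) - 2 * v x\<bar> \<le> C * min 1 (norm y ^ 2)"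
proof -
  obtain B where B: "\<And>y. \<bar>v y\<bar> \<le> B" using assms by (auto simp: test_fun_def bounded_iff)
  have "C2_near v x" using assms by (simp add: test_fun_def)
  then obtain e C where e: "0 < e" "e \<le> 1" "0 \<le> C"
    and sd: "\<And>x' y. x' \<in> ball x e \<Longrightarrow> norm y < e \<Longrightarrow> \<bar>v (x' + y) + v (x' - y) - 2 * v x'\<bar> \<le> C * (norm y)\<^sup>2"
    by (rule C2_second_difference) (rule that)
  have B0: "0 \<le> B" using B[of x] by linarith
  show thesis
  proof (rule that[of "C + 4 * B / e\<^sup>2"])
    fix y :: 'a
    show "\<bar>v (x + y) + v (x - y) - 2 * v x\<bar> \<le> (C + 4 * B / e\<^sup>2) * min 1 (norm y ^ 2)"
    proof (cases "norm y < e")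
      case True
      have "\<bar>v (x + y) + v (x - y) - 2 * v x\<bar> \<le> C * (norm y)\<^sup>2" using sd[of x y] e True by simp
      also have "\<dots> \<le> (C + 4 * B / e\<^sup>2) * (norm y)\<^sup>2" using B0 by (intro mult_right_mono) auto
      also have "(norm y)\<^sup>2 = min 1 (norm y ^ 2)" using True e by (simp add: power_le_one)
      finally show ?thesis .
    next
      case False
      have m: "e\<^sup>2 \<le> min 1 (norm y ^ 2)" using False e by (auto simp: power_le_one intro!: power_mono)
      have "\<bar>v (x + y) + v (x - y) - 2 * v x\<bar> \<le> 4 * B" using B[of "x + y"] B[of "x - y"] B[of x] by linarith
      also have "\<dots> = 4 * B / e\<^sup>2 * e\<^sup>2" using e by simp
      also have "\<dots> \<le> (C + 4 * B / e\<^sup>2) * min 1 (norm y ^ 2)"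
        using m e B0 by (intro mult_mono) auto
      finally show ?thesis .
    qed
  qed
qed

end

text \<open>Isolates what the viscosity arguments use of the mollifications. The \<open>W n\<close>
  need not be C^2, so they are not test functions themselves; \<open>Wt\<close> bounds their second
  differences and makes the integral in \<open>Lop J (W n)\<close> converge, with a constant that
  may blow up with \<open>n\<close>. Changing the sign of \<open>f\<close>, \<open>u0\<close> and
  \<open>W\<close> preserves the assumptions.\<close>

locale visc_approx = levy_op J b for J and b :: "'a::euclidean_space" +
  fixes D :: "'a set" and f u0 :: "'a \<Rightarrow> real" and W :: "nat \<Rightarrow> 'a \<Rightarrow> real" and B :: real
  assumes D_open: "open D" and D_bdd: "bounded D" and fc: "continuous_on D f"
    and u0c: "continuous_on UNIV u0" and u0z: "x \<notin> D \<Longrightarrow> u0 x = 0" and u0b: "\<bar>u0 x\<bar> \<le> B"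
    and Wc: "continuous_on UNIV (W n)" and Wb: "\<bar>W n x\<bar> \<le> B"
    and Wu: "0 < e \<Longrightarrow> \<exists>M. \<forall>n\<ge>M. \<forall>x. \<bar>W n x - u0 x\<bar> \<le> e"
    and Wt: "\<exists>C\<ge>0. \<forall>x. \<exists>p. \<forall>y. norm y \<le> 1 \<longrightarrow> \<bar>W n (x + y) - W n x - p \<bullet> y\<bar> \<le> C * (norm y)\<^sup>2"
    and Weq: "compact K \<Longrightarrow> K \<subseteq> D \<Longrightarrow> 0 < e \<Longrightarrow> \<exists>M. \<forall>n\<ge>M. \<forall>x\<in>K. \<bar>Lop J (W n) x - f x\<bar> \<le> e"
begin

lemma W_measurable: "W n \<in> borel_measurable borel"
  by (rule borel_measurable_continuous_onI[OF Wc])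

lemma B0: "0 \<le> B" using u0b[of 0] by linarith

lemma W_second_difference:
  obtains C where "\<And>x y. \<bar>W n (x + y) + W n (x - y) - 2 * W n x\<bar> \<le> C * min 1 (norm y ^ 2)"
proof -
  obtain C where C: "0 \<le> C" "\<And>x. \<exists>p. \<forall>y. norm y \<le> 1 \<longrightarrow> \<bar>W n (x + y) - W n x - p \<bullet> y\<bar> \<le> C * (norm y)\<^sup>2"
    using Wt[of n] by blast
  show thesis
  proof (rule that[of "2 * C + 4 * B"])
    fix x y :: 'a
    show "\<bar>W n (x + y) + W n (x - y) - 2 * W n x\<bar> \<le> (2 * C + 4 * B) * min 1 (norm y ^ 2)"
    proof (cases "norm y \<le> 1")
      case True
      obtain p where "\<forall>y. norm y \<le> 1 \<longrightarrow> \<bar>W n (x + y) - W n x - p \<bullet> y\<bar> \<le> C * (norm y)\<^sup>2" using C(2) by blast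
      then have "\<bar>W n (x + y) + W n (x - y) - 2 * W n x\<bar> \<le> 2 * C * (norm y)\<^sup>2"
        using True by (intro taylor_second_difference[where p=p]) auto
      also have "\<dots> \<le> (2 * C + 4 * B) * (norm y)\<^sup>2" using B0 by (intro mult_right_mono) auto
      also have "(norm y)\<^sup>2 = min 1 (norm y ^ 2)" using True by (simp add: power_le_one)
      finally show ?thesis .
    next
      case False
      then have "min 1 (norm y ^ 2) = 1" by simp
      moreover have "\<bar>W n (x + y) + W n (x - y) - 2 * W n x\<bar> \<le> 4 * B"
        using Wb[of n "x + y"] Wb[of n "x - y"] Wb[of n x] by linarith
      ultimately show ?thesis using C(1) by simp
    qed
  qed
qed

text \<open>Stability under approximation. The minimum points \<open>xs n\<close> of
  \<open>v - W n\<close> on a small ball converge to \<open>x\<close>. There the short-jump second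
  differences of \<open>W n\<close> lie below those of \<open>v\<close>, which are uniformly
  quadratic; the long-jump ones converge to those of \<open>u0\<close> at \<open>x\<close>, which
  again lie below those of \<open>v\<close>. The cutoff \<open>s\<close> makes the short jumps cost
  at most \<open>e'\<close>.\<close>

lemma touching_sub:
  assumes x: "x \<in> D" and tv: "test_fun v x" and vx: "v x = u0 x" and vgt: "\<And>y. y \<noteq> x \<Longrightarrow> u0 y < v y"
  shows "f x \<le> Lop J v x"
proof -
  have "C2_near v x" using tv by (simp add: test_fun_def)
  then obtain e C where e: "0 < e" "e \<le> 1" and C0: "0 \<le> C" and vc: "continuous_on (ball x e) v"
    and sd: "\<And>x' y. x' \<in> ball x e \<Longrightarrow> norm y < e \<Longrightarrow> \<bar>v (x' + y) + v (x' - y) - 2 * v x'\<bar> \<le> C * (norm y)\<^sup>2"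
    by (rule C2_second_difference) (rule that)
  obtain C1 where C1: "\<And>y. \<bar>v (x + y) + v (x - y) - 2 * v x\<bar> \<le> C1 * min 1 (norm y ^ 2)"
    by (rule test_fun_second_difference[OF tv]) (rule that)
  have vm: "v \<in> borel_measurable borel" using tv by (simp add: test_fun_def)
  obtain r where r: "0 < r" "cball x r \<subseteq> D" using D_open x by (meson open_contains_cball)
  define \<rho> where "\<rho> = min r (e / 2)"
  have rho: "0 < \<rho>" "\<rho> < e" "cball x \<rho> \<subseteq> D" using r e by (auto simp: \<rho>_def)
  have vcr: "continuous_on (cball x \<rho>) v" by (rule continuous_on_subset[OF vc]) (use rho in auto)
  have "\<exists>z. z \<in> cball x \<rho> \<and> (\<forall>y\<in>cball x \<rho>. v z - W n z \<le> v y - W n y)" for n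
  proof -
    have "continuous_on (cball x \<rho>) (\<lambda>z. v z - W n z)"
      by (intro continuous_on_diff vcr continuous_on_subset[OF Wc]) auto
    then show ?thesis using continuous_attains_inf[of "cball x \<rho>" "\<lambda>z. v z - W n z"] rho by auto
  qed
  then obtain xs where xs: "\<And>n. xs n \<in> cball x \<rho>" "\<And>n y. y \<in> cball x \<rho> \<Longrightarrow> v (xs n) - W n (xs n) \<le> v y - W n y"
    by metis
  \<comment> \<open>Strict contact leaves a positive gap \<open>\<mu>\<close> on the compact set
    away from \<open>x\<close>; once \<open>W n\<close> is within \<open>\<mu> / 3\<close> of
    \<open>u0\<close>, no minimum point can lie there.\<close>
  have xlim: "xs \<longlonglongrightarrow> x"
  proof (rule metric_LIMSEQ_I)
    fix \<epsilon> :: real assume eps: "0 < \<epsilon>"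
    let ?A = "cball x \<rho> - ball x \<epsilon>"
    have "\<exists>\<mu>>0. \<forall>a\<in>?A. \<mu> \<le> v a - u0 a"
    proof (cases "?A = {}")
      case False
      have cA: "compact ?A" by (intro compact_diff) auto
      have "continuous_on ?A (\<lambda>z. v z - u0 z)"
        by (intro continuous_on_diff continuous_on_subset[OF vcr] continuous_on_subset[OF u0c]) auto
      then obtain a where a: "a \<in> ?A" "\<forall>y\<in>?A. v a - u0 a \<le> v y - u0 y"
        using continuous_attains_inf[OF cA False] by blast
      have "a \<noteq> x" using a(1) eps by auto
      then show ?thesis using a(2) vgt[of a] by (intro exI[of _ "v a - u0 a"]) auto
    qed (use zero_less_one in blast)
    then obtain \<mu> where mu: "0 < \<mu>" "\<And>a. a \<in> ?A \<Longrightarrow> \<mu> \<le> v a - u0 a" by blast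
    obtain M where M: "\<And>n x. n \<ge> M \<Longrightarrow> \<bar>W n x - u0 x\<bar> \<le> \<mu> / 3" using Wu[of "\<mu> / 3"] mu(1) by auto
    show "\<exists>M. \<forall>n\<ge>M. dist (xs n) x < \<epsilon>"
    proof (intro exI allI impI, rule ccontr)
      fix n assume n: "n \<ge> M" and "\<not> dist (xs n) x < \<epsilon>"
      then have "xs n \<in> ?A" using xs(1)[of n] by (auto simp: dist_commute)
      then have "\<mu> \<le> v (xs n) - u0 (xs n)" by (rule mu(2))
      moreover have "v (xs n) - W n (xs n) \<le> v x - W n x" using xs(2)[of x n] rho by simp
      ultimately show False using M[OF n, of "xs n"] M[OF n, of x] vx mu(1) by linarith
    qed
  qed
  have "f x \<le> Lop J v x + e'" if e': "0 < e'" for e'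
  proof -
    obtain s0 where s0: "0 < s0" "\<And>s. s \<le> s0 \<Longrightarrow> small_jumps s < e' / (C + 1)"
      using small_jumps_small[of "e' / (C + 1)"] e' C0 by (metis add_nonneg_pos divide_pos_pos zero_less_one)
    define s where "s = min s0 (\<rho> / 2)"
    have s: "0 < s" "s \<le> \<rho> / 2" "s \<le> s0" using s0 rho by (auto simp: s_def)
    let ?tail = "{y::'a. s \<le> norm y}"
    let ?d = "\<lambda>u x y. u (x + y) + u (x - y) - 2 * u x"
    have [measurable]: "W n \<in> borel_measurable borel" for n by (rule W_measurable)
    have u0m [measurable]: "u0 \<in> borel_measurable borel" by (rule borel_measurable_continuous_onI[OF u0c])
    have it: "integrable lborel (\<lambda>y::'a. indicator ?tail y * J (norm y))" by (rule tail_int[OF s(1)])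
    have Wi: "integrable lborel (\<lambda>y. ?d (W n) (xs n) y * J (norm y))" for n
    proof -
      obtain Cn where Cn: "\<And>x y. \<bar>W n (x + y) + W n (x - y) - 2 * W n x\<bar> \<le> Cn * min 1 (norm y ^ 2)"
        by (rule W_second_difference[of n]) (rule that)
      show ?thesis by (rule levy_int[OF _ Cn]) measurable
    qed
    have tb: "integrable lborel (\<lambda>y::'a. (indicator ?tail y * J (norm y)) * ?d h z y)"
      if hm: "h \<in> borel_measurable borel" and hb: "\<And>x. \<bar>h x\<bar> \<le> B" for h z
    proof (rule integrable_bounded_mult[OF it, where B="4 * B"])
      note hm [measurable]
      show "(\<lambda>y. ?d h z y) \<in> borel_measurable borel" by measurable
      show "\<bar>?d h z y\<bar> \<le> 4 * B" for y using hb[of "z + y"] hb[of "z - y"] hb[of z] by linarith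
    qed
    have ev: "\<forall>\<^sub>F n in sequentially. Lop J (W n) (xs n) \<le> (1/2) * (C * small_jumps s + (\<integral>y. (indicator ?tail y * J (norm y)) * ?d (W n) (xs n) y \<partial>lborel))"
    proof -
      have "\<forall>\<^sub>F n in sequentially. dist (xs n) x < \<rho> / 2" using tendstoD[OF xlim, of "\<rho> / 2"] rho(1) by simp
      then show ?thesis
    proof eventually_elim
      case (elim n)
      note n = elim
      have "(\<integral>y. ?d (W n) (xs n) y * J (norm y) \<partial>lborel)
         \<le> (\<integral>y. C * (indicator (ball 0 s) y * (min 1 (norm y ^ 2) * J (norm y))) + (indicator ?tail y * J (norm y)) * ?d (W n) (xs n) y \<partial>lborel)"
      proof (rule integral_mono_AE[OF Wi])
        show "integrable lborel (\<lambda>y. C * (indicator (ball 0 s) y * (min 1 (norm y ^ 2) * J (norm y))) + (indicator ?tail y * J (norm y)) * ?d (W n) (xs n) y)"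
          by (intro Bochner_Integration.integrable_add integrable_mult_right small_jumps_int tb W_measurable Wb)
        show "AE y in lborel. ?d (W n) (xs n) y * J (norm y) \<le> C * (indicator (ball 0 s) y * (min 1 (norm y ^ 2) * J (norm y))) + (indicator ?tail y * J (norm y)) * ?d (W n) (xs n) y"
          using AE_ne0
        proof eventually_elim
          case (elim y)
          show ?case
          proof (cases "norm y < s")
            case True
            have "xs n + y \<in> cball x \<rho>" "xs n - y \<in> cball x \<rho>"
            proof -
              have "dist x (xs n + y) \<le> dist x (xs n) + norm y" "dist x (xs n - y) \<le> dist x (xs n) + norm y"
                using dist_triangle[of x "xs n + y" "xs n"] dist_triangle[of x "xs n - y" "xs n"] by (simp_all add: dist_norm)
              then show "xs n + y \<in> cball x \<rho>" "xs n - y \<in> cball x \<rho>" using n True s by (simp_all add: dist_commute)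
            qed
            then have "?d (W n) (xs n) y \<le> ?d v (xs n) y" using xs(2)[of "xs n + y" n] xs(2)[of "xs n - y" n] by linarith
            also have "\<dots> \<le> C * (norm y)\<^sup>2"
            proof -
              have "xs n \<in> ball x e" using xs(1)[of n] rho by auto
              then show ?thesis using sd[of "xs n" y] True s rho by (simp add: abs_le_iff)
            qed
            finally have "?d (W n) (xs n) y * J (norm y) \<le> C * (norm y)\<^sup>2 * J (norm y)"
              using J_nonneg[OF elim] by (rule mult_right_mono)
            moreover have "min 1 (norm y ^ 2) = (norm y)\<^sup>2" using True s rho e by (simp add: power_le_one)
            ultimately show ?thesis using True by simp
          next
            case False
            then show ?thesis by (simp add: mult.commute)
          qed
        qed
      qed
      also have "\<dots> = C * small_jumps s + (\<integral>y. (indicator ?tail y * J (norm y)) * ?d (W n) (xs n) y \<partial>lborel)"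
        using small_jumps_int[of s] tb[OF W_measurable Wb, of n "xs n"] by (simp add: small_jumps_def)
      finally show ?case by (simp add: Lop_def)
    qed
    qed
    have Wlim: "(\<lambda>n. W n (zs n)) \<longlonglongrightarrow> u0 z" if zs: "zs \<longlonglongrightarrow> z" for zs z
    proof -
      have "(\<lambda>n. W n (zs n) - u0 (zs n)) \<longlonglongrightarrow> 0"
      proof (rule LIMSEQ_I)
        fix r :: real assume "0 < r"
        then obtain M where M: "\<And>n x. n \<ge> M \<Longrightarrow> \<bar>W n x - u0 x\<bar> \<le> r / 2" using Wu[of "r / 2"] by auto
        show "\<exists>no. \<forall>n\<ge>no. norm (W n (zs n) - u0 (zs n) - 0) < r"
        proof (intro exI allI impI)
          fix n assume "n \<ge> M"
          then show "norm (W n (zs n) - u0 (zs n) - 0) < r"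
            using M[of n "zs n"] \<open>0 < r\<close> unfolding real_norm_def diff_zero by linarith
        qed
      qed
      moreover have "(\<lambda>n. u0 (zs n)) \<longlonglongrightarrow> u0 z"
        using u0c zs by (metis UNIV_I continuous_on_tendsto_compose eventually_sequentiallyI)
      ultimately show ?thesis using tendsto_add[of "\<lambda>n. W n (zs n) - u0 (zs n)" 0 sequentially "\<lambda>n. u0 (zs n)" "u0 z"] by simp
    qed
    have tl: "(\<lambda>n. \<integral>y. (indicator ?tail y * J (norm y)) * ?d (W n) (xs n) y \<partial>lborel) \<longlonglongrightarrow> (\<integral>y. (indicator ?tail y * J (norm y)) * ?d u0 x y \<partial>lborel)"
    proof (rule integral_dominated_convergence[where w="\<lambda>y. (indicator ?tail y * J (norm y)) * (4 * B)"])
      show "integrable lborel (\<lambda>y::'a. (indicator ?tail y * J (norm y)) * (4 * B))" using it by simp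
      show "AE y in lborel. (\<lambda>n. (indicator ?tail y * J (norm y)) * ?d (W n) (xs n) y) \<longlonglongrightarrow> (indicator ?tail y * J (norm y)) * ?d u0 x y"
        by (intro AE_I2 tendsto_intros Wlim xlim)
      show "AE y in lborel. norm ((indicator ?tail y * J (norm y)) * ?d (W n) (xs n) y) \<le> (indicator ?tail y * J (norm y)) * (4 * B)" for n
        using AE_ne0
      proof eventually_elim
        case (elim y)
        have "\<bar>?d (W n) (xs n) y\<bar> \<le> 4 * B"
          using Wb[of n "xs n + y"] Wb[of n "xs n - y"] Wb[of n "xs n"] by linarith
        moreover have p: "0 \<le> indicator ?tail y * J (norm y)" using J_nonneg[OF elim] by simp
        ultimately have "(indicator ?tail y * J (norm y)) * \<bar>?d (W n) (xs n) y\<bar> \<le> (indicator ?tail y * J (norm y)) * (4 * B)"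
          by (rule mult_left_mono)
        then show ?case unfolding real_norm_def abs_mult[of "indicator ?tail y * J (norm y)"] abs_of_nonneg[OF p] .
      qed
    qed measurable
    have flim: "(\<lambda>n. Lop J (W n) (xs n)) \<longlonglongrightarrow> f x"
    proof -
      have "(\<lambda>n. Lop J (W n) (xs n) - f (xs n)) \<longlonglongrightarrow> 0"
      proof (rule LIMSEQ_I)
        fix r :: real assume r: "0 < r"
        obtain M where M: "\<And>n x'. n \<ge> M \<Longrightarrow> x' \<in> cball x \<rho> \<Longrightarrow> \<bar>Lop J (W n) x' - f x'\<bar> \<le> r / 2"
          using Weq[OF compact_cball rho(3), of "r / 2"] r by (meson half_gt_zero)
        show "\<exists>no. \<forall>n\<ge>no. norm (Lop J (W n) (xs n) - f (xs n) - 0) < r"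
        proof (intro exI allI impI)
          fix n assume "n \<ge> M"
          then show "norm (Lop J (W n) (xs n) - f (xs n) - 0) < r"
            using M[of n "xs n"] xs(1)[of n] r unfolding real_norm_def diff_zero by linarith
        qed
      qed
      moreover have "(\<lambda>n. f (xs n)) \<longlonglongrightarrow> f x"
      proof (rule continuous_on_tendsto_compose[OF fc xlim x])
        have "xs n \<in> D" for n using xs(1)[of n] rho(3) by blast
        then show "\<forall>\<^sub>F n in sequentially. xs n \<in> D" by simp
      qed
      ultimately show ?thesis using tendsto_add[of "\<lambda>n. Lop J (W n) (xs n) - f (xs n)" 0 sequentially "\<lambda>n. f (xs n)" "f x"] by simp
    qed
    have "f x \<le> (1/2) * (C * small_jumps s + (\<integral>y. (indicator ?tail y * J (norm y)) * ?d u0 x y \<partial>lborel))"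
      by (rule tendsto_le[OF sequentially_bot _ flim ev]) (intro tendsto_intros tl)
    also have "\<dots> \<le> (1/2) * (C * small_jumps s + (2 * Lop J v x + C * small_jumps s))"
    proof -
      have vi: "integrable lborel (\<lambda>y. ?d v x y * J (norm y))"
        by (rule levy_int[OF _ C1]) (use vm in measurable)
      have "(\<integral>y. (indicator ?tail y * J (norm y)) * ?d u0 x y \<partial>lborel)
         \<le> (\<integral>y. ?d v x y * J (norm y) + C * (indicator (ball 0 s) y * (min 1 (norm y ^ 2) * J (norm y))) \<partial>lborel)"
      proof (rule integral_mono_AE)
        show "integrable lborel (\<lambda>y. (indicator ?tail y * J (norm y)) * ?d u0 x y)" by (rule tb[OF u0m u0b])
        show "integrable lborel (\<lambda>y. ?d v x y * J (norm y) + C * (indicator (ball 0 s) y * (min 1 (norm y ^ 2) * J (norm y))))"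
          by (intro Bochner_Integration.integrable_add vi integrable_mult_right small_jumps_int)
        show "AE y in lborel. (indicator ?tail y * J (norm y)) * ?d u0 x y \<le> ?d v x y * J (norm y) + C * (indicator (ball 0 s) y * (min 1 (norm y ^ 2) * J (norm y)))"
          using AE_ne0
        proof eventually_elim
          case (elim y)
          show ?case
          proof (cases "norm y < s")
            case True
            have "- (C * (norm y)\<^sup>2) \<le> ?d v x y" using sd[of x y] e True s rho by (simp add: abs_le_iff)
            then have "- (C * (norm y)\<^sup>2) * J (norm y) \<le> ?d v x y * J (norm y)" using J_nonneg[OF elim] by (rule mult_right_mono)
            moreover have "min 1 (norm y ^ 2) = (norm y)\<^sup>2" using True s rho e by (simp add: power_le_one)
            ultimately show ?thesis using True by simp
          next
            case False
            have "?d u0 x y \<le> ?d v x y" using vgt[of "x + y"] vgt[of "x - y"] vx elim by simp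
            then have "?d u0 x y * J (norm y) \<le> ?d v x y * J (norm y)" using J_nonneg[OF elim] by (rule mult_right_mono)
            then show ?thesis using False by (simp add: mult.commute)
          qed
        qed
      qed
      also have "\<dots> = 2 * Lop J v x + C * small_jumps s"
        using vi small_jumps_int[of s] by (simp add: Lop_def small_jumps_def)
      finally show ?thesis by simp
    qed
    also have "\<dots> = Lop J v x + C * small_jumps s" by simp
    also have "\<dots> \<le> Lop J v x + e'"
    proof -
      have "C * small_jumps s \<le> C * (e' / (C + 1))" using s0(2)[OF s(3)] C0 by (intro mult_left_mono) auto
      also have "\<dots> \<le> e'" using C0 e' by (simp add: field_simps)
      finally show ?thesis by simp
    qed
    finally show ?thesis .
  qed
  then show ?thesis by (rule field_le_epsilon)
qed

text \<open>\<open>V + c * indicator D\<close> is a strict supersolution close to \<open>u0\<close>,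
  since from each point of \<open>D\<close> jumps of total mass at least \<open>\<kappa>\<close>
  leave \<open>D\<close>. If \<open>u\<close> exceeded \<open>u0\<close>, a vertical translate of it
  would touch \<open>u\<close> from above at a point of \<open>D\<close>. As \<open>V\<close> need
  not be C^2, the translate is modified into an admissible test function at a small cost in the
  operator.\<close>

lemma comparison:
  assumes sub: "visc_sub J f D u" and uc: "continuous_on UNIV u" and uz: "\<And>x. x \<notin> D \<Longrightarrow> u x = 0"
  shows "u x1 \<le> u0 x1"
proof (rule ccontr)
  assume "\<not> u x1 \<le> u0 x1"
  define \<gamma> where "\<gamma> = u x1 - u0 x1"
  have g: "0 < \<gamma>" using \<open>\<not> u x1 \<le> u0 x1\<close> by (simp add: \<gamma>_def)
  \<comment> \<open>Both functions vanish off \<open>D\<close>, so \<open>K\<close> is compact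
    inside \<open>D\<close> and \<open>Weq\<close> applies on it; the contact point is sought
    there.\<close>
  define K where "K = {x. \<gamma> / 2 \<le> u x - u0 x}"
  have KD: "K \<subseteq> D"
  proof
    fix x assume "x \<in> K"
    then show "x \<in> D" using uz[of x] u0z[of x] g by (cases "x \<in> D") (auto simp: K_def)
  qed
  have "closed K" unfolding K_def by (intro closed_Collect_le continuous_intros uc u0c)
  then have Kc: "compact K" using bounded_subset[OF D_bdd KD] by (simp add: compact_eq_bounded_closed)
  have x1K: "x1 \<in> K" using g by (simp add: K_def \<gamma>_def)
  obtain Bu where Bu: "\<And>x. \<bar>u x\<bar> \<le> Bu"
  proof -
    have "compact (closure D)" using D_bdd by simp
    then have "compact (u ` closure D)" by (intro compact_continuous_image continuous_on_subset[OF uc]) auto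
    then obtain A where A: "\<forall>w\<in>u ` closure D. norm w \<le> A" using compact_imp_bounded bounded_iff by blast
    have "\<bar>u x\<bar> \<le> \<bar>A\<bar>" for x
    proof (cases "x \<in> D")
      case True
      then have "norm (u x) \<le> A" using A closure_subset by blast
      then show ?thesis by simp
    qed (simp add: uz)
    then show thesis by (rule that)
  qed
  obtain C0 where C0: "\<And>x. x \<in> D \<Longrightarrow> norm x \<le> C0" using D_bdd by (auto simp: bounded_iff)
  define R where "R = 2 * \<bar>C0\<bar> + 1"
  have R: "0 < R" and DR: "\<And>x y. x \<in> D \<Longrightarrow> x + y \<in> D \<Longrightarrow> norm y < R"
  proof -
    show "0 < R" by (simp add: R_def)
    fix x y assume "x \<in> D" "x + y \<in> D"
    then have "norm x \<le> C0" "norm (x + y) \<le> C0" using C0 by auto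
    then show "norm y < R" using norm_triangle_ineq4[of "x + y" x] by (simp add: R_def)
  qed
  define \<kappa> where "\<kappa> = (\<integral>y. indicator {y. R \<le> norm y} y * J (norm (y::'a)) \<partial>lborel)"
  have kap: "0 < \<kappa>" unfolding \<kappa>_def by (rule tail_pos[OF R])
  \<comment> \<open>With \<open>\<gamma> / 8\<close> both for \<open>c\<close> and for the distance
    from \<open>V\<close> to \<open>u0\<close>, \<open>mz\<close> is at least
    \<open>3 * \<gamma> / 4\<close>, while outside \<open>K\<close> the difference
    \<open>u - V\<close> stays below \<open>5 * \<gamma> / 8\<close>. So no contact occurs there,
    even where the indicator vanishes.\<close>
  define c where "c = \<gamma> / 8"
  have c: "0 < c" using g by (simp add: c_def)
  have ck: "0 < c * \<kappa>" using c kap by simp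
  obtain M1 where M1: "\<And>n x. n \<ge> M1 \<Longrightarrow> \<bar>W n x - u0 x\<bar> \<le> \<gamma> / 8" using Wu[of "\<gamma> / 8"] g by auto
  \<comment> \<open>The gain \<open>c * \<kappa>\<close> is spent in quarters: on the error in the
    equation, on small jumps and on the raise \<open>\<theta>\<close>. One quarter remains for the
    contradiction.\<close>
  obtain M2 where M2: "\<And>n x. n \<ge> M2 \<Longrightarrow> x \<in> K \<Longrightarrow> \<bar>Lop J (W n) x - f x\<bar> \<le> c * \<kappa> / 4"
    using Weq[OF Kc KD, of "c * \<kappa> / 4"] ck by (meson divide_pos_pos zero_less_numeral)
  define n where "n = max M1 M2"
  define V where "V = W n"
  have V1: "\<bar>V x - u0 x\<bar> \<le> \<gamma> / 8" for x using M1[of n x] by (simp add: n_def V_def)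
  have V2: "\<bar>Lop J V x - f x\<bar> \<le> c * \<kappa> / 4" if "x \<in> K" for x using M2[of n x] that by (simp add: n_def V_def)
  have Vm [measurable]: "V \<in> borel_measurable borel" unfolding V_def by (rule W_measurable)
  have Dm [measurable]: "D \<in> sets borel" using D_open by simp
  obtain C where C: "0 \<le> C" "\<And>x. \<exists>p. \<forall>y. norm y \<le> 1 \<longrightarrow> \<bar>V (x + y) - V x - p \<bullet> y\<bar> \<le> C * (norm y)\<^sup>2"
    using Wt[of n] unfolding V_def by blast
  obtain Cn where Cn': "\<And>x y. \<bar>W n (x + y) + W n (x - y) - 2 * W n x\<bar> \<le> Cn * min 1 (norm y ^ 2)"
    by (rule W_second_difference[of n]) (rule that)
  have Cn: "\<bar>V (x + y) + V (x - y) - 2 * V x\<bar> \<le> Cn * min 1 (norm y ^ 2)" for x y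
    unfolding V_def by (rule Cn')
  have "continuous_on K (\<lambda>x. u x - V x)"
    unfolding V_def by (intro continuous_on_diff continuous_on_subset[OF uc] continuous_on_subset[OF Wc]) auto
  then obtain z where z: "z \<in> K" "\<And>y. y \<in> K \<Longrightarrow> u y - V y \<le> u z - V z"
    using continuous_attains_sup[OF Kc] x1K by blast
  have zD: "z \<in> D" using z(1) KD by blast
  define mz where "mz = u z - V z - c"
  have mzb: "3 * \<gamma> / 4 \<le> mz"
  proof -
    have "V x1 - u0 x1 \<le> \<gamma> / 8" by (rule abs_le_D1[OF V1])
    moreover have "u x1 - u0 x1 = \<gamma>" by (simp add: \<gamma>_def)
    ultimately have "7 * \<gamma> / 8 \<le> u z - V z" using z(2)[OF x1K] by linarith
    then show ?thesis unfolding mz_def c_def by linarith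
  qed
  define G where "G y = V y + c * indicator D y" for y
  have Gm [measurable]: "G \<in> borel_measurable borel" unfolding G_def by measurable
  have Gz: "u z = G z + mz" using zD by (simp add: G_def mz_def)
  have uG: "u y \<le> G y + mz" for y
  proof (cases "y \<in> K")
    case True
    then show ?thesis using z(2)[OF True] KD by (auto simp: G_def mz_def)
  next
    case False
    have "0 \<le> c * indicator D y" using c by simp
    moreover have "u y - u0 y < \<gamma> / 2" using False by (simp add: K_def)
    moreover have "- (V y - u0 y) \<le> \<gamma> / 8" by (rule abs_le_D2[OF V1])
    ultimately show ?thesis using mzb g unfolding G_def by linarith
  qed
  obtain r where r: "0 < r" "ball z r \<subseteq> D" using openE[OF D_open zD] by metis
  have spos: "0 < c * \<kappa> / 4 / (2 * C + 1)" using ck C(1) by simp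
  obtain s0 where s0: "0 < s0" "\<And>s. s \<le> s0 \<Longrightarrow> small_jumps s < c * \<kappa> / 4 / (2 * C + 1)"
    by (rule small_jumps_small[OF spos]) (rule that)
  define s where "s = min 1 (min r s0)"
  have s: "0 < s" "s \<le> 1" "s \<le> r" "s \<le> s0" using r s0 by (auto simp: s_def)
  define \<nu> where "\<nu> = (\<integral>y. indicator {y. s \<le> norm y} y * J (norm (y::'a)) \<partial>lborel)"
  have nu: "0 < \<nu>" unfolding \<nu>_def by (rule tail_pos[OF s(1)])
  define \<theta> where "\<theta> = c * \<kappa> / 4 / \<nu>"
  have th: "0 < \<theta>" using ck nu by (simp add: \<theta>_def)
  obtain p where p: "\<And>y. norm y \<le> 1 \<Longrightarrow> \<bar>V (z + y) - V z - p \<bullet> y\<bar> \<le> C * (norm y)\<^sup>2" using C(2)[of z] by blast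
  \<comment> \<open>Near \<open>z\<close> the translate of \<open>V\<close> is replaced by its
    first-order part plus \<open>C + 1\<close> times the squared distance, where \<open>C\<close>
    alone would give contact from above and the extra 1 makes it strict. Elsewhere the raise
    \<open>\<theta>\<close> does this, and \<open>\<theta>\<close> is small compared with the tail
    mass \<open>\<nu>\<close> of the jumps that see it.\<close>
  define v where "v y = (if norm (y - z) < s then u z + p \<bullet> (y - z) + (C + 1) * (norm (y - z))\<^sup>2 else G y + mz + \<theta>)" for y
  have v_near: "v (z + y) = u z + p \<bullet> y + (C + 1) * (norm y)\<^sup>2" if "norm y < s" for y
    using that by (simp add: v_def)
  have v_far: "v (z + y) = G (z + y) + mz + \<theta>" if "s \<le> norm y" for y
    using that by (simp add: v_def)
  have vz: "v z = u z" using v_near[of 0] s by simp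
  have inD: "indicator D (z + y) = (1::real)" if "norm y < s" for y
  proof -
    have "z + y \<in> ball z r" using that s by (simp add: dist_norm)
    then show ?thesis using r(2) by auto
  qed
  have vgt: "u y < v y" if "y \<noteq> z" for y
  proof (cases "norm (y - z) < s")
    case True
    define h where "h = y - z"
    have h: "y = z + h" "norm h < s" "h \<noteq> 0" using True that by (auto simp: h_def)
    have "u y \<le> V y + c + mz" using uG[of y] inD[OF h(2)] by (simp add: G_def h(1))
    also have "\<dots> \<le> V z + p \<bullet> h + C * (norm h)\<^sup>2 + c + mz" using p[of h] h s by (simp add: abs_le_iff)
    also have "\<dots> < V z + p \<bullet> h + C * (norm h)\<^sup>2 + c + mz + (norm h)\<^sup>2" using h(3) by simp
    also have "\<dots> = v y" using v_near[OF h(2)] by (simp add: h(1) mz_def distrib_right)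
    finally show ?thesis .
  next
    case False
    then show ?thesis using uG[of y] th by (simp add: v_def)
  qed
  have tv: "test_fun v z"
    unfolding test_fun_def
  proof (intro conjI)
    show "C2_near v z" by (rule C2_near_quadratic[OF s(1) v_near])
    show "v \<in> borel_measurable borel" unfolding v_def by measurable
    show "bounded (range v)"
    proof -
      have "\<bar>v y\<bar> \<le> (Bu + norm p + (C + 1)) + (B + c + \<bar>mz\<bar> + \<theta>)" for y
      proof (cases "norm (y - z) < s")
        case True
        have n1: "norm (y - z) \<le> 1" using True s by simp
        have "\<bar>p \<bullet> (y - z)\<bar> \<le> norm p * norm (y - z)" by (rule Cauchy_Schwarz_ineq2)
        also have "\<dots> \<le> norm p * 1" using n1 by (intro mult_left_mono) auto
        finally have 1: "\<bar>p \<bullet> (y - z)\<bar> \<le> norm p" by simp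
        have "(norm (y - z))\<^sup>2 \<le> 1" using n1 by (simp add: power_le_one)
        then have 2: "(C + 1) * (norm (y - z))\<^sup>2 \<le> C + 1" using C(1) by (simp add: mult_left_le)
        have 3: "0 \<le> (C + 1) * (norm (y - z))\<^sup>2" using C(1) by simp
        have "\<bar>v y\<bar> \<le> Bu + norm p + (C + 1)" unfolding v_def using True 1 2 3 Bu[of z] by simp
        then show ?thesis using B0 c th by linarith
      next
        case False
        have "\<bar>c * indicator D y\<bar> \<le> c" using c by (simp add: indicator_def)
        then have "\<bar>v y\<bar> \<le> B + c + \<bar>mz\<bar> + \<theta>" unfolding v_def G_def using False Wb[of n y] th by (simp add: V_def)
        moreover have "0 \<le> Bu + norm p + (C + 1)" using Bu[of z] C(1) norm_ge_zero[of p] by linarith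
        ultimately show ?thesis by linarith
      qed
      then show ?thesis by (auto simp: bounded_iff)
    qed
  qed
  then have fL: "f z \<le> Lop J v z" using sub zD vz vgt unfolding visc_sub_def by blast
  let ?d = "\<lambda>(u :: 'a \<Rightarrow> real) x y. u (x + y) + u (x - y) - 2 * u x"
  have dI_near: "?d (indicator D) z y = (0::real)" if "norm y < s" for y
    using inD[of y] inD[of "- y"] that zD by simp
  have dI_le: "?d (indicator D) z y \<le> - 2 * indicator {y. R \<le> norm y} y" for y :: 'a
    using DR[OF zD, of y] DR[OF zD, of "- y"] zD by (auto simp: indicator_def not_le)
  have dI_abs: "\<bar>?d (indicator D) z y\<bar> \<le> (4 / s\<^sup>2) * min 1 (norm y ^ 2)" for y
  proof (cases "norm y < s")
    case True
    then show ?thesis using dI_near[OF True] by simp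
  next
    case False
    have m: "s\<^sup>2 \<le> min 1 (norm y ^ 2)" using False s by (auto simp: power_le_one intro!: power_mono)
    have "\<bar>?d (indicator D) z y\<bar> \<le> (4 / s\<^sup>2) * s\<^sup>2" using s by (auto simp: indicator_def)
    also have "\<dots> \<le> (4 / s\<^sup>2) * min 1 (norm y ^ 2)" using m by (intro mult_left_mono) auto
    finally show ?thesis .
  qed
  have dG: "?d G z y = ?d V z y + c * ?d (indicator D) z y" for y
    by (simp add: G_def algebra_simps)
  obtain C1 where C1: "\<And>y. \<bar>?d v z y\<bar> \<le> C1 * min 1 (norm y ^ 2)"
    by (rule test_fun_second_difference[OF tv]) (rule that)
  have "Lop J v z \<le> Lop J G z + (4 * C + 2) / 2 * small_jumps s + \<theta> * (\<integral>y. indicator {y. s \<le> norm y} y * J (norm (y::'a)) \<partial>lborel)"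
  proof (rule Lop_split)
    show "v \<in> borel_measurable borel" using tv by (simp add: test_fun_def)
    show "\<bar>?d v z y\<bar> \<le> C1 * min 1 (norm y ^ 2)" for y by (rule C1)
    show "G \<in> borel_measurable borel" by (rule Gm)
    show "\<bar>?d G z y\<bar> \<le> (Cn + c * (4 / s\<^sup>2)) * min 1 (norm y ^ 2)" for y
    proof -
      have "\<bar>?d G z y\<bar> \<le> \<bar>?d V z y\<bar> + \<bar>c * ?d (indicator D) z y\<bar>" unfolding dG by (rule abs_triangle_ineq)
      also have "\<bar>c * ?d (indicator D) z y\<bar> = c * \<bar>?d (indicator D) z y\<bar>" unfolding abs_mult using c by simp
      also have "\<bar>?d V z y\<bar> + c * \<bar>?d (indicator D) z y\<bar> \<le> Cn * min 1 (norm y ^ 2) + c * ((4 / s\<^sup>2) * min 1 (norm y ^ 2))"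
        using c by (intro add_mono Cn mult_left_mono dI_abs) auto
      finally show ?thesis by (simp add: distrib_right)
    qed
    show "0 < s" by (rule s)
    show "0 \<le> 4 * C + 2" using C(1) by simp
    show "?d v z y \<le> ?d G z y + (4 * C + 2) * min 1 (norm y ^ 2)" if y: "norm y < s" for y
    proof -
      have "?d v z y = 2 * (C + 1) * (norm y)\<^sup>2" using v_near[OF y] v_near[of "- y"] y vz by simp
      moreover have "\<bar>?d V z y\<bar> \<le> 2 * C * (norm y)\<^sup>2"
        by (rule taylor_second_difference[where p=p, OF p]) (use y s in auto)
      moreover have "?d G z y = ?d V z y" unfolding dG dI_near[OF y] by simp
      moreover have "2 * (C + 1) * (norm y)\<^sup>2 = 2 * (C * (norm y)\<^sup>2) + 2 * (norm y)\<^sup>2"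
        "(4 * C + 2) * (norm y)\<^sup>2 = 4 * (C * (norm y)\<^sup>2) + 2 * (norm y)\<^sup>2" "2 * C * (norm y)\<^sup>2 = 2 * (C * (norm y)\<^sup>2)"
        by (simp_all add: algebra_simps)
      ultimately have "?d v z y \<le> ?d G z y + (4 * C + 2) * (norm y)\<^sup>2" by linarith
      moreover have "min 1 (norm y ^ 2) = (norm y)\<^sup>2" using y s by (simp add: power_le_one)
      ultimately show ?thesis by (simp only:)
    qed
    show "?d v z y \<le> ?d G z y + 2 * \<theta>" if y: "s \<le> norm y" for y
    proof -
      have "v (z - y) = G (z - y) + mz + \<theta>" using v_far[of "- y"] y by simp
      then show ?thesis using v_far[OF y] vz Gz by linarith
    qed
  qed
  moreover have "(4 * C + 2) / 2 * small_jumps s + \<theta> * (\<integral>y. indicator {y. s \<le> norm y} y * J (norm (y::'a)) \<partial>lborel) \<le> c * \<kappa> / 4 + c * \<kappa> / 4"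
  proof -
    have "(4 * C + 2) / 2 * small_jumps s = (2 * C + 1) * small_jumps s" by (simp add: field_simps)
    also have "\<dots> \<le> (2 * C + 1) * (c * \<kappa> / 4 / (2 * C + 1))" using s0(2)[OF s(4)] C(1) by (intro mult_left_mono) auto
    also have "\<dots> = c * \<kappa> / 4"
    proof -
      have ne: "2 * C + 1 \<noteq> 0" using C(1) by linarith
      have "(2 * C + 1) * (q / (2 * C + 1)) = q" for q using ne by simp
      then show ?thesis by blast
    qed
    finally have "(4 * C + 2) / 2 * small_jumps s \<le> c * \<kappa> / 4" .
    moreover have "\<theta> * \<nu> = c * \<kappa> / 4" using nu by (simp add: \<theta>_def)
    ultimately show ?thesis unfolding \<nu>_def by linarith
  qed
  moreover have "Lop J G z \<le> Lop J V z - c * \<kappa>"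
  proof -
    have iV: "integrable lborel (\<lambda>y. ?d V z y * J (norm y))" by (rule levy_int[OF _ Cn]) measurable
    have iI: "integrable lborel (\<lambda>y. ?d (indicator D) z y * J (norm y))" by (rule levy_int[OF _ dI_abs]) measurable
    have iR: "integrable lborel (\<lambda>y::'a. indicator {y. R \<le> norm y} y * J (norm y))" by (rule tail_int[OF R])
    have "(\<integral>y. ?d (indicator D) z y * J (norm y) \<partial>lborel) \<le> (\<integral>y. (- 2) * (indicator {y. R \<le> norm y} y * J (norm (y::'a))) \<partial>lborel)"
    proof (rule integral_mono_AE[OF iI])
      show "integrable lborel (\<lambda>y::'a. (- 2) * (indicator {y. R \<le> norm y} y * J (norm y)))" using iR by simp
      show "AE y in lborel. ?d (indicator D) z y * J (norm y) \<le> (- 2) * (indicator {y. R \<le> norm y} y * J (norm y))"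
        using AE_ne0
      proof eventually_elim
        case (elim y)
        have "?d (indicator D) z y * J (norm y) \<le> (- 2 * indicator {y. R \<le> norm y} y) * J (norm y)"
          using dI_le[of y] J_nonneg[OF elim] by (rule mult_right_mono)
        then show ?case by (simp add: mult.assoc)
      qed
    qed
    also have "\<dots> = - 2 * \<kappa>" using iR by (simp add: \<kappa>_def)
    finally have I: "(\<integral>y. ?d (indicator D) z y * J (norm y) \<partial>lborel) \<le> - 2 * \<kappa>" .
    have "(\<integral>y. ?d G z y * J (norm y) \<partial>lborel) = (\<integral>y. ?d V z y * J (norm y) + c * (?d (indicator D) z y * J (norm y)) \<partial>lborel)"
      unfolding dG by (simp add: distrib_right mult.assoc)
    also have "\<dots> = (\<integral>y. ?d V z y * J (norm y) \<partial>lborel) + c * (\<integral>y. ?d (indicator D) z y * J (norm y) \<partial>lborel)"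
      by (subst Bochner_Integration.integral_add[OF iV integrable_mult_right[OF iI]]) simp
    also have "\<dots> \<le> (\<integral>y. ?d V z y * J (norm y) \<partial>lborel) + c * (- 2 * \<kappa>)"
      using I c by (intro add_left_mono mult_left_mono) auto
    finally show ?thesis unfolding Lop_def by simp
  qed
  ultimately have "f z \<le> Lop J V z - c * \<kappa> + c * \<kappa> / 4 + c * \<kappa> / 4" using fL by linarith
  then show False using abs_le_D1[OF V2[OF z(1)]] ck by linarith
qed

end

section \<open>Change of sign, which reduces supersolutions to subsolutions\<close>

lemma Lop_minus: "Lop J (\<lambda>x. - u x) x = - Lop J u x"
proof -
  have "(\<lambda>y. (- u (x + y) + - u (x - y) - 2 * - u x) * J (norm y)) = (\<lambda>y. - ((u (x + y) + u (x - y) - 2 * u x) * J (norm y)))"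
    by (auto simp: fun_eq_iff algebra_simps)
  then show ?thesis by (simp add: Lop_def)
qed

lemma C2_near_minus: "C2_near v x \<Longrightarrow> C2_near (\<lambda>x. - v x) x"
  unfolding C2_near_def
proof (elim exE conjE)
  fix e Dv and D2v :: "'a \<Rightarrow> ('a \<Rightarrow>\<^sub>L ('a \<Rightarrow>\<^sub>L real))"
  assume e: "0 < e" and d: "\<forall>y\<in>ball x e. (v has_derivative blinfun_apply (Dv y)) (at y) \<and> (Dv has_derivative blinfun_apply (D2v y)) (at y)"
    and c: "continuous_on (ball x e) D2v"
  have neg: "blinfun_apply (- L) = (\<lambda>h. - blinfun_apply L h)" for L :: "'a \<Rightarrow>\<^sub>L 'c::real_normed_vector"
    by (auto simp: blinfun.minus_left)
  show "\<exists>e>0. \<exists>(Dv :: 'a \<Rightarrow> ('a \<Rightarrow>\<^sub>L real)) (D2v :: 'a \<Rightarrow> ('a \<Rightarrow>\<^sub>L ('a \<Rightarrow>\<^sub>L real))).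
     (\<forall>y\<in>ball x e. ((\<lambda>x. - v x) has_derivative blinfun_apply (Dv y)) (at y)
                    \<and> (Dv has_derivative blinfun_apply (D2v y)) (at y))
     \<and> continuous_on (ball x e) D2v"
    using e d c
    by (intro exI[of _ e] conjI exI[of _ "\<lambda>y. - Dv y"] exI[of _ "\<lambda>y. - D2v y"])
       (auto simp: neg intro!: has_derivative_minus continuous_on_minus)
qed

lemma test_fun_minus: "test_fun v x \<Longrightarrow> test_fun (\<lambda>x. - v x) x"
  by (auto simp: test_fun_def C2_near_minus bounded_iff)

lemma visc_super_minus: "visc_super J f D u \<longleftrightarrow> visc_sub J (\<lambda>x. - f x) D (\<lambda>x. - u x)"
proof -
  have 1: "lsc_on (closure D) u \<longleftrightarrow> usc_on (closure D) (\<lambda>x. - u x)"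
  proof -
    have "(u x - e < u y) = (- u y < - u x + e)" for x y e by auto
    then show ?thesis unfolding lsc_on_def usc_on_def by simp
  qed
  have 2: "(\<forall>v. test_fun v x \<and> v x = u x \<and> (\<forall>y. y \<noteq> x \<longrightarrow> v y < u y) \<longrightarrow> Lop J v x \<le> f x)
     \<longleftrightarrow> (\<forall>v. test_fun v x \<and> v x = - u x \<and> (\<forall>y. y \<noteq> x \<longrightarrow> v y > - u y) \<longrightarrow> Lop J v x \<ge> - f x)" (is "?L = ?R") for x
  proof
    assume L: ?L
    show ?R
    proof (intro allI impI)
      fix v assume "test_fun v x \<and> v x = - u x \<and> (\<forall>y. y \<noteq> x \<longrightarrow> v y > - u y)"
      then show "Lop J v x \<ge> - f x"
        using L[rule_format, of "\<lambda>x. - v x"] test_fun_minus[of v x] Lop_minus[of J v x] by (auto simp: minus_less_iff)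
    qed
  next
    assume R: ?R
    show ?L
    proof (intro allI impI)
      fix v assume "test_fun v x \<and> v x = u x \<and> (\<forall>y. y \<noteq> x \<longrightarrow> v y < u y)"
      then show "Lop J v x \<le> f x"
        using R[rule_format, of "\<lambda>x. - v x"] test_fun_minus[of v x] Lop_minus[of J v x] by auto
    qed
  qed
  show ?thesis unfolding visc_super_def visc_sub_def 1 2 by simp
qed

lemma visc_approx_minus:
  assumes "visc_approx J b D f u0 W B"
  shows "visc_approx J b D (\<lambda>x. - f x) (\<lambda>x. - u0 x) (\<lambda>n x. - W n x) B"
proof -
  interpret visc_approx J b D f u0 W B by fact
  show ?thesis
  proof (unfold_locales)
    show "continuous_on D (\<lambda>x. - f x)" "continuous_on UNIV (\<lambda>x. - u0 x)" "continuous_on UNIV (\<lambda>x. - W n x)" for n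
      by (intro continuous_on_minus fc u0c Wc)+
    show "\<exists>M. \<forall>n\<ge>M. \<forall>x. \<bar>- W n x - - u0 x\<bar> \<le> e" if "0 < e" for e
      using Wu[OF that] by (simp add: abs_minus_commute)
    show "\<exists>C\<ge>0. \<forall>x. \<exists>p. \<forall>y. norm y \<le> 1 \<longrightarrow> \<bar>- W n (x + y) - - W n x - p \<bullet> y\<bar> \<le> C * (norm y)\<^sup>2" for n
    proof -
      obtain C where C: "0 \<le> C" "\<And>x. \<exists>p. \<forall>y. norm y \<le> 1 \<longrightarrow> \<bar>W n (x + y) - W n x - p \<bullet> y\<bar> \<le> C * (norm y)\<^sup>2"
        using Wt[of n] by blast
      have "\<exists>p. \<forall>y. norm y \<le> 1 \<longrightarrow> \<bar>- W n (x + y) - - W n x - p \<bullet> y\<bar> \<le> C * (norm y)\<^sup>2" for x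
      proof -
        obtain p where p: "\<forall>y. norm y \<le> 1 \<longrightarrow> \<bar>W n (x + y) - W n x - p \<bullet> y\<bar> \<le> C * (norm y)\<^sup>2" using C(2) by blast
        have "\<bar>- W n (x + y) - - W n x - (- p) \<bullet> y\<bar> = \<bar>W n (x + y) - W n x - p \<bullet> y\<bar>" for y by simp
        then show ?thesis using p by (intro exI[of _ "- p"]) simp
      qed
      then show ?thesis using C(1) by blast
    qed
    show "\<exists>M. \<forall>n\<ge>M. \<forall>x\<in>K. \<bar>Lop J (\<lambda>x. - W n x) x - - f x\<bar> \<le> e" if "compact K" "K \<subseteq> D" "0 < e" for K e
      using Weq[OF that] by (simp add: Lop_minus abs_minus_commute)
  qed (use D_open D_bdd u0z u0b Wb in auto)
qed

context visc_approx
begin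

lemma continuous_usc: "continuous_on UNIV u \<Longrightarrow> usc_on S u" for u :: "'a \<Rightarrow> real"
  unfolding usc_on_def
proof (intro ballI allI impI)
  fix x e assume c: "continuous_on UNIV u" and e: "(0::real) < e"
  then obtain d where d: "0 < d" "\<And>y. dist y x < d \<Longrightarrow> dist (u y) (u x) < e"
    by (metis UNIV_I continuous_on_iff)
  have "u y < u x + e" if "dist y x < d" for y using d(2)[OF that] unfolding dist_real_def by linarith
  then show "\<exists>d>0. \<forall>y\<in>S. dist y x < d \<longrightarrow> u y < u x + e" using d(1) by blast
qed

lemma visc_sub_u0: "visc_sub J f D u0"
  unfolding visc_sub_def using continuous_usc[OF u0c] touching_sub by blast

end

text \<open>A solution is upper and lower semicontinuous on the closure of \<open>D\<close> and zero
  on the closed complement, so gluing over two closed sets makes it continuous on the whole space;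
  the zero exterior values on the frontier enter here. Comparison for \<open>u\<close> and for
  \<open>- u\<close> then forces equality.\<close>

lemma visc_approx_unique_solution:
  assumes va: "visc_approx J b D f u0 W B"
  shows "visc_sol J f D u0"
    and "visc_sol J f D u \<Longrightarrow> (\<And>x. x \<notin> D \<Longrightarrow> u x = 0) \<Longrightarrow> u = u0"
proof -
  interpret visc_approx J b D f u0 W B by (rule va)
  interpret neg: visc_approx J b D "\<lambda>x. - f x" "\<lambda>x. - u0 x" "\<lambda>n x. - W n x" B by (rule visc_approx_minus[OF va])
  show "visc_sol J f D u0"
    unfolding visc_sol_def visc_super_minus using visc_sub_u0 neg.visc_sub_u0 by blast
  assume sol: "visc_sol J f D u" and uz: "\<And>x. x \<notin> D \<Longrightarrow> u x = 0"
  have sub: "visc_sub J f D u" and super: "visc_sub J (\<lambda>x. - f x) D (\<lambda>x. - u x)"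
    using sol unfolding visc_sol_def visc_super_minus by auto
  have us: "usc_on (closure D) u" and ls: "usc_on (closure D) (\<lambda>x. - u x)" using sub super by (auto simp: visc_sub_def)
  have cl: "continuous_on (closure D) u"
    unfolding continuous_on_iff
  proof (intro ballI allI impI)
    fix x e assume x: "x \<in> closure D" and e: "(0::real) < e"
    obtain d1 where d1: "0 < d1" "\<forall>y\<in>closure D. dist y x < d1 \<longrightarrow> u y < u x + e"
      using us x e unfolding usc_on_def by blast
    obtain d2 where d2: "0 < d2" "\<forall>y\<in>closure D. dist y x < d2 \<longrightarrow> - u y < - u x + e"
      using ls x e unfolding usc_on_def by blast
    have "dist (u y) (u x) < e" if "y \<in> closure D" "dist y x < min d1 d2" for y
    proof -
      have "u y < u x + e" "- u y < - u x + e" using d1(2) d2(2) that by auto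
      then show ?thesis unfolding dist_real_def by linarith
    qed
    then show "\<exists>d>0. \<forall>y\<in>closure D. dist y x < d \<longrightarrow> dist (u y) (u x) < e"
      using d1(1) d2(1) by (intro exI[of _ "min d1 d2"]) auto
  qed
  have "continuous_on (closure D \<union> - D) u"
  proof (rule continuous_on_closed_Un)
    show "closed (- D)" unfolding closed_def using D_open by simp
    show "continuous_on (- D) u" using uz by (intro continuous_on_eq[OF continuous_on_const[of "- D" "0::real"]]) auto
  qed (use cl in auto)
  moreover have "closure D \<union> - D = UNIV" using closure_subset by blast
  ultimately have uc: "continuous_on UNIV u" by simp
  show "u = u0"
  proof
    fix x
    have "u x \<le> u0 x" by (rule comparison[OF sub uc uz])
    moreover have "- u x \<le> - u0 x" by (rule neg.comparison[OF super]) (use uc uz in \<open>auto intro: continuous_on_minus\<close>)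
    ultimately show "u x = u0 x" by simp
  qed
qed

section \<open>The mollified limit as an approximating family\<close>

lemma moll_shift_le:
  fixes u :: "'a::euclidean_space \<Rightarrow> real"
  assumes d: "0 < \<delta>" and um [measurable]: "u \<in> borel_measurable borel" and B: "\<And>x. \<bar>u x\<bar> \<le> B"
    and e: "\<And>z. \<bar>u z - u (z + t)\<bar> \<le> e"
  shows "\<bar>moll \<delta> u x - moll \<delta> u (x + t)\<bar> \<le> bump_mass TYPE('a) \<delta> * e"
proof -
  have "moll \<delta> u x - moll \<delta> u (x + t) = (\<integral>z. bump \<delta> z * u (x + z) - bump \<delta> z * u (x + t + z) \<partial>lborel)"
    unfolding moll_def using moll_integrable[OF d um B] by simp
  also have "\<dots> = moll \<delta> (\<lambda>z. u z - u (z + t)) x"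
    unfolding moll_def by (simp add: right_diff_distrib add_ac)
  finally have eq: "moll \<delta> u x - moll \<delta> u (x + t) = moll \<delta> (\<lambda>z. u z - u (z + t)) x" .
  show ?thesis unfolding eq by (rule moll_abs[OF d _ e]) measurable
qed

context levy_dirichlet
begin

text \<open>The modulus \<open>omega\<close> makes \<open>u0\<close> uniformly continuous on the
  whole space, which gives uniform convergence of the mollifications. Uniform continuity of
  \<open>f\<close> on a compact neighbourhood of \<open>K'\<close> inside \<open>D\<close> makes the
  error of \<open>smooth_equation\<close> small on \<open>K'\<close>.\<close>

lemma mollified_visc_approx:
  assumes f: "in_C D f" and N: "0 < N" "\<And>x. x \<in> D \<Longrightarrow> \<bar>f x\<bar> \<le> N" and K: "0 < K" and lam: "0 < lam"
    and mt: "filterlim m at_top sequentially"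
    and Um: "\<And>n. U n \<in> borel_measurable borel" and Ub: "\<And>n x. \<bar>U n x\<bar> \<le> K * N"
    and Ueq: "\<And>n x. x \<in> D \<Longrightarrow> T.Lk (m n) (U n) x = f x"
    and lim: "\<And>x. (\<lambda>n. U n x) \<longlonglongrightarrow> u0 x" and u0b: "\<And>x. \<bar>u0 x\<bar> \<le> K * N"
    and u0z: "\<And>x. x \<notin> D \<Longrightarrow> u0 x = 0"
    and mod: "\<And>x y. x \<noteq> y \<Longrightarrow> \<bar>u0 x - u0 y\<bar> \<le> K * N * omega lam (dist x y)"
  shows "visc_approx J b D f u0 (\<lambda>n x. moll (1 / real (Suc n)) u0 x / bump_mass TYPE('a) (1 / real (Suc n))) (K * N)"
proof -
  define \<delta> where "\<delta> n = 1 / real (Suc n)" for n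
  have d: "0 < \<delta> n" "\<delta> n \<le> 1" for n by (auto simp: \<delta>_def)
  have dlim: "\<exists>M. \<forall>n\<ge>M. \<delta> n < r" if r0: "0 < r" for r
  proof -
    obtain M where M: "inverse (real (Suc M)) < r" using reals_Archimedean[OF r0] by auto
    have "\<delta> n < r" if "n \<ge> M" for n
    proof -
      have "\<delta> n \<le> inverse (real (Suc M))" using that by (simp add: \<delta>_def field_simps)
      then show ?thesis using M by linarith
    qed
    then show ?thesis by blast
  qed
  have KN: "0 < K * N" using K N by simp
  have unif: "\<exists>r>0. \<forall>x y. dist x y < r \<longrightarrow> \<bar>u0 x - u0 y\<bar> \<le> e" if e: "0 < e" for e
  proof -
    have e': "0 < e / (K * N)" using e KN by simp
    obtain r where r: "0 < r" "\<And>t. 0 < t \<Longrightarrow> t < r \<Longrightarrow> omega lam t < e / (K * N)"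
      by (rule omega_small[OF lam e']) (rule that)
    have "\<bar>u0 x - u0 y\<bar> \<le> e" if "dist x y < r" for x y
    proof (cases "x = y")
      case False
      have "\<bar>u0 x - u0 y\<bar> \<le> (K * N) * omega lam (dist x y)" using mod[OF False] by simp
      also have "\<dots> \<le> (K * N) * (e / (K * N))"
        using r(2)[of "dist x y"] False that KN by (intro mult_left_mono) auto
      also have "\<dots> = e" using K N by simp
      finally show ?thesis .
    qed (use e in simp)
    then show ?thesis using r(1) by blast
  qed
  have u0c: "continuous_on UNIV u0"
    unfolding continuous_on_iff
  proof (intro ballI allI impI)
    fix x and e :: real assume e: "0 < e"
    obtain r where r: "0 < r" "\<forall>x y. dist x y < r \<longrightarrow> \<bar>u0 x - u0 y\<bar> \<le> e / 2" using unif[of "e / 2"] e by auto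
    have "dist (u0 y) (u0 x) < e" if "dist y x < r" for y
    proof -
      have "\<bar>u0 y - u0 x\<bar> \<le> e / 2" using r(2) that by blast
      then show ?thesis unfolding dist_real_def using e by linarith
    qed
    then show "\<exists>d>0. \<forall>x'\<in>UNIV. dist x' x < d \<longrightarrow> dist (u0 x') (u0 x) < e" using r(1) by blast
  qed
  have u0m [measurable]: "u0 \<in> borel_measurable borel" by (rule borel_measurable_continuous_onI[OF u0c])
  define M where "M n = bump_mass TYPE('a) (\<delta> n)" for n
  have M: "0 < M n" for n unfolding M_def by (rule bump_mass_pos[OF d(1)])
  define W where "W n x = moll (\<delta> n) u0 x / M n" for n x
  have "visc_approx J b D f u0 W (K * N)"
  proof (unfold_locales)
    show "open D" "bounded D" by (rule D_open, rule D_bdd)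
    show fc: "continuous_on D f" using f by (simp add: in_C_def)
    show "continuous_on UNIV u0" by (rule u0c)
    show "u0 x = 0" if "x \<notin> D" for x by (rule u0z[OF that])
    show "\<bar>u0 x\<bar> \<le> K * N" for x by (rule u0b)
    show "\<bar>W n x\<bar> \<le> K * N" for n x
      using moll_abs[OF d(1) u0m u0b, of n x] M[of n] by (simp add: W_def M_def field_simps)
    show "continuous_on UNIV (W n)" for n
      unfolding continuous_on_iff
    proof (intro ballI allI impI)
      fix x and e :: real assume e: "0 < e"
      obtain r where r: "0 < r" "\<forall>x y. dist x y < r \<longrightarrow> \<bar>u0 x - u0 y\<bar> \<le> e / 2" using unif[of "e / 2"] e by auto
      have "dist (W n y) (W n x) < e" if "dist y x < r" for y
      proof -
        have "\<bar>u0 z - u0 (z + (y - x))\<bar> \<le> e / 2" for z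
          using r(2)[rule_format, of z "z + (y - x)"] that by (simp add: dist_norm norm_minus_commute)
        then have "\<bar>moll (\<delta> n) u0 x - moll (\<delta> n) u0 (x + (y - x))\<bar> \<le> bump_mass TYPE('a) (\<delta> n) * (e / 2)"
          by (rule moll_shift_le[OF d(1) u0m u0b])
        then have "\<bar>moll (\<delta> n) u0 x - moll (\<delta> n) u0 y\<bar> \<le> M n * (e / 2)" by (simp add: M_def)
        moreover have "W n x - W n y = (moll (\<delta> n) u0 x - moll (\<delta> n) u0 y) / M n" by (simp add: W_def diff_divide_distrib)
        then have "\<bar>W n x - W n y\<bar> = \<bar>moll (\<delta> n) u0 x - moll (\<delta> n) u0 y\<bar> / M n" using M[of n] by simp
        ultimately have "\<bar>W n x - W n y\<bar> \<le> e / 2" using M[of n] by (simp add: pos_divide_le_eq mult.commute)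
        then show ?thesis unfolding dist_real_def using e by linarith
      qed
      then show "\<exists>d>0. \<forall>x'\<in>UNIV. dist x' x < d \<longrightarrow> dist (W n x') (W n x) < e" using r(1) by blast
    qed
    show "\<exists>M. \<forall>n\<ge>M. \<forall>x. \<bar>W n x - u0 x\<bar> \<le> e" if e: "0 < e" for e
    proof -
      obtain r where r: "0 < r" "\<forall>x y. dist x y < r \<longrightarrow> \<bar>u0 x - u0 y\<bar> \<le> e" using unif[OF e] by blast
      obtain L where L: "\<forall>n\<ge>L. \<delta> n < r" using dlim[OF r(1)] by blast
      have "\<bar>W n x - u0 x\<bar> \<le> e" if n: "n \<ge> L" for n x
        unfolding W_def M_def
      proof (rule moll_close[OF d(1) u0m u0b])
        fix z :: 'a assume "norm z < \<delta> n"
        then have "norm z < r" using L n by fastforce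
        then show "\<bar>u0 (x + z) - u0 x\<bar> \<le> e" using r(2)[rule_format, of "x + z" x] by (simp add: dist_norm)
      qed
      then show ?thesis by blast
    qed
    show "\<exists>C\<ge>0. \<forall>x. \<exists>p. \<forall>y. norm y \<le> 1 \<longrightarrow> \<bar>W n (x + y) - W n x - p \<bullet> y\<bar> \<le> C * (norm y)\<^sup>2" for n
    proof -
      define C where "C = 27 * measure lborel (ball (0::'a) 2) * (K * N)"
      have C0: "0 \<le> C" using KN by (simp add: C_def)
      have "\<exists>p. \<forall>y. norm y \<le> 1 \<longrightarrow> \<bar>W n (x + y) - W n x - p \<bullet> y\<bar> \<le> C / M n * (norm y)\<^sup>2" for x
      proof -
        obtain p where p: "\<forall>y. norm y \<le> 1 \<longrightarrow> \<bar>moll (\<delta> n) u0 (x + y) - moll (\<delta> n) u0 x - p \<bullet> y\<bar> \<le> C * (norm y)\<^sup>2"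
          using moll_taylor[OF d u0m u0b] unfolding C_def by blast
        have "\<bar>W n (x + y) - W n x - (p /\<^sub>R M n) \<bullet> y\<bar> \<le> C / M n * (norm y)\<^sup>2" if "norm y \<le> 1" for y
        proof -
          have "W n (x + y) - W n x - (p /\<^sub>R M n) \<bullet> y = (moll (\<delta> n) u0 (x + y) - moll (\<delta> n) u0 x - p \<bullet> y) / M n"
            by (simp add: W_def diff_divide_distrib inverse_eq_divide)
          then have "\<bar>W n (x + y) - W n x - (p /\<^sub>R M n) \<bullet> y\<bar> = \<bar>moll (\<delta> n) u0 (x + y) - moll (\<delta> n) u0 x - p \<bullet> y\<bar> / M n"
            using M[of n] by simp
          also have "\<dots> \<le> C * (norm y)\<^sup>2 / M n" using p that M[of n] by (intro divide_right_mono) auto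
          finally show ?thesis by simp
        qed
        then show ?thesis by blast
      qed
      moreover have "0 \<le> C / M n" using C0 M[of n] by simp
      ultimately show ?thesis by blast
    qed
    show "\<exists>M. \<forall>n\<ge>M. \<forall>x\<in>K'. \<bar>Lop J (W n) x - f x\<bar> \<le> e" if Kc: "compact K'" and KD: "K' \<subseteq> D" and e: "0 < e" for K' e
    proof -
      obtain r where r: "0 < r" "(\<Union>x\<in>K'. cball x r) \<subseteq> D"
        by (rule compact_subset_open_imp_cball_epsilon_subset[OF Kc D_open KD]) (rule that)
      let ?Q = "\<Union>x\<in>K'. cball x r"
      have "uniformly_continuous_on ?Q f"
        by (intro compact_uniformly_continuous continuous_on_subset[OF fc r(2)] compact_minkowski_sum_cball[OF Kc])
      from this[unfolded uniformly_continuous_on_def, rule_format, OF e]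
      obtain d' where d': "0 < d'" "\<And>x x'. x \<in> ?Q \<Longrightarrow> x' \<in> ?Q \<Longrightarrow> dist x' x < d' \<Longrightarrow> dist (f x') (f x) < e"
        by blast
      obtain L where L: "\<forall>n\<ge>L. \<delta> n < min r d'" using dlim[of "min r d'"] r d' by auto
      have "\<bar>Lop J (W n) x - f x\<bar> \<le> e" if n: "n \<ge> L" and x: "x \<in> K'" for n x
        unfolding W_def[abs_def] M_def
      proof (rule smooth_equation[OF f N(2) mt Um Ub Ueq lim u0b d])
        have dn: "\<delta> n < r" "\<delta> n < d'" using L n by auto
        have "ball x (\<delta> n) \<subseteq> cball x r" using dn by auto
        then show "ball x (\<delta> n) \<subseteq> D" using r(2) x by blast
        fix z :: 'a assume z: "norm z < \<delta> n"
        have "x \<in> ?Q" using x r(1) by (intro UN_I[of x]) auto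
        moreover have "x + z \<in> ?Q" using x z dn by (intro UN_I[of x]) (auto simp: dist_norm)
        ultimately have "dist (f (x + z)) (f x) < e" using z dn by (intro d'(2)) (simp_all add: dist_norm)
        then show "\<bar>f (x + z) - f x\<bar> \<le> e" unfolding dist_real_def by linarith
      qed
      then show ?thesis by blast
    qed
  qed
  then show ?thesis by (simp add: W_def[abs_def] M_def \<delta>_def)
qed

text \<open>The square-root term is controlled by \<open>char_exp_lower\<close>. For the term
  \<open>t\<^sup>2\<close>, \<open>char_exp_upper\<close> bounds the exponent by a multiple of
  \<open>2 + 1 / t\<^sup>2\<close>, so that \<open>phiJ\<close> is at least a multiple of
  \<open>t ^ 4\<close> on bounded intervals; this is where \<open>t \<le> R\<close> enters.\<close>

lemma omega_le_phiJ:
  assumes lam: "0 < lam" and R: "1 \<le> R"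
  obtains C where "0 \<le> C" "\<And>t. 0 < t \<Longrightarrow> t \<le> R \<Longrightarrow> omega lam t \<le> C * sqrt (phiJ J DIM('a) t)"
proof -
  let ?n = "DIM('a)"
  have c1: "0 < cosvol b" by (rule cosvol_pos[OF b1])
  have J1: "0 < J 1" by (rule J_pos) simp
  have K20: "0 \<le> K2" unfolding K2_def
  proof (rule integral_nonneg_AE)
    show "AE y::'a in lborel. 0 \<le> min 1 (norm y ^ 2) * J (norm y)"
      using AE_ne0 by eventually_elim (intro mult_nonneg_nonneg J_nonneg, auto)
  qed
  define A1 A2 where "A1 = 80 * lam / (cosvol b * J 1)" and "A2 = 3 * R ^ 4 * K2 / (cosvol b * J 1)"
  have A: "0 \<le> A1" "0 \<le> A2" using c1 J1 lam K20 R by (auto simp: A1_def A2_def)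
  show thesis
  proof (rule that[of "sqrt A1 + sqrt A2"])
    show "0 \<le> sqrt A1 + sqrt A2" using A by simp
    fix t assume t: "0 < t" "t \<le> R"
    define P where "P = char_exp J (b /\<^sub>R t)"
    define h where "h = J t * t ^ ?n"
    have h0: "0 < h" using J_pos[OF t(1)] t by (simp add: h_def)
    have hP: "h * cosvol b \<le> P" using char_exp_lower[OF t(1)] by (simp add: h_def P_def mult.assoc)
    have phi: "phiJ J ?n t = J 1 / h" by (simp add: phiJ_def h_def)
    have hc: "0 < h * cosvol b" using h0 c1 by simp
    have "80 * lam / (lam + P) \<le> 80 * lam / (h * cosvol b)"
      using hP hc lam by (intro divide_left_mono) auto
    also have "\<dots> = A1 * (J 1 / h)" using J1 by (simp add: A1_def)
    finally have 1: "sqrt (80 * lam / (lam + P)) \<le> sqrt A1 * sqrt (J 1 / h)"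
      unfolding real_sqrt_mult[symmetric] by (rule real_sqrt_le_mono)
    have "(t\<^sup>2)\<^sup>2 \<le> A2 * (J 1 / h)"
    proof -
      have Pu: "P \<le> (2 + 1 / t\<^sup>2) * K2"
        using char_exp_upper[of "b /\<^sub>R t"] b1 t by (simp add: P_def power_divide inverse_eq_divide)
      have "t ^ 4 * (h * cosvol b) \<le> t ^ 4 * ((2 + 1 / t\<^sup>2) * K2)"
        using hP Pu t by (intro mult_left_mono) auto
      also have "\<dots> = (2 * t ^ 4 + t\<^sup>2) * K2" using t by (simp add: field_simps power2_eq_square power4_eq_xxxx)
      also have "\<dots> \<le> (3 * R ^ 4) * K2"
      proof (rule mult_right_mono[OF _ K20])
        have "t ^ 4 \<le> R ^ 4" using t by (intro power_mono) auto
        moreover have "t\<^sup>2 \<le> R\<^sup>2" using t by (intro power_mono) auto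
        moreover have "R\<^sup>2 \<le> R ^ 4" using R by (intro power_increasing) auto
        ultimately show "2 * t ^ 4 + t\<^sup>2 \<le> 3 * R ^ 4" by linarith
      qed
      finally have "t ^ 4 \<le> 3 * R ^ 4 * K2 / (h * cosvol b)" using hc by (simp add: pos_le_divide_eq)
      also have "\<dots> = A2 * (J 1 / h)" using J1 by (simp add: A2_def mult.commute)
      finally show ?thesis by simp
    qed
    then have "sqrt ((t\<^sup>2)\<^sup>2) \<le> sqrt (A2 * (J 1 / h))" by (rule real_sqrt_le_mono)
    then have 2: "t\<^sup>2 \<le> sqrt A2 * sqrt (J 1 / h)" by (simp only: real_sqrt_mult real_sqrt_abs abs_power2)
    show "omega lam t \<le> (sqrt A1 + sqrt A2) * sqrt (phiJ J ?n t)"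
      using 1 2 by (simp only: omega_def P_def[symmetric] phi distrib_right)
  qed
qed

end

text \<open>The estimates ask for \<open>N > 0\<close>, while \<open>sup_norm D f\<close> is 0 for
  \<open>f = 0\<close>. They are applied with every larger \<open>N\<close>, and the bound is then
  passed to the infimum.\<close>

lemma le_mult_limit:
  fixes a c N0 :: real
  assumes "0 \<le> c" and "\<And>N. N0 < N \<Longrightarrow> a \<le> c * N"
  shows "a \<le> c * N0"
proof (rule field_le_epsilon)
  fix e :: real assume e: "0 < e"
  have "a \<le> c * (N0 + e / (c + 1))" using assms(1) e by (intro assms(2)) simp
  also have "\<dots> \<le> c * N0 + e"
  proof -
    have "c * (e / (c + 1)) \<le> e" using assms(1) e by (simp add: field_simps)
    then show ?thesis by (simp add: distrib_left)
  qed
  finally show "a \<le> c * N0 + e" .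
qed

lemma sup_norm_upper:
  assumes "in_C D f"
  shows "0 \<le> sup_norm D f" "x \<in> D \<Longrightarrow> \<bar>f x\<bar> \<le> sup_norm D f"
proof -
  obtain A where A: "\<And>x. x \<in> D \<Longrightarrow> \<bar>f x\<bar> \<le> A" using assms by (auto simp: in_C_def bounded_iff)
  have bdd: "bdd_above (insert 0 ((\<lambda>x. \<bar>f x\<bar>) ` D))"
    unfolding bdd_above_def using A by (intro exI[of _ "max 0 A"]) (auto simp: le_max_iff_disj)
  show "0 \<le> sup_norm D f" unfolding sup_norm_def by (rule cSup_upper[OF _ bdd]) simp
  show "x \<in> D \<Longrightarrow> \<bar>f x\<bar> \<le> sup_norm D f" unfolding sup_norm_def by (rule cSup_upper[OF _ bdd]) simp
qed

theorem theorem2p1: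
  fixes J J' :: "real \<Rightarrow> real" and D :: "'a::euclidean_space set"
    and a1 a2 \<alpha>1 \<alpha>2 :: real
  assumes J_pos: "\<forall>r>0. J r > 0"
    and J_mono: "\<forall>r s. 0 < r \<longrightarrow> r \<le> s \<longrightarrow> J s \<le> J r"
    and levy: "integrable lborel (\<lambda>y::'a. min 1 (norm y ^ 2) * J (norm y))"
    and infinite: "(\<integral>\<^sup>+ y. ennreal (J (norm (y::'a))) \<partial>lborel) = \<infinity>"
    and a1: "a1 \<ge> 1" and alphas: "0 < \<alpha>1" "\<alpha>1 \<le> \<alpha>2" "\<alpha>2 < 1"
    and scaling: "\<forall>(z::'a) (w::'a). 1 < norm z \<longrightarrow> norm z \<le> norm w \<longrightarrow>
        (norm w / norm z) powr (2 * \<alpha>1) / a1 \<le> char_exp J w / char_exp J z \<and>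
        char_exp J w / char_exp J z \<le> a1 * (norm w / norm z) powr (2 * \<alpha>2)"
    and a2: "a2 > 0" and jump1: "\<forall>r>0. J (r + 1) \<le> a2 * J r"
    and J_deriv: "\<forall>r>0. (J has_real_derivative J' r) (at r)"
    and jump2: "\<forall>r s. 0 < r \<longrightarrow> r \<le> s \<longrightarrow> - J' s / s \<le> - J' r / r"
    and D_bdd: "bounded D" and D_C11: "C11_open D"
  shows "\<exists>C>0. \<forall>f. in_C D f \<longrightarrow>
           (\<exists>!u. visc_sol J f D u \<and> (\<forall>x. x \<notin> D \<longrightarrow> u x = 0)) \<and>
           (\<forall>u. visc_sol J f D u \<and> (\<forall>x. x \<notin> D \<longrightarrow> u x = 0) \<longrightarrow>
              in_Ch (\<lambda>r. sqrt (phiJ J DIM('a) r)) D u \<and>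
              Ch_norm (\<lambda>r. sqrt (phiJ J DIM('a) r)) D u \<le> C * sup_norm D f)"
proof -
  obtain b :: 'a where b: "b \<in> Basis" using nonempty_Basis by blast
  interpret levy_dirichlet J b D a1 \<alpha>1 \<alpha>2
  proof
    show "norm b = 1" by (rule norm_Basis[OF b])
  qed (use J_pos J_mono in blast, use J_mono in blast, rule levy, rule a1, rule alphas(1), rule alphas(3),
    rule scaling[rule_format], assumption, assumption, rule D_bdd, rule D_C11)
  let ?h = "\<lambda>r. sqrt (phiJ J DIM('a) r)"
  obtain K lam where K: "0 < K" and lam: "0 < lam"
    and lim: "\<forall>f N. in_C D f \<longrightarrow> 0 < N \<longrightarrow> (\<forall>x\<in>D. \<bar>f x\<bar> \<le> N) \<longrightarrow>
      (\<exists>(U :: nat \<Rightarrow> 'a \<Rightarrow> real) u0 (m :: nat \<Rightarrow> nat). filterlim m at_top sequentially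
        \<and> (\<forall>n. U n \<in> borel_measurable borel \<and> (\<forall>x. \<bar>U n x\<bar> \<le> K * N) \<and> (\<forall>x\<in>D. T.Lk (m n) (U n) x = f x))
        \<and> (\<forall>x. (\<lambda>n. U n x) \<longlonglongrightarrow> u0 x) \<and> (\<forall>x. \<bar>u0 x\<bar> \<le> K * N) \<and> (\<forall>x. x \<notin> D \<longrightarrow> u0 x = 0)
        \<and> (\<forall>x y. x \<noteq> y \<longrightarrow> \<bar>u0 x - u0 y\<bar> \<le> K * N * omega lam (dist x y)))"
    by (rule limit_solution) (rule that)
  obtain R where R: "1 \<le> R" "\<And>x y. x \<in> D \<Longrightarrow> y \<in> D \<Longrightarrow> dist x y < R"
    by (rule D_diam) (rule that)
  obtain C' where C': "0 \<le> C'" "\<And>t. 0 < t \<Longrightarrow> t \<le> R \<Longrightarrow> omega lam t \<le> C' * ?h t"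
    by (rule omega_le_phiJ[OF lam R(1)]) (rule that)
  have sol: "\<exists>u0. visc_sol J f D u0 \<and> (\<forall>x. x \<notin> D \<longrightarrow> u0 x = 0)
      \<and> (\<forall>u. visc_sol J f D u \<and> (\<forall>x. x \<notin> D \<longrightarrow> u x = 0) \<longrightarrow> u = u0)
      \<and> (\<forall>x. \<bar>u0 x\<bar> \<le> K * N) \<and> (\<forall>x y. x \<noteq> y \<longrightarrow> \<bar>u0 x - u0 y\<bar> \<le> K * N * omega lam (dist x y)) \<and> continuous_on UNIV u0"
    if f: "in_C D f" and N: "0 < N" "\<And>x. x \<in> D \<Longrightarrow> \<bar>f x\<bar> \<le> N" for f N
  proof -
    obtain U u0 m where mt: "filterlim m at_top sequentially"
      and U: "\<And>n. U n \<in> borel_measurable borel" "\<And>n x. \<bar>U n x\<bar> \<le> K * N" "\<And>n x. x \<in> D \<Longrightarrow> T.Lk (m n) (U n) x = f x"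
      and u0: "\<And>x. (\<lambda>n. U n x) \<longlonglongrightarrow> u0 x" "\<And>x. \<bar>u0 x\<bar> \<le> K * N" "\<And>x. x \<notin> D \<Longrightarrow> u0 x = 0"
        "\<And>x y. x \<noteq> y \<Longrightarrow> \<bar>u0 x - u0 y\<bar> \<le> K * N * omega lam (dist x y)"
      using lim[rule_format, OF f N] by blast
    note va = mollified_visc_approx[OF f N K lam mt U u0]
    show ?thesis
      using visc_approx_unique_solution[OF va] u0 visc_approx.u0c[OF va] by blast
  qed
  \<comment> \<open>\<open>K\<close> bounds the sup norm and \<open>K * C'\<close> the quotients in
    the second part of the norm.\<close>
  define C where "C = K * (1 + C')"
  have C0: "0 < C" using K C' by (simp add: C_def add_pos_nonneg)
  show ?thesis
  proof (intro exI[of _ C] conjI allI impI)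
    show "0 < C" by (rule C0)
    fix f assume f: "in_C D f"
    define N0 where "N0 = sup_norm D f"
    have N0: "0 \<le> N0" "\<And>x. x \<in> D \<Longrightarrow> \<bar>f x\<bar> \<le> N0" using sup_norm_upper[OF f] by (auto simp: N0_def)
    have fN: "\<bar>f x\<bar> \<le> N" if "N0 < N" "x \<in> D" for N x using N0(2)[OF that(2)] that(1) by linarith
    have "\<exists>u0. visc_sol J f D u0 \<and> (\<forall>x. x \<notin> D \<longrightarrow> u0 x = 0)
      \<and> (\<forall>u. visc_sol J f D u \<and> (\<forall>x. x \<notin> D \<longrightarrow> u x = 0) \<longrightarrow> u = u0)"
      using sol[OF f _ fN[of "N0 + 1"]] N0(1) by auto
    then show "\<exists>!u. visc_sol J f D u \<and> (\<forall>x. x \<notin> D \<longrightarrow> u x = 0)" by blast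
    fix u assume u: "visc_sol J f D u \<and> (\<forall>x. x \<notin> D \<longrightarrow> u x = 0)"
    \<comment> \<open>The function obtained from \<open>sol\<close> could a priori depend on
      \<open>N\<close>; uniqueness identifies it with \<open>u\<close>, so one function satisfies
      the estimates for all \<open>N > N0\<close>.\<close>
    have est: "\<bar>u x\<bar> \<le> K * N \<and> (x \<noteq> y \<longrightarrow> \<bar>u x - u y\<bar> \<le> K * N * omega lam (dist x y)) \<and> continuous_on UNIV u" if N: "N0 < N" for N x y
    proof -
      have "0 < N" using N N0(1) by linarith
      from sol[OF f this fN[OF N]]
      obtain u0 where u0: "\<forall>u. visc_sol J f D u \<and> (\<forall>x. x \<notin> D \<longrightarrow> u x = 0) \<longrightarrow> u = u0"
        "\<forall>x. \<bar>u0 x\<bar> \<le> K * N" "\<forall>x y. x \<noteq> y \<longrightarrow> \<bar>u0 x - u0 y\<bar> \<le> K * N * omega lam (dist x y)" "continuous_on UNIV u0"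
        by blast
      have "u = u0" using u0(1) u by blast
      then show ?thesis using u0 by blast
    qed
    have ub: "\<bar>u x\<bar> \<le> K * N0" for x
      by (rule le_mult_limit) (use K est in auto)
    have uq: "\<bar>u x - u y\<bar> / ?h (dist x y) \<le> K * C' * N0" if xy: "x \<in> D" "y \<in> D" "x \<noteq> y" for x y
    proof -
      let ?t = "dist x y"
      have t: "0 < ?t" "?t \<le> R" using xy R(2)[OF xy(1,2)] by auto
      have "0 < phiJ J DIM('a) ?t" unfolding phiJ_def using J_pos t by simp
      then have h0: "0 < ?h ?t" by simp
      have om0: "0 \<le> omega lam ?t" unfolding omega_def using lam char_exp_nonneg[of "b /\<^sub>R ?t"] by simp
      have "\<bar>u x - u y\<bar> \<le> (K * omega lam ?t) * N0"
        by (rule le_mult_limit) (use K om0 est xy(3) in \<open>auto simp: mult_ac\<close>)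
      also have "\<dots> \<le> (K * (C' * ?h ?t)) * N0"
        using C'(2)[OF t] K N0(1) by (intro mult_right_mono mult_left_mono) auto
      finally have "\<bar>u x - u y\<bar> \<le> (K * C' * N0) * ?h ?t" by (simp add: mult_ac)
      then show ?thesis using h0 by (simp only: pos_divide_le_eq)
    qed
    have KC: "0 \<le> K * C' * N0" using K C' N0 by simp
    have uc: "continuous_on UNIV u" using est[of "N0 + 1"] by simp
    show "in_Ch ?h D u"
      unfolding in_Ch_def in_C_def
    proof (intro conjI)
      show "continuous_on D u" by (rule continuous_on_subset[OF uc]) simp
      show "bounded (u ` D)" unfolding bounded_iff using ub by (intro exI[of _ "K * N0"]) auto
      show "bdd_above (hoelder_quot ?h D u)"
        unfolding bdd_above_def hoelder_quot_def using uq by (intro exI[of _ "K * C' * N0"]) blast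
    qed
    have "sup_norm D u \<le> K * N0"
      unfolding sup_norm_def using ub K N0 by (intro cSup_least) auto
    moreover have "Sup (insert 0 (hoelder_quot ?h D u)) \<le> K * C' * N0"
      using uq KC by (intro cSup_least) (auto simp: hoelder_quot_def)
    ultimately show "Ch_norm ?h D u \<le> C * sup_norm D f"
      unfolding Ch_norm_def C_def N0_def[symmetric] by (simp add: algebra_simps)
  qed
qed

end
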